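(* Let $\mathbf{M}_1,\mathbf{M}_2$ be loopless matroids on a finite set $E$ with $|E|=n$, accessible only through an oracle returning $r_{\min}(X)=\min\{r_1(X),r_2(X)\}$ for queried $X\subseteq E$, and let $r$ be the maximum cardinality of a common independent set. Suppose that for every circuit $C_1$ of $\mathbf{M}_1$ and every circuit $C_2$ of $\mathbf{M}_2$ we have $C_2\setminus C_1\neq\emptyset$. Then for any weight function $w\colon E\to\mathbb{R}$, one can find, for each $k=0,1,\dots,r$, a common independent set of cardinality $k$ maximizing $w(I)=\sum_{e\in I}w(e)$ among all common independent sets of cardinality $k$, in total time $O(r^3n^2)$ (each oracle call counted as unit time).
   Context: $r_1,r_2$ denote the rank functions; a common independent set is a set independent in both matroids. *)

theory Defs
  imports Complex_Main
begin

section \<open>Matroids\<close>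

locale matroid =
  fixes E :: "'a set" and indep :: "'a set \<Rightarrow> bool"
  assumes finite_ground: "finite E"
    and indep_subset_ground: "indep I \<Longrightarrow> I \<subseteq> E"
    and indep_empty: "indep {}"
    and indep_mono: "indep J \<Longrightarrow> I \<subseteq> J \<Longrightarrow> indep I"
    and indep_augment: "indep I \<Longrightarrow> indep J \<Longrightarrow> card I < card J \<Longrightarrow> \<exists>e\<in>J - I. indep (insert e I)"

definition loopless :: "'a set \<Rightarrow> ('a set \<Rightarrow> bool) \<Rightarrow> bool" where
  "loopless E indep \<longleftrightarrow> (\<forall>e\<in>E. indep {e})"

definition circuit :: "'a set \<Rightarrow> ('a set \<Rightarrow> bool) \<Rightarrow> 'a set \<Rightarrow> bool" where
  "circuit E indep C \<longleftrightarrow> C \<subseteq> E \<and> \<not> indep C \<and> (\<forall>D. D \<subset> C \<longrightarrow> indep D)"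

definition rank :: "('a set \<Rightarrow> bool) \<Rightarrow> 'a set \<Rightarrow> nat" where
  "rank indep X = Max {card I | I. I \<subseteq> X \<and> indep I}"

definition min_rank :: "('a set \<Rightarrow> bool) \<Rightarrow> ('a set \<Rightarrow> bool) \<Rightarrow> 'a set \<Rightarrow> nat" where
  "min_rank indep1 indep2 X = min (rank indep1 X) (rank indep2 X)"

definition common_indep :: "('a set \<Rightarrow> bool) \<Rightarrow> ('a set \<Rightarrow> bool) \<Rightarrow> 'a set \<Rightarrow> bool" where
  "common_indep indep1 indep2 I \<longleftrightarrow> indep1 I \<and> indep2 I"

definition max_common_card :: "('a set \<Rightarrow> bool) \<Rightarrow> ('a set \<Rightarrow> bool) \<Rightarrow> nat" where
  "max_common_card indep1 indep2 = Max {card I | I. common_indep indep1 indep2 I}"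

definition max_weight_common_indep ::
  "('a set \<Rightarrow> bool) \<Rightarrow> ('a set \<Rightarrow> bool) \<Rightarrow> ('a \<Rightarrow> real) \<Rightarrow> nat \<Rightarrow> 'a set \<Rightarrow> bool" where
  "max_weight_common_indep indep1 indep2 w k I \<longleftrightarrow>
     common_indep indep1 indep2 I \<and> card I = k \<and>
     (\<forall>J. common_indep indep1 indep2 J \<and> card J = k \<longrightarrow> (\<Sum>e\<in>J. w e) \<le> (\<Sum>e\<in>I. w e))"


section \<open>Machine model\<close>

text \<open>
  Programs are structured random access machine programs with unit cost for each operation,
  test, array access and oracle call.  The memory consists of two-dimensional arrays of natural
  numbers and of real numbers; a program names finitely many of them.  Real numbers can only be
  added, subtracted and compared.  The only growing operation on natural numbers is the
  successor, so that during a run with oracle answers at most \<open>n\<close> the stored numbers never exceed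
  \<open>n\<close> plus the elapsed time (\<open>exec_bounded\<close> below): in polynomial time all of them have
  \<open>O(log n)\<close> bits, and unit cost does not hide arithmetic on long numbers.
\<close>

record store =
  ncell :: "nat \<Rightarrow> nat \<Rightarrow> nat \<Rightarrow> nat"
  rcell :: "nat \<Rightarrow> nat \<Rightarrow> nat \<Rightarrow> real"

datatype nexp =
    NZero
  | NSuc nexp
  | NSub nexp nexp
  | NCell nat nexp nexp

datatype rexp =
    RZero
  | RAdd rexp rexp
  | RSub rexp rexp
  | RCell nat nexp nexp

datatype bexp =
    NLess nexp nexp
  | RLess rexp rexp
  | Neg bexp
  | Conj bexp bexp

text \<open>
  \<open>Query a i j b k\<close> asks the oracle for the set whose characteristic vector is row \<open>k\<close> of the
  number array \<open>b\<close> (nonzero meaning membership) and stores the answer in entry \<open>(i, j)\<close> of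
  the number array \<open>a\<close>.
\<close>

datatype com =
    Skip
  | NAssign nat nexp nexp nexp
  | RAssign nat nexp nexp rexp
  | Query nat nexp nexp nat nexp
  | Seq com com
  | Cond bexp com com
  | Loop bexp com

primrec nval :: "nexp \<Rightarrow> store \<Rightarrow> nat" where
  "nval NZero s = 0"
| "nval (NSuc e) s = Suc (nval e s)"
| "nval (NSub e f) s = nval e s - nval f s"
| "nval (NCell a e f) s = ncell s a (nval e s) (nval f s)"

primrec rval :: "rexp \<Rightarrow> store \<Rightarrow> real" where
  "rval RZero s = 0"
| "rval (RAdd e f) s = rval e s + rval f s"
| "rval (RSub e f) s = rval e s - rval f s"
| "rval (RCell a e f) s = rcell s a (nval e s) (nval f s)"

primrec bval :: "bexp \<Rightarrow> store \<Rightarrow> bool" where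
  "bval (NLess e f) s \<longleftrightarrow> nval e s < nval f s"
| "bval (RLess e f) s \<longleftrightarrow> rval e s < rval f s"
| "bval (Neg b) s \<longleftrightarrow> \<not> bval b s"
| "bval (Conj b c) s \<longleftrightarrow> bval b s \<and> bval c s"

primrec ncost :: "nexp \<Rightarrow> nat" where
  "ncost NZero = 1"
| "ncost (NSuc e) = 1 + ncost e"
| "ncost (NSub e f) = 1 + ncost e + ncost f"
| "ncost (NCell a e f) = 1 + ncost e + ncost f"

primrec rcost :: "rexp \<Rightarrow> nat" where
  "rcost RZero = 1"
| "rcost (RAdd e f) = 1 + rcost e + rcost f"
| "rcost (RSub e f) = 1 + rcost e + rcost f"
| "rcost (RCell a e f) = 1 + ncost e + ncost f"

primrec bcost :: "bexp \<Rightarrow> nat" where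
  "bcost (NLess e f) = 1 + ncost e + ncost f"
| "bcost (RLess e f) = 1 + rcost e + rcost f"
| "bcost (Neg b) = 1 + bcost b"
| "bcost (Conj b c) = 1 + bcost b + bcost c"

definition set_ncell :: "nat \<Rightarrow> nat \<Rightarrow> nat \<Rightarrow> nat \<Rightarrow> store \<Rightarrow> store" where
  "set_ncell a i j v s =
     s\<lparr>ncell := (ncell s)(a := (ncell s a)(i := (ncell s a i)(j := v)))\<rparr>"

definition set_rcell :: "nat \<Rightarrow> nat \<Rightarrow> nat \<Rightarrow> real \<Rightarrow> store \<Rightarrow> store" where
  "set_rcell a i j v s =
     s\<lparr>rcell := (rcell s)(a := (rcell s a)(i := (rcell s a i)(j := v)))\<rparr>"

text \<open>
  \<open>exec orc c s t s'\<close>: started in \<open>s\<close>, the program \<open>c\<close> halts in \<open>s'\<close> after exactly \<open>t\<close> time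
  units.
\<close>

inductive exec :: "(nat set \<Rightarrow> nat) \<Rightarrow> com \<Rightarrow> store \<Rightarrow> nat \<Rightarrow> store \<Rightarrow> bool"
  for orc :: "nat set \<Rightarrow> nat" where
  Skip: "exec orc Skip s 1 s"
| NAssign: "exec orc (NAssign a e f g) s (1 + ncost e + ncost f + ncost g)
    (set_ncell a (nval e s) (nval f s) (nval g s) s)"
| RAssign: "exec orc (RAssign a e f g) s (1 + ncost e + ncost f + rcost g)
    (set_rcell a (nval e s) (nval f s) (rval g s) s)"
| Query: "exec orc (Query a e f b g) s (1 + ncost e + ncost f + ncost g)
    (set_ncell a (nval e s) (nval f s) (orc {j. ncell s b (nval g s) j \<noteq> 0}) s)"
| Seq: "exec orc c s t s' \<Longrightarrow> exec orc d s' u s'' \<Longrightarrow>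
    exec orc (Seq c d) s (t + u) s''"
| Cond_True: "bval b s \<Longrightarrow> exec orc c s t s' \<Longrightarrow>
    exec orc (Cond b c d) s (1 + bcost b + t) s'"
| Cond_False: "\<not> bval b s \<Longrightarrow> exec orc d s t s' \<Longrightarrow>
    exec orc (Cond b c d) s (1 + bcost b + t) s'"
| Loop_False: "\<not> bval b s \<Longrightarrow> exec orc (Loop b c) s (1 + bcost b) s"
| Loop_True: "bval b s \<Longrightarrow> exec orc c s t s' \<Longrightarrow> exec orc (Loop b c) s' u s'' \<Longrightarrow>
    exec orc (Loop b c) s (1 + bcost b + t + u) s''"

inductive_cases exec_elims:
  "exec orc Skip s t s'"
  "exec orc (NAssign a e f g) s t s'"
  "exec orc (RAssign a e f g) s t s'"
  "exec orc (Query a e f b g) s t s'"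
  "exec orc (Seq c d) s t s'"
  "exec orc (Cond b c d) s t s'"
  "exec orc (Loop b c) s t s'"

lemma exec_deterministic:
  "exec orc c s t s' \<Longrightarrow> exec orc c s u s'' \<Longrightarrow> u = t \<and> s'' = s'"
proof (induction arbitrary: u s'' rule: exec.induct)
  case (Seq c s t s' d v s2)
  from Seq.prems obtain s1 t1 u1 where "exec orc c s t1 s1" "exec orc d s1 u1 s''" "u = t1 + u1"
    by (auto elim: exec_elims(5))
  with Seq.IH show ?case by metis
next
  case (Cond_True b s c t s' d)
  from Cond_True.prems show ?case
    by (rule exec_elims(6)) (simp_all add: Cond_True.IH Cond_True.hyps)
next
  case (Cond_False b s d t s' c)
  from Cond_False.prems show ?case
    by (rule exec_elims(6)) (simp_all add: Cond_False.IH Cond_False.hyps)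
next
  case (Loop_False b s c)
  from Loop_False.prems show ?case
    by (rule exec_elims(7)) (simp_all add: Loop_False.hyps)
next
  case (Loop_True b s c t s' v s2)
  from Loop_True.prems Loop_True.hyps obtain t1 s1 u1 where
    "exec orc c s t1 s1" "exec orc (Loop b c) s1 u1 s''" "u = 1 + bcost b + t1 + u1"
    by (auto elim: exec_elims(7))
  with Loop_True.IH show ?case by metis
next
  case (Skip s)
  then show ?case by (rule exec_elims(1)) simp
next
  case (NAssign a e f g s)
  then show ?case by (rule exec_elims(2)) simp
next
  case (RAssign a e f g s)
  then show ?case by (rule exec_elims(3)) simp
next
  case (Query a e f b g s)
  then show ?case by (rule exec_elims(4)) simp
qed

lemma nval_bounded:
  assumes "\<And>a i j. ncell s a i j \<le> B"
  shows "nval e s \<le> B + ncost e"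
proof (induction e)
  case (NCell a e f)
  show ?case using assms[of a "nval e s" "nval f s"] by simp
qed auto

lemma exec_bounded:
  assumes "exec orc c s t s'"
    and "\<And>X. orc X \<le> n"
    and "\<And>a i j. ncell s a i j \<le> n + B"
  shows "ncell s' a i j \<le> n + B + t"
  using assms(1,3)
proof (induction arbitrary: B a i j rule: exec.induct)
  case (NAssign a' e f g s)
  have "nval g s \<le> n + B + ncost g" using nval_bounded[OF NAssign.prems] .
  then show ?case using NAssign.prems[of a i j] by (auto simp: set_ncell_def)
next
  case (RAssign a' e f g s)
  show ?case using RAssign.prems[of a i j] by (simp add: set_rcell_def)
next
  case (Query a' e f b g s)
  have "orc {j. ncell s b (nval g s) j \<noteq> 0} \<le> n" by (rule assms(2))
  then show ?case using Query.prems[of a i j] by (auto simp: set_ncell_def)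
next
  case (Seq c s t s' d u s'')
  have "ncell s' a i j \<le> n + (B + t)" for a i j using Seq.IH(1)[OF Seq.prems] by (simp add: add.assoc)
  from Seq.IH(2)[OF this] show ?case by (simp add: add.assoc)
next
  case (Cond_True b s c t s' d)
  from Cond_True.IH[OF Cond_True.prems, of a i j] show ?case by simp
next
  case (Cond_False b s d t s' c)
  from Cond_False.IH[OF Cond_False.prems, of a i j] show ?case by simp
next
  case (Loop_False b s c)
  from Loop_False.prems[of a i j] show ?case by simp
next
  case (Loop_True b s c t s' u s'')
  have "ncell s' a i j \<le> n + (B + t)" for a i j using Loop_True.IH(1)[OF Loop_True.prems] by (simp add: add.assoc)
  from Loop_True.IH(2)[OF this, of a i j] show ?case by simp
next
  case (Skip s)
  from Skip[of a i j] show ?case by simp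
qed


section \<open>Input, oracle and output\<close>

text \<open>
  The ground set is presented to a program as a list \<open>xs\<close> without repetitions; the program refers
  to \<open>xs ! i\<close> by its index \<open>i\<close>.
\<close>

definition min_rank_oracle ::
  "('a set \<Rightarrow> bool) \<Rightarrow> ('a set \<Rightarrow> bool) \<Rightarrow> 'a list \<Rightarrow> nat set \<Rightarrow> nat" where
  "min_rank_oracle indep1 indep2 xs X = min_rank indep1 indep2 {xs ! i | i. i < length xs \<and> i \<in> X}"

definition initial_store :: "'a list \<Rightarrow> ('a \<Rightarrow> real) \<Rightarrow> store" where
  "initial_store xs w =
     \<lparr>ncell = (\<lambda>a i j. if a = 0 \<and> i = 0 \<and> j = 0 then length xs else 0),
      rcell = (\<lambda>a i j. if a = 0 \<and> i = 0 \<and> j < length xs then w (xs ! j) else 0)\<rparr>"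

text \<open>
  The output is a sequence of sets: number array 1 holds in row \<open>k\<close> the characteristic vector
  of the \<open>k\<close>-th set, and entry \<open>(0, 0)\<close> of number array 2 holds the largest valid \<open>k\<close>.
\<close>

definition output_last :: "store \<Rightarrow> nat" where
  "output_last s = ncell s 2 0 0"

definition output_set :: "'a list \<Rightarrow> store \<Rightarrow> nat \<Rightarrow> 'a set" where
  "output_set xs s k = {xs ! i | i. i < length xs \<and> ncell s 1 k i \<noteq> 0}"

end

theory Submission
  imports Defs
begin

text \<open>
  Weighted matroid intersection by successive augmentation.  Given an optimal common independent
  set \<open>I\<close> of size \<open>k\<close>, add a dummy element \<open>r\<close> that is free in both matroids truncated to rank
  \<open>k + 1\<close>; then \<open>J = I \<union> {r}\<close> is a common base, and an optimal common base avoiding \<open>r\<close> is the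
  symmetric difference of \<open>J\<close> with a closed walk through \<open>r\<close> in the exchange graph that minimises
  cost and then length.  The edges at \<open>y \<notin> J\<close> are given by the fundamental sets \<open>F y\<close> and
  \<open>G y\<close> of the two matroids.

  For small \<open>X \<subseteq> J\<close> and \<open>Z\<close> disjoint from \<open>J\<close>, one query of the minimum rank tells whether \<open>X\<close>
  meets both \<open>\<Union>z\<in>Z. F z\<close> and \<open>\<Union>z\<in>Z. G z\<close>.  This determines \<open>F y \<inter> G y\<close>, and it determines
  \<open>{F y, G y}\<close> as an unordered pair when the two sets are incomparable.  The hypothesis on circuits
  excludes \<open>G y \<subseteq> F y\<close> unless \<open>r \<in> F y\<close>, so that in the remaining columns all edges which an
  optimal walk can use are found by querying pairs of columns.  Two columns with a common edge that
  lies in only one graph, or each with such an edge missing from the other, can be oriented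
  consistently by one query, and a spanning forest of these links fixes all orientations up to one
  exchange of the two matroids per component.

  A wrong choice in some components is harmless.  Columns in different components are nested: the
  edges of one that lie in only one graph lie in both graphs for the other.  The two perfect
  matchings formed by an optimal walk are unique, hence triangular; along a triangular closed walk
  such exchanges can be compensated by rerouting (\<open>closed_walk\<close> below), so the recoloured graph
  has the same optimal value, and an optimal walk in it has the same vertex set as one in the true
  graph.  Shortest walks are found by dynamic programming over the exact length.
\<close>

section \<open>Exchanging colour classes along a closed walk\<close>

text \<open>The dummy element turns augmenting paths into closed walks, so that negative cycles and
  optimal augmentations obey one cyclic statement. The oracle is symmetric in the two matroids, so
  each component of linked columns is recovered only up to a mirror image, and the work lies in
  showing that wrong mirror images do no harm. When the graphs are exchanged on some columns of a
  walk, neighbouring columns claim the same row, or leave a row unclaimed, exactly where the colour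
  changes. Nestedness makes each such place an opening or a closing bracket, triangularity forces
  the brackets to match, and a column losing its row at one end of a matched pair takes the row that
  is free at the other end. Uniqueness of the partner makes the rerouting injective. The bound is
  governed by one phase: testing a column and a row against a second column and a second row costs
  \<open>n^2 k^2\<close> per augmentation, and summing over \<open>k \<le> r\<close> gives
  \<open>r^3 n^2\<close>. Looplessness supplies \<open>r \<ge> 1\<close> for \<open>n > 0\<close>,
  which absorbs the lower order terms.\<close>

inductive dyck :: "(int \<Rightarrow> bool) \<Rightarrow> (int \<Rightarrow> bool) \<Rightarrow> int \<Rightarrow> int \<Rightarrow> bool" for L R where
  empty: "dyck L R i i"
| skip: "\<not> L l \<Longrightarrow> \<not> R l \<Longrightarrow> dyck L R (l + 1) i \<Longrightarrow> dyck L R l i"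
| wrap: "L j \<Longrightarrow> dyck L R (j + 1) r \<Longrightarrow> R r \<Longrightarrow> dyck L R (r + 1) i \<Longrightarrow> dyck L R j i"

text \<open>Positions with \<open>L\<close> are opening and positions with \<open>R\<close> closing
  brackets; \<open>dyck L R a b\<close> says that the half-open interval from \<open>a\<close> to
  \<open>b\<close> is a balanced word. A closing bracket right after a balanced interval is the
  partner of the bracket in front of it, so the start of the interval determines it.\<close>

lemma dyck_unique:
  assumes "dyck L R a b" "dyck L R a c" "R b" "R c" and LR: "\<And>i. \<not> (L i \<and> R i)"
  shows "b = c"
  using assms(1-4)
proof (induction arbitrary: c rule: dyck.induct)
  case (empty i)
  from empty(1) show ?case by cases (use empty LR in auto)
next
  case (skip l i)
  note IH = skip.IH and hyps = skip.hyps and prems = skip.prems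
  from prems(1) show ?case
  proof cases
    case empty
    then show ?thesis using hyps prems by blast
  next
    case skip
    then show ?thesis using IH prems by blast
  next
    case wrap
    then show ?thesis using hyps by blast
  qed
next
  case (wrap j r i)
  note IH = wrap.IH and hyps = wrap.hyps and prems = wrap.prems
  from prems(1) show ?case
  proof cases
    case empty
    then show ?thesis using hyps prems LR by blast
  next
    case skip
    then show ?thesis using hyps by blast
  next
    case (wrap r')
    then have "r' = r" using IH(1)[of r'] hyps by simp
    with wrap IH(2) prems show ?thesis by simp
  qed
qed

lemma dyck_append: "dyck L R a b \<Longrightarrow> dyck L R b c \<Longrightarrow> dyck L R a c"
  by (induction rule: dyck.induct) (auto intro: dyck.skip dyck.wrap)

text \<open>The reflection sends the unit cell from \<open>i\<close> to \<open>i + 1\<close> to the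
  cell from \<open>- i - 1\<close> to \<open>- i\<close>, hence the offset in the bracket predicates
  but not in the end points.\<close>

lemma dyck_reflect: "dyck L R a b \<Longrightarrow> dyck (\<lambda>i. R (- i - 1)) (\<lambda>i. L (- i - 1)) (- b) (- a)"
proof (induction rule: dyck.induct)
  case (skip l i)
  have "dyck (\<lambda>i. R (- i - 1)) (\<lambda>i. L (- i - 1)) (- (l + 1)) (- l)"
    by (rule dyck.skip) (use skip.hyps in \<open>simp_all add: dyck.empty\<close>)
  with skip.IH show ?case by (rule dyck_append)
next
  case (wrap j r i)
  have "dyck (\<lambda>i. R (- i - 1)) (\<lambda>i. L (- i - 1)) (- (r + 1)) (- j)"
  proof (rule dyck.wrap)
    show "dyck (\<lambda>i. R (- i - 1)) (\<lambda>i. L (- i - 1)) (- (r + 1) + 1) (- (j + 1))"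
      using wrap.IH(1) by simp
    show "dyck (\<lambda>i. R (- i - 1)) (\<lambda>i. L (- i - 1)) (- (j + 1) + 1) (- j)"
      by (simp add: dyck.empty)
  qed (use wrap.hyps in auto)
  with wrap.IH(2) show ?case by (rule dyck_append)
qed (rule dyck.empty)

lemma dyck_unique_left:
  assumes "dyck L R a c" "dyck L R b c" "L (a - 1)" "L (b - 1)" and "\<And>i. \<not> (L i \<and> R i)"
  shows "a = b"
proof -
  have "- a = - b"
    by (rule dyck_unique[OF dyck_reflect[OF assms(1)] dyck_reflect[OF assms(2)]]) (use assms(3-5) in auto)
  then show ?thesis by simp
qed

lemma dyck_shift:
  assumes "dyck L R a b" and "\<And>i. L (i + d) = L i" "\<And>i. R (i + d) = R i"
  shows "dyck L R (a + d) (b + d)"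
  using assms(1)
proof induction
  case (skip l i)
  show ?case
  proof (rule dyck.skip)
    show "dyck L R (l + d + 1) (i + d)" using skip.IH by (simp add: algebra_simps)
  qed (use skip.hyps assms in auto)
next
  case (wrap j r i)
  show ?case
  proof (rule dyck.wrap)
    show "dyck L R (j + d + 1) (r + d)" using wrap.IH(1) by (simp add: algebra_simps)
    show "dyck L R (r + d + 1) (i + d)" using wrap.IH(2) by (simp add: algebra_simps)
  qed (use wrap.hyps assms in auto)
qed (rule dyck.empty)

text \<open>
  The closed walk \<open>\<dots> \<rightarrow> x i \<rightarrow> y i \<rightarrow> x (i + 1) \<rightarrow> \<dots>\<close> is indexed by the integers modulo \<open>n\<close>, and the
  keys \<open>B\<close> and \<open>G\<close> say that both bipartite graphs are triangular on it.  A column whose two walk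
  edges lie in both graphs can be matched either way, so it gets the colour of its predecessor.
\<close>

locale closed_walk =
  fixes n :: int and x :: "int \<Rightarrow> 'a" and y :: "int \<Rightarrow> 'b"
    and F1 F2 :: "'b \<Rightarrow> 'a set" and key1 key2 :: "int \<Rightarrow> int"
  assumes n_pos: "n > 0"
    and x_eq: "x i = x j \<longleftrightarrow> i mod n = j mod n"
    and y_eq: "y i = y j \<longleftrightarrow> i mod n = j mod n"
    and edge1: "x i \<in> F1 (y i)"
    and edge2: "x (i + 1) \<in> F2 (y i)"
    and chord1: "x i \<in> F1 (y j) \<Longrightarrow> i mod n = j mod n \<or> key1 j < key1 i"
    and chord2: "x (j + 1) \<in> F2 (y i) \<Longrightarrow> i mod n = j mod n \<or> key2 j < key2 i"
    and key1_per: "i mod n = j mod n \<Longrightarrow> key1 i = key1 j"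
    and key2_per: "i mod n = j mod n \<Longrightarrow> key2 i = key2 j"
begin

definition both :: "'b \<Rightarrow> 'a set" where "both c = F1 c \<inter> F2 c"

definition single :: "'b \<Rightarrow> 'a set" where "single c = {r \<in> range x. (r \<in> F1 c) \<noteq> (r \<in> F2 c)}"

definition neutral :: "int \<Rightarrow> bool" where
  "neutral i \<longleftrightarrow> x i \<in> both (y i) \<and> x (i + 1) \<in> both (y i)"

end

text \<open>\<open>kap\<close> marks the columns that are to be matched through \<open>F2\<close>;
  the others use \<open>F1\<close>. \<open>some_coloured\<close> makes the colour inherited by
  neutral columns well defined.\<close>

locale coloured_walk = closed_walk +
  fixes kap :: "'b \<Rightarrow> bool"
  assumes nested: "kap (y i) \<noteq> kap (y j) \<Longrightarrow> single (y i) \<subseteq> both (y j) \<or> single (y j) \<subseteq> both (y i)"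
    and some_coloured: "\<exists>i. \<not> neutral i"
begin

lemma mod_Suc_cong: "(i + 1) mod n = (j + 1) mod n \<longleftrightarrow> i mod n = j mod n" for i j
proof
  assume "(i + 1) mod n = (j + 1) mod n"
  then have "(i + 1 - 1) mod n = (j + 1 - 1) mod n" by (rule mod_diff_cong) simp
  then show "i mod n = j mod n" by simp
next
  assume "i mod n = j mod n"
  then show "(i + 1) mod n = (j + 1) mod n" by (rule mod_add_cong) simp
qed

lemma neutral_per: "i mod n = j mod n \<Longrightarrow> neutral i = neutral j"
  using mod_Suc_cong[of i j] unfolding neutral_def by (metis x_eq y_eq)

definition gap :: "int \<Rightarrow> nat" where "gap i = (LEAST d. \<not> neutral (i - int d))"

definition col :: "int \<Rightarrow> bool" where "col i = kap (y (i - int (gap i)))"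

lemma ex_gap: "\<exists>d. \<not> neutral (i - int d)"
proof -
  obtain j where j: "\<not> neutral j" using some_coloured by blast
  define d where "d = nat ((i - j) mod n)"
  have "int d = (i - j) mod n" using n_pos by (simp add: d_def)
  then have "(i - int d) mod n = (i - (i - j)) mod n" by (metis mod_diff_right_eq)
  then have "(i - int d) mod n = j mod n" by simp
  with j neutral_per show ?thesis by blast
qed

lemma gap_nonneutral: "\<not> neutral (i - int (gap i))"
  unfolding gap_def using LeastI_ex[OF ex_gap] .

lemma gap_least: "d < gap i \<Longrightarrow> neutral (i - int d)"
  unfolding gap_def using not_less_Least by blast

lemma gap_per: assumes "i mod n = j mod n" shows "gap i = gap j"
proof -
  have "(i - int d) mod n = (j - int d) mod n" for d using assms by (intro mod_diff_cong) auto
  then have "neutral (i - int d) = neutral (j - int d)" for d by (rule neutral_per)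
  then show ?thesis by (simp add: gap_def)
qed

lemma col_per: "i mod n = j mod n \<Longrightarrow> col i = col j"
  unfolding col_def using gap_per[of i j] by (metis mod_diff_left_eq y_eq)

lemma col_nonneutral: "\<not> neutral i \<Longrightarrow> col i = kap (y i)"
proof -
  assume "\<not> neutral i"
  then have "gap i = 0" unfolding gap_def by (intro Least_equality) auto
  then show ?thesis by (simp add: col_def)
qed

lemma gap_neutral: "neutral (i + 1) \<Longrightarrow> gap (i + 1) = Suc (gap i)"
  unfolding gap_def
proof (rule Least_equality)
  assume "neutral (i + 1)"
  show "\<not> neutral (i + 1 - int (Suc (LEAST d. \<not> neutral (i - int d))))"
    using gap_nonneutral[of i] by (simp add: gap_def)
  fix d assume d: "\<not> neutral (i + 1 - int d)"
  show "Suc (LEAST d. \<not> neutral (i - int d)) \<le> d"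
  proof (cases d)
    case 0
    with d \<open>neutral (i + 1)\<close> show ?thesis by simp
  next
    case (Suc e)
    with d have "\<not> neutral (i - int e)" by simp
    then show ?thesis using Suc by (simp add: Least_le)
  qed
qed

lemma col_neutral: "neutral (i + 1) \<Longrightarrow> col (i + 1) = col i"
  using gap_neutral[of i] by (simp add: col_def)

definition switch :: "int \<Rightarrow> bool" where "switch i \<longleftrightarrow> col i \<noteq> col (i + 1)"
text \<open>Only a change of colour creates a conflict or a free row: if the colour is true before
  and false after, both neighbours claim \<open>x (i + 1)\<close>; in the opposite case neither
  does. The bracket type records which neighbour has that row in only one graph: the later column
  for \<open>opn\<close>, the earlier one for \<open>cls\<close>. The other neighbour has the row in
  both graphs (see \<open>switch_nested\<close>).\<close>

definition opn :: "int \<Rightarrow> bool" where "opn i \<longleftrightarrow> switch i \<and> single (y (i + 1)) \<subseteq> both (y i)"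
definition cls :: "int \<Rightarrow> bool" where "cls i \<longleftrightarrow> switch i \<and> single (y i) \<subseteq> both (y (i + 1))"

lemma single_x: "x i \<in> single c \<longleftrightarrow> (x i \<in> F1 c) \<noteq> (x i \<in> F2 c)"
  by (simp add: single_def)

lemma both_x: "r \<in> both c \<longleftrightarrow> r \<in> F1 c \<and> r \<in> F2 c"
  by (simp add: both_def)

lemma chord1': "x i \<in> F1 (y j) \<Longrightarrow> key1 j \<le> key1 i"
  using chord1[of i j] key1_per[of i j] by auto

lemma chord2': "x (j + 1) \<in> F2 (y i) \<Longrightarrow> key2 j \<le> key2 i"
  using chord2[of j i] key2_per[of i j] by auto

lemma chord2'': "x j \<in> F2 (y i) \<Longrightarrow> key2 (j - 1) \<le> key2 i"
  using chord2'[of "j - 1" i] by simp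

lemma switch_right: "switch i \<Longrightarrow> \<not> neutral (i + 1)"
  using col_neutral[of i] by (auto simp: switch_def)

lemma switch_n: "switch i \<Longrightarrow> i mod n \<noteq> (i + 1) mod n"
  using col_per[of i "i + 1"] by (auto simp: switch_def)

lemma n_gt1: "switch i \<Longrightarrow> n > 1"
  using switch_n[of i] n_pos by (cases "n = 1") auto

text \<open>Inside a run of neutral columns each walk edge also lies in the other graph and is a
  chord there, so triangularity makes the keys monotone along the run.\<close>

lemma run_key1: assumes "d \<le> gap i" shows "key1 (i - int d + 1) \<le> key1 (i + 1)"
  using assms
proof (induction d)
  case (Suc d)
  have "neutral (i - int d)" using Suc.prems gap_least[of d i] by simp
  then have "x (i - int d + 1) \<in> F1 (y (i - int d))" by (simp add: neutral_def both_x)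
  then have "key1 (i - int d) \<le> key1 (i - int d + 1)" by (rule chord1')
  with Suc show ?case by (simp add: algebra_simps)
qed simp

lemma run_key2: assumes "d \<le> gap i" shows "key2 (i - int d) \<le> key2 i"
  using assms
proof (induction d)
  case (Suc d)
  have "neutral (i - int d)" using Suc.prems gap_least[of d i] by simp
  then have "x (i - int d) \<in> F2 (y (i - int d))" by (simp add: neutral_def both_x)
  then have "key2 (i - int d - 1) \<le> key2 (i - int d)" by (rule chord2'')
  with Suc show ?case by (simp add: algebra_simps)
qed simp


text \<open>Compare the last column \<open>v\<close> up to \<open>i\<close> that is not neutral with
  \<open>z = i + 1\<close>, which is not neutral either because neutral columns copy the colour
  before them. By nestedness, a single edge at the wrong row, or a neutral run between
  \<open>v\<close> and \<open>z\<close>, would yield a chord against the order of the keys. Hence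
  \<open>v = i\<close>, and the single edges sit at the contested row.\<close>

lemma switch_nested:
  assumes "switch i"
  shows "\<not> neutral i" "opn i \<or> cls i"
    "opn i \<Longrightarrow> x (i + 1) \<in> single (y (i + 1)) \<and> x (i + 1) \<in> both (y i) \<and> x i \<in> single (y i)"
    "cls i \<Longrightarrow> x (i + 1) \<in> single (y i) \<and> x (i + 1) \<in> both (y (i + 1)) \<and> x (i + 2) \<in> single (y (i + 1))"
proof -
  define v where "v = i - int (gap i)"
  define z where "z = i + 1"
  have nv: "\<not> neutral v" using gap_nonneutral by (simp add: v_def)
  have nz: "\<not> neutral z" using switch_right[OF assms] by (simp add: z_def)
  have cv: "col v = col i" using col_nonneutral[OF nv] by (simp add: col_def v_def)
  have vz: "col v \<noteq> col z" using assms cv by (simp add: switch_def z_def)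
  then have vz_mod: "v mod n \<noteq> z mod n" using col_per by blast
  have nest: "single (y v) \<subseteq> both (y z) \<or> single (y z) \<subseteq> both (y v)"
    using nested[of v z] vz col_nonneutral[OF nv] col_nonneutral[OF nz] by simp
  have k1: "key1 (v + 1) \<le> key1 z"
    using run_key1[of "gap i" i] by (simp add: v_def z_def)
  have k2: "key2 v \<le> key2 i" using run_key2[of "gap i" i] by (simp add: v_def)
  have both_single: "x j \<in> single (y c) \<longleftrightarrow> x j \<notin> both (y c)" if "x j \<in> F1 (y c) \<or> x j \<in> F2 (y c)" for j c
    using that by (auto simp: single_x both_x)
  have sv: "x v \<in> single (y v) \<or> x (v + 1) \<in> single (y v)"
    using nv edge1[of v] edge2[of v] by (auto simp: neutral_def single_x both_x)
  have sz: "x z \<in> single (y z) \<or> x (z + 1) \<in> single (y z)"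
    using nz edge1[of z] edge2[of z] by (auto simp: neutral_def single_x both_x)
  have in1: "x (v + 1) \<in> single (y v) \<and> gap i = 0" if sub: "single (y v) \<subseteq> both (y z)"
  proof -
    have *: "x (v + 1) \<in> single (y v)"
    proof (rule ccontr)
      assume a: "x (v + 1) \<notin> single (y v)"
      with sv sub have "x v \<in> F1 (y z)" by (auto simp: both_x)
      then have "key1 z < key1 v" using chord1 vz_mod by blast
      moreover have "x (v + 1) \<in> F1 (y v)" using a edge2[of v] by (auto simp: single_x)
      then have "key1 v \<le> key1 (v + 1)" by (rule chord1')
      ultimately show False using k1 by simp
    qed
    moreover have "gap i = 0"
    proof (rule ccontr)
      assume b: "gap i \<noteq> 0"
      have "neutral (v + 1)" using gap_least[of "gap i - 1" i] b by (simp add: v_def of_nat_diff algebra_simps)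
      then have "(v + 1) mod n \<noteq> z mod n" using neutral_per nz by blast
      moreover have "x (v + 1) \<in> F1 (y z)" using * sub by (auto simp: both_x)
      ultimately have "key1 z < key1 (v + 1)" using chord1 by blast
      with k1 show False by simp
    qed
    ultimately show ?thesis by simp
  qed
  have in2: "x z \<in> single (y z) \<and> gap i = 0" if sub: "single (y z) \<subseteq> both (y v)"
  proof -
    have *: "x z \<in> single (y z)"
    proof (rule ccontr)
      assume a: "x z \<notin> single (y z)"
      with sz sub have "x (z + 1) \<in> F2 (y v)" by (auto simp: both_x)
      then have "key2 z < key2 v" using chord2[of z v] vz_mod by auto
      moreover have "x z \<in> F2 (y z)" using a edge1[of z] by (auto simp: single_x)
      then have "key2 i \<le> key2 z" using chord2''[of z z] by (simp add: z_def)
      ultimately show False using k2 by simp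
    qed
    moreover have "gap i = 0"
    proof (rule ccontr)
      assume b: "gap i \<noteq> 0"
      have "neutral i" using gap_least[of 0 i] b by simp
      then have "i mod n \<noteq> v mod n" using neutral_per nv by blast
      moreover have "x (i + 1) \<in> F2 (y v)" using * sub by (auto simp: both_x z_def)
      ultimately have "key2 i < key2 v" using chord2 by metis
      with k2 show False by simp
    qed
    ultimately show ?thesis by simp
  qed
  have b0: "gap i = 0" using nest in1 in2 by blast
  then have vi: "v = i" by (simp add: v_def)
  show "\<not> neutral i" using nv vi by simp
  show "opn i \<or> cls i" using nest assms vi by (auto simp: opn_def cls_def z_def)
  show "x (i + 1) \<in> single (y (i + 1)) \<and> x (i + 1) \<in> both (y i) \<and> x i \<in> single (y i)" if o: "opn i"
  proof -
    have sub: "single (y z) \<subseteq> both (y v)" using o vi by (simp add: opn_def z_def)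
    then have 1: "x z \<in> single (y z)" using in2 by blast
    then have 2: "x z \<in> both (y v)" using sub by blast
    then have "x v \<notin> both (y v)" using nv by (simp add: neutral_def vi z_def)
    then have "x v \<in> single (y v)" using edge1[of v] by (auto simp: single_x both_x)
    with 1 2 show ?thesis by (simp add: vi z_def)
  qed
  show "x (i + 1) \<in> single (y i) \<and> x (i + 1) \<in> both (y (i + 1)) \<and> x (i + 2) \<in> single (y (i + 1))" if c: "cls i"
  proof -
    have sub: "single (y v) \<subseteq> both (y z)" using c vi by (simp add: cls_def z_def)
    then have 1: "x (v + 1) \<in> single (y v)" using in1 by blast
    then have 2: "x z \<in> both (y z)" using sub by (auto simp: vi z_def)
    then have "x (z + 1) \<notin> both (y z)" using nz by (simp add: neutral_def)
    then have "x (z + 1) \<in> single (y z)" using edge2[of z] by (auto simp: single_x both_x)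
    with 1 2 show ?thesis by (simp add: vi z_def algebra_simps)
  qed
qed

lemma opn_cls: "\<not> (opn i \<and> cls i)"
  using switch_nested(3,4)[of i] by (auto simp: opn_def cls_def single_x both_x)

lemma col_cls: "cls i \<Longrightarrow> col i \<noteq> col (i + 1)" and col_opn: "opn i \<Longrightarrow> col i \<noteq> col (i + 1)"
  by (simp_all add: opn_def cls_def switch_def)

lemma opn_nonneutral: "opn i \<Longrightarrow> \<not> neutral i \<and> \<not> neutral (i + 1)"
  using switch_nested(1)[of i] switch_right[of i] by (auto simp: opn_def)

lemma cls_nonneutral: "cls i \<Longrightarrow> \<not> neutral i \<and> \<not> neutral (i + 1)"
  using switch_nested(1)[of i] switch_right[of i] by (auto simp: cls_def)

text \<open>The partner is found by moving left from \<open>i\<close> as long as the interval stays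
  balanced, its left end has a colour different from that of \<open>z = i + 1\<close>, and
  \<open>key2\<close> stays below \<open>key2 z\<close>. Nested closing brackets met on the way have
  smaller key, so the induction supplies their partners and their intervals are absorbed; the first
  position that cannot be absorbed is an opening bracket.\<close>

lemma cls_match:
  assumes "cls i"
  shows "\<exists>j<i. opn j \<and> dyck opn cls (j + 1) i \<and> (\<forall>q\<in>{j..i}. key2 q < key2 (i + 1)) \<and>
    x (j + 1) \<in> both (y (i + 1)) \<and> col j = col (i + 1)"
  using assms
proof (induction "nat (key2 (i + 1) - Min (key2 ` {0..<n}))" arbitrary: i rule: less_induct)
  case less
  define z where "z = i + 1"
  note ci = switch_nested(4)[OF _ \<open>cls i\<close>]
  have swi: "switch i" using \<open>cls i\<close> by (simp add: cls_def)
  have nz: "\<not> neutral z" using cls_nonneutral[OF \<open>cls i\<close>] by (simp add: z_def)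
  have key2_min: "Min (key2 ` {0..<n}) \<le> key2 q" for q
  proof -
    have "key2 q = key2 (q mod n)" by (rule key2_per) simp
    then show ?thesis using n_pos by (auto intro!: Min_le)
  qed
  define S where "S = {l. l \<le> i \<and> dyck opn cls l i \<and> col l \<noteq> col z \<and> (\<forall>q\<in>{l..i}. key2 q < key2 z)}"
  have "x (i + 1) \<in> F2 (y z)" using ci swi by (simp add: z_def both_x)
  then have "key2 i < key2 z" using chord2[of i z] switch_n[OF swi] by (auto simp: z_def)
  then have iS: "i \<in> S" using col_cls[OF \<open>cls i\<close>] by (auto simp: S_def z_def intro: dyck.empty)
  \<comment> \<open>One full turn back the key equals \<open>key2 z\<close> again, so the search
    cannot pass that position.\<close>
  have S_low: "l > z - n" if "l \<in> S" for l
  proof (rule ccontr)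
    assume "\<not> l > z - n"
    moreover have "z - n \<le> i" using n_gt1[OF swi] by (simp add: z_def)
    ultimately have "key2 (z - n) < key2 z" using that by (auto simp: S_def)
    moreover have "key2 (z - n) = key2 z" by (rule key2_per) simp
    ultimately show False by simp
  qed
  define l where "l = z - n + int (LEAST d. z - n + int d \<in> S)"
  have lS: "l \<in> S" and least: "l' \<in> S \<Longrightarrow> l \<le> l'" for l'
  proof -
    have "z - n + int (nat (i - (z - n))) \<in> S" using iS S_low[OF iS] by simp
    then show "l \<in> S" unfolding l_def by (rule LeastI)
    assume l': "l' \<in> S"
    then have "z - n + int (nat (l' - (z - n))) \<in> S" using S_low[OF l'] by simp
    then have "(LEAST d. z - n + int d \<in> S) \<le> nat (l' - (z - n))" by (rule Least_le)
    then show "l \<le> l'" using S_low[OF l'] by (simp add: l_def)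
  qed
  have li: "l \<le> i" and dl: "dyck opn cls l i" and cl: "col l \<noteq> col z" and kl: "\<And>q. q \<in> {l..i} \<Longrightarrow> key2 q < key2 z"
    using lS by (auto simp: S_def)
  \<comment> \<open>The reverse inclusion would place \<open>x (z + 1)\<close>, a single edge of
    \<open>z\<close>, into \<open>F2 (y l)\<close> and force
    \<open>key2 z \<le> key2 l\<close>.\<close>
  have inner: "single (y l) \<subseteq> both (y z)" if nl: "\<not> neutral l"
  proof (rule ccontr)
    assume "\<not> single (y l) \<subseteq> both (y z)"
    then have "single (y z) \<subseteq> both (y l)"
      using nested[of l z] cl col_nonneutral[OF nl] col_nonneutral[OF nz] by auto
    then have "x (z + 1) \<in> F2 (y l)" using ci swi by (auto simp: z_def both_x algebra_simps)
    then have "key2 z \<le> key2 l" by (rule chord2')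
    with kl[of l] li show False by simp
  qed
  have "x l \<in> F2 (y l) \<or> x l \<in> F2 (y z)"
  proof (cases "x l \<in> F2 (y l)")
    case False
    then have "\<not> neutral l" "x l \<in> single (y l)" using edge1[of l] by (auto simp: neutral_def both_x single_x)
    with inner show ?thesis by (auto simp: both_x)
  qed simp
  moreover have "key2 (l - 1) < key2 z \<or> (l - 1) mod n = z mod n" if "x l \<in> F2 (y z)"
    using chord2[of "l - 1" z] that by auto
  moreover have "key2 (l - 1) < key2 z" if "x l \<in> F2 (y l)"
    using chord2''[OF that] kl[of l] li by simp
  ultimately have kl1: "key2 (l - 1) < key2 z \<or> (l - 1) mod n = z mod n" by blast
  have not_skip: "col (l - 1) \<noteq> col l"
  proof
    assume eq: "col (l - 1) = col l"
    then have "(l - 1) mod n \<noteq> z mod n" using cl col_per by metis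
    with kl1 have k: "key2 (l - 1) < key2 z" by simp
    have "l - 1 \<in> S" unfolding S_def
    proof (intro CollectI conjI ballI)
      show "dyck opn cls (l - 1) i"
        by (rule dyck.skip) (use eq dl in \<open>auto simp: opn_def cls_def switch_def\<close>)
      show "col (l - 1) \<noteq> col z" using eq cl by simp
      fix q assume "q \<in> {l - 1..i}"
      then show "key2 q < key2 z" using k kl by (cases "q = l - 1") auto
    qed (use li in simp)
    from least[OF this] show False by simp
  qed
  then have sw: "switch (l - 1)" by (simp add: switch_def)
  \<comment> \<open>A closing bracket here has a partner by induction, and wrapping that pair would
    extend the interval beyond its leftmost end \<open>l\<close>.\<close>
  have "\<not> cls (l - 1)"
  proof
    assume cls: "cls (l - 1)"
    have "key2 l < key2 z" using kl li by simp
    then have "nat (key2 (l - 1 + 1) - Min (key2 ` {0..<n})) < nat (key2 (i + 1) - Min (key2 ` {0..<n}))"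
      using key2_min[of l] by (simp add: z_def)
    from less.hyps[OF this cls] obtain j where j: "j < l - 1" "opn j" "dyck opn cls (j + 1) (l - 1)"
      "\<forall>q\<in>{j..l - 1}. key2 q < key2 l" "col j = col l" by auto
    have "j \<in> S" unfolding S_def
    proof (intro CollectI conjI ballI)
      show "dyck opn cls j i" by (rule dyck.wrap[of _ j _ "l - 1"]) (use j cls dl in auto)
      show "col j \<noteq> col z" using j cl by simp
      fix q assume q: "q \<in> {j..i}"
      show "key2 q < key2 z"
      proof (cases "q \<le> l - 1")
        case True
        then have "key2 q < key2 l" using j(4) q by simp
        with \<open>key2 l < key2 z\<close> show ?thesis by simp
      qed (use kl q in auto)
    qed (use j li in simp)
    from least[OF this] j show False by simp
  qed
  with switch_nested(2)[OF sw] have opn: "opn (l - 1)" by simp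
  have sl: "x l \<in> single (y l)" using switch_nested(3)[OF sw opn] by simp
  have "\<not> neutral l" using opn_nonneutral[OF opn] by simp
  with inner sl have xl: "x l \<in> both (y z)" by blast
  have colj: "col (l - 1) = col z" using not_skip cl by auto
  show ?case
  proof (intro exI[of _ "l - 1"] conjI ballI)
    have sj: "x (l - 1) \<in> single (y (l - 1))" using switch_nested(3)[OF sw opn] by simp
    have exitj: "x l \<in> both (y (l - 1))" using switch_nested(3)[OF sw opn] by simp
    have "(l - 1) mod n \<noteq> z mod n"
    proof
      assume e: "(l - 1) mod n = z mod n"
      then have "y (l - 1) = y z" using y_eq by blast
      moreover from e have "l mod n = (z + 1) mod n" using mod_Suc_cong[of "l - 1" z] by simp
      then have "x l = x (z + 1)" using x_eq by blast
      moreover have "x (z + 1) \<in> single (y z)" using ci swi by (simp add: z_def algebra_simps)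
      ultimately show False using exitj by (auto simp: single_x both_x)
    qed
    with kl1 have k: "key2 (l - 1) < key2 z" by simp
    fix q assume "q \<in> {l - 1..i}"
    then show "key2 q < key2 (i + 1)" using k kl by (cases "q = l - 1") (auto simp: z_def)
  qed (use li opn dl xl colj in \<open>auto simp: z_def\<close>)
qed


lemma switch_per: "i mod n = j mod n \<Longrightarrow> switch i = switch j"
  using col_per[of i j] col_per[of "i + 1" "j + 1"] mod_Suc_cong[of i j] by (simp add: switch_def)

lemma opn_per: "i mod n = j mod n \<Longrightarrow> opn i = opn j"
  using switch_per[of i j] y_eq[of i j] y_eq[of "i + 1" "j + 1"] mod_Suc_cong[of i j] by (simp add: opn_def)

lemma cls_per: "i mod n = j mod n \<Longrightarrow> cls i = cls j"
  using switch_per[of i j] y_eq[of i j] y_eq[of "i + 1" "j + 1"] mod_Suc_cong[of i j] by (simp add: cls_def)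

lemma uminus_mod_eq: "(- i) mod n = (- j) mod n \<longleftrightarrow> i mod n = j mod n" for i j
  by (metis mod_minus_cong minus_minus)

text \<open>Reversing the walk exchanges the two graphs, negates the keys and turns opening into
  closing brackets, so this is \<open>cls_match\<close> for the mirror image.\<close>

lemma opn_match:
  assumes "opn j"
  shows "\<exists>i>j. cls i \<and> dyck opn cls (j + 1) i \<and> x (i + 1) \<in> both (y j) \<and> col (i + 1) = col j"
proof -
  interpret r: closed_walk n "\<lambda>i. x (1 - i)" "\<lambda>i. y (- i)" F2 F1 "\<lambda>i. - key2 (- i)" "\<lambda>i. - key1 (- i)"
  proof
    fix i j :: int
    have "(1 - i) mod n = (1 - j) mod n \<longleftrightarrow> (- i) mod n = (- j) mod n"
      using mod_Suc_cong[of "- i" "- j"] by simp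
    then show "x (1 - i) = x (1 - j) \<longleftrightarrow> i mod n = j mod n"
      by (simp add: x_eq uminus_mod_eq)
    show "y (- i) = y (- j) \<longleftrightarrow> i mod n = j mod n"
      by (simp add: y_eq uminus_mod_eq)
    show "x (1 - i) \<in> F2 (y (- i))" using edge2[of "- i"] by simp
    show "x (1 - (i + 1)) \<in> F1 (y (- i))" using edge1[of "- i"] by simp
    show "i mod n = j mod n \<or> - key2 (- j) < - key2 (- i)" if "x (1 - i) \<in> F2 (y (- j))"
      using chord2[of "- i" "- j"] that by (auto simp: uminus_mod_eq)
    show "i mod n = j mod n \<or> - key1 (- j) < - key1 (- i)" if "x (1 - (j + 1)) \<in> F1 (y (- i))"
      using chord1[of "- j" "- i"] that by (auto simp: uminus_mod_eq)
    show "i mod n = j mod n \<Longrightarrow> - key2 (- i) = - key2 (- j)"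
      using key2_per[of "- i" "- j"] by (simp add: uminus_mod_eq)
    show "i mod n = j mod n \<Longrightarrow> - key1 (- i) = - key1 (- j)"
      using key1_per[of "- i" "- j"] by (simp add: uminus_mod_eq)
  qed (rule n_pos)
  have r_both: "r.both = both" by (auto simp: r.both_def both_def)
  have r_range: "range (\<lambda>i. x (1 - i)) = range x"
    by (auto simp: image_iff) (metis diff_diff_eq2 add_diff_cancel_left')
  have r_single: "r.single = single" unfolding r.single_def single_def r_range by auto
  have r_neutral: "r.neutral i = neutral (- i)" for i
    by (auto simp: r.neutral_def neutral_def r_both)
  interpret r: coloured_walk n "\<lambda>i. x (1 - i)" "\<lambda>i. y (- i)" F2 F1 "\<lambda>i. - key2 (- i)" "\<lambda>i. - key1 (- i)" kap
  proof
    show "kap (y (- i)) \<noteq> kap (y (- j)) \<Longrightarrow>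
      r.single (y (- i)) \<subseteq> r.both (y (- j)) \<or> r.single (y (- j)) \<subseteq> r.both (y (- i))" for i j
      using nested[of "- i" "- j"] by (simp add: r_both r_single)
    obtain i where "\<not> neutral i" using some_coloured by blast
    then show "\<exists>i. \<not> r.neutral i" by (intro exI[of _ "- i"]) (simp add: r_neutral)
  qed
  \<comment> \<open>In the mirror image neutral columns inherit their colour from the other side.
    Both inheritances agree because no switch occurs directly behind a neutral column.\<close>
  have r_col: "r.col i = col (- i)" for i
  proof -
    have run: "col (- i) = col (- i + int d)" if "d \<le> r.gap i" for d
      using that
    proof (induction d)
      case (Suc d)
      have "r.neutral (i - int d)" using Suc.prems r.gap_least by simp
      then have "neutral (- i + int d)" by (simp add: r_neutral)
      then have "\<not> switch (- i + int d)" using switch_nested(1) by blast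
      with Suc show ?case by (simp add: switch_def algebra_simps)
    qed simp
    have "\<not> neutral (- i + int (r.gap i))" using r.gap_nonneutral[of i] by (simp add: r_neutral)
    then have "kap (y (- i + int (r.gap i))) = col (- i + int (r.gap i))" using col_nonneutral by simp
    then show ?thesis using run[of "r.gap i"] by (simp add: r.col_def)
  qed
  have r_switch: "r.switch i = switch (- i - 1)" for i
    by (auto simp: r.switch_def switch_def r_col)
  have r_cls: "r.cls i = opn (- i - 1)" and r_opn: "r.opn i = cls (- i - 1)" for i
    by (simp_all add: r.cls_def r.opn_def opn_def cls_def r_switch r_both r_single)
  have "r.cls (- j - 1)" using assms by (simp add: r_cls)
  from r.cls_match[OF this] obtain j' where j': "j' < - j - 1" "r.opn j'"
    "dyck r.opn r.cls (j' + 1) (- j - 1)" "x (- j') \<in> both (y j)" "r.col j' = r.col (- j)"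
    by (auto simp: r_both)
  have "dyck opn cls (j + 1) (- j' - 1)"
  proof -
    have "- (- j - 1) = j + 1" "- (j' + 1) = - j' - 1" by auto
    then show ?thesis using dyck_reflect[OF j'(3)] by (simp only: r_cls r_opn) simp
  qed
  then show ?thesis using j' r_opn r_col by (intro exI[of _ "- j' - 1"]) auto
qed

definition mu :: "int \<Rightarrow> int" where
  "mu i = (SOME j. opn j \<and> dyck opn cls (j + 1) i \<and> x (j + 1) \<in> both (y (i + 1)) \<and> col j = col (i + 1))"

definition rho :: "int \<Rightarrow> int" where
  "rho j = (SOME i. cls i \<and> dyck opn cls (j + 1) i \<and> x (i + 1) \<in> both (y j) \<and> col (i + 1) = col j)"

lemma mu: assumes "cls i"
  shows "opn (mu i)" "dyck opn cls (mu i + 1) i" "x (mu i + 1) \<in> both (y (i + 1))" "col (mu i) = col (i + 1)"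
proof -
  have "opn (mu i) \<and> dyck opn cls (mu i + 1) i \<and> x (mu i + 1) \<in> both (y (i + 1)) \<and> col (mu i) = col (i + 1)"
    unfolding mu_def by (rule someI_ex) (use cls_match[OF assms] in blast)
  then show "opn (mu i)" "dyck opn cls (mu i + 1) i" "x (mu i + 1) \<in> both (y (i + 1))" "col (mu i) = col (i + 1)"
    by simp_all
qed

lemma rho: assumes "opn j"
  shows "cls (rho j)" "dyck opn cls (j + 1) (rho j)" "x (rho j + 1) \<in> both (y j)" "col (rho j + 1) = col j"
proof -
  have "cls (rho j) \<and> dyck opn cls (j + 1) (rho j) \<and> x (rho j + 1) \<in> both (y j) \<and> col (rho j + 1) = col j"
    unfolding rho_def by (rule someI_ex) (use opn_match[OF assms] in blast)
  then show "cls (rho j)" "dyck opn cls (j + 1) (rho j)" "x (rho j + 1) \<in> both (y j)" "col (rho j + 1) = col j"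
    by simp_all
qed

text \<open>Column \<open>i\<close> will be matched with the row \<open>x (slot i + 1)\<close>. By
  default this is the walk edge that its colour demands. Where two columns claim one row, the column
  that has the row in both graphs gives way and takes the row left free at the matching
  bracket.\<close>

definition slot :: "int \<Rightarrow> int" where
  "slot i = (if col i then if opn i then rho i else i else if cls (i - 1) then mu (i - 1) else i - 1)"

lemma mod_shift_eq: "c mod n = b mod n \<Longrightarrow> (a + (c - b)) mod n = a mod n" for a b c
  by (simp add: mod_eq_dvd_iff)

lemma dyck_shift_n: assumes "dyck opn cls a b" "c mod n = b mod n"
  shows "dyck opn cls (a + (c - b)) c"
proof -
  have *: "(i + (c - b)) mod n = i mod n" for i
    using assms(2) by (metis mod_shift_eq)
  have "dyck opn cls (a + (c - b)) (b + (c - b))"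
    by (rule dyck_shift[OF assms(1)]) (rule opn_per cls_per, rule *)+
  then show ?thesis by simp
qed

text \<open>Each column is rerouted or not and has one of two colours. These four kinds occupy slots
  that differ in colour or bracket type, so a collision stays within one kind; for the rerouted
  kinds it contradicts the uniqueness of the matching bracket.\<close>

lemma slot_inj:
  assumes "slot i mod n = slot j mod n"
  shows "i mod n = j mod n"
proof -
  note per = opn_per[OF assms] cls_per[OF assms] col_per[OF assms]
  have flip: "col k \<noteq> col (k + 1)" if "opn k \<or> cls k" for k using that col_opn col_cls by blast
  have A: "cls (slot k) \<and> \<not> col (slot k)" if "col k" "opn k" for k
    using that rho[of k] flip[of "rho k"] by (simp add: slot_def)
  have B: "col (slot k) \<and> \<not> opn (slot k)" if "col k" "\<not> opn k" for k
    using that by (simp add: slot_def)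
  have C: "opn (slot k) \<and> \<not> col (slot k)" if "\<not> col k" "cls (k - 1)" for k
    using that mu[of "k - 1"] by (simp add: slot_def)
  have D: "(\<not> col (slot k) \<and> \<not> opn (slot k) \<and> \<not> cls (slot k)) \<or> (opn (slot k) \<and> col (slot k))"
    if "\<not> col k" "\<not> cls (k - 1)" for k
    using that flip[of "k - 1"] switch_nested(2)[of "k - 1"] by (auto simp: slot_def switch_def)
  note shift = mod_shift_eq
  consider "col i" "opn i" "col j" "opn j" | "col i" "\<not> opn i" "col j" "\<not> opn j"
    | "\<not> col i" "cls (i - 1)" "\<not> col j" "cls (j - 1)" | "\<not> col i" "\<not> cls (i - 1)" "\<not> col j" "\<not> cls (j - 1)"
    using A[of i] B[of i] C[of i] D[of i] A[of j] B[of j] C[of j] D[of j] per opn_cls by metis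
  then show ?thesis
  proof cases
    case 1
    then have e: "rho j mod n = rho i mod n" using assms by (simp add: slot_def)
    have "dyck opn cls (i + 1 + (rho j - rho i)) (rho j)"
      using dyck_shift_n[OF rho(2)[OF 1(2)] e] .
    moreover have "opn (i + (rho j - rho i))" using 1(2) opn_per shift[OF e] by blast
    ultimately have "i + 1 + (rho j - rho i) = j + 1"
      using rho(2)[OF 1(4)] 1(4) opn_cls by (intro dyck_unique_left[of opn cls _ "rho j"]) auto
    then have "j = i + (rho j - rho i)" by simp
    then show ?thesis using shift[OF e] by metis
  next
    case 3
    then have e: "mu (j - 1) mod n = mu (i - 1) mod n" using assms by (simp add: slot_def)
    let ?d = "mu (j - 1) - mu (i - 1)"
    have e': "(i - 1 + ?d) mod n = (i - 1) mod n" using shift[OF e] .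
    have "dyck opn cls (mu (i - 1) + 1 + (i - 1 + ?d - (i - 1))) (i - 1 + ?d)"
      using dyck_shift_n[OF mu(2)[OF 3(2)] e'] .
    then have "dyck opn cls (mu (j - 1) + 1) (i - 1 + ?d)" by (simp add: add.commute)
    moreover have "cls (i - 1 + ?d)" using 3(2) cls_per[OF e'] by blast
    ultimately have "i - 1 + ?d = j - 1"
      using mu(2)[OF 3(4)] 3(4) opn_cls by (intro dyck_unique[of opn cls "mu (j - 1) + 1"]) auto
    then have "j = i + ?d" by simp
    then show ?thesis using shift[OF e] by metis
  next
    case 4
    then show ?thesis using assms mod_Suc_cong[of "i - 1" "j - 1"] by (simp add: slot_def)
  qed (use assms in \<open>simp add: slot_def\<close>)
qed

lemma slot_edge: "x (slot i + 1) \<in> (if kap (y i) then F2 (y i) else F1 (y i))"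
proof (cases "neutral i")
  case True
  then have "\<not> opn i" "\<not> cls (i - 1)" using opn_nonneutral cls_nonneutral[of "i - 1"] by auto
  with True show ?thesis by (auto simp: slot_def neutral_def both_x)
next
  case False
  then show ?thesis
    using col_nonneutral[OF False] mu(3)[of "i - 1"] rho(3)[of i] edge1[of i] edge2[of i]
    by (auto simp: slot_def both_x)
qed

end

text \<open>If all columns are neutral, the walk edges themselves do; otherwise \<open>slot\<close>
  describes the matching.\<close>

lemma (in closed_walk) recolour:
  assumes nested: "\<And>i j. kap (y i) \<noteq> kap (y j) \<Longrightarrow>
    single (y i) \<subseteq> both (y j) \<or> single (y j) \<subseteq> both (y i)"
  shows "\<exists>f. inj_on f (range y) \<and> f ` range y \<subseteq> range x \<and>
    (\<forall>c\<in>range y. f c \<in> (if kap c then F2 c else F1 c))"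
proof -
  define idx where "idx c = (SOME i. y i = c)" for c
  have idx: "y (idx c) = c" if "c \<in> range y" for c
    unfolding idx_def by (rule someI_ex) (use that in auto)
  have "\<exists>s :: int \<Rightarrow> int. (\<forall>i j. s i mod n = s j mod n \<longrightarrow> i mod n = j mod n) \<and>
    (\<forall>i. x (s i) \<in> (if kap (y i) then F2 (y i) else F1 (y i)))"
  proof (cases "\<exists>i. \<not> neutral i")
    case True
    then interpret coloured_walk n x y F1 F2 key1 key2 kap by unfold_locales (use nested in auto)
    show ?thesis
      using slot_inj slot_edge mod_Suc_cong by (intro exI[of _ "\<lambda>i. slot i + 1"]) blast
  next
    case False
    then show ?thesis by (intro exI[of _ "\<lambda>i. i"]) (auto simp: neutral_def both_def)
  qed
  then obtain s :: "int \<Rightarrow> int" where s: "\<And>i j. s i mod n = s j mod n \<Longrightarrow> i mod n = j mod n"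
    "\<And>i. x (s i) \<in> (if kap (y i) then F2 (y i) else F1 (y i))" by blast
  show ?thesis
  proof (intro exI[of _ "\<lambda>c. x (s (idx c))"] conjI ballI)
    show "inj_on (\<lambda>c. x (s (idx c))) (range y)"
    proof (rule inj_onI)
      fix c d assume "c \<in> range y" "d \<in> range y" "x (s (idx c)) = x (s (idx d))"
      then show "c = d" using s(1) x_eq y_eq idx by metis
    qed
    show "x (s (idx c)) \<in> (if kap c then F2 c else F1 c)" if "c \<in> range y" for c
      using s(2)[of "idx c"] unfolding idx[OF that] .
  qed auto
qed

section \<open>Minimal closed walks\<close>

text \<open>A walk from row to row is the list of its steps, a step being the column passed and the
  row reached. Columns are entered through \<open>F\<close> and left through
  \<open>G\<close>.\<close>

primrec wk :: "('a \<Rightarrow> 'a set) \<Rightarrow> ('a \<Rightarrow> 'a set) \<Rightarrow> 'a \<Rightarrow> ('a \<times> 'a) list \<Rightarrow> 'a \<Rightarrow> bool" where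
  "wk F G x [] z \<longleftrightarrow> x = z"
| "wk F G x (p # ps) z \<longleftrightarrow> x \<in> F (fst p) \<and> snd p \<in> G (fst p) \<and> wk F G (snd p) ps z"

text \<open>The weight lost when the rows of the walk are replaced by its columns.\<close>

definition wcost :: "('a \<Rightarrow> real) \<Rightarrow> ('a \<times> 'a) list \<Rightarrow> real" where
  "wcost w ps = (\<Sum>p\<leftarrow>ps. w (snd p) - w (fst p))"

lemma wcost_simps [simp]:
  "wcost w [] = 0" "wcost w (p # ps) = w (snd p) - w (fst p) + wcost w ps"
  "wcost w (ps @ qs) = wcost w ps + wcost w qs"
  by (simp_all add: wcost_def)

lemma wk_append: "wk F G x (ps @ qs) z \<longleftrightarrow> (\<exists>m. wk F G x ps m \<and> wk F G m qs z)"
  by (induction ps arbitrary: x) auto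

lemma wk_end: "wk F G x ps z \<Longrightarrow> ps \<noteq> [] \<Longrightarrow> snd (last ps) = z"
  by (induction ps arbitrary: x) auto

definition row :: "'a \<Rightarrow> ('a \<times> 'a) list \<Rightarrow> nat \<Rightarrow> 'a" where
  "row x ps i = (if i = 0 then x else snd (ps ! (i - 1)))"

lemma row_simps [simp]: "row x ps 0 = x" "row x ps (Suc i) = snd (ps ! i)"
  by (simp_all add: row_def)

lemma wk_take_drop:
  assumes "wk F G x ps z" "i \<le> length ps"
  shows "wk F G x (take i ps) (row x ps i)" "wk F G (row x ps i) (drop i ps) z"
proof -
  have "wk F G x (take i ps @ drop i ps) z" using assms(1) by simp
  then obtain m where m: "wk F G x (take i ps) m" "wk F G m (drop i ps) z"
    unfolding wk_append by blast
  have "m = row x ps i"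
  proof (cases i)
    case 0
    with m(1) show ?thesis by simp
  next
    case (Suc k)
    then have "take i ps \<noteq> []" using assms(2) by auto
    with wk_end[OF m(1)] show ?thesis using Suc assms(2)
      by (simp add: last_conv_nth min_def split: if_splits)
  qed
  with m show "wk F G x (take i ps) (row x ps i)" "wk F G (row x ps i) (drop i ps) z" by simp_all
qed

lemma wk_nth:
  assumes "wk F G x ps z" "i < length ps"
  shows "row x ps i \<in> F (fst (ps ! i))" "snd (ps ! i) \<in> G (fst (ps ! i))"
  using wk_take_drop(2)[OF assms(1), of i] assms(2) by (simp_all add: Cons_nth_drop_Suc[symmetric])

lemma wk_segment:
  assumes "wk F G x ps z" "i \<le> j" "j \<le> length ps"
  shows "wk F G (row x ps i) (take (j - i) (drop i ps)) (row x ps j)"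
proof (cases "i = j")
  case False
  have "row (row x ps i) (drop i ps) (j - i) = row x ps j"
    using False assms by (auto simp: row_def)
  with wk_take_drop(1)[OF wk_take_drop(2)[OF assms(1)], of i "j - i"] assms show ?thesis by simp
qed simp

lemma wcost_segment:
  assumes "i \<le> j"
  shows "wcost w (take (j - i) (drop i ps)) = wcost w (take j ps) - wcost w (take i ps)"
proof -
  have "take j ps = take i ps @ take (j - i) (drop i ps)"
    using assms by (metis le_add_diff_inverse take_add)
  then show ?thesis by (metis add_diff_cancel_left' wcost_simps(3))
qed

lemma wcost_take_Suc:
  "i < length ps \<Longrightarrow> wcost w (take (Suc i) ps) = wcost w (take i ps) + w (snd (ps ! i)) - w (fst (ps ! i))"
  by (simp add: take_Suc_conv_app_nth)

lemma wcost_drop: "i \<le> length ps \<Longrightarrow> wcost w (drop i ps) = wcost w ps - wcost w (take i ps)"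
  by (metis add_diff_cancel_left' append_take_drop_id wcost_simps(3))

text \<open>
  The common features of a negative closed walk with fewest steps and of a closed walk through
  \<open>x\<close> that is lexicographically minimal with respect to cost and length.
\<close>

definition minwalk :: "('a \<Rightarrow> 'a set) \<Rightarrow> ('a \<Rightarrow> 'a set) \<Rightarrow> ('a \<Rightarrow> real) \<Rightarrow> 'a \<Rightarrow> ('a \<times> 'a) list \<Rightarrow> bool" where
  "minwalk F G w x ps \<longleftrightarrow> wk F G x ps x \<and> ps \<noteq> [] \<and> x \<notin> snd ` set (butlast ps) \<and>
    (\<forall>z qs. wk F G z qs z \<and> qs \<noteq> [] \<and> x \<notin> snd ` set qs \<and> snd ` set qs \<subseteq> snd ` set ps \<and>
      length qs < length ps \<longrightarrow> 0 \<le> wcost w qs) \<and>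
    (\<forall>qs. wk F G x qs x \<and> qs \<noteq> [] \<and> x \<notin> snd ` set (butlast qs) \<and> snd ` set qs \<subseteq> snd ` set ps \<and>
      length qs < length ps \<longrightarrow> wcost w ps < wcost w qs)"

context
  fixes F G :: "'a \<Rightarrow> 'a set" and w :: "'a \<Rightarrow> real" and x :: 'a and ps :: "('a \<times> 'a) list"
  assumes mw: "minwalk F G w x ps"
begin

abbreviation (input) "len \<equiv> length ps"
abbreviation (input) "cl i \<equiv> fst (ps ! i)"

text \<open>The costs up to row \<open>i\<close> and, for \<open>pre2\<close>, up to the column
  after it serve as potentials: they order the matchings formed by the entering and by the leaving
  edges.\<close>

definition pre1 :: "nat \<Rightarrow> real" where "pre1 i = wcost w (take i ps)"
definition pre2 :: "nat \<Rightarrow> real" where "pre2 i = pre1 i - w (fst (ps ! i))"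

lemma mw_wk: "wk F G x ps x" "ps \<noteq> []" "x \<notin> snd ` set (butlast ps)"
  using mw by (simp_all add: minwalk_def)

lemma mw_closed: "wk F G z qs z \<Longrightarrow> qs \<noteq> [] \<Longrightarrow> x \<notin> snd ` set qs \<Longrightarrow> snd ` set qs \<subseteq> snd ` set ps \<Longrightarrow>
    length qs < length ps \<Longrightarrow> 0 \<le> wcost w qs"
  using mw unfolding minwalk_def by blast

lemma mw_rooted: "wk F G x qs x \<Longrightarrow> qs \<noteq> [] \<Longrightarrow> x \<notin> snd ` set (butlast qs) \<Longrightarrow> snd ` set qs \<subseteq> snd ` set ps \<Longrightarrow>
    length qs < length ps \<Longrightarrow> wcost w ps < wcost w qs"
  using mw unfolding minwalk_def by blast

lemma row_neq: "0 < i \<Longrightarrow> i < len \<Longrightarrow> row x ps i \<noteq> x"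
proof
  assume "0 < i" "i < len" "row x ps i = x"
  then have "butlast ps ! (i - 1) = ps ! (i - 1)" "i - 1 < length (butlast ps)"
    by (auto simp: nth_butlast)
  then have "snd (ps ! (i - 1)) \<in> snd ` set (butlast ps)" by (metis image_eqI nth_mem)
  with \<open>row x ps i = x\<close> \<open>0 < i\<close> mw_wk(3) show False by (simp add: row_def)
qed

lemma row_in: "0 < i \<Longrightarrow> i \<le> len \<Longrightarrow> row x ps i \<in> snd ` set ps"
  by (auto simp: row_def)

lemma row_segment:
  assumes "r \<in> snd ` set (take (j - i) (drop i ps))" "j < len"
  shows "r \<noteq> x" "r \<in> snd ` set ps"
proof -
  from assms(1) obtain p where p: "p \<in> set (take (j - i) (drop i ps))" "r = snd p" by auto
  then obtain k where k: "k < length (take (j - i) (drop i ps))" "p = take (j - i) (drop i ps) ! k"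
    by (metis in_set_conv_nth)
  then have "r = row x ps (Suc (i + k))" "Suc (i + k) < len" using p assms(2) by (auto)
  then show "r \<noteq> x" "r \<in> snd ` set ps" using row_neq[of "Suc (i + k)"] row_in[of "Suc (i + k)"] by auto
qed

lemma set_butlast_drop: "set (butlast (drop i ps)) \<subseteq> set (butlast ps)"
  by (auto simp: drop_butlast[symmetric] dest: in_set_dropD)

lemma set_take_butlast: "i < len \<Longrightarrow> set (take i ps) \<subseteq> set (butlast ps)"
  by (metis Suc_pred length_butlast length_greater_0_conv less_Suc_eq_le mw_wk(2) set_take_subset
      take_butlast)

text \<open>A forward chord shortcuts the walk, and a backward chord closes a shorter walk that
  avoids \<open>x\<close>. Minimality makes the shortcut strictly dearer and the other walk
  nonnegative. Both facts compare prefix costs, with the position as tie-breaker.\<close>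

lemma chord_F:
  assumes ij: "i < len" "j < len" "i \<noteq> j" and e: "row x ps i \<in> F (cl j)"
  shows "pre1 j < pre1 i \<or> pre1 j = pre1 i \<and> j < i"
proof (cases "i < j")
  case True
  let ?qs = "take i ps @ drop j ps"
  have d: "drop j ps = ps ! j # drop (Suc j) ps" using ij by (simp add: Cons_nth_drop_Suc)
  have "wk F G (row x ps i) (drop j ps) x"
    using wk_take_drop(2)[OF mw_wk(1), of j] e ij by (simp add: d)
  then have "wk F G x ?qs x"
    unfolding wk_append using wk_take_drop(1)[OF mw_wk(1), of i] ij by auto
  moreover have "drop j ps \<noteq> []" using ij by simp
  then have "set (butlast ?qs) \<subseteq> set (butlast ps)"
    using set_take_butlast[of i] set_butlast_drop[of j] ij by (auto simp: butlast_append)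
  moreover have "set ?qs \<subseteq> set ps" by (auto dest: in_set_takeD in_set_dropD)
  moreover have "length ?qs < len" using ij True by simp
  ultimately have "wcost w ps < wcost w ?qs"
    using mw_wk(3) \<open>drop j ps \<noteq> []\<close> by (intro mw_rooted) auto
  then show ?thesis using ij by (simp add: wcost_drop pre1_def)
next
  case False
  then have ji: "j < i" using ij by simp
  let ?qs = "take (i - j) (drop j ps)"
  have d: "?qs = ps ! j # take (i - Suc j) (drop (Suc j) ps)"
    using ji ij by (simp add: Cons_nth_drop_Suc[symmetric] take_Cons')
  have "wk F G (row x ps i) ?qs (row x ps i)"
    using wk_segment[OF mw_wk(1), of j i] e ji ij unfolding d by simp
  moreover have "?qs \<noteq> []" by (simp add: d)
  moreover have "x \<notin> snd ` set ?qs" "snd ` set ?qs \<subseteq> snd ` set ps"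
    using row_segment[of _ i j] ij by blast+
  moreover have "length ?qs < len" using ij ji by simp
  ultimately have "0 \<le> wcost w ?qs" by (rule mw_closed)
  then show ?thesis using ji wcost_segment[of j i w ps] by (auto simp: pre1_def)
qed

lemma chord_G:
  assumes ij: "i < len" "j < len" "i \<noteq> j" and e: "snd (ps ! j) \<in> G (cl i)"
  shows "pre2 j < pre2 i \<or> pre2 j = pre2 i \<and> j < i"
proof (cases "i < j")
  case True
  let ?qs = "take i ps @ (cl i, snd (ps ! j)) # drop (Suc j) ps"
  have "wk F G (row x ps i) ((cl i, snd (ps ! j)) # drop (Suc j) ps) x"
    using wk_take_drop(2)[OF mw_wk(1), of "Suc j"] wk_nth(1)[OF mw_wk(1)] e ij by simp
  then have "wk F G x ?qs x"
    unfolding wk_append using wk_take_drop(1)[OF mw_wk(1), of i] ij by auto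
  moreover have "x \<notin> snd ` set (butlast ?qs)"
  proof (cases "Suc j = len")
    case True
    then show ?thesis using set_take_butlast[of i] ij mw_wk(3) by (auto simp: butlast_append)
  next
    case False
    then have "snd (ps ! j) \<noteq> x" using row_neq[of "Suc j"] ij by simp
    then show ?thesis
      using set_take_butlast[of i] set_butlast_drop[of "Suc j"] ij mw_wk(3) by (auto simp: butlast_append)
  qed
  moreover have "snd ` set ?qs \<subseteq> snd ` set ps" using ij by (auto dest: in_set_takeD in_set_dropD)
  moreover have "length ?qs < len" using ij True by simp
  ultimately have "wcost w ps < wcost w ?qs" by (intro mw_rooted) auto
  then show ?thesis using ij by (simp add: wcost_drop pre1_def pre2_def wcost_take_Suc)
next
  case False
  then have ji: "j < i" using ij by simp
  let ?s = "take (i - Suc j) (drop (Suc j) ps)"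
  let ?qs = "?s @ [(cl i, snd (ps ! j))]"
  have "wk F G (snd (ps ! j)) ?qs (snd (ps ! j))"
    unfolding wk_append using wk_segment[OF mw_wk(1), of "Suc j" i] wk_nth(1)[OF mw_wk(1), of i] e ji ij
    by auto
  moreover have "snd (ps ! j) \<noteq> x" using row_neq[of "Suc j"] ij ji by simp
  then have "x \<notin> snd ` set ?qs" using row_segment[of _ i "Suc j"] ij by auto
  moreover have "snd ` set ?qs \<subseteq> snd ` set ps" using row_segment(2)[of _ i "Suc j"] ij by auto
  moreover have "length ?qs < len" using ij ji by simp
  ultimately have "0 \<le> wcost w ?qs" by (intro mw_closed) auto
  then show ?thesis using ji ij wcost_segment[of "Suc j" i w ps]
    by (auto simp: pre1_def pre2_def wcost_take_Suc)
qed

text \<open>If a row occurred twice, the entering edge at each occurrence would be a chord at the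
  other, and the order would have to hold in both directions.\<close>

lemma row_inj: "i < len \<Longrightarrow> j < len \<Longrightarrow> row x ps i = row x ps j \<Longrightarrow> i = j"
proof (induction i j rule: linorder_wlog)
  case (le i j)
  show ?case
  proof (rule ccontr)
    assume "i \<noteq> j"
    then have "pre1 j < pre1 i" "pre1 i < pre1 j \<or> pre1 i = pre1 j"
      using chord_F[of i j] chord_F[of j i] wk_nth(1)[OF mw_wk(1), of j] wk_nth(1)[OF mw_wk(1), of i] le by auto
    then show False by simp
  qed
qed simp

lemma cl_inj: "i < len \<Longrightarrow> j < len \<Longrightarrow> cl i = cl j \<Longrightarrow> i = j"
proof (induction i j rule: linorder_wlog)
  case (le i j)
  show ?case
  proof (rule ccontr)
    assume "i \<noteq> j"
    then have "pre2 j < pre2 i" "pre2 i < pre2 j \<or> pre2 i = pre2 j"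
      using chord_G[of i j] chord_G[of j i] wk_nth(2)[OF mw_wk(1), of j] wk_nth(2)[OF mw_wk(1), of i] le by auto
    then show False by simp
  qed
qed simp

lemma distinct_cols: "distinct (map fst ps)"
  using cl_inj by (auto simp: distinct_conv_nth)

lemma row_Suc_mod: "i < len \<Longrightarrow> row x ps (Suc i mod len) = snd (ps ! i)"
proof (cases "Suc i = len")
  case True
  then have "len - Suc 0 = i" by simp
  with True wk_end[OF mw_wk(1,2)] mw_wk(2) show ?thesis by (simp add: last_conv_nth)
qed simp

lemma distinct_rows: "distinct (map snd ps)"
proof -
  have "i = j" if "i < len" "j < len" "snd (ps ! i) = snd (ps ! j)" for i j
  proof -
    have "Suc i mod len = Suc j mod len"
      using that row_Suc_mod[of i] row_Suc_mod[of j] row_inj[of "Suc i mod len" "Suc j mod len"] mw_wk(2)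
      by (simp del: mod_Suc)
    then show ?thesis using that by (cases "Suc i = len"; cases "Suc j = len") auto
  qed
  then show ?thesis by (auto simp: distinct_conv_nth)
qed

definition lex1 :: "nat \<Rightarrow> nat \<Rightarrow> bool" where "lex1 j i \<longleftrightarrow> pre1 j < pre1 i \<or> pre1 j = pre1 i \<and> j < i"
definition lex2 :: "nat \<Rightarrow> nat \<Rightarrow> bool" where "lex2 j i \<longleftrightarrow> pre2 j < pre2 i \<or> pre2 j = pre2 i \<and> j < i"
text \<open>Pairs of prefix cost and position are replaced by their ranks because the keys of
  \<open>closed_walk\<close> are integers.\<close>

definition rank1 :: "nat \<Rightarrow> nat" where "rank1 i = card {j. j < len \<and> lex1 j i}"
definition rank2 :: "nat \<Rightarrow> nat" where "rank2 i = card {j. j < len \<and> lex2 j i}"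

lemma rank1: "j < len \<Longrightarrow> lex1 j i \<Longrightarrow> rank1 j < rank1 i"
  unfolding rank1_def by (rule psubset_card_mono) (auto simp: lex1_def)

lemma rank2: "j < len \<Longrightarrow> lex2 j i \<Longrightarrow> rank2 j < rank2 i"
  unfolding rank2_def by (rule psubset_card_mono) (auto simp: lex2_def)

lemma chord_rank1: "i < len \<Longrightarrow> j < len \<Longrightarrow> row x ps i \<in> F (cl j) \<Longrightarrow> i = j \<or> rank1 j < rank1 i"
  using chord_F[of i j] rank1[of j i] by (auto simp: lex1_def)

lemma chord_rank2: "i < len \<Longrightarrow> j < len \<Longrightarrow> snd (ps ! j) \<in> G (cl i) \<Longrightarrow> i = j \<or> rank2 j < rank2 i"
  using chord_G[of i j] rank2[of j i] by (auto simp: lex2_def)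

lemma rows_image: "row x ps ` {..<len} = snd ` set ps"
proof
  show "row x ps ` {..<len} \<subseteq> snd ` set ps"
  proof
    fix r assume "r \<in> row x ps ` {..<len}"
    then obtain i where "i < len" "r = row x ps i" by auto
    then show "r \<in> snd ` set ps"
      using row_in[of i] row_Suc_mod[of "len - 1"] mw_wk(2) by (cases "i = 0") auto
  qed
  show "snd ` set ps \<subseteq> row x ps ` {..<len}"
  proof
    fix r assume "r \<in> snd ` set ps"
    then obtain i where "i < len" "r = snd (ps ! i)" by (auto simp: in_set_conv_nth)
    then have "r = row x ps (Suc i mod len)" "Suc i mod len < len" using row_Suc_mod mw_wk(2) by (auto simp del: mod_Suc)
    then show "r \<in> row x ps ` {..<len}" by blast
  qed
qed

text \<open>Minimality refers to the large graphs \<open>F\<close> and \<open>G\<close>, the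
  recolouring to the subgraphs \<open>F'\<close> and \<open>G'\<close>. A chord of a subgraph is a
  chord of the large graph, so triangularity is inherited. Used with \<open>kap\<close> and with its
  complement, the lemma gives the two matchings of the exchanged graphs.\<close>

lemma recolour_bij:
  assumes sub: "\<And>y. F' y \<subseteq> F y" "\<And>y. G' y \<subseteq> G y" and wk': "wk F' G' x ps x"
    and nested: "\<And>y z. y \<in> fst ` set ps \<Longrightarrow> z \<in> fst ` set ps \<Longrightarrow> kap y \<noteq> kap z \<Longrightarrow>
      (F' y - G' y) \<union> (G' y - F' y) \<subseteq> F' z \<inter> G' z \<or> (F' z - G' z) \<union> (G' z - F' z) \<subseteq> F' y \<inter> G' y"
  shows "\<exists>f. bij_betw f (fst ` set ps) (snd ` set ps) \<and> (\<forall>y\<in>fst ` set ps. f y \<in> (if kap y then G' y else F' y))"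
proof -
  define n where "n = int len"
  have n0: "n > 0" using mw_wk(2) by (simp add: n_def)
  define im where "im i = nat (i mod n)" for i
  have im: "im i < len" "int (im i) = i mod n" for i using n0 by (simp_all add: im_def n_def nat_less_iff)
  have im_eq: "im i = im j \<longleftrightarrow> i mod n = j mod n" for i j using im(2) by (metis of_nat_eq_iff)
  have im_Suc: "im (i + 1) = Suc (im i) mod len" for i
  proof -
    have "int (im (i + 1)) = (int (im i) + 1) mod n" by (simp add: im(2) mod_add_left_eq)
    also have "\<dots> = int (Suc (im i) mod len)" by (simp add: n_def zmod_int add.commute)
    finally show ?thesis by simp
  qed
  have range_im: "range im = {..<len}"
  proof -
    have "im (int i) = i" if "i < len" for i using that by (simp add: im_def n_def)
    then have "{..<len} \<subseteq> range im" by (metis lessThan_iff rangeI subsetI)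
    then show ?thesis using im(1) by auto
  qed
  interpret closed_walk n "\<lambda>i. row x ps (im i)" "\<lambda>i. fst (ps ! im i)" F' G' "\<lambda>i. int (rank1 (im i))" "\<lambda>i. int (rank2 (im i))"
  proof
    fix i j
    show "row x ps (im i) = row x ps (im j) \<longleftrightarrow> i mod n = j mod n"
      using row_inj im(1) im_eq by metis
    show "fst (ps ! im i) = fst (ps ! im j) \<longleftrightarrow> i mod n = j mod n"
      using cl_inj im(1) im_eq by metis
    show "row x ps (im i) \<in> F' (fst (ps ! im i))" using wk_nth(1)[OF wk'] im(1) by blast
    show "row x ps (im (i + 1)) \<in> G' (fst (ps ! im i))"
      using wk_nth(2)[OF wk'] im(1) row_Suc_mod by (simp add: im_Suc)
    show "i mod n = j mod n \<or> int (rank1 (im j)) < int (rank1 (im i))" if "row x ps (im i) \<in> F' (fst (ps ! im j))"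
      using chord_rank1[of "im i" "im j"] that sub(1) im(1) im_eq by auto
    show "i mod n = j mod n \<or> int (rank2 (im j)) < int (rank2 (im i))" if "row x ps (im (j + 1)) \<in> G' (fst (ps ! im i))"
      using chord_rank2[of "im i" "im j"] that sub(2) im(1) im_eq row_Suc_mod by (auto simp: im_Suc)
    show "int (rank1 (im i)) = int (rank1 (im j))" "int (rank2 (im i)) = int (rank2 (im j))"
      if "i mod n = j mod n"
      using that by (simp_all add: im_def)
  qed (rule n0)
  have ry: "range (\<lambda>i. fst (ps ! im i)) = fst ` set ps"
  proof -
    have "range (\<lambda>i. fst (ps ! im i)) = (\<lambda>i. fst (ps ! i)) ` {..<len}" by (simp add: range_im[symmetric] image_image)
    also have "\<dots> = fst ` (!) ps ` {..<len}" by (simp add: image_image)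
    also have "(!) ps ` {..<len} = set ps" by (auto simp: set_conv_nth)
    finally show ?thesis .
  qed
  have rx: "range (\<lambda>i. row x ps (im i)) = snd ` set ps"
    using rows_image by (metis (no_types) image_image range_im)
  have "\<exists>f. inj_on f (range (\<lambda>i. fst (ps ! im i))) \<and>
     f ` range (\<lambda>i. fst (ps ! im i)) \<subseteq> range (\<lambda>i. row x ps (im i)) \<and>
     (\<forall>c\<in>range (\<lambda>i. fst (ps ! im i)). f c \<in> (if kap c then G' c else F' c))"
  proof (rule recolour)
    fix i j assume k: "kap (fst (ps ! im i)) \<noteq> kap (fst (ps ! im j))"
    have "single c \<subseteq> (F' c - G' c) \<union> (G' c - F' c)" "both c = F' c \<inter> G' c" for c
      by (auto simp: single_def both_def)
    moreover have "fst (ps ! im i) \<in> fst ` set ps" "fst (ps ! im j) \<in> fst ` set ps" using im(1) by auto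
    ultimately show "single (fst (ps ! im i)) \<subseteq> both (fst (ps ! im j)) \<or> single (fst (ps ! im j)) \<subseteq> both (fst (ps ! im i))"
      using nested[OF _ _ k] by blast
  qed
  then obtain f where f: "inj_on f (fst ` set ps)" "f ` fst ` set ps \<subseteq> snd ` set ps"
    "\<forall>c\<in>fst ` set ps. f c \<in> (if kap c then G' c else F' c)" unfolding ry rx by blast
  have "card (fst ` set ps) = card (snd ` set ps)"
    using distinct_cols distinct_rows by (metis distinct_card length_map set_map)
  then have "f ` fst ` set ps = snd ` set ps"
    using f by (intro card_subset_eq) (auto simp: card_image)
  with f show ?thesis unfolding bij_betw_def by blast
qed

end

lemma bij_betw_remove_point:
  "bij_betw f A B \<Longrightarrow> a \<in> A \<Longrightarrow> bij_betw f (A - {a}) (B - {f a})"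
  unfolding bij_betw_def by (auto simp: inj_on_def)

text \<open>Starting in \<open>x'\<close>, follow the inverse of \<open>f\<close> to a column and
  \<open>g\<close> to the next row. The two ranges differ only in the end points, so the walk can
  only stop in \<open>x\<close>, and what remains is again a pair of bijections with a common
  range.\<close>

lemma split_off_walk:
  assumes "finite Z" "bij_betw f Z (insert x' A)" "bij_betw g Z (insert x A)" "x \<notin> A" "x' \<notin> A"
    and "\<And>y. y \<in> Z \<Longrightarrow> f y \<in> F y \<and> g y \<in> G y"
  shows "\<exists>ps. ps \<noteq> [] \<and> wk F G x' ps x \<and> distinct (map fst ps) \<and> distinct (map snd ps) \<and>
    fst ` set ps \<subseteq> Z \<and> snd ` set ps \<subseteq> insert x A \<and> x \<notin> snd ` set (butlast ps) \<and>
    bij_betw f (Z - fst ` set ps) (A - snd ` set ps) \<and> bij_betw g (Z - fst ` set ps) (A - snd ` set ps)"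
  using assms
proof (induction "card Z" arbitrary: Z x' A rule: less_induct)
  case less
  obtain y where y: "y \<in> Z" "f y = x'" using less.prems(2) by (metis bij_betw_iff_bijections insertI1)
  have f': "bij_betw f (Z - {y}) A"
    using bij_betw_remove_point[OF less.prems(2) y(1)] y(2) less.prems(5) by simp
  have g': "bij_betw g (Z - {y}) (insert x A - {g y})"
    using bij_betw_remove_point[OF less.prems(3) y(1)] .
  show ?case
  proof (cases "g y = x")
    case True
    then have "insert x A - {g y} = A" "A - {x} = A" using less.prems(4) by auto
    then show ?thesis using f' g' y less.prems(6)[OF y(1)] True
      by (intro exI[of _ "[(y, x)]"]) auto
  next
    case False
    have gA: "g y \<in> A" using False less.prems(3) y(1) by (auto simp: bij_betw_def)
    define A' where "A' = A - {g y}"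
    have A: "A = insert (g y) A'" "insert x A - {g y} = insert x A'" "x \<notin> A'" "g y \<notin> A'"
      using gA False less.prems(4) by (auto simp: A'_def)
    have "card (Z - {y}) < card Z" using less.prems(1) y(1) by (rule card_Diff1_less)
    from less.hyps[OF this, of "g y" A'] obtain ps where ps: "ps \<noteq> []" "wk F G (g y) ps x"
      "distinct (map fst ps)" "distinct (map snd ps)" "fst ` set ps \<subseteq> Z - {y}" "snd ` set ps \<subseteq> insert x A'"
      "x \<notin> snd ` set (butlast ps)" "bij_betw f (Z - {y} - fst ` set ps) (A' - snd ` set ps)"
      "bij_betw g (Z - {y} - fst ` set ps) (A' - snd ` set ps)"
      using less.prems f' g' A by auto
    have eqs: "Z - fst ` set ((y, g y) # ps) = Z - {y} - fst ` set ps"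
      "A - snd ` set ((y, g y) # ps) = A' - snd ` set ps" by (auto simp: A'_def)
    show ?thesis
    proof (intro exI[of _ "(y, g y) # ps"] conjI)
      show "bij_betw f (Z - fst ` set ((y, g y) # ps)) (A - snd ` set ((y, g y) # ps))"
        "bij_betw g (Z - fst ` set ((y, g y) # ps)) (A - snd ` set ((y, g y) # ps))"
        unfolding eqs using ps by auto
      have "A' \<subseteq> A" by (auto simp: A'_def)
      then show "snd ` set ((y, g y) # ps) \<subseteq> insert x A" using ps(6) gA by auto
      have "g y \<notin> snd ` set ps" using ps(6) A(4) False by auto
      then show "distinct (map snd ((y, g y) # ps))" using ps(4) by simp
      have "y \<notin> fst ` set ps" using ps(5) by blast
      then show "distinct (map fst ((y, g y) # ps))" using ps(3) by simp
      show "fst ` set ((y, g y) # ps) \<subseteq> Z" using ps(5) y(1) by auto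
      show "wk F G x' ((y, g y) # ps) x" using ps(2) y less.prems(6)[OF y(1)] by simp
      show "x \<notin> snd ` set (butlast ((y, g y) # ps))" using ps(1,7) False by auto
    qed simp
  qed
qed

text \<open>The form in which optimality of \<open>J\<close> among the common bases containing
  \<open>r\<close> enters.\<close>

definition noneg :: "('a \<Rightarrow> 'a set) \<Rightarrow> ('a \<Rightarrow> 'a set) \<Rightarrow> ('a \<Rightarrow> real) \<Rightarrow> 'a \<Rightarrow> bool" where
  "noneg F G w r \<longleftrightarrow> (\<forall>x ps. wk F G x ps x \<longrightarrow> r \<notin> snd ` set ps \<longrightarrow> 0 \<le> wcost w ps)"

definition rooted :: "('a \<Rightarrow> 'a set) \<Rightarrow> ('a \<Rightarrow> 'a set) \<Rightarrow> 'a \<Rightarrow> nat \<Rightarrow> ('a \<times> 'a) list \<Rightarrow> bool" where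
  "rooted F G r N ps \<longleftrightarrow> wk F G r ps r \<and> ps \<noteq> [] \<and> r \<notin> snd ` set (butlast ps) \<and> length ps \<le> N"

text \<open>The length bound \<open>N\<close> keeps the set of competitors finite. It will be the
  size of \<open>J\<close>, which is also the number of levels of the dynamic program.\<close>

definition lexmin :: "('a \<Rightarrow> 'a set) \<Rightarrow> ('a \<Rightarrow> 'a set) \<Rightarrow> ('a \<Rightarrow> real) \<Rightarrow> 'a \<Rightarrow> nat \<Rightarrow> ('a \<times> 'a) list \<Rightarrow> bool" where
  "lexmin F G w r N ps \<longleftrightarrow> rooted F G r N ps \<and> (\<forall>qs. rooted F G r N qs \<longrightarrow>
    wcost w ps < wcost w qs \<or> wcost w ps = wcost w qs \<and> length ps \<le> length qs)"

lemma wcost_sets: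
  assumes "distinct (map fst ps)" "distinct (map snd ps)"
  shows "wcost w ps = sum w (snd ` set ps) - sum w (fst ` set ps)"
proof -
  have "wcost w ps = sum_list (map w (map snd ps)) - sum_list (map w (map fst ps))"
    by (simp add: wcost_def sum_list_subtractf o_def)
  also have "\<dots> = sum w (set (map snd ps)) - sum w (set (map fst ps))"
    using sum_list_distinct_conv_sum_set[OF assms(1), of w] sum_list_distinct_conv_sum_set[OF assms(2), of w]
    by simp
  finally show ?thesis by simp
qed

lemma lexmin_minwalk:
  assumes "noneg F G w r" "lexmin F G w r N ps"
  shows "minwalk F G w r ps"
  using assms unfolding minwalk_def noneg_def lexmin_def rooted_def
  by (smt (verit, best) dual_order.trans leD less_imp_le_nat)

text \<open>Take a negative closed walk avoiding \<open>r\<close> with the fewest steps. All shorter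
  ones are nonnegative, which gives both clauses of \<open>minwalk\<close> at once. Returning to the
  start early would split the walk into two shorter ones, not both nonnegative.\<close>

lemma negative_minwalk:
  assumes "\<not> noneg F G w r"
  obtains x ps where "minwalk F G w x ps" "r \<notin> snd ` set ps" "wcost w ps < 0"
proof -
  define P where "P n \<longleftrightarrow> (\<exists>x ps. wk F G x ps x \<and> r \<notin> snd ` set ps \<and> wcost w ps < 0 \<and> length ps = n)" for n
  have "\<exists>n. P n" using assms unfolding noneg_def P_def by (meson not_le)
  then have "P (LEAST n. P n)" by (rule LeastI_ex)
  then obtain x ps where ps: "wk F G x ps x" "r \<notin> snd ` set ps" "wcost w ps < 0" "length ps = (LEAST n. P n)"
    unfolding P_def by blast
  have shorter: "0 \<le> wcost w qs" if "wk F G z qs z" "r \<notin> snd ` set qs" "length qs < length ps" for z qs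
  proof (rule ccontr)
    assume "\<not> 0 \<le> wcost w qs"
    then have "wcost w qs < 0" by simp
    then have "P (length qs)" using that unfolding P_def by blast
    then show False using that(3) ps(4) not_less_Least[of "length qs" P] by simp
  qed
  have "x \<notin> snd ` set (butlast ps)"
  proof
    assume "x \<in> snd ` set (butlast ps)"
    then obtain i where i: "i < length (butlast ps)" "x = snd (butlast ps ! i)" by (metis in_set_conv_nth image_iff)
    then have i': "Suc i < length ps" "x = row x ps (Suc i)" by (simp_all add: nth_butlast)
    have "wk F G x (take (Suc i) ps) x" "wk F G x (drop (Suc i) ps) x"
      using wk_take_drop[OF ps(1), of "Suc i"] i' by simp_all
    moreover have "r \<notin> snd ` set (take (Suc i) ps)" "r \<notin> snd ` set (drop (Suc i) ps)"
      using ps(2) by (auto dest: in_set_takeD in_set_dropD)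
    moreover have "length (take (Suc i) ps) < length ps" "length (drop (Suc i) ps) < length ps"
      using i' by simp_all
    ultimately have "0 \<le> wcost w (take (Suc i) ps)" "0 \<le> wcost w (drop (Suc i) ps)"
      using shorter by blast+
    then show False using ps(3) wcost_drop[of "Suc i" ps w] i' by simp
  qed
  moreover have "ps \<noteq> []" using ps(3) by auto
  ultimately have "minwalk F G w x ps"
    unfolding minwalk_def using ps shorter by (smt (verit) subsetD)
  with ps that show ?thesis by blast
qed

text \<open>The union of the two matchings decomposes into closed walks; none of them meets
  \<open>r\<close>, so each has nonnegative cost.\<close>

lemma noneg_sets:
  assumes "noneg F G w r" "finite Z" "bij_betw f Z X" "bij_betw g Z X" "r \<notin> X"
    and "\<And>y. y \<in> Z \<Longrightarrow> f y \<in> F y \<and> g y \<in> G y"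
  shows "sum w Z \<le> sum w X"
  using assms(2-)
proof (induction "card Z" arbitrary: Z X rule: less_induct)
  case less
  show ?case
  proof (cases "Z = {}")
    case True
    with less.prems show ?thesis by (simp add: bij_betw_def)
  next
    case False
    then have "X \<noteq> {}" using less.prems(2) by (auto simp: bij_betw_def)
    then obtain x A where A: "X = insert x A" "x \<notin> A" by (metis Set.set_insert all_not_in_conv)
    from split_off_walk[of Z f x A g x F G] less.prems A obtain ps where ps: "ps \<noteq> []" "wk F G x ps x"
      "distinct (map fst ps)" "distinct (map snd ps)" "fst ` set ps \<subseteq> Z" "snd ` set ps \<subseteq> insert x A"
      "bij_betw f (Z - fst ` set ps) (A - snd ` set ps)" "bij_betw g (Z - fst ` set ps) (A - snd ` set ps)"
      by auto
    have "x \<in> snd ` set ps" using wk_end[OF ps(2,1)] ps(1) by (metis image_eqI last_in_set)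
    then have eq: "A - snd ` set ps = X - snd ` set ps" using A by auto
    have "finite X" using less.prems(1,2) bij_betw_finite by blast
    have "card (Z - fst ` set ps) < card Z"
      using ps(1,5) less.prems(1) by (intro psubset_card_mono) (auto simp: neq_Nil_conv)
    then have "sum w (Z - fst ` set ps) \<le> sum w (X - snd ` set ps)"
      using ps less.prems by (intro less.hyps) (auto simp: eq)
    moreover have "0 \<le> wcost w ps" using assms(1) ps(2,6) less.prems(4) A unfolding noneg_def by blast
    then have "sum w (fst ` set ps) \<le> sum w (snd ` set ps)" using wcost_sets[OF ps(3,4), of w] by simp
    moreover have "sum w Z = sum w (Z - fst ` set ps) + sum w (fst ` set ps)"
      using less.prems(1) ps(5) by (intro sum.subset_diff) auto
    moreover have "sum w X = sum w (X - snd ` set ps) + sum w (snd ` set ps)"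
      using \<open>finite X\<close> ps(6) A by (intro sum.subset_diff) auto
    ultimately show ?thesis by linarith
  qed
qed

text \<open>After the walk through \<open>r\<close> is split off, the remaining pair of matchings
  has nonnegative cost by \<open>noneg_sets\<close>, so dropping it does not raise the cost.\<close>

lemma rooted_sets:
  assumes "noneg F G w r" "finite Z" "bij_betw f Z X" "bij_betw g Z X" "r \<in> X"
    and "\<And>y. y \<in> Z \<Longrightarrow> f y \<in> F y \<and> g y \<in> G y" and "card Z \<le> N"
  obtains ps where "rooted F G r N ps" "wcost w ps \<le> sum w X - sum w Z" "length ps \<le> card Z"
    "length ps = card Z \<Longrightarrow> fst ` set ps = Z \<and> snd ` set ps = X"
proof -
  obtain A where A: "X = insert r A" "r \<notin> A" using assms(5) by (meson Set.set_insert)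
  from split_off_walk[of Z f r A g r F G] assms A obtain ps where ps: "ps \<noteq> []" "wk F G r ps r"
    "distinct (map fst ps)" "distinct (map snd ps)" "fst ` set ps \<subseteq> Z" "snd ` set ps \<subseteq> insert r A"
    "r \<notin> snd ` set (butlast ps)"
    "bij_betw f (Z - fst ` set ps) (A - snd ` set ps)" "bij_betw g (Z - fst ` set ps) (A - snd ` set ps)"
    by auto
  have "r \<in> snd ` set ps" using wk_end[OF ps(2,1)] ps(1) by (metis image_eqI last_in_set)
  then have eq: "A - snd ` set ps = X - snd ` set ps" using A by auto
  have fX: "finite X" using assms(2,3) bij_betw_finite by blast
  have lf: "length ps = card (fst ` set ps)" "length ps = card (snd ` set ps)"
    using ps(3,4) by (metis distinct_card length_map set_map)+
  have "sum w (Z - fst ` set ps) \<le> sum w (X - snd ` set ps)"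
    by (rule noneg_sets[OF assms(1), of _ f _ g])
      (use ps(8,9) assms(2,6) \<open>r \<in> snd ` set ps\<close> in \<open>simp_all add: eq\<close>)
  moreover have "sum w Z = sum w (Z - fst ` set ps) + sum w (fst ` set ps)"
    using assms(2) ps(5) by (intro sum.subset_diff) auto
  moreover have "sum w X = sum w (X - snd ` set ps) + sum w (snd ` set ps)"
    using fX ps(6) A by (intro sum.subset_diff) auto
  ultimately have "wcost w ps \<le> sum w X - sum w Z" using wcost_sets[OF ps(3,4), of w] by simp
  moreover have le: "length ps \<le> card Z" using lf ps(5) assms(2) by (simp add: card_mono)
  moreover have "rooted F G r N ps" using ps le assms(7) by (simp add: rooted_def)
  moreover have "fst ` set ps = Z \<and> snd ` set ps = X" if "length ps = card Z"
  proof
    show "fst ` set ps = Z" using that lf ps(5) assms(2) by (intro card_subset_eq) auto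
    have "card Z = card X" using assms(3) bij_betw_same_card by blast
    then show "snd ` set ps = X" using that lf ps(6) fX A by (intro card_subset_eq) auto
  qed
  ultimately show ?thesis using that by blast
qed

lemma lexmin_exists:
  assumes "rooted F G r N qs" "finite C" "\<And>y x. x \<in> F y \<Longrightarrow> y \<in> C" "finite J" "\<And>y. G y \<subseteq> J"
  obtains ps where "lexmin F G w r N ps"
proof -
  have sub: "set ps \<subseteq> C \<times> J" if "wk F G x ps z" for x ps z
    using that by (induction ps arbitrary: x) (use assms in force)+
  have fin: "finite {ps. rooted F G r N ps}"
  proof (rule finite_subset)
    show "{ps. rooted F G r N ps} \<subseteq> {ps. set ps \<subseteq> C \<times> J \<and> length ps \<le> N}"
      unfolding rooted_def using sub by blast
    show "finite {ps. set ps \<subseteq> C \<times> J \<and> length ps \<le> N}"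
      using assms(2,4) by (intro finite_lists_length_le) simp
  qed
  define m where "m = Min (wcost w ` {ps. rooted F G r N ps})"
  have m: "m \<in> wcost w ` {ps. rooted F G r N ps}" "\<And>qs. rooted F G r N qs \<Longrightarrow> m \<le> wcost w qs"
    unfolding m_def using fin assms(1) by (auto intro!: Min_in Min_le)
  define k where "k = (LEAST k. \<exists>ps. rooted F G r N ps \<and> wcost w ps = m \<and> length ps = k)"
  have "\<exists>k ps. rooted F G r N ps \<and> wcost w ps = m \<and> length ps = k" using m(1) by auto
  then have "\<exists>ps. rooted F G r N ps \<and> wcost w ps = m \<and> length ps = k" unfolding k_def by (rule LeastI_ex)
  then obtain ps where ps: "rooted F G r N ps" "wcost w ps = m" "length ps = k" by blast
  have "k \<le> length qs" if "rooted F G r N qs" "wcost w qs = m" for qs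
    unfolding k_def by (rule Least_le) (use that in blast)
  then have "lexmin F G w r N ps" unfolding lexmin_def using ps m(2) by force
  then show ?thesis by (rule that)
qed

text \<open>
  Exchanging the two exchange graphs on the columns of a set \<open>kap\<close> that is nested with its
  complement affects neither the cost and length of a lexicographically minimal closed walk nor
  the vertex set of such a walk.
\<close>

locale recoloured =
  fixes F G F' G' HF HG :: "'a \<Rightarrow> 'a set" and kap :: "'a \<Rightarrow> bool" and w :: "'a \<Rightarrow> real" and r :: 'a
    and N :: nat and C J :: "'a set"
  assumes sub: "F' y \<subseteq> F y" "G' y \<subseteq> G y"
    and H: "HF y = (if kap y then G' y else F' y)" "HG y = (if kap y then F' y else G' y)"
    and nested: "kap y \<noteq> kap z \<Longrightarrow> (F' y - G' y) \<union> (G' y - F' y) \<subseteq> F' z \<inter> G' z \<or>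
      (F' z - G' z) \<union> (G' z - F' z) \<subseteq> F' y \<inter> G' y"
    and noneg: "noneg F G w r"
    and complete: "lexmin F G w r N ps \<Longrightarrow> wk F' G' r ps r"
    and fin: "finite C" "\<And>x y. x \<in> F y \<Longrightarrow> y \<in> C" "finite J" "\<And>y. G y \<subseteq> J"
begin

text \<open>Exchanging the graphs is an involution: recolouring \<open>HF\<close> and
  \<open>HG\<close> by \<open>kap\<close> and by its complement leads back into \<open>F\<close> and
  \<open>G\<close>.\<close>

lemma minwalk_H_bij:
  assumes "minwalk HF HG w x ps"
  obtains f g where "bij_betw f (fst ` set ps) (snd ` set ps)" "bij_betw g (fst ` set ps) (snd ` set ps)"
    "\<forall>y\<in>fst ` set ps. f y \<in> F y \<and> g y \<in> G y"
proof -
  have wk: "wk HF HG x ps x" using assms by (simp add: minwalk_def)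
  have nest: "(HF y - HG y) \<union> (HG y - HF y) \<subseteq> HF z \<inter> HG z \<or> (HF z - HG z) \<union> (HG z - HF z) \<subseteq> HF y \<inter> HG y"
    if "kap y \<noteq> kap z" for y z
    using nested[OF that] by (auto simp: H)
  obtain f where f: "bij_betw f (fst ` set ps) (snd ` set ps)"
    "\<forall>y\<in>fst ` set ps. f y \<in> (if kap y then HG y else HF y)"
    using recolour_bij[OF assms, of HF HG kap] wk nest by blast
  obtain g where g: "bij_betw g (fst ` set ps) (snd ` set ps)"
    "\<forall>y\<in>fst ` set ps. g y \<in> (if \<not> kap y then HG y else HF y)"
    using recolour_bij[OF assms, of HF HG "\<lambda>y. \<not> kap y"] wk nest by blast
  have "f y \<in> F y \<and> g y \<in> G y" if "y \<in> fst ` set ps" for y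
    using f(2) g(2) that sub[of y] by (auto simp: H split: if_splits)
  then show ?thesis by (intro that[OF f(1) g(1)]) blast
qed

lemma minwalk_D_bij:
  assumes "minwalk F G w x ps" "wk F' G' x ps x"
  obtains f g where "bij_betw f (fst ` set ps) (snd ` set ps)" "bij_betw g (fst ` set ps) (snd ` set ps)"
    "\<forall>y\<in>fst ` set ps. f y \<in> HF y \<and> g y \<in> HG y"
proof -
  obtain f where f: "bij_betw f (fst ` set ps) (snd ` set ps)"
    "\<forall>y\<in>fst ` set ps. f y \<in> (if kap y then G' y else F' y)"
    using recolour_bij[OF assms(1), of F' G' kap] assms(2) nested sub by blast
  obtain g where g: "bij_betw g (fst ` set ps) (snd ` set ps)"
    "\<forall>y\<in>fst ` set ps. g y \<in> (if \<not> kap y then G' y else F' y)"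
    using recolour_bij[OF assms(1), of F' G' "\<lambda>y. \<not> kap y"] assms(2) nested sub by blast
  have "f y \<in> HF y \<and> g y \<in> HG y" if "y \<in> fst ` set ps" for y
    using f(2) g(2) that by (auto simp: H split: if_splits)
  then show ?thesis by (intro that[OF f(1) g(1)]) blast
qed

lemma minwalk_sums:
  assumes "minwalk F1 G1 w x ps"
  shows "wcost w ps = sum w (snd ` set ps) - sum w (fst ` set ps)" "card (fst ` set ps) = length ps"
  using wcost_sets[OF distinct_cols[OF assms] distinct_rows[OF assms]]
    distinct_card[OF distinct_cols[OF assms]] by simp_all

text \<open>A shortest negative walk of the recoloured graphs is triangular, so its vertex set also
  carries a pair of matchings in \<open>F\<close> and \<open>G\<close>, where the same cost cannot
  be negative.\<close>

lemma noneg_H: "noneg HF HG w r"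
proof (rule ccontr)
  assume "\<not> noneg HF HG w r"
  then obtain x ps where ps: "minwalk HF HG w x ps" "r \<notin> snd ` set ps" "wcost w ps < 0"
    by (rule negative_minwalk)
  from minwalk_H_bij[OF ps(1)] obtain f g where fg: "bij_betw f (fst ` set ps) (snd ` set ps)"
    "bij_betw g (fst ` set ps) (snd ` set ps)" "\<forall>y\<in>fst ` set ps. f y \<in> F y \<and> g y \<in> G y" .
  have "sum w (fst ` set ps) \<le> sum w (snd ` set ps)"
    by (rule noneg_sets[OF noneg _ fg(1,2) ps(2)]) (use fg(3) in auto)
  with ps(3) minwalk_sums(1)[OF ps(1)] show False by simp
qed

lemma minwalk_rooted: "minwalk F1 G1 w r ps \<Longrightarrow> r \<in> snd ` set ps"
  unfolding minwalk_def by (metis image_eqI last_in_set wk_end)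

lemma lexmin_D_to_H:
  assumes "lexmin F G w r N ps"
  obtains qs where "rooted HF HG r N qs" "wcost w qs \<le> wcost w ps" "length qs \<le> length ps"
proof -
  have mw: "minwalk F G w r ps" using lexmin_minwalk[OF noneg assms] .
  from minwalk_D_bij[OF mw complete[OF assms]] obtain f g where fg: "bij_betw f (fst ` set ps) (snd ` set ps)"
    "bij_betw g (fst ` set ps) (snd ` set ps)" "\<forall>y\<in>fst ` set ps. f y \<in> HF y \<and> g y \<in> HG y" .
  have "card (fst ` set ps) \<le> N" using minwalk_sums(2)[OF mw] assms by (simp add: lexmin_def rooted_def)
  then obtain qs where "rooted HF HG r N qs" "wcost w qs \<le> sum w (snd ` set ps) - sum w (fst ` set ps)"
    "length qs \<le> card (fst ` set ps)"
    using rooted_sets[OF noneg_H _ fg(1,2) minwalk_rooted[OF mw]] fg(3) by (metis List.finite_set finite_imageI)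
  with minwalk_sums[OF mw] that show ?thesis by simp
qed

lemma rooted_D_to_H: assumes "rooted F G r N ps" shows "\<exists>qs. rooted HF HG r N qs"
proof -
  obtain ms where "lexmin F G w r N ms" by (rule lexmin_exists[OF assms fin])
  then obtain qs where "rooted HF HG r N qs" by (rule lexmin_D_to_H)
  then show ?thesis by blast
qed

text \<open>Walks can be carried over in both directions without increasing cost or, at equal cost,
  length, so equality holds throughout. Then the walk obtained in \<open>F\<close> and
  \<open>G\<close> uses as many columns as are available, nothing was dropped by
  \<open>rooted_sets\<close>, and the vertex sets agree.\<close>

lemma lexmin_H_to_D:
  assumes "lexmin HF HG w r N qs"
  obtains ps where "lexmin F G w r N ps" "fst ` set ps = fst ` set qs" "snd ` set ps = snd ` set qs"
proof -
  have mw: "minwalk HF HG w r qs" using lexmin_minwalk[OF noneg_H assms] .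
  from minwalk_H_bij[OF mw] obtain f g where fg: "bij_betw f (fst ` set qs) (snd ` set qs)"
    "bij_betw g (fst ` set qs) (snd ` set qs)" "\<forall>y\<in>fst ` set qs. f y \<in> F y \<and> g y \<in> G y" .
  have "card (fst ` set qs) \<le> N" using minwalk_sums(2)[OF mw] assms by (simp add: lexmin_def rooted_def)
  then obtain ps where ps: "rooted F G r N ps" "wcost w ps \<le> sum w (snd ` set qs) - sum w (fst ` set qs)"
    "length ps \<le> card (fst ` set qs)"
    "length ps = card (fst ` set qs) \<Longrightarrow> fst ` set ps = fst ` set qs \<and> snd ` set ps = snd ` set qs"
    using rooted_sets[OF noneg _ fg(1,2) minwalk_rooted[OF mw]] fg(3) by (metis List.finite_set finite_imageI)
  obtain ms where ms: "lexmin F G w r N ms" by (rule lexmin_exists[OF ps(1) fin])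
  then obtain qs' where qs': "rooted HF HG r N qs'" "wcost w qs' \<le> wcost w ms" "length qs' \<le> length ms"
    by (rule lexmin_D_to_H)
  have "wcost w qs < wcost w qs' \<or> wcost w qs = wcost w qs' \<and> length qs \<le> length qs'"
    "wcost w ms < wcost w ps \<or> wcost w ms = wcost w ps \<and> length ms \<le> length ps"
    using assms ms qs'(1) ps(1) by (auto simp: lexmin_def)
  then have "wcost w ps = wcost w ms" "length ps = length qs" "length ps = length ms"
    using ps(2,3) qs'(2,3) minwalk_sums[OF mw] by auto
  then have "lexmin F G w r N ps" using ps(1) ms by (simp add: lexmin_def)
  then show ?thesis using that ps(4) \<open>length ps = length qs\<close> minwalk_sums(2)[OF mw] by simp
qed

end

section \<open>Exchange graphs of two matroids\<close>

lemma card_swap: "finite J \<Longrightarrow> x \<in> J \<Longrightarrow> y \<notin> J \<Longrightarrow> card (insert y (J - {x})) = card J"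
  by (metis DiffD1 card.insert card_Suc_Diff1 finite_Diff)

context matroid
begin

lemma indep_finite: "indep I \<Longrightarrow> finite I"
  using finite_ground indep_subset_ground finite_subset by blast

lemma augment_to:
  assumes "indep A" "indep B" "card A \<le> card B"
  shows "\<exists>C. A \<subseteq> C \<and> C \<subseteq> A \<union> B \<and> indep C \<and> card C = card B"
  using assms
proof (induction "card B - card A" arbitrary: A)
  case 0
  then show ?case by (intro exI[of _ A]) auto
next
  case (Suc k)
  have "card A < card B" using Suc.hyps(2) by linarith
  then obtain e where e: "e \<in> B - A" "indep (insert e A)" using indep_augment[of A B] Suc.prems by blast
  then have "card (insert e A) = Suc (card A)" using Suc.prems(1) indep_finite by simp
  then have "k = card B - card (insert e A)" "card (insert e A) \<le> card B" using Suc.hyps(2) by auto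
  with Suc.hyps(1)[of "insert e A"] e Suc.prems obtain C where
    "insert e A \<subseteq> C" "C \<subseteq> insert e A \<union> B" "indep C" "card C = card B" by auto
  with e show ?case by (intro exI[of _ C]) auto
qed

text \<open>For a base \<open>J\<close> this is the fundamental circuit of \<open>y\<close> without
  \<open>y\<close> itself.\<close>

definition fund :: "'a set \<Rightarrow> 'a \<Rightarrow> 'a set" where
  "fund J y = {x \<in> J. y \<notin> J \<and> indep (insert y (J - {x}))}"

lemma fund_subset: "fund J y \<subseteq> J"
  by (auto simp: fund_def)

text \<open>Extend \<open>insert y A\<close> by elements of \<open>J\<close> to a base. By its size
  it omits exactly one element of \<open>J\<close>, and that element lies outside
  \<open>A\<close>.\<close>

lemma fund_witness:
  assumes "indep J" "\<And>K. indep K \<Longrightarrow> card K \<le> card J" "y \<notin> J" "A \<subseteq> J" "indep (insert y A)"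
  shows "\<exists>x\<in>fund J y. x \<notin> A"
proof -
  obtain C where C: "insert y A \<subseteq> C" "C \<subseteq> insert y A \<union> J" "indep C" "card C = card J"
    using augment_to[OF assms(5,1)] assms(2)[OF assms(5)] by blast
  have fJ: "finite J" using indep_finite assms(1) by blast
  have fC: "finite C" using indep_finite C(3) by blast
  have "card (C - {y}) < card J" using C(1,4) fC by (metis card_Diff1_less insert_subset)
  moreover have "card J \<le> card (C - {y})" if "J \<subseteq> C" using that fC assms(3) by (intro card_mono) auto
  ultimately obtain x where x: "x \<in> J" "x \<notin> C" by force
  have "C \<subseteq> insert y (J - {x})" using C(2) x assms(4) by auto
  moreover have "card (insert y (J - {x})) = card J" using card_swap[OF fJ x(1) assms(3)] .
  ultimately have "C = insert y (J - {x})" using C(4) fJ by (intro card_subset_eq) auto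
  with x C assms(3) show ?thesis by (auto simp: fund_def)
qed

lemma fund_dependent:
  assumes "indep J" "\<And>K. indep K \<Longrightarrow> card K \<le> card J" "y \<notin> J"
  shows "\<not> indep (insert y (fund J y))"
  using fund_witness[OF assms fund_subset] by blast

lemma rank_finite: "finite {card I | I. I \<subseteq> X \<and> indep I}"
proof -
  have "{card I | I. I \<subseteq> X \<and> indep I} \<subseteq> card ` Pow E" using indep_subset_ground by auto
  then show ?thesis using finite_ground finite_subset by blast
qed

lemma le_rank: "t \<le> rank indep X \<longleftrightarrow> (\<exists>I. I \<subseteq> X \<and> indep I \<and> t \<le> card I)"
proof -
  have "{card I | I. I \<subseteq> X \<and> indep I} \<noteq> {}" using indep_empty by blast
  then show ?thesis unfolding rank_def using rank_finite[of X] by (subst Max_ge_iff) auto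
qed

text \<open>The oracle is only used through this equivalence.\<close>

lemma rank_hit:
  assumes "indep J" "\<And>K. indep K \<Longrightarrow> card K \<le> card J" "X \<subseteq> J" "Z \<inter> J = {}"
  shows "card J - card X < rank indep ((J - X) \<union> Z) \<longleftrightarrow> (\<exists>z\<in>Z. fund J z \<inter> X \<noteq> {})"
proof -
  have fin: "finite J" using indep_finite assms(1) by blast
  have cJX: "card (J - X) = card J - card X" using assms(3) fin by (meson card_Diff_subset finite_subset)
  have "(\<exists>I. I \<subseteq> (J - X) \<union> Z \<and> indep I \<and> card (J - X) < card I) \<longleftrightarrow> (\<exists>z\<in>Z. fund J z \<inter> X \<noteq> {})"
  proof
    assume "\<exists>I. I \<subseteq> (J - X) \<union> Z \<and> indep I \<and> card (J - X) < card I"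
    then obtain I where I: "I \<subseteq> (J - X) \<union> Z" "indep I" "card (J - X) < card I" by blast
    have "indep (J - X)" using assms(1) indep_mono by blast
    then obtain z where z: "z \<in> I - (J - X)" "indep (insert z (J - X))" using indep_augment I by blast
    then have "z \<in> Z" "z \<notin> J" using I(1) assms(4) by auto
    with fund_witness[OF assms(1,2), of z "J - X"] z(2) show "\<exists>z\<in>Z. fund J z \<inter> X \<noteq> {}"
      using fund_subset by blast
  next
    assume "\<exists>z\<in>Z. fund J z \<inter> X \<noteq> {}"
    then obtain z x where zx: "z \<in> Z" "x \<in> X" "x \<in> J" "z \<notin> J" "indep (insert z (J - {x}))"
      by (auto simp: fund_def)
    have "indep (insert z (J - X))" by (rule indep_mono[OF zx(5)]) (use zx(2) in auto)
    moreover have "card (insert z (J - X)) = Suc (card (J - X))" using zx fin by simp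
    ultimately show "\<exists>I. I \<subseteq> (J - X) \<union> Z \<and> indep I \<and> card (J - X) < card I"
      using zx(1) by (intro exI[of _ "insert z (J - X)"]) auto
  qed
  then show ?thesis using le_rank[of "Suc (card J - card X)" "(J - X) \<union> Z"] by (simp add: Suc_le_eq cJX)
qed

text \<open>If no exchange worked, \<open>B = K - {y}\<close> would be a largest independent subset
  of \<open>A \<union> B\<close>, where \<open>A\<close> is the fundamental set of \<open>y\<close>.
  Extend \<open>A\<close> within \<open>A \<union> B\<close> to the size of \<open>B\<close> and
  then by one element of \<open>K\<close>: if that element is \<open>y\<close>, the dependent set
  \<open>insert y A\<close> would be independent, otherwise the size of \<open>B\<close> is
  exceeded.\<close>

lemma exchange_step:
  assumes "indep J" "\<And>K. indep K \<Longrightarrow> card K \<le> card J" "indep K" "card K = card J" "y \<in> K - J"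
  shows "\<exists>x\<in>fund J y. x \<notin> K \<and> indep (insert x (K - {y}))"
proof (rule ccontr)
  define A where "A = fund J y"
  define B where "B = K - {y}"
  assume "\<not> ?thesis"
  then have no: "\<not> indep (insert x B)" if "x \<in> A" "x \<notin> K" for x using that by (auto simp: A_def B_def)
  have yA: "y \<notin> A" using assms(5) by (auto simp: A_def fund_def)
  have finK: "finite K" using assms(3) indep_finite by blast
  have iB: "indep B" using assms(3) indep_mono by (auto simp: B_def)
  have cB: "Suc (card B) = card K" using assms(5) finK card_Suc_Diff1[of K y] by (simp add: B_def)
  have maxB: "card D \<le> card B" if iD: "indep D" and sD: "D \<subseteq> A \<union> B" for D
  proof (rule ccontr)
    assume "\<not> card D \<le> card B"
    then obtain e where "e \<in> D - B" "indep (insert e B)" using indep_augment[OF iB iD] by auto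
    with no[of e] sD yA show False by (auto simp: B_def)
  qed
  have iA: "indep A" using assms(1) fund_subset indep_mono A_def by blast
  obtain A' where A': "A \<subseteq> A'" "A' \<subseteq> A \<union> B" "indep A'" "card A' = card B"
    using augment_to[OF iA iB maxB[OF iA]] by auto
  obtain e where e: "e \<in> K - A'" "indep (insert e A')" using indep_augment[OF A'(3) assms(3)] A'(4) cB by auto
  show False
  proof (cases "e = y")
    case True
    then have "indep (insert y A)" using e(2) A'(1) indep_mono by (meson insert_mono)
    then show False using fund_dependent[OF assms(1,2), of y] assms(5) by (simp add: A_def)
  next
    case False
    then have "insert e A' \<subseteq> A \<union> B" using e(1) A'(2) by (auto simp: B_def)
    then have "card (insert e A') \<le> card B" using maxB e(2) by blast
    then show False using e(1) A'(3,4) indep_finite by simp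
  qed
qed

text \<open>The induction moves \<open>K\<close> towards the fixed base \<open>J\<close>, so the
  fundamental sets with respect to \<open>J\<close> never change.\<close>

lemma exchange_bij:
  assumes "indep J" "\<And>K. indep K \<Longrightarrow> card K \<le> card J" "indep K" "card K = card J"
  shows "\<exists>f. bij_betw f (K - J) (J - K) \<and> (\<forall>y\<in>K - J. f y \<in> fund J y)"
  using assms(3,4)
proof (induction "card (K - J)" arbitrary: K)
  case 0
  have "finite K" "finite J" using 0 assms(1) indep_finite by auto
  then have "K - J = {}" using 0 by simp
  then have "K = J" using 0 \<open>finite J\<close> by (intro card_subset_eq) auto
  then show ?case by (auto simp: bij_betw_def)
next
  case (Suc k)
  have fin: "finite K" "finite J" using Suc.prems assms(1) indep_finite by auto
  have "K - J \<noteq> {}" using Suc.hyps(2) by (metis card.empty nat.distinct(1))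
  then obtain y where y: "y \<in> K - J" by blast
  obtain x where x: "x \<in> fund J y" "x \<notin> K" "indep (insert x (K - {y}))"
    using exchange_step[OF assms(1,2) Suc.prems y] by blast
  let ?K = "insert x (K - {y})"
  have xJ: "x \<in> J" using x(1) fund_subset by blast
  have d: "?K - J = K - J - {y}" "J - ?K = J - K - {x}" using xJ y by auto
  have "k = card (?K - J)" using Suc.hyps(2) y fin by (simp add: d)
  moreover have "card ?K = card J" unfolding Suc.prems(2)[symmetric] by (rule card_swap) (use x(2) y fin in auto)
  ultimately obtain f where f: "bij_betw f (K - J - {y}) (J - K - {x})" "\<forall>y\<in>?K - J. f y \<in> fund J y"
    using Suc.hyps(1)[of ?K] x(3) d by auto
  have K: "K - J = insert y (K - J - {y})" "J - K = insert x (J - K - {x})" using y x(2) xJ by auto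
  have "bij_betw (f(y := x)) (K - J - {y}) (J - K - {x})"
    using f(1) by (subst bij_betw_cong[of _ _ f]) auto
  then have "bij_betw (f(y := x)) (K - J) (J - K)"
    using notIn_Un_bij_betw[of y "K - J - {y}" "f(y := x)" "J - K - {x}"] K by simp
  moreover have "\<forall>z\<in>K - J. (f(y := x)) z \<in> fund J z" using f(2) x(1) d by auto
  ultimately show ?case by blast
qed

text \<open>The fundamental circuit of \<open>z\<close> avoids \<open>a\<close>, hence it survives
  the exchange and is still the only circuit that \<open>z\<close> closes.\<close>

lemma fund_exchange:
  assumes "indep J" "\<And>K. indep K \<Longrightarrow> card K \<le> card J" "a \<in> fund J y" "a \<notin> fund J z" "z \<notin> J" "z \<noteq> y"
  shows "fund (insert y (J - {a})) z = fund J z"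
proof -
  define J' where "J' = insert y (J - {a})"
  have a: "a \<in> J" "y \<notin> J" "indep J'" using assms(3) by (auto simp: fund_def J'_def)
  have fin: "finite J" using assms(1) indep_finite by blast
  have cJ: "card J' = card J" unfolding J'_def using card_swap[OF fin a(1,2)] .
  have max: "card K \<le> card J'" if "indep K" for K using assms(2)[OF that] cJ by simp
  have zJ': "z \<notin> J'" using assms(5,6) by (simp add: J'_def)
  have sub: "fund J z \<subseteq> J'" using fund_subset assms(4) by (auto simp: J'_def)
  have dep: "\<not> indep (insert z (fund J z))" using fund_dependent[OF assms(1,2,5)] .
  have sub1: "fund J z \<subseteq> fund J' z"
  proof
    fix x assume x: "x \<in> fund J z"
    then have "indep (insert z (J - {x}))" by (simp add: fund_def)
    then have "indep (insert z (fund J z - {x}))" by (rule indep_mono) (use fund_subset in auto)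
    then obtain u where u: "u \<in> fund J' z" "u \<notin> fund J z - {x}"
      using fund_witness[OF a(3) max zJ', of "fund J z - {x}"] sub by blast
    have "u = x"
    proof (rule ccontr)
      assume "u \<noteq> x"
      then have "insert z (fund J z) \<subseteq> insert z (J' - {u})" using u sub by auto
      moreover have "indep (insert z (J' - {u}))" using u(1) by (simp add: fund_def)
      ultimately show False using dep indep_mono by blast
    qed
    then show "x \<in> fund J' z" using u by simp
  qed
  have sub2: "fund J' z \<subseteq> fund J z"
  proof
    fix u assume u: "u \<in> fund J' z"
    then have i: "indep (insert z (J' - {u}))" by (simp add: fund_def)
    show "u \<in> fund J z"
    proof (rule ccontr)
      assume "u \<notin> fund J z"
      then have "insert z (fund J z) \<subseteq> insert z (J' - {u})" using sub by auto
      then show False using dep i indep_mono by blast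
    qed
  qed
  from sub1 sub2 show ?thesis by (simp add: J'_def)
qed

text \<open>Exchange the pair of least key first. Its row lies in no fundamental set of a remaining
  column, so by \<open>fund_exchange\<close> those sets stay the same and the induction continues.
  This is the classical fact that a unique perfect matching in the exchange graph guarantees
  independence.\<close>

lemma triangular_exchange:
  fixes key :: "'i \<Rightarrow> int"
  assumes "finite A" "indep J" "\<And>K. indep K \<Longrightarrow> card K \<le> card J" "inj_on r A" "inj_on c A"
    and "\<And>i. i \<in> A \<Longrightarrow> r i \<in> fund J (c i)"
    and "\<And>i j. i \<in> A \<Longrightarrow> j \<in> A \<Longrightarrow> r i \<in> fund J (c j) \<Longrightarrow> i = j \<or> key j < key i"
  shows "indep ((J - r ` A) \<union> c ` A) \<and> card ((J - r ` A) \<union> c ` A) = card J"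
  using assms
proof (induction "card A" arbitrary: A J)
  case 0
  then show ?case by auto
next
  case (Suc k)
  then have "A \<noteq> {}" by auto
  then obtain a where a: "a \<in> A" "\<And>j. j \<in> A \<Longrightarrow> key a \<le> key j"
    using Suc.prems(1) by (metis arg_min_if_finite(1,2) not_le)
  define J' where "J' = insert (c a) (J - {r a})"
  define B where "B = A - {a}"
  have A: "A = insert a B" "a \<notin> B" using a(1) by (auto simp: B_def)
  have ra: "r a \<in> fund J (c a)" using Suc.prems(6) a(1) by blast
  then have rJ: "r a \<in> J" "c a \<notin> J" "indep J'" by (auto simp: fund_def J'_def)
  have fin: "finite J" using Suc.prems(2) indep_finite by blast
  have cJ: "card J' = card J" unfolding J'_def using card_swap[OF fin rJ(1,2)] .
  have feq: "fund J' (c j) = fund J (c j)" if "j \<in> B" for j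
  proof -
    have j: "j \<in> A" "j \<noteq> a" using that A by auto
    have "r a \<notin> fund J (c j)" using Suc.prems(7)[OF a(1) j(1)] a(2)[OF j(1)] j(2) by force
    moreover have "c j \<notin> J" using Suc.prems(6)[OF j(1)] by (simp add: fund_def)
    moreover have "c j \<noteq> c a" using Suc.prems(5) j a(1) by (meson inj_onD)
    ultimately show ?thesis unfolding J'_def using fund_exchange[OF Suc.prems(2,3) ra] by blast
  qed
  have "k = card B" using Suc.hyps(2) Suc.prems(1) a(1) by (simp add: B_def)
  then have IH: "indep ((J' - r ` B) \<union> c ` B) \<and> card ((J' - r ` B) \<union> c ` B) = card J'"
  proof (rule Suc.hyps(1))
    show "r i \<in> fund J' (c i)" if "i \<in> B" for i using that feq Suc.prems(6) A by auto
    show "i = j \<or> key j < key i" if "i \<in> B" "j \<in> B" "r i \<in> fund J' (c j)" for i j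
      using that feq Suc.prems(7)[of i j] A by auto
  qed (use Suc.prems rJ cJ A in \<open>auto simp: inj_on_def\<close>)
  have "c a \<notin> r ` B"
  proof
    assume "c a \<in> r ` B"
    then obtain j where "j \<in> A" "c a = r j" using A by auto
    then show False using Suc.prems(6)[of j] rJ(2) fund_subset by fastforce
  qed
  then have "(J' - r ` B) \<union> c ` B = (J - r ` A) \<union> c ` A" unfolding J'_def A(1) by auto
  then show ?case using IH cJ by simp
qed

end

text \<open>\<open>opt\<close> compares \<open>J\<close> only with common bases containing the dummy
  \<open>r\<close>, that is, with sets of the current size. \<open>full1\<close> and
  \<open>full2\<close> reflect that \<open>r\<close> is free: an element that can replace
  \<open>r\<close> can replace every element of \<open>J\<close>.\<close>

locale exchange = M1: matroid E i1 + M2: matroid E i2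
  for E :: "'a set" and i1 i2 :: "'a set \<Rightarrow> bool" +
  fixes J :: "'a set" and r :: 'a and w :: "'a \<Rightarrow> real"
  assumes base1: "i1 J" "\<And>K. i1 K \<Longrightarrow> card K \<le> card J"
    and base2: "i2 J" "\<And>K. i2 K \<Longrightarrow> card K \<le> card J"
    and r_in: "r \<in> J"
    and full1: "r \<in> M1.fund J y \<Longrightarrow> M1.fund J y = J"
    and full2: "r \<in> M2.fund J y \<Longrightarrow> M2.fund J y = J"
    and no_inclusion: "y \<in> E - J \<Longrightarrow> r \<notin> M1.fund J y \<Longrightarrow> \<not> M2.fund J y \<subseteq> M1.fund J y"
    and opt: "i1 K \<Longrightarrow> i2 K \<Longrightarrow> card K = card J \<Longrightarrow> r \<in> K \<Longrightarrow> sum w K \<le> sum w J"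
begin

abbreviation "F \<equiv> M1.fund J"
abbreviation "G \<equiv> M2.fund J"

lemma finJ: "finite J" using base1(1) M1.indep_finite by blast

lemma wk_cols: "wk F G x ps z \<Longrightarrow> p \<in> set ps \<Longrightarrow> fst p \<in> E - J"
proof (induction ps arbitrary: x)
  case (Cons q qs)
  then show ?case using M1.indep_subset_ground by (auto simp: M1.fund_def)
qed simp

lemma wk_rows: "wk F G x ps z \<Longrightarrow> p \<in> set ps \<Longrightarrow> snd p \<in> J"
  by (induction ps arbitrary: x) (use M2.fund_subset in auto)

definition after :: "('a \<times> 'a) list \<Rightarrow> 'a set" where
  "after ps = (J - snd ` set ps) \<union> fst ` set ps"

lemma minwalk_base:
  assumes mw: "minwalk F G w x ps"
  shows "i1 (after ps)" "i2 (after ps)" "card (after ps) = card J"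
    "sum w (after ps) = sum w J - wcost w ps"
proof -
  note wk = mw_wk(1)[OF mw]
  have inj: "inj_on (\<lambda>i. fst (ps ! i)) {..<length ps}" using cl_inj[OF mw] by (auto simp: inj_on_def)
  have cols: "(\<lambda>i. fst (ps ! i)) ` {..<length ps} = fst ` set ps" by (auto simp: set_conv_nth)
  have rows: "(\<lambda>i. snd (ps ! i)) ` {..<length ps} = snd ` set ps" by (auto simp: set_conv_nth)
  have "i1 ((J - row x ps ` {..<length ps}) \<union> (\<lambda>i. fst (ps ! i)) ` {..<length ps}) \<and>
    card ((J - row x ps ` {..<length ps}) \<union> (\<lambda>i. fst (ps ! i)) ` {..<length ps}) = card J"
    by (rule M1.triangular_exchange[OF _ base1 _ inj, of _ "\<lambda>i. int (rank1 w ps i)"])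
      (use row_inj[OF mw] chord_rank1[OF mw] wk_nth(1)[OF wk] in \<open>auto simp: inj_on_def\<close>)
  then show "i1 (after ps)" "card (after ps) = card J"
    unfolding after_def rows_image[OF mw] cols by simp_all
  have "inj_on (\<lambda>i. snd (ps ! i)) {..<length ps}"
    using distinct_rows[OF mw] by (auto simp: inj_on_def distinct_conv_nth)
  \<comment> \<open>For the leaving edges, \<open>chord_rank2\<close> orders rows against columns in
    the opposite direction, hence the negated key.\<close>
  then have "i2 ((J - (\<lambda>i. snd (ps ! i)) ` {..<length ps}) \<union> (\<lambda>i. fst (ps ! i)) ` {..<length ps}) \<and>
    card ((J - (\<lambda>i. snd (ps ! i)) ` {..<length ps}) \<union> (\<lambda>i. fst (ps ! i)) ` {..<length ps}) = card J"
    by (intro M2.triangular_exchange[OF _ base2 _ inj, of _ "\<lambda>i. - int (rank2 w ps i)"])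
      (use chord_rank2[OF mw] wk_nth(2)[OF wk] in auto)
  then show "i2 (after ps)" unfolding after_def rows cols by simp
  have "fst ` set ps \<inter> J = {}" "snd ` set ps \<subseteq> J" using wk_cols[OF wk] wk_rows[OF wk] by auto
  then have "sum w (after ps) = sum w J - sum w (snd ` set ps) + sum w (fst ` set ps)"
    unfolding after_def using finJ by (subst sum.union_disjoint) (auto simp: sum_diff)
  then show "sum w (after ps) = sum w J - wcost w ps"
    using wcost_sets[OF distinct_cols[OF mw] distinct_rows[OF mw]] by simp
qed

text \<open>A shortest negative walk avoiding \<open>r\<close> would produce a better common base
  that still contains \<open>r\<close>.\<close>

lemma noneg_exchange: "noneg F G w r"
proof (rule ccontr)
  assume "\<not> ?thesis"
  then obtain x ps where ps: "minwalk F G w x ps" "r \<notin> snd ` set ps" "wcost w ps < 0"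
    by (rule negative_minwalk)
  have "r \<in> after ps" using ps(2) r_in by (simp add: after_def)
  then have "sum w (after ps) \<le> sum w J" using opt minwalk_base[OF ps(1)] by blast
  with ps(3) minwalk_base(4)[OF ps(1)] show False by simp
qed

text \<open>The exchange bijections of the two matroids are matchings between the same sets, with
  \<open>r\<close> among the rows, and \<open>rooted_sets\<close> extracts a walk that is at least
  as good.\<close>

lemma common_base_walk:
  assumes "i1 K" "i2 K" "card K = card J" "r \<notin> K"
  obtains ps where "rooted F G r (card J) ps" "sum w K \<le> sum w J - wcost w ps"
proof -
  obtain f where f: "bij_betw f (K - J) (J - K)" "\<forall>y\<in>K - J. f y \<in> F y"
    using M1.exchange_bij[OF base1 assms(1,3)] by blast
  obtain g where g: "bij_betw g (K - J) (J - K)" "\<forall>y\<in>K - J. g y \<in> G y"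
    using M2.exchange_bij[OF base2 assms(2,3)] by blast
  have finK: "finite K" using assms(1) M1.indep_finite by blast
  have cKJ: "card (K - J) \<le> card J" using assms(3) finK by (metis card_mono Diff_subset)
  obtain ps where ps: "rooted F G r (card J) ps" "wcost w ps \<le> sum w (J - K) - sum w (K - J)"
    by (rule rooted_sets[OF noneg_exchange _ f(1) g(1), of "card J"])
      (use f(2) g(2) finK r_in assms(4) cKJ in auto)
  have "sum w K - sum w J = sum w (K - J) - sum w (J - K)"
    using sum.Int_Diff[OF finK, of w J] sum.Int_Diff[OF finJ, of w K] by (simp add: Int_commute)
  with ps that show ?thesis by simp
qed

lemma lexmin_optimal:
  assumes "lexmin F G w r (card J) ps"
  shows "i1 (after ps)" "i2 (after ps)" "card (after ps) = card J" "r \<notin> after ps"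
    "\<And>K. i1 K \<Longrightarrow> i2 K \<Longrightarrow> card K = card J \<Longrightarrow> r \<notin> K \<Longrightarrow> sum w K \<le> sum w (after ps)"
proof -
  have mw: "minwalk F G w r ps" using lexmin_minwalk[OF noneg_exchange assms] .
  show "i1 (after ps)" "i2 (after ps)" "card (after ps) = card J" using minwalk_base[OF mw] by simp_all
  have "r \<in> snd ` set ps" using mw unfolding minwalk_def by (metis image_eqI last_in_set wk_end)
  then show "r \<notin> after ps" using wk_cols[OF mw_wk(1)[OF mw]] r_in by (auto simp: after_def)
  fix K assume "i1 K" "i2 K" "card K = card J" "r \<notin> K"
  then obtain qs where "rooted F G r (card J) qs" "sum w K \<le> sum w J - wcost w qs" by (rule common_base_walk)
  moreover then have "wcost w ps \<le> wcost w qs" using assms by (force simp: lexmin_def)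
  ultimately show "sum w K \<le> sum w (after ps)" using minwalk_base(4)[OF mw] by simp
qed

text \<open>
  A lexicographically minimal walk leaves a column \<open>y\<close> with \<open>F y \<subseteq> G y\<close> through an edge that is
  not in \<open>F\<close> only if an earlier column \<open>z\<close> of the walk makes that edge visible to the oracle.
\<close>

lemma lexmin_column:
  assumes lm: "lexmin F G w r (card J) ps" and i: "i < length ps"
  defines "y \<equiv> fst (ps ! i)" and "x \<equiv> snd (ps ! i)"
  shows "r \<in> F y \<inter> G y \<or> (\<exists>s t. r \<in> F s - G s \<and> r \<in> G t - F t) \<and>
    (r \<in> F y - G y \<or> r \<in> G y - F y \<or> r \<notin> F y \<and> r \<notin> G y \<and>
      (F y \<subseteq> G y \<longrightarrow> x \<in> F y \<or> (\<exists>z u. u \<in> F z - G z \<and> u \<notin> G y \<and> x \<notin> G z)))"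
proof -
  have mw: "minwalk F G w r ps" using lexmin_minwalk[OF noneg_exchange lm] .
  note wk = mw_wk(1)[OF mw]
  define c where "c k = fst (ps ! k)" for k
  define n where "n = length ps"
  have n0: "n > 0" using mw_wk(2)[OF mw] by (simp add: n_def)
  have e1: "row r ps k \<in> F (c k)" and e2: "snd (ps ! k) \<in> G (c k)" if "k < n" for k
    using wk_nth[OF wk] that by (simp_all add: c_def n_def)
  have last: "snd (ps ! (n - 1)) = r"
    using wk_end[OF wk mw_wk(2)[OF mw]] mw_wk(2)[OF mw] by (simp add: n_def last_conv_nth)
  have F0: "F (c 0) = J" using full1 e1[OF n0] by simp
  have Gn: "G (c (n - 1)) = J" using full2 e2[of "n - 1"] last n0 by simp
  \<comment> \<open>All of \<open>J\<close> lies in \<open>F (c 0)\<close>, so each row gives a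
    chord to the first column; a second column entered from \<open>r\<close> would give one in the
    reverse order.\<close>
  have rF: "r \<notin> F (c k)" if "0 < k" "k < n" for k
  proof
    assume "r \<in> F (c k)"
    then have "rank1 w ps k < rank1 w ps 0"
      using chord_rank1[OF mw, of 0 k] that n0 by (auto simp: c_def n_def)
    moreover have "row r ps k \<in> F (c 0)" using F0 e1[OF that(2)] M1.fund_subset by blast
    then have "rank1 w ps 0 < rank1 w ps k"
      using chord_rank1[OF mw, of k 0] that n0 by (auto simp: c_def n_def)
    ultimately show False by simp
  qed
  have rG: "r \<notin> G (c k)" if "k < n - 1" for k
  proof
    assume "r \<in> G (c k)"
    then have "rank2 w ps (n - 1) < rank2 w ps k"
      using chord_rank2[OF mw, of k "n - 1"] that n0 last by (auto simp: c_def n_def)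
    moreover have "snd (ps ! k) \<in> J" using e2[of k] that M2.fund_subset[of J "c k"] by auto
    then have "snd (ps ! k) \<in> G (c (n - 1))" using Gn by simp
    then have "rank2 w ps k < rank2 w ps (n - 1)"
      using chord_rank2[OF mw, of "n - 1" k] that n0 by (auto simp: c_def n_def)
    ultimately show False by simp
  qed
  have rJ: "r \<in> F (c 0)" "r \<in> G (c (n - 1))" using F0 Gn r_in by auto
  show ?thesis
  proof (cases "n = 1")
    case True
    then show ?thesis using i rJ by (simp add: y_def c_def n_def)
  next
    case False
    then have st: "r \<in> F (c 0) - G (c 0)" "r \<in> G (c (n - 1)) - F (c (n - 1))"
      using rJ rF[of "n - 1"] rG[of 0] n0 by auto
    have "x \<in> F y \<or> (\<exists>z u. u \<in> F z - G z \<and> u \<notin> G y \<and> x \<notin> G z)"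
      if y: "r \<notin> F y" "r \<notin> G y" "F y \<subseteq> G y"
    proof (rule ccontr)
      assume "\<not> ?thesis"
      then have none: "u \<in> G z \<or> u \<in> G y \<or> x \<in> G z" if "u \<in> F z" for z u using that by blast
      have i0: "0 < i" using y(1) rJ(1) by (cases i) (auto simp: y_def c_def)
      have in_key: "row r ps (Suc k) \<in> G (c l) \<Longrightarrow> k = l \<or> rank2 w ps k < rank2 w ps l" if "k < n" "l < n" for k l
        using chord_rank2[OF mw, of l k] that by (auto simp: c_def n_def)
      \<comment> \<open>Since \<open>x \<in> G (c k)\<close> contradicts the order,
        \<open>none\<close> puts the entry row of column \<open>k\<close> into
        \<open>G (c k)\<close> or \<open>G y\<close>. Either chord bounds the rank of the preceding
        column by that of column \<open>i\<close>.\<close>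
      have step: "r \<in> G (c k) \<or> r \<in> G y \<or> k > 0 \<and> rank2 w ps (k - 1) < rank2 w ps i" if k: "k < i" "rank2 w ps k < rank2 w ps i" for k
      proof -
        have kn: "k < n" "i < n" using k i by (auto simp: n_def)
        have "x \<notin> G (c k)"
        proof
          assume "x \<in> G (c k)"
          then have "rank2 w ps i < rank2 w ps k" using in_key[of i k] kn k(1) by (simp add: x_def)
          with k(2) show False by simp
        qed
        then have *: "row r ps k \<in> G (c k) \<or> row r ps k \<in> G y" using none[OF e1[OF kn(1)]] by blast
        show ?thesis
        proof (cases k)
          case (Suc l)
          then show ?thesis using * in_key[of l k] in_key[of l i] kn k by (auto simp: y_def c_def[symmetric])
        qed (use * in simp)
      qed
      \<comment> \<open>Moving backwards, starting with the entry row of \<open>y\<close> itself,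
        this reaches the first column. Its entry row is \<open>r\<close>, which lies neither in
        \<open>G (c 0)\<close> nor in \<open>G y\<close>.\<close>
      have "rank2 w ps (i - Suc d) < rank2 w ps i" if "d < i" for d
        using that
      proof (induction d)
        case 0
        have "row r ps i \<in> G y" using e1[of i] y(3) i by (auto simp: y_def c_def n_def)
        moreover have "i - 1 < n" "i < n" "Suc (i - 1) = i" using i i0 by (auto simp: n_def)
        ultimately show ?case using in_key[of "i - 1" i] by (auto simp: y_def c_def)
      next
        case (Suc d)
        then have "rank2 w ps (i - Suc d) < rank2 w ps i" by simp
        moreover have "i - Suc d < i" "i - Suc d < n - 1" using Suc.prems i by (auto simp: n_def)
        ultimately have "rank2 w ps (i - Suc d - 1) < rank2 w ps i" using step rG y(2) by blast
        then show ?case by simp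
      qed
      from this[of "i - 1"] i0 have "rank2 w ps 0 < rank2 w ps i" by simp
      from step[OF i0 this] st(1) y(2) show False by simp
    qed
    then show ?thesis using st full1 full2 by blast
  qed
qed

end

section \<open>What the oracle reveals\<close>

context exchange
begin

text \<open>The content of one query by \<open>rank_hit\<close>: the minimum of the ranks exceeds
  the threshold iff both ranks do, hence the conjunction.\<close>

definition hit :: "'a set \<Rightarrow> 'a set \<Rightarrow> bool" where
  "hit X Z \<longleftrightarrow> (\<exists>z\<in>Z. F z \<inter> X \<noteq> {}) \<and> (\<exists>z\<in>Z. G z \<inter> X \<noteq> {})"

definition sided :: "'a \<Rightarrow> bool" where
  "sided y \<longleftrightarrow> \<not> F y \<subseteq> G y \<and> \<not> G y \<subseteq> F y"

definition paired :: bool where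
  "paired \<longleftrightarrow> (\<exists>s t. r \<in> F s - G s \<and> r \<in> G t - F t)"

text \<open>
  \<open>F' y\<close> and \<open>G' y\<close> are the edges at \<open>y\<close> that the algorithm knows, up to exchanging the two sets:
  everything, or \<open>F y\<close> and a part of \<open>G y \<supseteq> F y\<close>, or only the edges in both graphs.
\<close>

definition known :: "'a \<Rightarrow> 'a set \<Rightarrow> 'a set \<Rightarrow> bool" where
  "known y F' G' \<longleftrightarrow> F' \<inter> G' = F y \<inter> G y \<and> F' \<subseteq> F y \<and> G' \<subseteq> G y \<and>
    (F' = F y \<and> G' = G y \<or> F' = F y \<and> F y \<subseteq> G y \<or> F' = G')"

definition oriented :: "'a set \<times> 'a set \<Rightarrow> 'a set \<Rightarrow> 'a set \<Rightarrow> bool" where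
  "oriented p A B \<longleftrightarrow> p = (A, B) \<or> p = (B, A)"

lemma known_single:
  assumes "known y F' G'" "(a \<in> F') \<noteq> (a \<in> G')"
  shows "F' = F y" "a \<in> F' \<Longrightarrow> G' = G y" "(a \<in> F') = (a \<in> F y)" "(a \<in> F y) \<noteq> (a \<in> G y)"
  using assms unfolding known_def by blast+

text \<open>Each of the two rows counts only at its own column, or they coincide, and there it lies
  in exactly one graph. The query succeeds iff both graphs are represented.\<close>

lemma link_colour:
  assumes y: "known y F1 G1" "(a \<in> F1) \<noteq> (a \<in> G1)" and z: "known z F2 G2" "(b \<in> F2) \<noteq> (b \<in> G2)"
    and ab: "a = b \<or> a \<notin> F2 \<and> a \<notin> G2 \<and> b \<notin> F1 \<and> b \<notin> G1"
  shows "hit {a, b} {y, z} \<longleftrightarrow> (a \<in> F1) \<noteq> (b \<in> F2)"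
  using known_single[OF y] known_single[OF z] ab y(2) z(2) unfolding hit_def by auto

text \<open>At \<open>z\<close> the row \<open>x\<close> adds no graph that \<open>u\<close> does
  not already supply, so the graph missing at \<open>u\<close> must come from \<open>y\<close>. It
  can only be \<open>G y\<close>, because \<open>x\<close> and \<open>u\<close> avoid
  \<open>F y\<close>; and if \<open>u\<close> alone gave a negative answer, the new edge is at
  \<open>x\<close>.\<close>

lemma detect_sound:
  assumes y: "F y \<subseteq> G y" "x \<notin> F y" "u \<notin> F y"
    and z: "known z F2 G2" "oriented (A, B) F2 G2" "(u \<in> A) \<noteq> (u \<in> B)" "x \<in> A \<Longrightarrow> u \<in> A" "x \<in> B \<Longrightarrow> u \<in> B"
    and h: "x = u \<and> hit {u} {y, z} \<or> x \<noteq> u \<and> \<not> hit {u} {y, z} \<and> hit {u, x} {y, z}"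
  shows "x \<in> G y"
proof -
  have u: "(u \<in> F2) \<noteq> (u \<in> G2)" "x \<in> F2 \<Longrightarrow> u \<in> F2" "x \<in> G2 \<Longrightarrow> u \<in> G2"
    using z by (auto simp: oriented_def)
  show ?thesis
  proof (cases "u \<in> F2")
    case True
    then show ?thesis using known_single[OF z(1) u(1)] u h y unfolding hit_def by auto
  next
    case False
    then show ?thesis using known_single[OF z(1) u(1)] u h y unfolding hit_def by auto
  qed
qed

text \<open>By \<open>no_inclusion\<close>, a comparable column with an edge only in
  \<open>F\<close> contains the dummy in \<open>F\<close>. Witnesses for detection are therefore
  incomparable columns or sources, whose unordered pairs are found in earlier phases.\<close>

lemma detect_column:
  assumes "u \<in> F z - G z" "\<not> sided z"
  shows "r \<in> F z - G z"
proof -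
  have "z \<in> E - J" using assms(1) M1.indep_subset_ground by (auto simp: M1.fund_def)
  then have "r \<in> F z" using no_inclusion[of z] assms by (auto simp: sided_def)
  moreover have "r \<notin> G z" using full2[of z] assms(1) M1.fund_subset by blast
  ultimately show ?thesis by blast
qed

text \<open>The row \<open>u\<close> meets only \<open>F\<close>, so the first query fails;
  \<open>x\<close> adds \<open>G y\<close>, so the second one succeeds.\<close>

lemma detect_complete:
  assumes "u \<in> F z - G z" "u \<notin> G y" "x \<notin> G z" "x \<in> G y" and AB: "oriented (A, B) (F z) (G z)"
  shows "(u \<in> A) \<noteq> (u \<in> B)" "x \<in> A \<Longrightarrow> u \<in> A" "x \<in> B \<Longrightarrow> u \<in> B" "x \<noteq> u" "\<not> hit {u} {y, z}" "hit {u, x} {y, z}"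
  using assms unfolding oriented_def hit_def by auto

lemma sided_r: "sided y \<Longrightarrow> r \<notin> F y \<and> r \<notin> G y"
  using full1[of y] full2[of y] M1.fund_subset[of J y] M2.fund_subset[of J y] by (auto simp: sided_def)

lemma paired_hit:
  assumes "r \<notin> F y \<inter> G y" "r \<notin> F z \<inter> G z"
  shows "hit {r} {y, z} \<longleftrightarrow> r \<in> F y - G y \<and> r \<in> G z - F z \<or> r \<in> G y - F y \<and> r \<in> F z - G z"
  using assms unfolding hit_def by auto

lemma unsided_subset:
  assumes "y \<in> E - J" "\<not> sided y" "r \<notin> F y"
  shows "F y \<subseteq> G y"
  using no_inclusion[of y] assms by (auto simp: sided_def)

text \<open>
  \<open>knows\<close> adds to \<open>known\<close> that every edge which an optimal walk can use has been found
  (\<open>knows_complete\<close>).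
\<close>

definition knows :: "('a \<Rightarrow> 'a set) \<Rightarrow> ('a \<Rightarrow> 'a set) \<Rightarrow> 'a \<Rightarrow> bool" where
  "knows F' G' y \<longleftrightarrow> known y (F' y) (G' y) \<and>
    (sided y \<longrightarrow> F' y = F y \<and> G' y = G y) \<and>
    (paired \<longrightarrow> ((r \<in> F y) \<noteq> (r \<in> G y) \<longrightarrow> F' y = F y \<and> G' y = G y) \<and>
      (r \<notin> F y \<longrightarrow> r \<notin> G y \<longrightarrow> F y \<subseteq> G y \<longrightarrow> F' y = F y \<and>
        (\<forall>x z u. x \<in> G y \<longrightarrow> u \<in> F z - G z \<longrightarrow> u \<notin> G y \<longrightarrow> x \<notin> G z \<longrightarrow> x \<in> G' y)))"

text \<open>Incomparable columns are known exactly. By \<open>lexmin_column\<close>, any other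
  column of an optimal walk has both sets equal to \<open>J\<close>, or is a source or sink, or is
  comparable with a leaving edge that is common or detected.\<close>

lemma knows_complete:
  assumes kn: "\<And>y. y \<in> E - J \<Longrightarrow> knows F' G' y" and lm: "lexmin F G w r (card J) ps"
  shows "wk F' G' r ps r"
proof -
  have wk: "wk F G r ps r" using lm by (simp add: lexmin_def rooted_def)
  have edge: "row r ps i \<in> F' (fst (ps ! i)) \<and> snd (ps ! i) \<in> G' (fst (ps ! i))" if i: "i < length ps" for i
  proof -
    define y where "y = fst (ps ! i)"
    have yE: "y \<in> E - J" using wk_cols[OF wk] i by (simp add: y_def)
    have e: "row r ps i \<in> F y" "snd (ps ! i) \<in> G y" using wk_nth[OF wk i] by (simp_all add: y_def)
    have kn': "known y (F' y) (G' y)" using kn[OF yE] by (simp add: knows_def)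
    note lc = lexmin_column[OF lm i, folded y_def]
    have exact: ?thesis if "F' y = F y" "G' y = G y" using e that by (simp add: y_def)
    show ?thesis
    proof (cases "sided y")
      case True
      then show ?thesis using exact kn[OF yE] by (simp add: knows_def)
    next
      case unsided: False
      from lc consider "r \<in> F y \<inter> G y" | "paired" "(r \<in> F y) \<noteq> (r \<in> G y)"
        | "paired" "r \<notin> F y" "r \<notin> G y"
          "F y \<subseteq> G y \<longrightarrow> snd (ps ! i) \<in> F y \<or> (\<exists>z u. u \<in> F z - G z \<and> u \<notin> G y \<and> snd (ps ! i) \<notin> G z)"
        unfolding paired_def by blast
      then show ?thesis
      proof cases
        case 1
        then show ?thesis using exact full1[of y] full2[of y] kn' by (auto simp: known_def)
      next
        case 2
        then show ?thesis using exact kn[OF yE] by (simp add: knows_def)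
      next
        case 3
        have sub: "F y \<subseteq> G y" using unsided_subset[OF yE unsided 3(2)] .
        then have F': "F' y = F y" and det: "\<And>x z u. x \<in> G y \<Longrightarrow> u \<in> F z - G z \<Longrightarrow> u \<notin> G y \<Longrightarrow> x \<notin> G z \<Longrightarrow> x \<in> G' y"
          using kn[OF yE] 3 unfolding knows_def by blast+
        have "snd (ps ! i) \<in> G' y" using 3(4) sub det e(2) kn' F' by (auto simp: known_def)
        then show ?thesis using e(1) F' by (simp add: y_def)
      qed
    qed
  qed
  have "wk F' G' (row r ps i) (drop i ps) r" if "i \<le> length ps" for i
    using that
  proof (induction "length ps - i" arbitrary: i)
    case 0
    then show ?case using wk_take_drop(2)[OF wk, of i] by simp
  next
    case (Suc d)
    then have i: "i < length ps" by simp
    then have "drop i ps = ps ! i # drop (Suc i) ps" by (simp add: Cons_nth_drop_Suc)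
    then show ?case using Suc.hyps(1)[of "Suc i"] Suc.hyps(2) i edge[OF i] by simp
  qed
  from this[of 0] show ?thesis by simp
qed

lemma recoloured_exchange:
  assumes kn: "\<And>y. y \<in> E - J \<Longrightarrow> knows F' G' y" and out: "\<And>y. y \<notin> E - J \<Longrightarrow> F' y = {} \<and> G' y = {}"
    and H: "\<And>y. HF y = (if kap y then G' y else F' y)" "\<And>y. HG y = (if kap y then F' y else G' y)"
    and nested: "\<And>y z. y \<in> E - J \<Longrightarrow> z \<in> E - J \<Longrightarrow> kap y \<noteq> kap z \<Longrightarrow>
      (F' y - G' y) \<union> (G' y - F' y) \<subseteq> F' z \<inter> G' z \<or> (F' z - G' z) \<union> (G' z - F' z) \<subseteq> F' y \<inter> G' y"
  shows "recoloured F G F' G' HF HG kap w r (card J) E J"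
proof
  show "F' y \<subseteq> F y" "G' y \<subseteq> G y" for y
    using kn[of y] out[of y] by (cases "y \<in> E - J"; force simp: knows_def known_def)+
  show "(F' y - G' y) \<union> (G' y - F' y) \<subseteq> F' z \<inter> G' z \<or> (F' z - G' z) \<union> (G' z - F' z) \<subseteq> F' y \<inter> G' y"
    if "kap y \<noteq> kap z" for y z
    using nested[OF _ _ that] out[of y] out[of z] by blast
  show "wk F' G' r ps r" if "lexmin F G w r (card J) ps" for ps using knows_complete[OF kn that] .
  show "x \<in> F y \<Longrightarrow> y \<in> E" for x y using M1.indep_subset_ground by (auto simp: M1.fund_def)
qed (use H noneg_exchange M1.finite_ground finJ M2.fund_subset in auto)

end

text \<open>The direct sum with a coloop \<open>r\<close>, truncated to rank
  \<open>K\<close>.\<close>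

definition extend :: "'a \<Rightarrow> nat \<Rightarrow> ('a set \<Rightarrow> bool) \<Rightarrow> 'a set \<Rightarrow> bool" where
  "extend r K indep X \<longleftrightarrow> indep (X - {r}) \<and> card X \<le> K"

context matroid
begin

lemma matroid_extend:
  assumes "r \<notin> E"
  shows "matroid (insert r E) (extend r K indep)"
proof
  show "finite (insert r E)" using finite_ground by simp
  show "extend r K indep {}" by (simp add: extend_def indep_empty)
  show "extend r K indep I \<Longrightarrow> I \<subseteq> insert r E" for I
    using indep_subset_ground unfolding extend_def by blast
  have fin: "finite I" if "extend r K indep I" for I
    using that indep_finite[of "I - {r}"] by (simp add: extend_def)
  show "extend r K indep I" if J: "extend r K indep J" and "I \<subseteq> J" for I J
    using that indep_mono[of "J - {r}" "I - {r}"] card_mono[OF fin[OF J] \<open>I \<subseteq> J\<close>] by (auto simp: extend_def)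
  show "\<exists>e\<in>J - I. extend r K indep (insert e I)"
    if I: "extend r K indep I" and J: "extend r K indep J" and c: "card I < card J" for I J
  proof (cases "r \<in> J - I")
    case True
    then have "extend r K indep (insert r I)"
      using I J c fin[OF I] by (auto simp: extend_def insert_Diff_if)
    with True show ?thesis by blast
  next
    case False
    moreover have "r \<in> I \<Longrightarrow> card I > 0" using fin[OF I] by (auto simp: card_gt_0_iff)
    \<comment> \<open>Here \<open>r \<in> J\<close> implies \<open>r \<in> I\<close>, so dropping
      \<open>r\<close> keeps the inequality strict.\<close>
    ultimately have "card (I - {r}) < card (J - {r})"
      using c fin[OF I] fin[OF J] by (cases "r \<in> I"; cases "r \<in> J") (auto simp: card_Diff_singleton_if)
    then obtain e where e: "e \<in> (J - {r}) - (I - {r})" "indep (insert e (I - {r}))"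
      using indep_augment[of "I - {r}" "J - {r}"] I J by (auto simp: extend_def)
    then have "insert e I - {r} = insert e (I - {r})" by auto
    moreover have "card (insert e I) = Suc (card I)" using e(1) fin[OF I] by (subst card_insert_disjoint) auto
    moreover have "card J \<le> K" using J by (simp add: extend_def)
    ultimately have "extend r K indep (insert e I)" unfolding extend_def using e(2) c by simp
    with e show ?thesis by auto
  qed
qed

text \<open>Allows the oracle of the original matroids to answer queries about the extended
  ones.\<close>

lemma le_rank_extend:
  assumes "r \<notin> E"
  shows "t \<le> rank (extend r K indep) Q \<longleftrightarrow> t \<le> K \<and> t \<le> rank indep (Q - {r}) + (if r \<in> Q then 1 else 0)"
proof -
  interpret e: matroid "insert r E" "extend r K indep" by (rule matroid_extend[OF assms])
  show ?thesis
  proof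
    assume "t \<le> rank (extend r K indep) Q"
    then obtain I where I: "I \<subseteq> Q" "extend r K indep I" "t \<le> card I" unfolding e.le_rank by blast
    have fin: "finite I" using I(2) e.indep_finite by blast
    have "card (I - {r}) \<le> rank indep (Q - {r})" 
      unfolding le_rank using I by (intro exI[of _ "I - {r}"]) (auto simp: extend_def)
    moreover have "card I \<le> card (I - {r}) + (if r \<in> Q then 1 else 0)"
      using I(1) fin by (cases "r \<in> I") (auto simp: card_Diff_singleton_if)
    ultimately show "t \<le> K \<and> t \<le> rank indep (Q - {r}) + (if r \<in> Q then 1 else 0)"
      using I by (auto simp: extend_def)
  next
    assume t: "t \<le> K \<and> t \<le> rank indep (Q - {r}) + (if r \<in> Q then 1 else 0)"
    obtain I where I: "I \<subseteq> Q - {r}" "indep I" "rank indep (Q - {r}) \<le> card I"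
      using le_rank[of "rank indep (Q - {r})" "Q - {r}"] by blast
    define I' where "I' = (if r \<in> Q then insert r I else I)"
    have fin: "finite I" using I(2) indep_finite by blast
    have "r \<notin> I" using I(1) by blast
    then have I': "I' \<subseteq> Q" "I' - {r} = I" "t \<le> card I'"
      using I t fin by (auto simp: I'_def)
    then obtain D where D: "D \<subseteq> I'" "card D = t" using obtain_subset_with_card_n by metis
    have "indep (D - {r})" by (rule indep_mono[OF I(2)]) (use D(1) I'(2) in blast)
    then have "extend r K indep D" using t D(2) by (simp add: extend_def)
    then show "t \<le> rank (extend r K indep) Q" unfolding e.le_rank
      using D I'(1) by (intro exI[of _ D]) auto
  qed
qed

end

locale two_matroids = M1: matroid E m1 + M2: matroid E m2 for E :: "'a set" and m1 m2 :: "'a set \<Rightarrow> bool" +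
  fixes r :: 'a and w :: "'a \<Rightarrow> real"
  assumes r_notin: "r \<notin> E"
    and circuits: "circuit E m1 C1 \<Longrightarrow> circuit E m2 C2 \<Longrightarrow> C2 - C1 \<noteq> {}"
begin

lemma exchange_extend:
  assumes I: "max_weight_common_indep m1 m2 w k I"
  shows "exchange (insert r E) (extend r (Suc k) m1) (extend r (Suc k) m2) (insert r I) r w"
proof -
  interpret e1: matroid "insert r E" "extend r (Suc k) m1" by (rule M1.matroid_extend[OF r_notin])
  interpret e2: matroid "insert r E" "extend r (Suc k) m2" by (rule M2.matroid_extend[OF r_notin])
  have I': "m1 I" "m2 I" "card I = k" using I by (auto simp: max_weight_common_indep_def common_indep_def)
  have IE: "I \<subseteq> E" "finite I" "r \<notin> I"
    using I' M1.indep_subset_ground M1.indep_finite r_notin by auto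
  define J where "J = insert r I"
  have cJ: "card J = Suc k" "J - {r} = I" using I' IE by (simp_all add: J_def)
  have base: "extend r (Suc k) m1 J" "extend r (Suc k) m2 J" using cJ I' by (simp_all add: extend_def)
  have max: "extend r (Suc k) m K \<Longrightarrow> card K \<le> card J" for m K by (simp add: extend_def cJ)
  \<comment> \<open>If \<open>y\<close> can replace \<open>r\<close>, then \<open>insert y I\<close>
    is independent in the original matroid, and so is what remains of it after any other exchange;
    the size fits the truncation.\<close>
  have full: "{x \<in> J. y \<notin> J \<and> extend r (Suc k) m (insert y (J - {x}))} = J"
    if "matroid E m" "r \<in> {x \<in> J. y \<notin> J \<and> extend r (Suc k) m (insert y (J - {x}))}" for m y
  proof -
    interpret matroid E m by fact
    have y: "y \<notin> J" "m (insert y I - {r})" using that(2) by (auto simp: extend_def J_def IE insert_Diff_if)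
    then have yr: "y \<noteq> r" "m (insert y I)" using IE by (auto simp: J_def insert_Diff_if)
    have "extend r (Suc k) m (insert y (J - {x}))" if "x \<in> J" for x
    proof -
      have "card (insert y (J - {x})) = Suc k" using card_swap[of J x y] that y(1) IE cJ by (simp add: J_def)
      moreover have "m (insert y (J - {x}) - {r})" by (rule indep_mono[OF yr(2)]) (auto simp: J_def)
      ultimately show ?thesis by (simp add: extend_def)
    qed
    then show ?thesis using y(1) by auto
  qed
  \<comment> \<open>Avoiding \<open>r\<close>, the fundamental circuit is a circuit of the original
    matroid: it has at most \<open>k + 1\<close> elements, so the truncation is not the cause of its
    dependence.\<close>
  have fund_circuit: "circuit E m (insert y (matroid.fund (extend r (Suc k) m) J y))"
    if "matroid E m" "m I" "y \<in> E - I" "r \<notin> matroid.fund (extend r (Suc k) m) J y" for m y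
  proof -
    interpret matroid E m by fact
    interpret e: matroid "insert r E" "extend r (Suc k) m" by (rule matroid_extend[OF r_notin])
    have yJ: "y \<notin> J" using that(3) r_notin by (auto simp: J_def)
    have bJ: "extend r (Suc k) m J" using cJ that(2) by (simp add: extend_def)
    let ?C = "insert y (e.fund J y)"
    have sub: "e.fund J y \<subseteq> I" using e.fund_subset[of J y] that(4) by (auto simp: J_def)
    have yr: "y \<noteq> r" using that(3) r_notin by auto
    have "card ?C \<le> card (insert y I)" using sub IE by (intro card_mono) auto
    also have "\<dots> \<le> Suc k" using I' IE by (simp add: card_insert_if)
    finally have "card ?C \<le> Suc k" .
    moreover have "\<not> extend r (Suc k) m ?C" using e.fund_dependent[OF bJ max yJ] .
    moreover have "?C - {r} = ?C" using sub IE yr by auto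
    ultimately have dep: "\<not> m ?C" by (auto simp: extend_def)
    have "m D" if D: "D \<subset> ?C" for D
    proof (cases "y \<in> D")
      case False
      then show ?thesis using D sub indep_mono[OF \<open>m I\<close>, of D] by auto
    next
      case True
      then obtain x where x: "x \<in> e.fund J y" "x \<notin> D" using D by auto
      then have "extend r (Suc k) m (insert y (J - {x}))" by (simp add: e.fund_def)
      then have "m (insert y (J - {x}) - {r})" by (simp add: extend_def)
      then show ?thesis by (rule indep_mono) (use x D sub IE yr in \<open>auto simp: J_def\<close>)
    qed
    then show ?thesis using dep sub IE that(3) by (auto simp: circuit_def)
  qed
  have f1: "r \<in> e1.fund J y \<Longrightarrow> e1.fund J y = J" for y
    unfolding e1.fund_def by (rule full) (auto intro: M1.matroid_axioms)
  have f2: "r \<in> e2.fund J y \<Longrightarrow> e2.fund J y = J" for y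
    unfolding e2.fund_def by (rule full) (auto intro: M2.matroid_axioms)
  have "exchange (insert r E) (extend r (Suc k) m1) (extend r (Suc k) m2) J r w"
  proof
    \<comment> \<open>Both fundamental circuits contain \<open>y\<close>, so an inclusion of
      fundamental sets would be the inclusion of circuits that the hypothesis forbids.\<close>
    show "\<not> e2.fund J y \<subseteq> e1.fund J y" if y: "y \<in> insert r E - J" "r \<notin> e1.fund J y" for y
    proof
      assume sub: "e2.fund J y \<subseteq> e1.fund J y"
      have yE: "y \<in> E - I" using y(1) by (auto simp: J_def)
      have "circuit E m1 (insert y (e1.fund J y))" "circuit E m2 (insert y (e2.fund J y))"
        using fund_circuit[OF M1.matroid_axioms I'(1) yE] fund_circuit[OF M2.matroid_axioms I'(2) yE] y(2) sub by auto
      from circuits[OF this] sub show False by auto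
    qed
    show "sum w K \<le> sum w J" if "extend r (Suc k) m1 K" "extend r (Suc k) m2 K" "card K = card J" "r \<in> K" for K
    proof -
      have fin: "finite K" using that(3) cJ by (metis card.infinite nat.distinct(1))
      have "sum w (K - {r}) \<le> sum w I"
        using I that cJ fin by (auto simp: max_weight_common_indep_def common_indep_def extend_def)
      then show ?thesis using that(4) fin IE by (simp add: J_def sum.remove[of K r])
    qed
  qed (use base max f1 f2 in \<open>auto simp: J_def\<close>)
  then show ?thesis by (simp add: J_def)
qed

end

section \<open>A structured programming language\<close>

abbreviation V :: "nat \<Rightarrow> nexp" where "V a \<equiv> NCell a NZero NZero"
abbreviation asg :: "nat \<Rightarrow> nexp \<Rightarrow> com" where "asg a e \<equiv> NAssign a NZero NZero e"
abbreviation one :: nexp where "one \<equiv> NSuc NZero"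
abbreviation disj :: "bexp \<Rightarrow> bexp \<Rightarrow> bexp" where "disj b c \<equiv> Neg (Conj (Neg b) (Neg c))"
abbreviation nle :: "nexp \<Rightarrow> nexp \<Rightarrow> bexp" where "nle e f \<equiv> Neg (NLess f e)"
abbreviation neq :: "nexp \<Rightarrow> nexp \<Rightarrow> bexp" where "neq e f \<equiv> Conj (nle e f) (nle f e)"

lemma ncell_set [simp]:
  "ncell (set_ncell a i j v s) a' i' j' = (if a' = a \<and> i' = i \<and> j' = j then v else ncell s a' i' j')"
  "ncell (set_rcell a i j u s) = ncell s"
  by (simp_all add: set_ncell_def set_rcell_def)

lemma rcell_set [simp]:
  "rcell (set_rcell a i j u s) a' i' j' = (if a' = a \<and> i' = i \<and> j' = j then u else rcell s a' i' j')"
  "rcell (set_ncell a i j v s) = rcell s"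
  by (simp_all add: set_ncell_def set_rcell_def)

lemma ncell_set_other: "a' \<noteq> a \<Longrightarrow> ncell (set_ncell a i j v s) a' = ncell s a'"
  by (simp add: set_ncell_def)

lemma rcell_set_other: "a' \<noteq> a \<Longrightarrow> rcell (set_rcell a i j v s) a' = rcell s a'"
  by (simp add: set_rcell_def)

primrec loopfree :: "com \<Rightarrow> bool" where
  "loopfree Skip = True"
| "loopfree (NAssign a e f g) = True"
| "loopfree (RAssign a e f g) = True"
| "loopfree (Query a e f b g) = True"
| "loopfree (Seq c d) = (loopfree c \<and> loopfree d)"
| "loopfree (Cond b c d) = (loopfree c \<and> loopfree d)"
| "loopfree (Loop b c) = False"

primrec ev :: "(nat set \<Rightarrow> nat) \<Rightarrow> com \<Rightarrow> store \<Rightarrow> store" where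
  "ev orc Skip s = s"
| "ev orc (NAssign a e f g) s = set_ncell a (nval e s) (nval f s) (nval g s) s"
| "ev orc (RAssign a e f g) s = set_rcell a (nval e s) (nval f s) (rval g s) s"
| "ev orc (Query a e f b g) s = set_ncell a (nval e s) (nval f s) (orc {j. ncell s b (nval g s) j \<noteq> 0}) s"
| "ev orc (Seq c d) s = ev orc d (ev orc c s)"
| "ev orc (Cond b c d) s = (if bval b s then ev orc c s else ev orc d s)"
| "ev orc (Loop b c) s = s"

primrec ccost :: "com \<Rightarrow> nat" where
  "ccost Skip = 1"
| "ccost (NAssign a e f g) = 1 + ncost e + ncost f + ncost g"
| "ccost (RAssign a e f g) = 1 + ncost e + ncost f + rcost g"
| "ccost (Query a e f b g) = 1 + ncost e + ncost f + ncost g"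
| "ccost (Seq c d) = ccost c + ccost d"
| "ccost (Cond b c d) = 1 + bcost b + ccost c + ccost d"
| "ccost (Loop b c) = 0"

primrec cmods :: "com \<Rightarrow> nat set" where
  "cmods Skip = {}"
| "cmods (NAssign a e f g) = {a}"
| "cmods (RAssign a e f g) = {}"
| "cmods (Query a e f b g) = {a}"
| "cmods (Seq c d) = cmods c \<union> cmods d"
| "cmods (Cond b c d) = cmods c \<union> cmods d"
| "cmods (Loop b c) = {}"

primrec crmods :: "com \<Rightarrow> nat set" where
  "crmods Skip = {}"
| "crmods (NAssign a e f g) = {}"
| "crmods (RAssign a e f g) = {a}"
| "crmods (Query a e f b g) = {}"
| "crmods (Seq c d) = crmods c \<union> crmods d"
| "crmods (Cond b c d) = crmods c \<union> crmods d"
| "crmods (Loop b c) = {}"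

lemma exec_Cond:
  "exec orc c s t s1 \<Longrightarrow> exec orc d s u s2 \<Longrightarrow>
    exec orc (Cond b c d) s (1 + bcost b + (if bval b s then t else u)) (if bval b s then s1 else s2)"
  by (cases "bval b s") (simp_all only: if_True if_False exec.Cond_True exec.Cond_False simp_thms)

lemma exec_ev:
  assumes "loopfree c"
  shows "\<exists>t\<le>ccost c. exec orc c s t (ev orc c s)"
  using assms
proof (induction c arbitrary: s)
  case (Seq c d)
  then obtain t u where "t \<le> ccost c" "exec orc c s t (ev orc c s)" "u \<le> ccost d"
    "exec orc d (ev orc c s) u (ev orc d (ev orc c s))" by fastforce
  then show ?case by (intro exI[of _ "t + u"]) (auto intro: exec.Seq)
next
  case (Cond b c d)
  then obtain t u where "t \<le> ccost c" "exec orc c s t (ev orc c s)" "u \<le> ccost d"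
    "exec orc d s u (ev orc d s)" by fastforce
  then show ?case
    using exec_Cond[of orc _ s t _ _ u _ b]
    by (intro exI[of _ "1 + bcost b + (if bval b s then t else u)"]) auto
qed (simp_all only: loopfree.simps ev.simps ccost.simps, (blast intro: exec.intros)+)

lemma ev_frame: "a \<notin> cmods c \<Longrightarrow> ncell (ev orc c s) a = ncell s a"
  by (induction c arbitrary: s) (auto simp: ncell_set_other)

lemma ev_rframe: "a \<notin> crmods c \<Longrightarrow> rcell (ev orc c s) a = rcell s a"
  by (induction c arbitrary: s) (auto simp: rcell_set_other)

text \<open>A temporary change of one entry of array 3. Nested changes are undone in reverse order,
  so coinciding indices do no harm.\<close>

definition swap :: "nat \<Rightarrow> nexp \<Rightarrow> nexp \<Rightarrow> com \<Rightarrow> com" where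
  "swap sv i e c = Seq (asg sv (NCell 3 NZero i)) (Seq (NAssign 3 NZero i e) (Seq c (NAssign 3 NZero i (V sv))))"

text \<open>
  \<open>probe two\<close> removes the elements at positions 17 and, if \<open>two\<close>, 18 of the list in array 4 from
  the set in array 3, adds the elements 15 and 16, asks the oracle, and restores the set.
\<close>

definition probe_core :: "bool \<Rightarrow> com" where
  "probe_core two = Seq (Query 14 NZero NZero 3 NZero)
    (Cond (NLess (NSub (V 2) (NCell 3 NZero (V 0))) (if two then NSuc (V 14) else V 14)) (asg 13 one) (asg 13 NZero))"

definition probe :: "bool \<Rightarrow> com" where
  "probe two =
    swap 31 (NCell 4 NZero (V 17)) NZero
   (swap 32 (NCell 4 NZero (V (if two then 18 else 17))) NZero
   (swap 33 (V 15) one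
   (swap 34 (V 16) one (probe_core two))))"

definition probe_ids :: "nat set" where "probe_ids = {13, 14, 31, 32, 33, 34}"

lemma swap_row:
  assumes "sv \<noteq> 3" "\<And>t. ncell (ev orc c t) 3 = ncell t 3" "\<And>t. ncell (ev orc c t) sv = ncell t sv"
    and "\<And>t. nval i (ev orc c t) = nval i t" "\<And>t j u. nval i (set_ncell 3 0 j u t) = nval i t"
    "\<And>t u. nval i (set_ncell sv 0 0 u t) = nval i t"
  shows "ncell (ev orc (swap sv i e c) s) 3 = ncell s 3"
  using assms by (simp add: swap_def fun_eq_iff)

lemma swap_other:
  assumes "a \<noteq> 3"
  shows "ncell (ev orc (swap sv i e c) s) a =
    (let s1 = set_ncell sv 0 0 (ncell s 3 0 (nval i s)) s
     in ncell (ev orc c (set_ncell 3 0 (nval i s1) (nval e s1) s1)) a)"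
  using assms by (simp add: swap_def Let_def ncell_set_other)

lemma probe_frame: "a \<notin> probe_ids \<Longrightarrow> ncell (ev orc (probe two) s) a = ncell s a"
proof (cases "a = 3")
  case True
  have core: "ncell (ev orc (probe_core two) t) b = ncell t b" if "b \<notin> {13, 14}" for t b
    using that by (intro ev_frame) (simp add: probe_core_def)
  define c4 where "c4 = swap 34 (V 16) one (probe_core two)"
  have c4: "ncell (ev orc c4 t) b = ncell t b" if "b \<notin> {13, 14, 34}" for t b
  proof (cases "b = 3")
    case True
    show ?thesis unfolding c4_def True by (rule swap_row) (simp_all add: core)
  next
    case False
    then show ?thesis using that by (simp add: c4_def swap_other core ncell_set_other)
  qed
  define c3 where "c3 = swap 33 (V 15) one c4"
  have c3: "ncell (ev orc c3 t) b = ncell t b" if "b \<notin> {13, 14, 33, 34}" for t b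
  proof (cases "b = 3")
    case True
    show ?thesis unfolding c3_def True by (rule swap_row) (simp_all add: c4)
  next
    case False
    then show ?thesis using that by (simp add: c3_def swap_other c4 ncell_set_other)
  qed
  define c2 where "c2 = swap 32 (NCell 4 NZero (V (if two then 18 else 17))) NZero c3"
  have c2: "ncell (ev orc c2 t) b = ncell t b" if "b \<notin> {13, 14, 32, 33, 34}" for t b
  proof (cases "b = 3")
    case True
    show ?thesis unfolding c2_def True by (rule swap_row) (simp_all add: c3)
  next
    case False
    then show ?thesis using that by (simp add: c2_def swap_other c3 ncell_set_other)
  qed
  have "ncell (ev orc (swap 31 (NCell 4 NZero (V 17)) NZero c2) s) 3 = ncell s 3"
    by (rule swap_row) (simp_all add: c2)
  then show ?thesis by (simp add: True probe_def c2_def c3_def c4_def)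
next
  case False
  assume "a \<notin> probe_ids"
  with False have "a \<notin> cmods (probe two)" by (simp add: probe_def probe_core_def swap_def probe_ids_def)
  then show ?thesis by (rule ev_frame)
qed

lemma probe_result:
  fixes s :: store and two :: bool
  defines "x \<equiv> ncell s 4 0 (ncell s 17 0 0)" and "x' \<equiv> ncell s 4 0 (ncell s (if two then 18 else 17) 0 0)"
    and "y \<equiv> ncell s 15 0 0" and "z \<equiv> ncell s 16 0 0"
  defines "Q \<equiv> ({j. ncell s 3 0 j \<noteq> 0} - {x, x'}) \<union> {y, z}"
  assumes r: "ncell s 3 0 (ncell s 0 0 0) = 1" "ncell s 0 0 0 \<notin> {y, z}"
  shows "ncell (ev orc (probe two) s) 13 0 0 =
    (if ncell s 2 0 0 - (if ncell s 0 0 0 \<in> Q then 1 else 0) < orc Q + (if two then 1 else 0) then 1 else 0)"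
proof -
  define s2 where "s2 = set_ncell 3 0 x 0 (set_ncell 31 0 0 (ncell s 3 0 x) s)"
  define s3 where "s3 = set_ncell 3 0 x' 0 (set_ncell 32 0 0 (ncell s2 3 0 x') s2)"
  define s4 where "s4 = set_ncell 3 0 y 1 (set_ncell 33 0 0 (ncell s3 3 0 y) s3)"
  define s5 where "s5 = set_ncell 3 0 z 1 (set_ncell 34 0 0 (ncell s4 3 0 z) s4)"
  have q: "ncell s5 3 0 j = (if j = z \<or> j = y then 1 else if j = x' \<or> j = x then 0 else ncell s 3 0 j)" for j
    by (simp add: s5_def s4_def s3_def s2_def)
  have other: "a \<notin> {3, 31, 32, 33, 34} \<Longrightarrow> ncell s5 a = ncell s a" for a
    by (simp add: s5_def s4_def s3_def s2_def ncell_set_other)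
  have Q: "{j. 0 < ncell s5 3 0 j} = Q" by (auto simp: q Q_def)
  have c: "ncell (ev orc (probe two) s) 13 = ncell (ev orc (probe_core two) s5) 13"
    by (simp add: probe_def swap_other Let_def s5_def s4_def s3_def s2_def x_def x'_def y_def z_def ncell_set_other)
  have n: "ncell s5 3 0 (ncell s 0 0 0) = (if ncell s 0 0 0 \<in> Q then 1 else 0)"
    using r by (auto simp: q Q_def)
  show ?thesis unfolding c probe_core_def
    by (simp add: Q other n ncell_set_other)
qed

text \<open>One augmentation only needs loops with \<open>n\<close> or \<open>k + 1\<close>
  iterations. Programs restricted to these have the total semantics \<open>pe\<close>, and their
  running time is bounded through the nesting depth of loops.\<close>

datatype pr = Basic com | Probe bool | Sq pr pr | If bexp pr pr | ForN nat pr | ForK nat pr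

fun blk :: "pr list \<Rightarrow> pr" where
  "blk [] = Basic Skip"
| "blk [p] = p"
| "blk (p # ps) = Sq p (blk ps)"

abbreviation When :: "bexp \<Rightarrow> pr \<Rightarrow> pr" where "When b p \<equiv> If b p (Basic Skip)"

primrec loop :: "nat \<Rightarrow> (store \<Rightarrow> store) \<Rightarrow> nat \<Rightarrow> store \<Rightarrow> store" where
  "loop v f 0 s = set_ncell v 0 0 0 s"
| "loop v f (Suc m) s = set_ncell v 0 0 (Suc m) (f (loop v f m s))"

primrec pe :: "(nat set \<Rightarrow> nat) \<Rightarrow> nat \<Rightarrow> nat \<Rightarrow> pr \<Rightarrow> store \<Rightarrow> store" where
  "pe orc n k (Basic c) s = ev orc c s"
| "pe orc n k (Probe two) s = ev orc (probe two) s"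
| "pe orc n k (Sq p q) s = pe orc n k q (pe orc n k p s)"
| "pe orc n k (If b p q) s = (if bval b s then pe orc n k p s else pe orc n k q s)"
| "pe orc n k (ForN v p) s = loop v (pe orc n k p) n s"
| "pe orc n k (ForK v p) s = loop v (pe orc n k p) (Suc k) s"

primrec mods :: "pr \<Rightarrow> nat set" where
  "mods (Basic c) = cmods c"
| "mods (Probe two) = probe_ids"
| "mods (Sq p q) = mods p \<union> mods q"
| "mods (If b p q) = mods p \<union> mods q"
| "mods (ForN v p) = insert v (mods p)"
| "mods (ForK v p) = insert v (mods p)"

primrec rmods :: "pr \<Rightarrow> nat set" where
  "rmods (Basic c) = crmods c"
| "rmods (Probe two) = {}"
| "rmods (Sq p q) = rmods p \<union> rmods q"
| "rmods (If b p q) = rmods p \<union> rmods q"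
| "rmods (ForN v p) = rmods p"
| "rmods (ForK v p) = rmods p"

text \<open>Arrays 0 and 2 hold the loop bounds. They must not change inside a loop or before a
  later command, but the last command of a sequence may change them, as the final increment of
  \<open>k\<close> does.\<close>

primrec wellformed :: "pr \<Rightarrow> bool" where
  "wellformed (Basic c) = loopfree c"
| "wellformed (Probe two) = True"
| "wellformed (Sq p q) = (wellformed p \<and> wellformed q \<and> 0 \<notin> mods p \<and> 2 \<notin> mods p)"
| "wellformed (If b p q) = (wellformed p \<and> wellformed q)"
| "wellformed (ForN v p) = (wellformed p \<and> 0 \<notin> mods p \<and> 2 \<notin> mods p \<and> v \<notin> mods p \<and> v \<noteq> 0 \<and> v \<noteq> 2)"
| "wellformed (ForK v p) = (wellformed p \<and> 0 \<notin> mods p \<and> 2 \<notin> mods p \<and> v \<notin> mods p \<and> v \<noteq> 0 \<and> v \<noteq> 2)"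

definition For :: "nat \<Rightarrow> nexp \<Rightarrow> com \<Rightarrow> com" where
  "For v e c = Seq (asg v NZero) (Loop (NLess (V v) e) (Seq c (asg v (NSuc (V v)))))"

primrec compile :: "pr \<Rightarrow> com" where
  "compile (Basic c) = c"
| "compile (Probe two) = probe two"
| "compile (Sq p q) = Seq (compile p) (compile q)"
| "compile (If b p q) = Cond b (compile p) (compile q)"
| "compile (ForN v p) = For v (V 0) (compile p)"
| "compile (ForK v p) = For v (NSuc (V 2)) (compile p)"

text \<open>The 20 covers test and increment of one iteration; the extra iteration pays for
  initialisation and final test.\<close>

primrec tm :: "nat \<Rightarrow> nat \<Rightarrow> pr \<Rightarrow> nat" where
  "tm n k (Basic c) = ccost c"
| "tm n k (Probe two) = ccost (probe two)"
| "tm n k (Sq p q) = tm n k p + tm n k q"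
| "tm n k (If b p q) = 1 + bcost b + tm n k p + tm n k q"
| "tm n k (ForN v p) = Suc n * (tm n k p + 20)"
| "tm n k (ForK v p) = Suc (Suc k) * (tm n k p + 20)"

lemma loop_frame:
  assumes "a \<noteq> v" "\<And>s. ncell (f s) a = ncell s a"
  shows "ncell (loop v f m s) a = ncell s a"
  by (induction m) (simp_all add: assms ncell_set_other)

lemma loop_rframe:
  assumes "\<And>s. rcell (f s) a = rcell s a"
  shows "rcell (loop v f m s) a = rcell s a"
  by (induction m) (simp_all add: assms)

lemma pe_frame: "a \<notin> mods p \<Longrightarrow> ncell (pe orc n k p s) a = ncell s a"
proof (induction p arbitrary: s)
  case (ForN v p)
  then show ?case by (simp add: loop_frame del: loop.simps)
next
  case (ForK v p)
  then show ?case by (simp add: loop_frame del: loop.simps)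
qed (auto simp: ev_frame probe_frame)

lemma pe_rframe: "a \<notin> rmods p \<Longrightarrow> rcell (pe orc n k p s) a = rcell s a"
proof (induction p arbitrary: s)
  case (Probe two)
  have "crmods (probe two) = {}" by (simp add: probe_def probe_core_def swap_def)
  then show ?case by (simp add: ev_rframe)
next
  case (ForN v p)
  then show ?case by (simp add: loop_rframe del: loop.simps)
next
  case (ForK v p)
  then show ?case by (simp add: loop_rframe del: loop.simps)
qed (auto simp: ev_rframe)

lemma loop_counter: "ncell (loop v f m s) v 0 0 = m"
  by (cases m) simp_all

lemma loop_induct:
  assumes "Inv 0 (set_ncell v 0 0 0 s)"
    and "\<And>i t. i < m \<Longrightarrow> Inv i t \<Longrightarrow> ncell t v 0 0 = i \<Longrightarrow> Inv (Suc i) (set_ncell v 0 0 (Suc i) (f t))"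
  shows "Inv m (loop v f m s)"
proof -
  have "i \<le> m \<Longrightarrow> Inv i (loop v f i s)" for i
  proof (induction i)
    case (Suc i)
    then show ?case using assms(2)[of i "loop v f i s"] by (simp add: loop_counter)
  qed (use assms(1) in simp)
  then show ?thesis by simp
qed

text \<open>The bound \<open>T\<close> may depend on the counter because in the outermost loop the
  cost grows with the current size.\<close>

lemma exec_For:
  assumes body: "\<And>i s. i < m \<Longrightarrow> Inv s \<Longrightarrow> ncell s v 0 0 = i \<Longrightarrow>
      (\<exists>t\<le>T i. exec orc c s t (f s)) \<and> ncell (f s) v 0 0 = i \<and> Inv (set_ncell v 0 0 (Suc i) (f s))"
    and bound: "\<And>s. Inv s \<Longrightarrow> nval e s = m" and e: "ncost e \<le> 4"
    and init: "Inv (set_ncell v 0 0 0 s)"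
  shows "\<exists>t\<le>(\<Sum>i<m. T i + 20) + 20. exec orc (For v e c) s t (loop v f m s)"
proof -
  let ?L = "Loop (NLess (V v) e) (Seq c (asg v (NSuc (V v))))"
  have "\<exists>t\<le>(\<Sum>i=m - d..<m. T i + 20) + 15. exec orc ?L s t (loop v f m s0)"
    if "s = loop v f (m - d) s0" "Inv s" "d \<le> m" for d s s0
    using that
  proof (induction d arbitrary: s)
    case 0
    then have "\<not> bval (NLess (V v) e) s" using bound[of s] by (simp add: loop_counter)
    then have "exec orc ?L s (1 + bcost (NLess (V v) e)) s" by (rule exec.Loop_False)
    then show ?case using 0 e by (intro exI[of _ "1 + bcost (NLess (V v) e)"]) auto
  next
    case (Suc d)
    define i where "i = m - Suc d"
    have i: "i < m" "ncell s v 0 0 = i" "Suc i = m - d" using Suc.prems by (auto simp: i_def loop_counter)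
    obtain t where t: "t \<le> T i" "exec orc c s t (f s)" "ncell (f s) v 0 0 = i" "Inv (set_ncell v 0 0 (Suc i) (f s))"
      using body[OF i(1) Suc.prems(2) i(2)] by blast
    have "exec orc (asg v (NSuc (V v))) (f s) 7 (set_ncell v 0 0 (Suc i) (f s))"
      using exec.NAssign[of orc v NZero NZero "NSuc (V v)" "f s"] t(3) by (simp add: eval_nat_numeral)
    then have step: "exec orc (Seq c (asg v (NSuc (V v)))) s (t + 7) (set_ncell v 0 0 (Suc i) (f s))"
      using t(2) exec.Seq by blast
    have "set_ncell v 0 0 (Suc i) (f s) = loop v f (m - d) s0"
      using Suc.prems(1) i(3) by (simp add: i_def[symmetric] flip: i(3))
    from Suc.IH[OF this t(4)] Suc.prems(3) obtain u where
      u: "u \<le> (\<Sum>i=m - d..<m. T i + 20) + 15" "exec orc ?L (set_ncell v 0 0 (Suc i) (f s)) u (loop v f m s0)"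
      by auto
    have "bval (NLess (V v) e) s" using bound[OF Suc.prems(2)] i by simp
    from exec.Loop_True[OF this step u(2)]
    have ex: "exec orc ?L s (1 + bcost (NLess (V v) e) + (t + 7) + u) (loop v f m s0)" .
    have "(\<Sum>i=m - Suc d..<m. T i + 20) = T i + 20 + (\<Sum>i=m - d..<m. T i + 20)"
      using i by (simp add: i_def[symmetric] sum.atLeast_Suc_lessThan flip: i(3))
    then have "1 + bcost (NLess (V v) e) + (t + 7) + u \<le> (\<Sum>i=m - Suc d..<m. T i + 20) + 15"
      using t(1) u(1) e by simp
    with ex show ?case by blast
  qed
  from this[of "set_ncell v 0 0 0 s" m s] init obtain t where
    t: "t \<le> (\<Sum>i<m. T i + 20) + 15" "exec orc ?L (set_ncell v 0 0 0 s) t (loop v f m s)"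
    by (auto simp: atLeast0LessThan)
  have "exec orc (asg v NZero) s 4 (set_ncell v 0 0 0 s)"
    using exec.NAssign[of orc v NZero NZero NZero s] by (simp add: eval_nat_numeral)
  then have "exec orc (For v e c) s (4 + t) (loop v f m s)" unfolding For_def using t(2) by (rule exec.Seq)
  with t(1) show ?thesis by (intro exI[of _ "4 + t"]) auto
qed

lemma exec_compile:
  assumes "wellformed p" "ncell s 0 0 0 = n" "ncell s 2 0 0 = k"
  shows "\<exists>t\<le>tm n k p. exec orc (compile p) s t (pe orc n k p s)"
  using assms
proof (induction p arbitrary: s)
  case (Basic c)
  then show ?case using exec_ev by simp
next
  case (Probe two)
  have "loopfree (probe two)" by (simp add: probe_def probe_core_def swap_def)
  then show ?case using exec_ev by simp
next
  case (Sq p q)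
  then obtain t where t: "t \<le> tm n k p" "exec orc (compile p) s t (pe orc n k p s)" by fastforce
  obtain u where "u \<le> tm n k q" "exec orc (compile q) (pe orc n k p s) u (pe orc n k q (pe orc n k p s))"
    using Sq.IH(2)[of "pe orc n k p s"] Sq.prems by (auto simp: pe_frame)
  with t show ?case by (intro exI[of _ "t + u"]) (auto intro: exec.Seq)
next
  case (If b p q)
  then obtain t u where "t \<le> tm n k p" "exec orc (compile p) s t (pe orc n k p s)"
    "u \<le> tm n k q" "exec orc (compile q) s u (pe orc n k q s)" by fastforce
  then show ?case
    using exec_Cond[of orc _ s t _ _ u _ b]
    by (intro exI[of _ "1 + bcost b + (if bval b s then t else u)"]) auto
next
  case (ForN v p)
  have "\<exists>t\<le>(\<Sum>i<n. tm n k p + 20) + 20. exec orc (For v (V 0) (compile p)) s t (loop v (pe orc n k p) n s)"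
    by (rule exec_For[where Inv = "\<lambda>s. ncell s 0 0 0 = n \<and> ncell s 2 0 0 = k"])
      (use ForN in \<open>auto simp: pe_frame\<close>)
  then obtain t where "t \<le> n * (tm n k p + 20) + 20"
    "exec orc (For v (V 0) (compile p)) s t (loop v (pe orc n k p) n s)" by auto
  then show ?case by (intro exI[of _ t]) simp
next
  case (ForK v p)
  have sum: "(\<Sum>i<m. tm n k p + 20) = m * (tm n k p + 20)" for m by simp
  have "\<exists>t\<le>(\<Sum>i<Suc k. tm n k p + 20) + 20.
      exec orc (For v (NSuc (V 2)) (compile p)) s t (loop v (pe orc n k p) (Suc k) s)"
    by (rule exec_For[where Inv = "\<lambda>s. ncell s 0 0 0 = n \<and> ncell s 2 0 0 = k"])
      (use ForK in \<open>auto simp: pe_frame\<close>)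
  then obtain t where "t \<le> Suc k * (tm n k p + 20) + 20"
    "exec orc (For v (NSuc (V 2)) (compile p)) s t (loop v (pe orc n k p) (Suc k) s)"
    unfolding sum by blast
  then show ?case by (intro exI[of _ t]) simp
qed

section \<open>The augmentation step\<close>

text \<open>
  Number arrays: 0 the size \<open>n\<close> of the ground set, 1 output, 2 the size \<open>k\<close>, 3 characteristic vector of
  \<open>J\<close> with \<open>n\<close> as the dummy element, 4 list of \<open>J\<close>, 5 and 6 the known edges at column \<open>y\<close> and
  position \<open>p\<close> of the list, 7 columns known up to orientation, 8 whether some oracle answer concerns
  the dummy element, 9 finished and reached columns of the orientation search, 10 and 11 parents in
  the dynamic program (shifted by one, 0 meaning unreachable), 12 stop flag, 13 oracle answer, 14 to
  18 and 31 to 34 query scratch, 20 to 26 loop counters, from 40 on scalars, 50 a constant zero.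
  Real arrays: 0 weights, 1 and 2 distances of columns and positions, 3 the best closed walk.
\<close>

abbreviation nz :: "nexp \<Rightarrow> bexp" where "nz e \<equiv> NLess NZero e"
abbreviation zr :: "nexp \<Rightarrow> bexp" where "zr e \<equiv> Neg (NLess NZero e)"
abbreviation implies :: "bexp \<Rightarrow> bexp \<Rightarrow> bexp" where "implies b c \<equiv> Neg (Conj b (Neg c))"
abbreviation xor :: "bexp \<Rightarrow> bexp \<Rightarrow> bexp" where "xor b c \<equiv> Conj (disj b c) (Neg (Conj b c))"
abbreviation outside :: "nat \<Rightarrow> bexp" where "outside v \<equiv> zr (NCell 3 NZero (V v))"
abbreviation hf :: "nat \<Rightarrow> nat \<Rightarrow> bexp" where "hf v p \<equiv> nz (NCell 5 (V v) (V p))"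
abbreviation hg :: "nat \<Rightarrow> nat \<Rightarrow> bexp" where "hg v p \<equiv> nz (NCell 6 (V v) (V p))"
abbreviation vis :: "nat \<Rightarrow> nexp" where "vis v \<equiv> NCell 7 NZero (V v)"
abbreviation put :: "nat \<Rightarrow> nat \<Rightarrow> nat \<Rightarrow> nexp \<Rightarrow> pr" where "put a v p e \<equiv> Basic (NAssign a (V v) (V p) e)"
abbreviation put0 :: "nat \<Rightarrow> nat \<Rightarrow> nexp \<Rightarrow> pr" where "put0 a v e \<equiv> Basic (NAssign a NZero (V v) e)"
abbreviation set0 :: "nat \<Rightarrow> nexp \<Rightarrow> pr" where "set0 a e \<equiv> Basic (asg a e)"

definition ask :: "bool \<Rightarrow> nat \<Rightarrow> nat \<Rightarrow> nat \<Rightarrow> nat \<Rightarrow> pr" where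
  "ask two a b c d = blk [set0 15 (V a), set0 16 (V b), set0 17 (V c), set0 18 (V d), Probe two]"

definition ask_ids :: "nat set" where "ask_ids = {13, 14, 15, 16, 17, 18, 31, 32, 33, 34}"

lemma mods_ask [simp]: "mods (ask two a b c d) = ask_ids" "rmods (ask two a b c d) = {}"
  "wellformed (ask two a b c d)"
  by (auto simp: ask_def ask_ids_def probe_ids_def)

locale min_rank_input = two_matroids "{..<n}" m1 m2 n w for n :: nat and m1 m2 :: "nat set \<Rightarrow> bool" and w :: "nat \<Rightarrow> real" +
  fixes orc :: "nat set \<Rightarrow> nat"
  assumes orc: "orc X = min (rank m1 (X \<inter> {..<n})) (rank m2 (X \<inter> {..<n}))"

text \<open>The dummy has position 0 in the list of \<open>J\<close>, so a test for zero recognises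
  it.\<close>

locale stage = min_rank_input +
  fixes k :: nat and I :: "nat set" and lst :: "nat \<Rightarrow> nat"
  assumes opt: "max_weight_common_indep m1 m2 w k I"
    and lst: "lst 0 = n" "inj_on lst {..k}" "lst ` {..k} = insert n I"
begin

sublocale ex: exchange "insert n {..<n}" "extend n (Suc k) m1" "extend n (Suc k) m2" "insert n I" n w
  by (rule exchange_extend[OF opt])

abbreviation "J \<equiv> insert n I"
abbreviation "Y \<equiv> {..<n} - I"
abbreviation "F \<equiv> ex.F"
abbreviation "G \<equiv> ex.G"
abbreviation "W y \<equiv> F y \<inter> G y"
abbreviation "P \<equiv> pe orc n k"

lemma I_facts: "I \<subseteq> {..<n}" "n \<notin> I" "finite I" "card I = k" "m1 I" "m2 I"
  using opt M1.indep_subset_ground[of I] finite_subset[of I "{..<n}"]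
  by (auto simp: max_weight_common_indep_def common_indep_def)

lemma card_J: "card J = Suc k" using I_facts by simp

lemma Y_eq: "insert n {..<n} - J = Y" by auto

lemma col_out: "y \<notin> Y \<Longrightarrow> F y = {} \<and> G y = {}"
proof -
  assume y: "y \<notin> Y"
  have "m \<in> Y" if "x \<in> F m \<or> x \<in> G m" for x m
  proof -
    have "m \<in> insert n {..<n} - J"
      using that ex.M1.indep_subset_ground ex.M2.indep_subset_ground
      by (auto simp: ex.M1.fund_def ex.M2.fund_def)
    then show ?thesis by auto
  qed
  with y show ?thesis by blast
qed

lemma lst_eq: "p \<le> k \<Longrightarrow> p' \<le> k \<Longrightarrow> lst p = lst p' \<longleftrightarrow> p = p'"
  using lst(2) by (auto simp: inj_on_def)

lemma lst_in: "p \<le> k \<Longrightarrow> lst p \<in> J" using lst(3) by blast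

lemma J_lst: "x \<in> J \<Longrightarrow> \<exists>p\<le>k. x = lst p" using lst(3) by (metis atMost_iff imageE)

definition base :: "store \<Rightarrow> bool" where
  "base s \<longleftrightarrow> ncell s 0 0 0 = n \<and> ncell s 2 0 0 = k \<and> (\<forall>j. ncell s 3 0 j = of_bool (j \<in> J)) \<and>
    (\<forall>p\<le>k. ncell s 4 0 p = lst p) \<and> (\<forall>j<n. rcell s 0 0 j = w j) \<and> ncell s 50 0 0 = 0"

definition base_ids :: "nat set" where "base_ids = {0, 2, 3, 4, 50}"

lemma base_cong:
  assumes "\<And>a. a \<in> base_ids \<Longrightarrow> ncell s' a = ncell s a" "rcell s' 0 = rcell s 0"
  shows "base s' \<longleftrightarrow> base s"
  using assms by (simp add: base_def base_ids_def)

lemma base_P: "base s \<Longrightarrow> mods p \<inter> base_ids = {} \<Longrightarrow> 0 \<notin> rmods p \<Longrightarrow> base (P p s)"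
  by (subst base_cong) (auto intro!: pe_frame pe_rframe)

lemma base_set [simp]: "a \<notin> base_ids \<Longrightarrow> base (set_ncell a i j v s) \<longleftrightarrow> base s"
  by (rule base_cong) (metis ncell_set_other, simp)

lemma base_rset [simp]: "a \<noteq> 0 \<Longrightarrow> base (set_rcell a i j v s) \<longleftrightarrow> base s"
  by (rule base_cong) (auto simp: rcell_set_other)

lemma base_outside: "base s \<Longrightarrow> ncell s 3 0 j = 0 \<longleftrightarrow> j \<notin> J" "base s \<Longrightarrow> 0 < ncell s 3 0 j \<longleftrightarrow> j \<in> J"
  by (auto simp: base_def)

text \<open>\<open>J\<close> has \<open>k + 1\<close> elements, so the threshold of
  \<open>rank_hit\<close> is \<open>k\<close> for one removed row and \<open>k - 1\<close> for two;
  the program adds one to the answer instead in the latter case. The dummy, which the oracle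
  ignores, raises both extended ranks by one if it is still in the set.\<close>

lemma probe_hit:
  assumes s: "base s" and yz: "ncell s 15 0 0 = y" "ncell s 16 0 0 = z" "y \<in> Y" "z \<in> Y"
    and p: "ncell s 17 0 0 = p" "p \<le> k" "two \<Longrightarrow> ncell s 18 0 0 = p' \<and> p' \<le> k \<and> p \<noteq> p'"
  defines "X \<equiv> (if two then {lst p, lst p'} else {lst p})"
  shows "ncell (ev orc (probe two) s) 13 0 0 = of_bool (ex.hit X {y, z})"
proof -
  define Q where "Q = (J - X) \<union> {y, z}"
  have X: "X \<subseteq> J" "X \<noteq> {}" "card X = (if two then 2 else 1)"
    using lst_in p lst_eq[of p p'] by (auto simp: X_def)
  have Yn: "n \<notin> {y, z}" "{y, z} \<inter> J = {}" using yz by auto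
  have set_q: "{j. ncell s 3 0 j \<noteq> 0} = J" using s by (auto simp: base_outside)
  have "ncell (ev orc (probe two) s) 13 0 0 =
    (if k - (if n \<in> Q then 1 else 0) < orc Q + (if two then 1 else 0) then 1 else 0)"
  proof -
    have n0: "ncell s 0 0 0 = n" "ncell s 2 0 0 = k" using s by (auto simp: base_def)
    have l: "ncell s 4 0 p = lst p" "two \<Longrightarrow> ncell s 4 0 p' = lst p'" using s p by (auto simp: base_def)
    have "({j. ncell s 3 0 j \<noteq> 0} - {ncell s 4 0 (ncell s 17 0 0), ncell s 4 0 (ncell s (if two then 18 else 17) 0 0)}) \<union>
        {ncell s 15 0 0, ncell s 16 0 0} = Q"
      unfolding set_q using l p yz by (cases two) (auto simp: Q_def X_def)
    moreover have "ncell s 3 0 (ncell s 0 0 0) = 1" using s by (simp add: base_def)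
    ultimately show ?thesis using probe_result[of s orc two] n0 Yn yz by simp
  qed
  moreover have "ex.hit X {y, z} \<longleftrightarrow> k - (if n \<in> Q then 1 else 0) < orc Q + (if two then 1 else 0)"
  proof -
    have nE: "n \<notin> {..<n}" by simp
    have QE: "Q - {n} = Q \<inter> {..<n}" using I_facts yz by (auto simp: Q_def)
    have h1: "(\<exists>v\<in>{y, z}. F v \<inter> X \<noteq> {}) \<longleftrightarrow> Suc k - card X < rank (extend n (Suc k) m1) Q"
      using ex.M1.rank_hit[OF ex.base1 X(1) Yn(2)] unfolding card_J Q_def by blast
    have h2: "(\<exists>v\<in>{y, z}. G v \<inter> X \<noteq> {}) \<longleftrightarrow> Suc k - card X < rank (extend n (Suc k) m2) Q"
      using ex.M2.rank_hit[OF ex.base2 X(1) Yn(2)] unfolding card_J Q_def by blast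
    have r1: "Suc k - card X < rank (extend n (Suc k) m1) Q \<longleftrightarrow>
      Suc (Suc k - card X) \<le> rank m1 (Q \<inter> {..<n}) + (if n \<in> Q then 1 else 0)"
      unfolding Suc_le_eq[symmetric] M1.le_rank_extend[OF nE] QE using X(3) by auto
    have r2: "Suc k - card X < rank (extend n (Suc k) m2) Q \<longleftrightarrow>
      Suc (Suc k - card X) \<le> rank m2 (Q \<inter> {..<n}) + (if n \<in> Q then 1 else 0)"
      unfolding Suc_le_eq[symmetric] M2.le_rank_extend[OF nE] QE using X(3) by auto
    \<comment> \<open>If the dummy stays in the set, \<open>X\<close> lies in \<open>I\<close> and
      has at most \<open>k\<close> elements, so the truncated subtraction is exact.\<close>
    have kX: "card X \<le> k" if "n \<in> Q"
    proof -
      have "X \<subseteq> I" using that X(1) Yn by (auto simp: Q_def)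
      then show ?thesis using card_mono I_facts by metis
    qed
    have "card X \<le> Suc k" using card_mono[OF _ X(1)] I_facts(3) card_J by simp
    then show ?thesis unfolding ex.hit_def h1 h2 r1 r2 orc using kX X(3) by (auto split: if_splits)
  qed
  ultimately show ?thesis by simp
qed

lemma ask:
  assumes t: "base t" and abcd: "a \<notin> {15, 16, 17, 18}" "b \<notin> {15, 16, 17, 18}" "c \<notin> {15, 16, 17, 18}" "d \<notin> {15, 16, 17, 18}"
    and yz: "ncell t a 0 0 \<in> Y" "ncell t b 0 0 \<in> Y" and p: "ncell t c 0 0 \<le> k"
    "two \<Longrightarrow> ncell t d 0 0 \<le> k \<and> ncell t c 0 0 \<noteq> ncell t d 0 0"
  shows "ncell (P (ask two a b c d) t) 13 0 0 =
    of_bool (ex.hit (if two then {lst (ncell t c 0 0), lst (ncell t d 0 0)} else {lst (ncell t c 0 0)}) {ncell t a 0 0, ncell t b 0 0})"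
proof -
  define s where "s = ev orc (Seq (asg 15 (V a)) (Seq (asg 16 (V b)) (Seq (asg 17 (V c)) (asg 18 (V d))))) t"
  have s: "base s" using t by (simp add: s_def base_ids_def)
  have "ncell s 15 0 0 = ncell t a 0 0" "ncell s 16 0 0 = ncell t b 0 0" "ncell s 17 0 0 = ncell t c 0 0"
    "ncell s 18 0 0 = ncell t d 0 0" using abcd by (simp_all add: s_def)
  moreover have "P (ask two a b c d) t = ev orc (probe two) s" by (simp add: ask_def s_def)
  ultimately show ?thesis using probe_hit[OF s _ _ yz _ p(1), of two "ncell t d 0 0"] p(2) by simp
qed

lemma ask_frame: "x \<notin> ask_ids \<Longrightarrow> ncell (P (ask two a b c d) t) x = ncell t x"
  "rcell (P (ask two a b c d) t) = rcell t"
  by (auto intro!: pe_frame pe_rframe)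

lemma base_ask: "base t \<Longrightarrow> base (P (ask two a b c d) t)"
  by (rule base_P) (auto simp: ask_ids_def base_ids_def)

text \<open>\<open>A\<close> and \<open>B\<close> are the stored fundamental sets, possibly in the
  wrong order.\<close>

definition A :: "store \<Rightarrow> nat \<Rightarrow> nat set" where "A s y = {lst p |p. p \<le> k \<and> ncell s 5 y p \<noteq> 0}"
definition B :: "store \<Rightarrow> nat \<Rightarrow> nat set" where "B s y = {lst p |p. p \<le> k \<and> ncell s 6 y p \<noteq> 0}"

lemma A_iff: "p \<le> k \<Longrightarrow> lst p \<in> A s y \<longleftrightarrow> ncell s 5 y p \<noteq> 0"
  and B_iff: "p \<le> k \<Longrightarrow> lst p \<in> B s y \<longleftrightarrow> ncell s 6 y p \<noteq> 0"
  using lst_eq by (auto simp: A_def B_def)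

lemma set_lst_eqI: "S \<subseteq> J \<Longrightarrow> T \<subseteq> J \<Longrightarrow> (\<And>p. p \<le> k \<Longrightarrow> lst p \<in> S \<longleftrightarrow> lst p \<in> T) \<Longrightarrow> S = T"
  by (rule set_eqI) (metis J_lst subsetD)

lemma AB_sub: "A s y \<subseteq> J" "B s y \<subseteq> J" using lst_in by (auto simp: A_def B_def)
lemma FG_sub: "F y \<subseteq> J" "G y \<subseteq> J" by (rule ex.M1.fund_subset, rule ex.M2.fund_subset)

end

subsection \<open>Edges in both exchange graphs\<close>

text \<open>Asking with one column and one row tests membership in both fundamental sets, so arrays
  5 and 6 start with the same entries.\<close>

definition PA :: pr where
  "PA = blk [set0 8 NZero,
    ForN 21 (When (outside 21) (blk [put0 7 21 NZero, put0 9 21 NZero, Basic (NAssign 9 one (V 21) NZero),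
      ForK 23 (blk [ask False 21 21 23 23, put 5 21 23 (V 13), put 6 21 23 (V 13)])]))]"

context stage
begin

lemma PA:
  assumes "base s"
  shows "base (P PA s)" "ncell (P PA s) 8 0 0 = 0"
    "\<And>y. y \<in> Y \<Longrightarrow> A (P PA s) y = W y \<and> B (P PA s) y = W y"
    "\<And>y. y \<in> Y \<Longrightarrow> ncell (P PA s) 7 0 y = 0 \<and> ncell (P PA s) 9 0 y = 0 \<and> ncell (P PA s) 9 1 y = 0"
proof -
  define row where "row t y p \<longleftrightarrow> (ncell t 5 y p \<noteq> 0) = (lst p \<in> W y) \<and> (ncell t 6 y p \<noteq> 0) = (lst p \<in> W y)" for t :: store and y p
  define clear where "clear t y \<longleftrightarrow> ncell t 7 0 y = 0 \<and> ncell t 9 0 y = 0 \<and> ncell t 9 1 y = 0" for t :: store and y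
  let ?inner = "ForK 23 (blk [ask False 21 21 23 23, put 5 21 23 (V 13), put 6 21 23 (V 13)])"
  have inner: "(\<forall>p\<le>k. row (P ?inner t) y p) \<and> (\<forall>y'\<noteq>y. \<forall>p. row t y' p \<longrightarrow> row (P ?inner t) y' p)"
    if t: "base t" "ncell t 21 0 0 = y" "y \<in> Y" for t y
  proof -
    define Inv where "Inv i u \<longleftrightarrow> base u \<and> ncell u 21 0 0 = y \<and> (\<forall>p<i. row u y p) \<and>
      (\<forall>y'\<noteq>y. \<forall>p. row t y' p \<longrightarrow> row u y' p)" for i and u :: store
    have "Inv (Suc k) (P ?inner t)"
      unfolding pe.simps
    proof (rule loop_induct)
      show "Inv 0 (set_ncell 23 0 0 0 t)" using t by (auto simp: Inv_def base_ids_def row_def)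
      fix i u assume i: "i < Suc k" and u: "Inv i u" "ncell u 23 0 0 = i"
      define v where "v = P (ask False 21 21 23 23) u"
      have bu: "base u" "ncell u 21 0 0 = y" using u by (auto simp: Inv_def)
      have v: "ncell v 13 0 0 = of_bool (ex.hit {lst i} {y})" "base v"
        using ask[OF bu(1), of 21 21 23 23 False] base_ask[OF bu(1)] bu t(3) u(2) i by (simp_all add: v_def)
      have fr: "x \<notin> ask_ids \<Longrightarrow> ncell v x = ncell u x" for x by (simp add: v_def ask_frame)
      have hit: "ex.hit {lst i} {y} \<longleftrightarrow> lst i \<in> W y" by (auto simp: ex.hit_def)
      show "Inv (Suc i) (set_ncell 23 0 0 (Suc i) (P (blk [ask False 21 21 23 23, put 5 21 23 (V 13), put 6 21 23 (V 13)]) u))"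
        using u v bu by (auto simp: Inv_def v_def[symmetric] fr ask_ids_def base_ids_def row_def hit less_Suc_eq)
    qed
    then show ?thesis by (auto simp: Inv_def less_Suc_eq_le)
  qed
  define Inv where "Inv i t \<longleftrightarrow> base t \<and> ncell t 8 0 0 = 0 \<and>
    (\<forall>y\<in>Y. y < i \<longrightarrow> clear t y \<and> (\<forall>p\<le>k. row t y p))" for i and t :: store
  let ?body = "When (outside 21) (blk [put0 7 21 NZero, put0 9 21 NZero, Basic (NAssign 9 one (V 21) NZero), ?inner])"
  have PA_eq: "P PA s = loop 21 (P ?body) n (ev orc (asg 8 NZero) s)"
    by (simp only: PA_def blk.simps pe.simps)
  have "Inv n (P PA s)"
    unfolding PA_eq
  proof (rule loop_induct)
    show "Inv 0 (set_ncell 21 0 0 0 (ev orc (asg 8 NZero) s))" using assms by (simp add: Inv_def base_ids_def)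
    fix i t assume i: "i < n" and t: "Inv i t" "ncell t 21 0 0 = i"
    have bt: "base t" using t by (simp add: Inv_def)
    show "Inv (Suc i) (set_ncell 21 0 0 (Suc i) (P ?body t))"
    proof (cases "i \<in> Y")
      case False
      then have "P ?body t = t" using bt t(2) i by (simp add: base_def)
      then show ?thesis using t False by (auto simp: Inv_def base_ids_def clear_def row_def less_Suc_eq)
    next
      case True
      define t1 where "t1 = set_ncell 9 1 i 0 (set_ncell 9 0 i 0 (set_ncell 7 0 i 0 t))"
      have t1: "base t1" "ncell t1 21 0 0 = i" using bt t(2) by (simp_all add: t1_def base_ids_def)
      have eq: "P ?body t = P ?inner t1" using bt t(2) True i by (simp add: t1_def base_def)
      define t2 where "t2 = P ?inner t1"
      have b2: "base t2" unfolding t2_def using t1(1) by (rule base_P) (auto simp: ask_ids_def base_ids_def)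
      have fr: "x \<notin> insert 23 (insert 5 (insert 6 ask_ids)) \<Longrightarrow> ncell t2 x = ncell t1 x" for x
        unfolding t2_def by (rule pe_frame) (auto simp: ask_ids_def)
      have "clear t2 y" if "y \<in> Y" "y < Suc i" for y
        using that t(1) by (auto simp: clear_def fr ask_ids_def t1_def Inv_def less_Suc_eq)
      moreover have "row t2 y p" if "y \<in> Y" "y < Suc i" "p \<le> k" for y p
      proof (cases "y = i")
        case False
        then have "row t1 y p" using that t(1) by (auto simp: t1_def Inv_def row_def)
        then show ?thesis using inner[OF t1 True] False by (simp add: t2_def)
      qed (use inner[OF t1 True] that t2_def in auto)
      moreover have "ncell t2 8 0 0 = 0" using t(1) by (simp add: fr ask_ids_def t1_def Inv_def)
      ultimately show ?thesis using b2 unfolding eq t2_def[symmetric]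
        by (auto simp: Inv_def base_ids_def clear_def row_def)
    qed
  qed
  note fin = this
  from fin show "base (P PA s)" "ncell (P PA s) 8 0 0 = 0"
    "\<And>y. y \<in> Y \<Longrightarrow> ncell (P PA s) 7 0 y = 0 \<and> ncell (P PA s) 9 0 y = 0 \<and> ncell (P PA s) 9 1 y = 0"
    by (auto simp: Inv_def clear_def)
  from fin have r: "\<And>y p. y \<in> Y \<Longrightarrow> p \<le> k \<Longrightarrow> row (P PA s) y p"
    by (auto simp: Inv_def)
  show "A (P PA s) y = W y \<and> B (P PA s) y = W y" if "y \<in> Y" for y
  proof
    show "A (P PA s) y = W y" using r[OF that] FG_sub[of y]
      by (intro set_lst_eqI AB_sub) (auto simp: A_iff row_def)
    show "B (P PA s) y = W y" using r[OF that] FG_sub[of y]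
      by (intro set_lst_eqI AB_sub) (auto simp: B_iff row_def)
  qed
qed

end

context stage
begin

text \<open>Invariants are indexed by the set of columns already treated, which hides the skipped
  indices that belong to \<open>J\<close>.\<close>

lemma forY:
  assumes "Inv {} s" and base: "\<And>D t. Inv D t \<Longrightarrow> base t"
    and step: "\<And>D t y. Inv D t \<Longrightarrow> ncell t v 0 0 = y \<Longrightarrow> y \<in> Y \<Longrightarrow> y \<notin> D \<Longrightarrow> Inv (insert y D) (P body t)"
    and set: "\<And>D t i. Inv D t \<Longrightarrow> Inv D (set_ncell v 0 0 i t)"
  shows "Inv Y (P (ForN v (When (outside v) body)) s)"
proof -
  have "Inv (Y \<inter> {..<n}) (P (ForN v (When (outside v) body)) s)"
    unfolding pe.simps(5)
  proof (rule loop_induct[where Inv = "\<lambda>i. Inv (Y \<inter> {..<i})"])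
    show "Inv (Y \<inter> {..<0}) (set_ncell v 0 0 0 s)" using set[OF assms(1)] by simp
    fix i t assume i: "i < n" and t: "Inv (Y \<inter> {..<i}) t" "ncell t v 0 0 = i"
    show "Inv (Y \<inter> {..<Suc i}) (set_ncell v 0 0 (Suc i) (P (When (outside v) body) t))"
    proof (cases "i \<in> Y")
      case True
      then have "P (When (outside v) body) t = P body t" using base[OF t(1)] t(2) by (simp add: base_outside)
      moreover have "Y \<inter> {..<Suc i} = insert i (Y \<inter> {..<i})" using True by auto
      ultimately show ?thesis using step[OF t True] set by simp
    next
      case False
      then have "P (When (outside v) body) t = t" using base[OF t(1)] t(2) i by (simp add: base_outside)
      moreover have "Y \<inter> {..<Suc i} = Y \<inter> {..<i}" using False by (auto simp: less_Suc_eq)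
      ultimately show ?thesis using t(1) set by simp
    qed
  qed
  moreover have "Y \<inter> {..<n} = Y" by auto
  ultimately show ?thesis by simp
qed

lemma forK:
  assumes "Inv {} s"
    and step: "\<And>D t p. Inv D t \<Longrightarrow> ncell t v 0 0 = p \<Longrightarrow> p \<le> k \<Longrightarrow> p \<notin> D \<Longrightarrow> Inv (insert p D) (P body t)"
    and set: "\<And>D t i. Inv D t \<Longrightarrow> Inv D (set_ncell v 0 0 i t)"
  shows "Inv {..k} (P (ForK v body) s)"
proof -
  have "Inv {..<Suc k} (P (ForK v body) s)"
    unfolding pe.simps(6)
  proof (rule loop_induct[where Inv = "\<lambda>i. Inv {..<i}"])
    show "Inv {..<0} (set_ncell v 0 0 0 s)" using set[OF assms(1)] by simp
    fix i t assume i: "i < Suc k" and t: "Inv {..<i} t" "ncell t v 0 0 = i"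
    have "{..<Suc i} = insert i {..<i}" by auto
    then show "Inv {..<Suc i} (set_ncell v 0 0 (Suc i) (P body t))" using step[OF t] i set by simp
  qed
  then show ?thesis by (simp add: lessThan_Suc_atMost)
qed

lemma hit_pair:
  assumes "x \<notin> W y" "x' \<notin> W y"
  shows "ex.hit {x, x'} {y} \<longleftrightarrow> x \<in> F y \<and> x' \<in> G y \<or> x \<in> G y \<and> x' \<in> F y"
  using assms unfolding ex.hit_def by auto

lemma A_eqI: "S \<subseteq> J \<Longrightarrow> (\<And>p. p \<le> k \<Longrightarrow> ncell t 5 y p \<noteq> 0 \<longleftrightarrow> lst p \<in> S) \<Longrightarrow> A t y = S"
  and B_eqI: "S \<subseteq> J \<Longrightarrow> (\<And>p. p \<le> k \<Longrightarrow> ncell t 6 y p \<noteq> 0 \<longleftrightarrow> lst p \<in> S) \<Longrightarrow> B t y = S"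
  by (rule set_lst_eqI[OF AB_sub(1)], simp_all add: A_iff) (rule set_lst_eqI[OF AB_sub(2)], simp_all add: B_iff)

lemma n_J: "lst 0 = n" "n \<in> J" using lst by auto

end

subsection \<open>Incomparable circuits\<close>

text \<open>Scalars 41 and 42 keep two rows on opposite sides of the column. Such a pair exists iff
  the column is incomparable, and it then serves as a reference for all other rows.\<close>

definition PB_scan :: pr where
  "PB_scan = When (Conj (Conj (Neg (hg 21 23)) (Neg (hg 21 24))) (Neg (neq (V 23) (V 24))))
    (blk [ask True 21 21 23 24, When (nz (V 13)) (blk [set0 40 one, set0 41 (V 23), set0 42 (V 24)])])"

definition PB_mark :: pr where
  "PB_mark = When (Neg (hg 21 23)) (blk
    [When (Neg (neq (V 23) (V 42))) (blk [ask True 21 21 23 42, When (nz (V 13)) (put 5 21 23 one)]),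
     When (Neg (neq (V 23) (V 41))) (blk [ask True 21 21 23 41, When (nz (V 13)) (put 6 21 23 one)])])"

definition PB_col :: pr where
  "PB_col = blk [set0 40 NZero, ForK 23 (ForK 24 PB_scan),
    When (nz (V 40)) (blk [put0 7 21 one, ForK 23 PB_mark])]"

definition PB :: pr where "PB = ForN 21 (When (outside 21) PB_col)"

context stage
begin

lemma PB_scan:
  assumes s: "base s" "ncell s 21 0 0 = y" "y \<in> Y" "B s y = W y" "ncell s 40 0 0 = 0"
  defines "t \<equiv> P (ForK 23 (ForK 24 PB_scan)) s"
  shows "ncell t 40 0 0 \<noteq> 0 \<Longrightarrow> ncell t 41 0 0 \<le> k \<and> ncell t 42 0 0 \<le> k \<and>
      lst (ncell t 41 0 0) \<notin> W y \<and> lst (ncell t 42 0 0) \<notin> W y \<and>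
      ex.hit {lst (ncell t 41 0 0), lst (ncell t 42 0 0)} {y}"
    "ncell t 40 0 0 = 0 \<Longrightarrow> \<not> ex.sided y"
proof -
  define good where "good p q \<longleftrightarrow> p \<le> k \<and> q \<le> k \<and> lst p \<notin> W y \<and> lst q \<notin> W y \<and> ex.hit {lst p, lst q} {y}" for p q
  define C where "C u \<longleftrightarrow> base u \<and> ncell u 21 0 0 = y \<and> ncell u 6 = ncell s 6 \<and>
    (ncell u 40 0 0 \<noteq> 0 \<longrightarrow> good (ncell u 41 0 0) (ncell u 42 0 0))" for u :: store
  define Inv1 where "Inv1 D u \<longleftrightarrow> C u \<and> (ncell u 40 0 0 = 0 \<longrightarrow> (\<forall>p\<in>D. \<forall>q\<le>k. \<not> good p q))" for D u
  have W: "lst p \<in> W y \<longleftrightarrow> ncell s 6 y p \<noteq> 0" if "p \<le> k" for p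
    using B_iff[OF that, of s y] s(4) by simp
  have not_self: "\<not> good p p" for p by (auto simp: good_def ex.hit_def)
  have "Inv1 {..k} t" unfolding t_def
  proof (rule forK)
    show "Inv1 {} s" using s by (simp add: Inv1_def C_def)
    show "Inv1 D u \<Longrightarrow> Inv1 D (set_ncell 23 0 0 i u)" for D u i
      by (auto simp: Inv1_def C_def base_ids_def ncell_set_other)
    fix D u p assume u: "Inv1 D u" "ncell u 23 0 0 = p" "p \<le> k"
    define Inv2 where "Inv2 E v \<longleftrightarrow> Inv1 D v \<and> ncell v 23 0 0 = p \<and>
      (ncell v 40 0 0 = 0 \<longrightarrow> (\<forall>q\<in>E. \<not> good p q))" for E v
    have "Inv2 {..k} (P (ForK 24 PB_scan) u)"
    proof (rule forK)
      show "Inv2 {} u" using u by (simp add: Inv2_def)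
      show "Inv2 E v \<Longrightarrow> Inv2 E (set_ncell 24 0 0 i v)" for E v i
        by (auto simp: Inv2_def Inv1_def C_def base_ids_def ncell_set_other)
      fix E v q assume v: "Inv2 E v" "ncell v 24 0 0 = q" "q \<le> k"
      have vb: "base v" "ncell v 21 0 0 = y" "ncell v 6 = ncell s 6" "ncell v 23 0 0 = p"
        using v by (auto simp: Inv2_def Inv1_def C_def)
      show "Inv2 (insert q E) (P PB_scan v)"
      proof (cases "lst p \<notin> W y \<and> lst q \<notin> W y \<and> p \<noteq> q")
        case False
        then have "\<not> good p q" using not_self[of q] by (cases "p = q") (auto simp: good_def)
        moreover have "\<not> (ncell s 6 y p = 0 \<and> ncell s 6 y q = 0 \<and> p \<noteq> q)"
          using False W[OF u(3)] W[OF v(3)] by auto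
        ultimately show ?thesis using v vb by (auto simp: PB_scan_def Inv2_def)
      next
        case True
        then have c: "ncell s 6 y p = 0" "ncell s 6 y q = 0" "p \<noteq> q" using W u(3) v(3) by auto
        define v1 where "v1 = P (ask True 21 21 23 24) v"
        have h: "ncell v1 13 0 0 = of_bool (ex.hit {lst p, lst q} {y})"
          using ask[OF vb(1), of 21 21 23 24 True] vb v u(3) c(3) s(3) by (simp add: v1_def)
        have fr: "x \<notin> ask_ids \<Longrightarrow> ncell v1 x = ncell v x" for x by (simp add: v1_def ask_frame)
        have b1: "base v1" using base_ask[OF vb(1)] by (simp add: v1_def)
        have eq: "P PB_scan v = (if ex.hit {lst p, lst q} {y} then set_ncell 42 0 0 q (set_ncell 41 0 0 p (set_ncell 40 0 0 1 v1)) else v1)"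
          using vb c v(2) h by (auto simp: PB_scan_def v1_def[symmetric] fr ask_ids_def ncell_set_other)
        have gd: "good p q \<longleftrightarrow> ex.hit {lst p, lst q} {y}" using True u(3) v(3) by (simp add: good_def)
        show ?thesis unfolding eq using v vb b1 gd
          by (auto simp: Inv2_def Inv1_def C_def fr ask_ids_def base_ids_def ncell_set_other)
      qed
    qed
    then show "Inv1 (insert p D) (P (ForK 24 PB_scan) u)" by (auto simp: Inv2_def Inv1_def)
  qed
  then have t: "Inv1 {..k} t" .
  then show "ncell t 40 0 0 \<noteq> 0 \<Longrightarrow> ncell t 41 0 0 \<le> k \<and> ncell t 42 0 0 \<le> k \<and>
      lst (ncell t 41 0 0) \<notin> W y \<and> lst (ncell t 42 0 0) \<notin> W y \<and>
      ex.hit {lst (ncell t 41 0 0), lst (ncell t 42 0 0)} {y}"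
    by (auto simp: Inv1_def C_def good_def)
  show "\<not> ex.sided y" if "ncell t 40 0 0 = 0"
  proof
    assume "ex.sided y"
    then obtain x x' where x: "x \<in> F y - G y" "x' \<in> G y - F y" by (auto simp: ex.sided_def)
    then obtain p q where "p \<le> k" "q \<le> k" "x = lst p" "x' = lst q" using FG_sub J_lst by (meson DiffD1 subsetD)
    then have "good p q" using x by (auto simp: good_def ex.hit_def)
    then show False using t that \<open>p \<le> k\<close> \<open>q \<le> k\<close> by (auto simp: Inv1_def)
  qed
qed

text \<open>By \<open>hit_pair\<close>, a row outside \<open>W y\<close> belongs to the side of
  \<open>p0\<close> iff it is hit together with \<open>q0\<close>, and conversely. A reference row
  is not paired with itself; the zero already stored is then the right value.\<close>

lemma PB_mark:
  assumes s: "base s" "ncell s 21 0 0 = y" "y \<in> Y" "A s y = W y" "B s y = W y"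
    and pq: "ncell s 41 0 0 = p0" "ncell s 42 0 0 = q0" "p0 \<le> k" "q0 \<le> k" "lst p0 \<notin> W y" "lst q0 \<notin> W y"
      "ex.hit {lst p0, lst q0} {y}"
  defines "t \<equiv> P (ForK 23 PB_mark) s"
  shows "ex.oriented (A t y, B t y) (F y) (G y)" "\<And>y'. y' \<noteq> y \<Longrightarrow> A t y' = A s y' \<and> B t y' = B s y'"
proof -
  define S where "S = (if lst p0 \<in> F y then F y else G y)"
  define T where "T = (if lst p0 \<in> F y then G y else F y)"
  define Inv where "Inv D u \<longleftrightarrow> base u \<and> ncell u 21 0 0 = y \<and> ncell u 41 0 0 = p0 \<and> ncell u 42 0 0 = q0 \<and>
    (\<forall>y'\<noteq>y. ncell u 5 y' = ncell s 5 y' \<and> ncell u 6 y' = ncell s 6 y') \<and>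
    (\<forall>p\<le>k. if p \<in> D then (ncell u 5 y p \<noteq> 0 \<longleftrightarrow> lst p \<in> S) \<and> (ncell u 6 y p \<noteq> 0 \<longleftrightarrow> lst p \<in> T)
      else (ncell u 5 y p \<noteq> 0 \<longleftrightarrow> lst p \<in> W y) \<and> (ncell u 6 y p \<noteq> 0 \<longleftrightarrow> lst p \<in> W y))" for D u
  have p0: "lst p0 \<in> S" "lst p0 \<notin> T" "lst q0 \<in> T" "lst q0 \<notin> S" "W y \<subseteq> S" "W y \<subseteq> T" "p0 \<noteq> q0"
    using pq(5-7) hit_pair[OF pq(5,6)] by (auto simp: S_def T_def split: if_splits)
  have hq: "ex.hit {lst p, lst q0} {y} \<longleftrightarrow> lst p \<in> S" if "lst p \<notin> W y" for p
    using hit_pair[OF that pq(6)] p0 by (auto simp: S_def T_def split: if_splits)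
  have hp: "ex.hit {lst p, lst p0} {y} \<longleftrightarrow> lst p \<in> T" if "lst p \<notin> W y" for p
    using hit_pair[OF that pq(5)] p0 by (auto simp: S_def T_def split: if_splits)
  have "Inv {..k} t" unfolding t_def
  proof (rule forK)
    show "Inv {} s" using s pq A_iff[of _ s y] B_iff[of _ s y] by (auto simp: Inv_def)
    show "Inv D u \<Longrightarrow> Inv D (set_ncell 23 0 0 i u)" for D u i
      by (simp add: Inv_def base_ids_def ncell_set_other cong: if_cong split del: if_split)
    fix D u p assume u: "Inv D u" "ncell u 23 0 0 = p" "p \<le> k" "p \<notin> D"
    have ub: "base u" "ncell u 21 0 0 = y" "ncell u 41 0 0 = p0" "ncell u 42 0 0 = q0"
      "ncell u 5 y p \<noteq> 0 \<longleftrightarrow> lst p \<in> W y" "ncell u 6 y p \<noteq> 0 \<longleftrightarrow> lst p \<in> W y"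
      using u by (auto simp: Inv_def)
    show "Inv (insert p D) (P PB_mark u)"
    proof (cases "lst p \<in> W y")
      case True
      then have "P PB_mark u = u" using ub u(2) by (simp add: PB_mark_def)
      then show ?thesis using u True p0(5,6) by (auto simp: Inv_def)
    next
      case False
      let ?a = "When (Neg (neq (V 23) (V 42))) (blk [ask True 21 21 23 42, When (nz (V 13)) (put 5 21 23 one)])"
      let ?b = "When (Neg (neq (V 23) (V 41))) (blk [ask True 21 21 23 41, When (nz (V 13)) (put 6 21 23 one)])"
      define u1 where "u1 = P ?a u"
      have u1: "base u1 \<and> (\<forall>x. x \<notin> insert 5 ask_ids \<longrightarrow> ncell u1 x = ncell u x) \<and>
        (\<forall>y' p'. (y', p') \<noteq> (y, p) \<longrightarrow> ncell u1 5 y' p' = ncell u 5 y' p') \<and> (ncell u1 5 y p \<noteq> 0 \<longleftrightarrow> lst p \<in> S)"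
      proof (cases "p = q0")
        case True
        then have "u1 = u" using ub u(2) by (simp add: u1_def)
        then show ?thesis using ub True p0(4) False by simp
      next
        case pq0: False
        define v where "v = P (ask True 21 21 23 42) u"
        have h: "ncell v 13 0 0 = of_bool (ex.hit {lst p, lst q0} {y})"
          using ask[OF ub(1), of 21 21 23 42 True] ub u(2,3) pq0 s(3) pq(4) by (simp add: v_def)
        have fr: "x \<notin> ask_ids \<Longrightarrow> ncell v x = ncell u x" for x by (simp add: v_def ask_frame)
        have "base v" using base_ask[OF ub(1)] by (simp add: v_def)
        moreover have "u1 = (if lst p \<in> S then set_ncell 5 y p 1 v else v)"
          using ub u(2) pq0 h hq[OF False] by (auto simp: u1_def v_def[symmetric] fr ask_ids_def)
        ultimately show ?thesis using ub False
          by (auto simp: fr ask_ids_def base_ids_def ncell_set_other)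
      qed
      define u2 where "u2 = P ?b u1"
      have eq: "P PB_mark u = u2"
        using ub u(2) False by (simp add: PB_mark_def u2_def u1_def)
      have u1b: "ncell u1 21 0 0 = y" "ncell u1 41 0 0 = p0" "ncell u1 42 0 0 = q0" "ncell u1 23 0 0 = p" "ncell u1 6 = ncell u 6" "base u1"
        using u1 ub u(2) by (auto simp: ask_ids_def)
      have u2: "base u2 \<and> (\<forall>x. x \<notin> insert 6 ask_ids \<longrightarrow> ncell u2 x = ncell u1 x) \<and>
        (\<forall>y' p'. (y', p') \<noteq> (y, p) \<longrightarrow> ncell u2 6 y' p' = ncell u 6 y' p') \<and> (ncell u2 6 y p \<noteq> 0 \<longleftrightarrow> lst p \<in> T)"
      proof (cases "p = p0")
        case True
        then have "u2 = u1" using u1b by (simp add: u2_def)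
        then show ?thesis using u1b ub True p0(2) False by simp
      next
        case pp0: False
        define v where "v = P (ask True 21 21 23 41) u1"
        have h: "ncell v 13 0 0 = of_bool (ex.hit {lst p, lst p0} {y})"
          using ask[OF u1b(6), of 21 21 23 41 True] u1b u(3) pp0 s(3) pq(3) by (simp add: v_def)
        have fr: "x \<notin> ask_ids \<Longrightarrow> ncell v x = ncell u1 x" for x by (simp add: v_def ask_frame)
        have "base v" using base_ask[OF u1b(6)] by (simp add: v_def)
        moreover have "u2 = (if lst p \<in> T then set_ncell 6 y p 1 v else v)"
          using u1b pp0 h hp[OF False] by (auto simp: u2_def v_def[symmetric] fr ask_ids_def)
        ultimately show ?thesis using ub u1b False
          by (auto simp: fr ask_ids_def base_ids_def ncell_set_other)
      qed
      have u25: "ncell u2 5 = ncell u1 5" using u2 by (simp add: ask_ids_def)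
      have iu: "ncell u 5 y' = ncell s 5 y' \<and> ncell u 6 y' = ncell s 6 y'" if "y' \<noteq> y" for y'
        using u(1) that by (simp add: Inv_def)
      have keep5: "ncell u2 5 y' p' = ncell u 5 y' p'" if "(y', p') \<noteq> (y, p)" for y' p'
        unfolding u25 using that u1 by blast
      have keep6: "ncell u2 6 y' p' = ncell u 6 y' p'" if "(y', p') \<noteq> (y, p)" for y' p'
        using that u2 by blast
      have "\<forall>y'\<noteq>y. ncell u2 5 y' = ncell s 5 y' \<and> ncell u2 6 y' = ncell s 6 y'"
        using keep5 keep6 iu by (simp add: fun_eq_iff)
      moreover have "ncell u2 21 0 0 = y" "ncell u2 41 0 0 = p0" "ncell u2 42 0 0 = q0" "base u2"
        using u2 u1b by (simp_all add: ask_ids_def)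
      moreover have "if p' \<in> insert p D
        then (ncell u2 5 y p' \<noteq> 0 \<longleftrightarrow> lst p' \<in> S) \<and> (ncell u2 6 y p' \<noteq> 0 \<longleftrightarrow> lst p' \<in> T)
        else (ncell u2 5 y p' \<noteq> 0 \<longleftrightarrow> lst p' \<in> W y) \<and> (ncell u2 6 y p' \<noteq> 0 \<longleftrightarrow> lst p' \<in> W y)"
        if "p' \<le> k" for p'
      proof (cases "p' = p")
        case True
        then show ?thesis using u1 u2 u25 by simp
      next
        case False
        then show ?thesis using keep5[of y p'] keep6[of y p'] u(1) that by (simp add: Inv_def cong: if_cong split del: if_split)
      qed
      ultimately show ?thesis unfolding eq Inv_def by blast
    qed
  qed
  then have t: "\<And>p. p \<le> k \<Longrightarrow> (ncell t 5 y p \<noteq> 0 \<longleftrightarrow> lst p \<in> S) \<and> (ncell t 6 y p \<noteq> 0 \<longleftrightarrow> lst p \<in> T)"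
    "\<And>y'. y' \<noteq> y \<Longrightarrow> ncell t 5 y' = ncell s 5 y' \<and> ncell t 6 y' = ncell s 6 y'" by (auto simp: Inv_def)
  have "S \<subseteq> J" "T \<subseteq> J" using FG_sub by (auto simp: S_def T_def)
  then have "A t y = S" "B t y = T" using A_eqI[of S t y] B_eqI[of T t y] t(1) by blast+
  then show "ex.oriented (A t y, B t y) (F y) (G y)" by (auto simp: ex.oriented_def S_def T_def)
  show "\<And>y'. y' \<noteq> y \<Longrightarrow> A t y' = A s y' \<and> B t y' = B s y'" using t(2) by (simp add: A_def B_def)
qed

definition plain :: "store \<Rightarrow> nat \<Rightarrow> bool" where
  "plain s y \<longleftrightarrow> A s y = W y \<and> B s y = W y \<and> ncell s 7 0 y = 0"

definition split_col :: "store \<Rightarrow> nat \<Rightarrow> bool" where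
  "split_col s y \<longleftrightarrow> (if ex.sided y then ex.oriented (A s y, B s y) (F y) (G y) \<and> ncell s 7 0 y \<noteq> 0 else plain s y)"

lemma AB_cong: "ncell t 5 y = ncell s 5 y \<Longrightarrow> A t y = A s y" "ncell t 6 y = ncell s 6 y \<Longrightarrow> B t y = B s y"
  by (simp_all add: A_def B_def)

lemma plain_cong: "ncell t 5 y = ncell s 5 y \<Longrightarrow> ncell t 6 y = ncell s 6 y \<Longrightarrow> ncell t 7 0 y = ncell s 7 0 y \<Longrightarrow>
    plain t y = plain s y"
  by (simp only: plain_def AB_cong[of t y s])

lemma split_col_cong: "ncell t 5 y = ncell s 5 y \<Longrightarrow> ncell t 6 y = ncell s 6 y \<Longrightarrow> ncell t 7 0 y = ncell s 7 0 y \<Longrightarrow>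
    split_col t y = split_col s y"
  by (simp only: split_col_def AB_cong[of t y s] plain_cong[of t y s])

lemma phase_insert:
  assumes "\<forall>y\<in>Y. if y \<in> D then Q t y else R t y" "Q t' y"
    and "\<And>y'. y' \<noteq> y \<Longrightarrow> Q t y' \<Longrightarrow> Q t' y'" "\<And>y'. y' \<noteq> y \<Longrightarrow> R t y' \<Longrightarrow> R t' y'"
  shows "\<forall>y'\<in>Y. if y' \<in> insert y D then Q t' y' else R t' y'"
  using assms by (metis insert_iff)

lemma split_col_set [simp]: "a \<notin> {5, 6, 7} \<Longrightarrow> split_col (set_ncell a i j v t) y = split_col t y"
  and plain_set [simp]: "a \<notin> {5, 6, 7} \<Longrightarrow> plain (set_ncell a i j v t) y = plain t y"
  and A_set [simp]: "a \<noteq> 5 \<Longrightarrow> A (set_ncell a i j v t) y = A t y"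
  and B_set [simp]: "a \<noteq> 6 \<Longrightarrow> B (set_ncell a i j v t) y = B t y"
  by (simp_all add: split_col_def plain_def A_def B_def ncell_set_other)

lemma PB:
  assumes "base s" "\<And>y. y \<in> Y \<Longrightarrow> plain s y"
  shows "base (P PB s)" "\<And>y. y \<in> Y \<Longrightarrow> split_col (P PB s) y"
proof -
  define Inv where "Inv D t \<longleftrightarrow> base t \<and> (\<forall>y\<in>Y. if y \<in> D then split_col t y else plain t y)" for D t
  have "Inv Y (P PB s)" unfolding PB_def
  proof (rule forY)
    show "Inv {} s" using assms by (simp add: Inv_def)
    show "Inv D t \<Longrightarrow> base t" for D t by (simp add: Inv_def)
    show "Inv D t \<Longrightarrow> Inv D (set_ncell 21 0 0 i t)" for D t i
      by (simp add: Inv_def base_ids_def cong: if_cong split del: if_split)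
    fix D t y assume t: "Inv D t" "ncell t 21 0 0 = y" "y \<in> Y" "y \<notin> D"
    have pl: "base t" "plain t y" using t by (simp_all add: Inv_def)
    define t0 where "t0 = set_ncell 40 0 0 0 t"
    have t0: "base t0" "ncell t0 21 0 0 = y" "plain t0 y" "ncell t0 40 0 0 = 0"
      using t(2) pl by (simp_all add: t0_def base_ids_def)
    define t1 where "t1 = P (ForK 23 (ForK 24 PB_scan)) t0"
    have fr: "x \<notin> insert 23 (insert 24 (insert 40 (insert 41 (insert 42 ask_ids)))) \<Longrightarrow> ncell t1 x = ncell t0 x" for x
      unfolding t1_def by (rule pe_frame) (auto simp: PB_scan_def ask_ids_def)
    have b1: "base t1" unfolding t1_def using t0(1)
      by (rule base_P) (auto simp: PB_scan_def ask_ids_def base_ids_def)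
    have same: "ncell t1 5 = ncell t 5" "ncell t1 6 = ncell t 6" "ncell t1 7 = ncell t 7" "ncell t1 21 0 0 = y"
      using t(2) by (simp_all add: fr ask_ids_def t0_def ncell_set_other)
    have scan: "ncell t1 40 0 0 \<noteq> 0 \<Longrightarrow> ncell t1 41 0 0 \<le> k \<and> ncell t1 42 0 0 \<le> k \<and>
        lst (ncell t1 41 0 0) \<notin> W y \<and> lst (ncell t1 42 0 0) \<notin> W y \<and>
        ex.hit {lst (ncell t1 41 0 0), lst (ncell t1 42 0 0)} {y}" "ncell t1 40 0 0 = 0 \<Longrightarrow> \<not> ex.sided y"
      using PB_scan[OF t0(1,2) t(3) _ t0(4)] t0(3) unfolding t1_def by (auto simp: plain_def)
    have old: "plain t1 y" "\<And>y'. plain t y' \<Longrightarrow> plain t1 y'" "\<And>y'. split_col t y' \<Longrightarrow> split_col t1 y'"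
      using pl(2) plain_cong[of t1 _ t] split_col_cong[of t1 _ t] same by simp_all
    show "Inv (insert y D) (P PB_col t)"
    proof (cases "ncell t1 40 0 0 = 0")
      case True
      then have "P PB_col t = t1" by (simp add: PB_col_def t1_def t0_def)
      moreover have "split_col t1 y" using old(1) scan(2)[OF True] by (simp add: split_col_def)
      then have "\<forall>y'\<in>Y. if y' \<in> insert y D then split_col t1 y' else plain t1 y'"
        using t(1) old(2,3) by (intro phase_insert[where t = t]) (auto simp: Inv_def)
      ultimately show ?thesis using b1 by (simp add: Inv_def)
    next
      case False
      define t2 where "t2 = set_ncell 7 0 y 1 t1"
      have eq: "P PB_col t = P (ForK 23 PB_mark) t2"
        using False same(4) by (simp add: PB_col_def t1_def t0_def t2_def)
      have t2: "base t2" "ncell t2 21 0 0 = y" "A t2 y = W y" "B t2 y = W y" "ncell t2 41 = ncell t1 41" "ncell t2 42 = ncell t1 42"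
        using b1 same(4) old(1) by (auto simp: t2_def base_ids_def plain_def A_def B_def ncell_set_other)
      define t3 where "t3 = P (ForK 23 PB_mark) t2"
      have mark: "ex.oriented (A t3 y, B t3 y) (F y) (G y)" "\<And>y'. y' \<noteq> y \<Longrightarrow> A t3 y' = A t2 y' \<and> B t3 y' = B t2 y'"
        using PB_mark[OF t2(1,2) t(3) t2(3,4) refl refl] scan(1)[OF False] t2(5,6) unfolding t3_def by auto
      have b3: "base t3" unfolding t3_def using t2(1)
        by (rule base_P) (auto simp: PB_mark_def ask_ids_def base_ids_def)
      have v3: "ncell t3 7 = ncell t2 7" unfolding t3_def by (rule pe_frame) (auto simp: PB_mark_def ask_ids_def)
      have "ex.sided y" using scan(1)[OF False] hit_pair unfolding ex.sided_def by blast
      then have "split_col t3 y" using mark(1) v3 by (simp add: split_col_def t2_def)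
      moreover have "A t2 y' = A t1 y'" "B t2 y' = B t1 y'" for y' by (simp_all add: A_def B_def t2_def)
      then have "plain t1 y' \<Longrightarrow> plain t3 y'" "split_col t1 y' \<Longrightarrow> split_col t3 y'" if "y' \<noteq> y" for y'
        using mark(2)[OF that] that by (auto simp: plain_def split_col_def v3 t2_def)
      ultimately have "\<forall>y'\<in>Y. if y' \<in> insert y D then split_col t3 y' else plain t3 y'"
        using t(1) old(2,3) by (intro phase_insert[where t = t]) (auto simp: Inv_def)
      then show ?thesis unfolding eq t3_def[symmetric] using b3 by (simp add: Inv_def)
    qed
  qed
  then show "base (P PB s)" "\<And>y. y \<in> Y \<Longrightarrow> split_col (P PB s) y" by (auto simp: Inv_def)
qed

end

subsection \<open>Sources and sinks\<close>

text \<open>Scalar 50 is zero, the position of the dummy. Among columns without the dummy in both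
  sets, the answer is positive iff one is a source and the other a sink.\<close>

definition PC_scan :: pr where
  "PC_scan = When (Neg (nz (NCell 6 (V 22) NZero))) (blk [ask False 21 22 50 50, When (nz (V 13)) (set0 40 one)])"

definition PC_col :: pr where
  "PC_col = When (Neg (nz (NCell 6 (V 21) NZero))) (blk [set0 40 NZero, ForN 22 (When (outside 22) PC_scan),
    When (nz (V 40)) (blk [put0 7 21 one, set0 8 one, ForK 23 (put 5 21 23 one)])])"

definition PC :: pr where "PC = ForN 21 (When (outside 21) PC_col)"

context stage
begin

definition partner :: "nat \<Rightarrow> bool" where
  "partner y \<longleftrightarrow> n \<notin> W y \<and> (\<exists>z\<in>Y. n \<notin> W z \<and> ex.hit {n} {y, z})"

lemma n_B: "split_col t y \<Longrightarrow> n \<in> B t y \<longleftrightarrow> n \<in> W y"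
  using ex.sided_r[of y] by (auto simp: split_col_def plain_def ex.oriented_def split: if_splits)

lemma ncell_B0: "split_col t y \<Longrightarrow> ncell t 6 y 0 = 0 \<longleftrightarrow> n \<notin> W y"
  using n_B[of t y] B_iff[of 0 t y] n_J by simp

lemma PC_scan:
  assumes s: "base s" "ncell s 21 0 0 = y" "y \<in> Y" "n \<notin> W y" "ncell s 40 0 0 = 0"
    and sp: "\<And>z. z \<in> Y \<Longrightarrow> ncell s 6 z 0 = 0 \<longleftrightarrow> n \<notin> W z"
  defines "t \<equiv> P (ForN 22 (When (outside 22) PC_scan)) s"
  shows "ncell t 40 0 0 \<noteq> 0 \<longleftrightarrow> partner y"
proof -
  define Inv where "Inv D u \<longleftrightarrow> base u \<and> ncell u 21 0 0 = y \<and> ncell u 6 = ncell s 6 \<and>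
    (ncell u 40 0 0 \<noteq> 0 \<longleftrightarrow> (\<exists>z\<in>D \<inter> Y. n \<notin> W z \<and> ex.hit {n} {y, z}))" for D u
  have "Inv Y t" unfolding t_def
  proof (rule forY)
    show "Inv {} s" using s by (simp add: Inv_def)
    show "Inv D u \<Longrightarrow> base u" for D u by (simp add: Inv_def)
    show "Inv D u \<Longrightarrow> Inv D (set_ncell 22 0 0 i u)" for D u i
      by (simp add: Inv_def base_ids_def ncell_set_other)
    fix D u z assume u: "Inv D u" "ncell u 22 0 0 = z" "z \<in> Y" "z \<notin> D"
    have ub: "base u" "ncell u 21 0 0 = y" "ncell u 6 = ncell s 6" using u by (auto simp: Inv_def)
    show "Inv (insert z D) (P PC_scan u)"
    proof (cases "n \<in> W z")
      case True
      then have "ncell s 6 z 0 \<noteq> 0" using sp[OF u(3)] by simp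
      then have "P PC_scan u = u" using ub u(2) by (simp add: PC_scan_def)
      then show ?thesis using u True by (auto simp: Inv_def)
    next
      case False
      then have z0: "ncell s 6 z 0 = 0" using sp[OF u(3)] by simp
      define v where "v = P (ask False 21 22 50 50) u"
      have zero: "ncell u 50 0 0 = 0" using ub(1) by (simp add: base_def)
      have h: "ncell v 13 0 0 = of_bool (ex.hit {n} {y, z})"
        using ask[OF ub(1), of 21 22 50 50 False] ub u s(3) zero n_J by (simp add: v_def)
      have fr: "x \<notin> ask_ids \<Longrightarrow> ncell v x = ncell u x" for x by (simp add: v_def ask_frame)
      have bv: "base v" using base_ask[OF ub(1)] by (simp add: v_def)
      have eq: "P PC_scan u = (if ex.hit {n} {y, z} then set_ncell 40 0 0 1 v else v)"
        using ub u(2) z0 h by (auto simp: PC_scan_def v_def[symmetric])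
      show ?thesis unfolding eq using u bv False
        by (auto simp: Inv_def fr ask_ids_def base_ids_def ncell_set_other)
    qed
  qed
  then show ?thesis using s(4) by (auto simp: Inv_def partner_def)
qed

definition source_col :: "store \<Rightarrow> nat \<Rightarrow> bool" where
  "source_col s y \<longleftrightarrow> (if partner y then A s y = J \<and> B s y = W y \<and> ncell s 7 0 y \<noteq> 0 else split_col s y)"

lemma source_col_cong: "ncell t 5 y = ncell s 5 y \<Longrightarrow> ncell t 6 y = ncell s 6 y \<Longrightarrow> ncell t 7 0 y = ncell s 7 0 y \<Longrightarrow>
    source_col t y = source_col s y"
  by (simp only: source_col_def AB_cong[of t y s] split_col_cong[of t y s])

lemma source_col_set [simp]: "a \<notin> {5, 6, 7} \<Longrightarrow> source_col (set_ncell a i j v t) y = source_col t y"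
  by (simp add: source_col_def ncell_set_other)

lemma partner_sided: "partner y \<Longrightarrow> \<not> ex.sided y"
  using ex.sided_r[of y] ex.paired_hit[of y] by (auto simp: partner_def)

lemma PC:
  assumes "base s" "\<And>y. y \<in> Y \<Longrightarrow> split_col s y" "ncell s 8 0 0 = 0"
  shows "base (P PC s)" "\<And>y. y \<in> Y \<Longrightarrow> source_col (P PC s) y" "ncell (P PC s) 8 0 0 \<noteq> 0 \<longleftrightarrow> (\<exists>y\<in>Y. partner y)"
proof -
  define Inv where "Inv D t \<longleftrightarrow> base t \<and> ncell t 6 = ncell s 6 \<and> (\<forall>y\<in>Y. if y \<in> D then source_col t y else split_col t y) \<and>
    (ncell t 8 0 0 \<noteq> 0 \<longleftrightarrow> (\<exists>y\<in>D \<inter> Y. partner y))" for D t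
  have sp: "ncell s 6 z 0 = 0 \<longleftrightarrow> n \<notin> W z" if "z \<in> Y" for z using ncell_B0[OF assms(2)[OF that]] .
  have "Inv Y (P PC s)" unfolding PC_def
  proof (rule forY)
    show "Inv {} s" using assms by (simp add: Inv_def)
    show "Inv D t \<Longrightarrow> base t" for D t by (simp add: Inv_def)
    show "Inv D t \<Longrightarrow> Inv D (set_ncell 21 0 0 i t)" for D t i
      by (simp add: Inv_def base_ids_def ncell_set_other cong: if_cong split del: if_split)
    fix D t y assume t: "Inv D t" "ncell t 21 0 0 = y" "y \<in> Y" "y \<notin> D"
    have tb: "base t" "ncell t 6 = ncell s 6" "split_col t y" using t by (auto simp: Inv_def)
    show "Inv (insert y D) (P PC_col t)"
    proof (cases "n \<in> W y")
      case True
      then have "ncell s 6 y 0 \<noteq> 0" using sp[OF t(3)] by simp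
      then have "P PC_col t = t" using tb t(2) by (simp add: PC_col_def)
      moreover have "\<not> partner y" using True by (simp add: partner_def)
      moreover have "\<forall>y'\<in>Y. if y' \<in> insert y D then source_col t y' else split_col t y'"
        using t(1) tb(3) \<open>\<not> partner y\<close>
        by (intro phase_insert[where t = t]) (auto simp: Inv_def source_col_def[of t y])
      ultimately show ?thesis using t by (simp add: Inv_def)
    next
      case False
      then have y0: "ncell s 6 y 0 = 0" using sp[OF t(3)] by simp
      define t0 where "t0 = set_ncell 40 0 0 0 t"
      have t0: "base t0" "ncell t0 21 0 0 = y" "ncell t0 40 0 0 = 0" "ncell t0 6 = ncell s 6"
        using t tb by (auto simp: t0_def base_ids_def ncell_set_other)
      define t1 where "t1 = P (ForN 22 (When (outside 22) PC_scan)) t0"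
      have scan: "ncell t1 40 0 0 \<noteq> 0 \<longleftrightarrow> partner y"
        unfolding t1_def using PC_scan[OF t0(1,2) t(3) False t0(3)] sp t0(4) by simp
      have fr: "x \<notin> insert 22 (insert 40 ask_ids) \<Longrightarrow> ncell t1 x = ncell t0 x" for x
        unfolding t1_def by (rule pe_frame) (auto simp: PC_scan_def ask_ids_def)
      have b1: "base t1" unfolding t1_def using t0(1)
        by (rule base_P) (auto simp: PC_scan_def ask_ids_def base_ids_def)
      have same: "ncell t1 5 = ncell t 5" "ncell t1 6 = ncell s 6" "ncell t1 7 = ncell t 7" "ncell t1 8 = ncell t 8" "ncell t1 21 0 0 = y"
        using t(2) tb by (simp_all add: fr ask_ids_def t0_def ncell_set_other)
      have old: "split_col t y' \<Longrightarrow> split_col t1 y'" "source_col t y' \<Longrightarrow> source_col t1 y'" for y'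
        using same tb source_col_cong[of t1 y' t] split_col_cong[of t1 y' t] by simp_all
      show ?thesis
      proof (cases "partner y")
        case np: False
        then have "P PC_col t = t1" using scan t(2) tb y0 by (simp add: PC_col_def t1_def t0_def)
        moreover have "\<forall>y'\<in>Y. if y' \<in> insert y D then source_col t1 y' else split_col t1 y'"
          using t(1) old tb(3) np
          by (intro phase_insert[where t = t]) (auto simp: Inv_def source_col_def[of t1 y])
        ultimately show ?thesis using np b1 same t by (simp add: Inv_def)
      next
        case True
        define t2 where "t2 = set_ncell 8 0 0 1 (set_ncell 7 0 y 1 t1)"
        have "ncell t1 40 0 0 \<noteq> 0" using scan True by simp
        then have eq: "P PC_col t = P (ForK 23 (put 5 21 23 one)) t2"
          using t(2) tb y0 same(5) by (simp add: PC_col_def t1_def t0_def t2_def)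
        define Fil where "Fil E u \<longleftrightarrow> ncell u 21 0 0 = y \<and> (\<forall>p\<in>E. ncell u 5 y p \<noteq> 0) \<and>
          (\<forall>y'\<noteq>y. ncell u 5 y' = ncell t2 5 y')" for E and u :: store
        define t3 where "t3 = P (ForK 23 (put 5 21 23 one)) t2"
        have "Fil {..k} t3" unfolding t3_def
        proof (rule forK)
          show "Fil {} t2" using same by (simp add: Fil_def t2_def)
          show "Fil E u \<Longrightarrow> Fil E (set_ncell 23 0 0 i u)" for E u i by (simp add: Fil_def fun_eq_iff)
          show "Fil (insert p E) (P (put 5 21 23 one) u)"
            if "Fil E u" "ncell u 23 0 0 = p" for E u p using that by (auto simp: Fil_def fun_eq_iff)
        qed
        then have f3: "\<And>p. p \<le> k \<Longrightarrow> ncell t3 5 y p \<noteq> 0" "\<And>y'. y' \<noteq> y \<Longrightarrow> ncell t3 5 y' = ncell t 5 y'"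
          using same(1) by (auto simp: Fil_def t2_def ncell_set_other)
        have fr3: "x \<notin> {5, 23} \<Longrightarrow> ncell t3 x = ncell t2 x" for x
          unfolding t3_def by (rule pe_frame) auto
        have b3: "base t3" unfolding t3_def by (rule base_P) (use b1 in \<open>auto simp: base_ids_def t2_def\<close>)
        have s3: "ncell t3 6 = ncell s 6" "ncell t3 8 0 0 = 1" "ncell t3 7 0 y = 1" "\<And>y'. y' \<noteq> y \<Longrightarrow> ncell t3 7 0 y' = ncell t 7 0 y'"
          using same by (simp_all add: fr3 t2_def ncell_set_other)
        have "A t3 y = J" by (rule A_eqI) (use f3(1) lst_in in auto)
        moreover have "B t3 y = B t y" using s3(1) tb by (simp add: B_def)
        moreover have "B t y = W y" using tb(3) partner_sided[OF True] by (simp add: split_col_def plain_def)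
        ultimately have "source_col t3 y" using True s3(3) by (simp add: source_col_def)
        moreover have "A t3 y' = A t y'" "B t3 y' = B t y'" if "y' \<noteq> y" for y'
          using f3(2)[OF that] s3(1) tb by (simp_all add: A_def B_def)
        then have "split_col t y' \<Longrightarrow> split_col t3 y'" "source_col t y' \<Longrightarrow> source_col t3 y'" if "y' \<noteq> y" for y'
          using that s3(4) by (simp_all add: source_col_def plain_def split_col_def cong: if_cong split del: if_split)
        ultimately have "\<forall>y'\<in>Y. if y' \<in> insert y D then source_col t3 y' else split_col t3 y'"
          using t(1) by (intro phase_insert[where t = t]) (auto simp: Inv_def)
        then show ?thesis unfolding eq t3_def[symmetric] using b3 s3 t(3) True by (auto simp: Inv_def)
      qed
    qed
  qed
  then show "base (P PC s)" "\<And>y. y \<in> Y \<Longrightarrow> source_col (P PC s) y"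
    "ncell (P PC s) 8 0 0 \<noteq> 0 \<longleftrightarrow> (\<exists>y\<in>Y. partner y)" by (auto simp: Inv_def)
qed

lemma partner_iff: "y \<in> Y \<Longrightarrow> partner y \<longleftrightarrow> ex.paired \<and> (n \<in> F y) \<noteq> (n \<in> G y)"
proof
  assume "partner y"
  then obtain z where "n \<notin> W y" "n \<notin> W z" "ex.hit {n} {y, z}" by (auto simp: partner_def)
  with ex.paired_hit[of y z] show "ex.paired \<and> (n \<in> F y) \<noteq> (n \<in> G y)" unfolding ex.paired_def by auto
next
  assume y: "ex.paired \<and> (n \<in> F y) \<noteq> (n \<in> G y)"
  then obtain s t where st: "n \<in> F s - G s" "n \<in> G t - F t" by (auto simp: ex.paired_def)
  have "s \<in> Y" "t \<in> Y" using st col_out by blast+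
  then show "partner y" using y st ex.paired_hit[of y s] ex.paired_hit[of y t] unfolding partner_def by blast
qed

lemma found_iff: "(\<exists>y\<in>Y. partner y) \<longleftrightarrow> ex.paired"
proof
  assume "ex.paired"
  then obtain s where "n \<in> F s - G s" by (auto simp: ex.paired_def)
  moreover then have "s \<in> Y" using col_out by blast
  ultimately show "\<exists>y\<in>Y. partner y" using partner_iff \<open>ex.paired\<close> by blast
qed (use partner_iff in blast)

definition visible :: "store \<Rightarrow> nat \<Rightarrow> bool" where
  "visible s y \<longleftrightarrow>
    (if ex.sided y \<or> ex.paired \<and> (n \<in> F y) \<noteq> (n \<in> G y)
     then ncell s 7 0 y \<noteq> 0 \<and> ex.oriented (A s y, B s y) (F y) (G y) else plain s y)"

text \<open>At a source or sink the set containing the dummy is all of \<open>J\<close> by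
  \<open>full1\<close> and \<open>full2\<close>, so the other set is the intersection
  \<open>W y\<close>, which is known. Storing \<open>J\<close> beside it therefore completes the
  unordered pair.\<close>

lemma source_visible: "y \<in> Y \<Longrightarrow> source_col s y \<Longrightarrow> visible s y"
  using ex.full1[of y] ex.full2[of y] FG_sub[of y] partner_iff[of y]
  by (auto simp: source_col_def visible_def split_col_def ex.oriented_def split: if_splits)

end

subsection \<open>Edges at comparable circuits\<close>

text \<open>Counter 21 is the column \<open>y\<close> and 23 the position of the row
  \<open>x\<close> under test; 22 is the witness column \<open>z\<close> and 24 the position of
  \<open>u\<close>. The guard checks the hypotheses of \<open>detect_sound\<close> that can be read
  from memory.\<close>

definition PD_ask :: pr where
  "PD_ask = When (Conj (Conj (xor (hf 22 24) (hg 22 24)) (Neg (hf 21 24)))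
      (Conj (implies (hf 22 23) (hf 22 24)) (implies (hg 22 23) (hg 22 24))))
    (blk [ask False 21 22 24 24,
      If (nz (V 13)) (When (neq (V 23) (V 24)) (put 6 21 23 one))
        (When (Neg (neq (V 23) (V 24))) (blk [ask True 21 22 24 23, When (nz (V 13)) (put 6 21 23 one)]))])"

definition PD_z :: pr where "PD_z = ForN 22 (When (outside 22) (ForK 24 PD_ask))"
definition PD_p :: pr where "PD_p = ForK 23 (When (Neg (hf 21 23)) PD_z)"
definition PD :: pr where "PD = When (nz (V 8)) (ForN 21 (When (outside 21) (When (zr (vis 21)) PD_p)))"

lemma mods_PD: "mods PD_ask \<subseteq> insert 6 ask_ids" "mods PD_z \<subseteq> {6, 22, 24} \<union> ask_ids" "mods PD_p \<subseteq> {6, 22, 23, 24} \<union> ask_ids"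
  "mods PD \<subseteq> {6, 21, 22, 23, 24} \<union> ask_ids" "rmods PD = {}" "rmods PD_ask = {}" "rmods PD_z = {}" "rmods PD_p = {}"
  by (auto simp: PD_def PD_p_def PD_z_def PD_ask_def)

context stage
begin

definition special :: "nat \<Rightarrow> bool" where
  "special y \<longleftrightarrow> ex.sided y \<or> ex.paired \<and> (n \<in> F y) \<noteq> (n \<in> G y)"

definition mid :: "store \<Rightarrow> nat \<Rightarrow> bool" where
  "mid s y \<longleftrightarrow> (if special y then ncell s 7 0 y \<noteq> 0 \<and> ex.oriented (A s y, B s y) (F y) (G y)
     else ncell s 7 0 y = 0 \<and> A s y = W y \<and> W y \<subseteq> B s y \<and> B s y \<subseteq> G y)"

text \<open>Detection only adds entries to array 6, so edges found once are kept.\<close>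

definition le :: "store \<Rightarrow> store \<Rightarrow> bool" where "le s t \<longleftrightarrow> (\<forall>y. B s y \<subseteq> B t y)"

lemma le_refl: "le s s" and le_trans: "le s t \<Longrightarrow> le t u \<Longrightarrow> le s u" and le_set: "v \<noteq> 6 \<Longrightarrow> le s t \<Longrightarrow> le s (set_ncell v i j x t)"
  by (auto simp: le_def)

lemma visible_mid: "visible s y \<Longrightarrow> mid s y"
  unfolding visible_def mid_def special_def[symmetric] by (auto simp: plain_def split: if_splits)

definition Ctx :: "store \<Rightarrow> bool" where "Ctx s \<longleftrightarrow> base s \<and> (\<forall>y\<in>Y. mid s y)"

lemma Ctx_set [simp]: "a \<notin> {5, 6, 7} \<Longrightarrow> a \<notin> base_ids \<Longrightarrow> Ctx (set_ncell a i j v s) \<longleftrightarrow> Ctx s"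
  by (simp add: Ctx_def mid_def ncell_set_other)

lemma growK:
  assumes C: "C s" and set: "\<And>t i. C t \<Longrightarrow> C (set_ncell v 0 0 i t)" and v: "v \<noteq> 6"
    and step: "\<And>t p. C t \<Longrightarrow> ncell t v 0 0 = p \<Longrightarrow> p \<le> k \<Longrightarrow> C (P body t) \<and> le t (P body t) \<and> Q p (P body t)"
    and mono: "\<And>t t' q. le t t' \<Longrightarrow> Q q t \<Longrightarrow> Q q t'"
  shows "C (P (ForK v body) s) \<and> le s (P (ForK v body) s) \<and> (\<forall>p\<le>k. Q p (P (ForK v body) s))"
proof -
  define Inv where "Inv D t \<longleftrightarrow> C t \<and> le s t \<and> (\<forall>p\<in>D. Q p t)" for D t
  have "Inv {..k} (P (ForK v body) s)"
  proof (rule forK)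
    show "Inv {} s" using C by (simp add: Inv_def le_refl)
    show "Inv D t \<Longrightarrow> Inv D (set_ncell v 0 0 i t)" for D t i
      using set le_set[OF v] mono[OF le_set[OF v le_refl]] unfolding Inv_def by blast
    show "Inv (insert p D) (P body t)" if "Inv D t" "ncell t v 0 0 = p" "p \<le> k" for D t p
      using step[of t p] mono that le_trans unfolding Inv_def by blast
  qed
  then show ?thesis by (simp add: Inv_def)
qed

lemma growY:
  assumes C: "C s" and set: "\<And>t i. C t \<Longrightarrow> C (set_ncell v 0 0 i t)" and v: "v \<noteq> 6" and base: "\<And>t. C t \<Longrightarrow> base t"
    and step: "\<And>t p. C t \<Longrightarrow> ncell t v 0 0 = p \<Longrightarrow> p \<in> Y \<Longrightarrow> C (P body t) \<and> le t (P body t) \<and> Q p (P body t)"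
    and mono: "\<And>t t' q. le t t' \<Longrightarrow> Q q t \<Longrightarrow> Q q t'"
  shows "C (P (ForN v (When (outside v) body)) s) \<and> le s (P (ForN v (When (outside v) body)) s) \<and>
    (\<forall>p\<in>Y. Q p (P (ForN v (When (outside v) body)) s))"
proof -
  define Inv where "Inv D t \<longleftrightarrow> C t \<and> le s t \<and> (\<forall>p\<in>D. Q p t)" for D t
  have "Inv Y (P (ForN v (When (outside v) body)) s)"
  proof (rule forY)
    show "Inv {} s" using C by (simp add: Inv_def le_refl)
    show "Inv D t \<Longrightarrow> base t" for D t using base by (simp add: Inv_def)
    show "Inv D t \<Longrightarrow> Inv D (set_ncell v 0 0 i t)" for D t i
      using set le_set[OF v] mono[OF le_set[OF v le_refl]] unfolding Inv_def by blast
    show "Inv (insert p D) (P body t)" if "Inv D t" "ncell t v 0 0 = p" "p \<in> Y" for D t p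
      using step[of t p] mono that le_trans unfolding Inv_def by blast
  qed
  then show ?thesis by (simp add: Inv_def)
qed

definition detectable :: "nat \<Rightarrow> nat \<Rightarrow> nat \<Rightarrow> nat \<Rightarrow> bool" where
  "detectable y p z u \<longleftrightarrow> lst u \<in> F z - G z \<and> lst u \<notin> G y \<and> lst p \<notin> G z \<and> lst p \<in> G y"

lemma unspecial_subset:
  assumes "y \<in> Y" "\<not> special y" "ex.paired"
  shows "F y \<subseteq> G y" "W y = F y"
proof -
  have "F y \<subseteq> G y"
  proof (cases "n \<in> F y")
    case True
    then have "n \<in> G y" using assms by (auto simp: special_def)
    then show ?thesis using ex.full2 FG_sub by blast
  qed (use ex.unsided_subset[of y] assms Y_eq in \<open>auto simp: special_def\<close>)
  then show "F y \<subseteq> G y" "W y = F y" by blast+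
qed

lemma mid_known:
  assumes "y \<in> Y" "mid s y" "ex.paired"
  shows "\<exists>F' G'. ex.known y F' G' \<and> ex.oriented (A s y, B s y) F' G'"
proof (cases "special y")
  case True
  then show ?thesis using assms by (intro exI[of _ "F y"] exI[of _ "G y"]) (auto simp: mid_def ex.known_def)
next
  case False
  then show ?thesis using assms unspecial_subset[OF assms(1) False assms(3)]
    by (intro exI[of _ "A s y"] exI[of _ "B s y"]) (auto simp: mid_def ex.known_def ex.oriented_def)
qed

lemma PD_ask:
  assumes C: "Ctx t" and v: "ncell t 21 0 0 = y" "ncell t 23 0 0 = p" "ncell t 22 0 0 = z" "ncell t 24 0 0 = u"
    and r: "y \<in> Y" "z \<in> Y" "p \<le> k" "u \<le> k" and y: "\<not> special y" "ex.paired" "lst p \<notin> W y"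
  shows "Ctx (P PD_ask t) \<and> le t (P PD_ask t) \<and> (detectable y p z u \<longrightarrow> lst p \<in> B (P PD_ask t) y)"
proof -
  have bt: "base t" and md: "\<And>y. y \<in> Y \<Longrightarrow> mid t y" using C by (auto simp: Ctx_def)
  note sub = unspecial_subset[OF r(1) y(1,2)]
  have Ay: "A t y = F y" using md[OF r(1)] y(1) sub by (simp add: mid_def)
  define cond where "cond \<longleftrightarrow> ((lst u \<in> A t z) \<noteq> (lst u \<in> B t z)) \<and> lst u \<notin> F y \<and>
    (lst p \<in> A t z \<longrightarrow> lst u \<in> A t z) \<and> (lst p \<in> B t z \<longrightarrow> lst u \<in> B t z)"
  define h where "h \<longleftrightarrow> p = u \<and> ex.hit {lst u} {y, z} \<or> p \<noteq> u \<and> \<not> ex.hit {lst u} {y, z} \<and> ex.hit {lst u, lst p} {y, z}"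
  have b: "bval (Conj (Conj (xor (hf 22 24) (hg 22 24)) (Neg (hf 21 24)))
      (Conj (implies (hf 22 23) (hf 22 24)) (implies (hg 22 23) (hg 22 24)))) t \<longleftrightarrow> cond"
    using v r A_iff[of _ t] B_iff[of _ t] unfolding cond_def Ay[symmetric] by auto
  define t1 where "t1 = P (ask False 21 22 24 24) t"
  define t2 where "t2 = P (ask True 21 22 24 23) t1"
  have fr1: "x \<notin> ask_ids \<Longrightarrow> ncell t1 x = ncell t x" for x by (simp add: t1_def ask_frame)
  have fr2: "x \<notin> ask_ids \<Longrightarrow> ncell t2 x = ncell t x" for x by (simp add: t2_def ask_frame fr1)
  have v1: "ncell t1 21 0 0 = y" "ncell t1 23 0 0 = p" "ncell t1 22 0 0 = z" "ncell t1 24 0 0 = u"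
    "ncell t2 21 0 0 = y" "ncell t2 23 0 0 = p" using v by (simp_all add: fr1 fr2 ask_ids_def)
  have b1: "base t1" "base t2" using bt base_ask by (simp_all add: t1_def t2_def)
  have h1: "ncell t1 13 0 0 = of_bool (ex.hit {lst u} {y, z})"
    using ask[OF bt, of 21 22 24 24 False] v r by (simp add: t1_def)
  have h2: "p \<noteq> u \<Longrightarrow> ncell t2 13 0 0 = of_bool (ex.hit {lst u, lst p} {y, z})"
    using ask[OF b1(1), of 21 22 24 23 True] v1 r by (simp add: t2_def)
  have AB: "A t1 = A t" "B t1 = B t" "A t2 = A t" "B t2 = B t"
    by (simp_all add: fun_eq_iff A_def B_def fr1 fr2 ask_ids_def)
  have C12: "Ctx t1" "Ctx t2" using C b1 by (simp_all add: Ctx_def mid_def AB fr1 fr2 ask_ids_def)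
  define t' where "t' = (if p = u then t1 else if ex.hit {lst u} {y, z} then t1 else t2)"
  have t': "Ctx t'" "A t' = A t" "B t' = B t" using C12 AB by (simp_all add: t'_def)
  have eq: "P PD_ask t = (if cond then if h then set_ncell 6 y p 1 t' else t' else t)"
  proof (cases cond)
    case True
    then have "P PD_ask t = P (If (nz (V 13)) (When (neq (V 23) (V 24)) (put 6 21 23 one))
        (When (Neg (neq (V 23) (V 24))) (blk [ask True 21 22 24 23, When (nz (V 13)) (put 6 21 23 one)]))) t1"
      using b by (simp only: PD_ask_def pe.simps blk.simps t1_def if_True)
    also have "\<dots> = (if h then set_ncell 6 y p 1 t' else t')"
      using h1 h2 v1 by (auto simp: h_def t'_def t2_def[symmetric])
    finally show ?thesis using True by simp
  next
    case False
    then show ?thesis using b by (simp only: PD_ask_def pe.simps if_False ev.simps)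
  qed
  have set6: "B (set_ncell 6 y p (Suc 0) t') y = insert (lst p) (B t y)" "y' \<noteq> y \<Longrightarrow> B (set_ncell 6 y p (Suc 0) t') y' = B t y'" for y'
    using r(3) unfolding t'(3)[symmetric] by (auto simp: B_def)
  \<comment> \<open>The witness column is incomparable or a source, so its stored pair is exact and
    \<open>detect_complete\<close> applies.\<close>
  have det: "cond \<and> h" if "detectable y p z u" "lst p \<notin> B t y"
  proof -
    have "special z" using that(1) ex.detect_column[of "lst u" z] y(2) by (auto simp: detectable_def special_def)
    then have "ex.oriented (A t z, B t z) (F z) (G z)" using md[OF r(2)] by (simp add: mid_def)
    from ex.detect_complete[OF _ _ _ _ this, of "lst u" y "lst p"] that sub
    show ?thesis unfolding cond_def h_def detectable_def by auto
  qed
  \<comment> \<open>Soundness only needs a partially known pair at \<open>z\<close>, so the columns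
    already enlarged during this phase do no harm as witnesses.\<close>
  have sound: "lst p \<in> G y" if cond h
  proof -
    obtain F' G' where "ex.known z F' G'" "ex.oriented (A t z, B t z) F' G'" using mid_known[OF r(2) md[OF r(2)] y(2)] by blast
    from ex.detect_sound[OF sub(1) _ _ this, of "lst p" "lst u"] show ?thesis
      using that y(3) sub lst_eq[OF r(3,4)] unfolding cond_def h_def by auto
  qed
  show ?thesis
  proof (cases "cond \<and> h")
    case True
    have "mid (set_ncell 6 y p 1 t') y'" if "y' \<in> Y" for y'
    proof (cases "y' = y")
      case True
      have "ncell t' 7 = ncell t 7" by (simp add: t'_def fr1 fr2 ask_ids_def)
      moreover have "W y \<subseteq> insert (lst p) (B t y)" "insert (lst p) (B t y) \<subseteq> G y"
        using md[OF r(1)] y(1) sound \<open>cond \<and> h\<close> by (auto simp: mid_def)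
      ultimately show ?thesis using md[OF r(1)] y(1) True by (simp add: mid_def set6 t'(2) ncell_set_other)
    next
      case False
      moreover have "mid t' y'" using t'(1) that by (simp add: Ctx_def)
      ultimately show ?thesis by (simp add: mid_def set6 ncell_set_other t'(3) cong: if_cong split del: if_split)
    qed
    then have "Ctx (set_ncell 6 y p 1 t')" using t'(1) by (simp add: Ctx_def base_ids_def)
    moreover have "le t (set_ncell 6 y p (Suc 0) t')" using set6 by (metis le_def subset_insertI subset_refl)
    ultimately show ?thesis unfolding eq using True set6 by simp
  next
    case False
    then have "P PD_ask t = (if cond then t' else t)" unfolding eq by auto
    then show ?thesis using False det t' C by (auto simp: le_def)
  qed
qed

lemma PD:
  assumes C: "base s" "\<And>y. y \<in> Y \<Longrightarrow> visible s y" and found: "ncell s 8 0 0 \<noteq> 0 \<longleftrightarrow> ex.paired"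
  shows "base (P PD s)" "\<And>y. y \<in> Y \<Longrightarrow> mid (P PD s) y" "\<not> ex.paired \<Longrightarrow> P PD s = s"
    "\<And>y x z u. ex.paired \<Longrightarrow> y \<in> Y \<Longrightarrow> \<not> special y \<Longrightarrow> x \<in> G y \<Longrightarrow> u \<in> F z - G z \<Longrightarrow> u \<notin> G y \<Longrightarrow> x \<notin> G z \<Longrightarrow> x \<in> B (P PD s) y"
proof -
  have Cs: "Ctx s" using C visible_mid by (simp add: Ctx_def)
  have mono: "le t t' \<Longrightarrow> (a \<longrightarrow> x \<in> B t y) \<Longrightarrow> (a \<longrightarrow> x \<in> B t' y)" for t t' a x y by (auto simp: le_def)
  have fr: "ncell (P p t) x = ncell t x" if "x \<notin> mods p" for x p t using pe_frame[OF that] .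
  have L1: "Ctx (P (ForK 24 PD_ask) t) \<and> le t (P (ForK 24 PD_ask) t) \<and>
      (\<forall>u\<le>k. detectable y p z u \<longrightarrow> lst p \<in> B (P (ForK 24 PD_ask) t) y)"
    if C: "Ctx t" and v: "ncell t 21 0 0 = y" "ncell t 23 0 0 = p" "ncell t 22 0 0 = z"
    and r: "y \<in> Y" "z \<in> Y" "p \<le> k" and y: "\<not> special y" "ex.paired" "lst p \<notin> W y" for t y p z
  proof -
    let ?C = "\<lambda>t. Ctx t \<and> ncell t 21 0 0 = y \<and> ncell t 23 0 0 = p \<and> ncell t 22 0 0 = z"
    have "?C (P (ForK 24 PD_ask) t) \<and> le t (P (ForK 24 PD_ask) t) \<and>
      (\<forall>u\<le>k. detectable y p z u \<longrightarrow> lst p \<in> B (P (ForK 24 PD_ask) t) y)"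
    proof (rule growK[where C = ?C and Q = "\<lambda>u t. detectable y p z u \<longrightarrow> lst p \<in> B t y"])
      show "?C (set_ncell 24 0 0 i t)" if "?C t" for t i using that by (simp add: base_ids_def)
      have "21 \<notin> mods PD_ask" "22 \<notin> mods PD_ask" "23 \<notin> mods PD_ask" using mods_PD(1) by (auto simp: ask_ids_def)
      then show "?C (P PD_ask t) \<and> le t (P PD_ask t) \<and> (detectable y p z u \<longrightarrow> lst p \<in> B (P PD_ask t) y)"
        if "?C t" "ncell t 24 0 0 = u" "u \<le> k" for t u
        using PD_ask[of t y p z u] that r y fr by simp
    qed (use C v mono in auto)
    then show ?thesis by blast
  qed
  have L2: "Ctx (P PD_z t) \<and> le t (P PD_z t) \<and> (\<forall>z\<in>Y. \<forall>u\<le>k. detectable y p z u \<longrightarrow> lst p \<in> B (P PD_z t) y)"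
    if C: "Ctx t" and v: "ncell t 21 0 0 = y" "ncell t 23 0 0 = p"
    and r: "y \<in> Y" "p \<le> k" and y: "\<not> special y" "ex.paired" "lst p \<notin> W y" for t y p
  proof -
    let ?C = "\<lambda>t. Ctx t \<and> ncell t 21 0 0 = y \<and> ncell t 23 0 0 = p"
    have "?C (P PD_z t) \<and> le t (P PD_z t) \<and> (\<forall>z\<in>Y. \<forall>u\<le>k. detectable y p z u \<longrightarrow> lst p \<in> B (P PD_z t) y)"
      unfolding PD_z_def
    proof (rule growY[where C = ?C and Q = "\<lambda>z t. \<forall>u\<le>k. detectable y p z u \<longrightarrow> lst p \<in> B t y"])
      show "?C (set_ncell 22 0 0 i t)" if "?C t" for t i using that by (simp add: base_ids_def)
      have "21 \<notin> mods (ForK 24 PD_ask)" "23 \<notin> mods (ForK 24 PD_ask)" using mods_PD(1) by (auto simp: ask_ids_def)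
      then show "?C (P (ForK 24 PD_ask) t) \<and> le t (P (ForK 24 PD_ask) t) \<and>
          (\<forall>u\<le>k. detectable y p z u \<longrightarrow> lst p \<in> B (P (ForK 24 PD_ask) t) y)"
        if "?C t" "ncell t 22 0 0 = z" "z \<in> Y" for t z
        using L1[of t y p z] that r y fr by (simp del: pe.simps)
    qed (use C v mono in \<open>auto simp: Ctx_def\<close>)
    then show ?thesis by blast
  qed
  have L3: "Ctx (P PD_p t) \<and> le t (P PD_p t) \<and>
      (\<forall>p\<le>k. \<forall>z\<in>Y. \<forall>u\<le>k. detectable y p z u \<longrightarrow> lst p \<in> B (P PD_p t) y)"
    if C: "Ctx t" and v: "ncell t 21 0 0 = y" and r: "y \<in> Y" and y: "\<not> special y" "ex.paired" for t y
  proof -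
    let ?C = "\<lambda>t. Ctx t \<and> ncell t 21 0 0 = y"
    let ?b = "When (Neg (hf 21 23)) PD_z"
    have "?C (P PD_p t) \<and> le t (P PD_p t) \<and> (\<forall>p\<le>k. \<forall>z\<in>Y. \<forall>u\<le>k. detectable y p z u \<longrightarrow> lst p \<in> B (P PD_p t) y)"
      unfolding PD_p_def
    proof (rule growK[where C = ?C and Q = "\<lambda>p t. \<forall>z\<in>Y. \<forall>u\<le>k. detectable y p z u \<longrightarrow> lst p \<in> B t y"])
      show "?C (set_ncell 23 0 0 i t)" if "?C t" for t i using that by (simp add: base_ids_def)
      have m: "21 \<notin> mods PD_z" using mods_PD(2) by (auto simp: ask_ids_def)
      show "?C (P ?b t) \<and> le t (P ?b t) \<and> (\<forall>z\<in>Y. \<forall>u\<le>k. detectable y p z u \<longrightarrow> lst p \<in> B (P ?b t) y)"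
        if t: "?C t" "ncell t 23 0 0 = p" "p \<le> k" for t p
      proof -
        have md: "A t y = W y" "W y \<subseteq> B t y" using t(1) r y(1) by (auto simp: Ctx_def mid_def)
        show ?thesis
        proof (cases "lst p \<in> W y")
          case True
          then have "P ?b t = t" using A_iff[OF t(3), of t y] md t by simp
          then show ?thesis using True md t le_refl by auto
        next
          case False
          then have "ncell t 5 y p = 0" using A_iff[OF t(3), of t y] md by auto
          then have "P ?b t = P PD_z t" using t by simp
          then show ?thesis using L2[of t y p] t r y False fr[OF m] by simp
        qed
      qed
    qed (use C v mono in auto)
    then show ?thesis by blast
  qed
  let ?b = "When (zr (vis 21)) PD_p"
  let ?p = "ForN 21 (When (outside 21) ?b)"
  have L4: "Ctx (P ?p s) \<and> le s (P ?p s) \<and>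
    (\<forall>y\<in>Y. \<not> special y \<longrightarrow> (\<forall>p\<le>k. \<forall>z\<in>Y. \<forall>u\<le>k. detectable y p z u \<longrightarrow> lst p \<in> B (P ?p s) y))" if pr: ex.paired
  proof (rule growY[where C = Ctx and Q = "\<lambda>y t. \<not> special y \<longrightarrow> (\<forall>p\<le>k. \<forall>z\<in>Y. \<forall>u\<le>k. detectable y p z u \<longrightarrow> lst p \<in> B t y)"])
    show "Ctx (set_ncell 21 0 0 i t)" if "Ctx t" for t i using that by (simp add: base_ids_def)
    show "Ctx (P ?b t) \<and> le t (P ?b t) \<and>
      (\<not> special y \<longrightarrow> (\<forall>p\<le>k. \<forall>z\<in>Y. \<forall>u\<le>k. detectable y p z u \<longrightarrow> lst p \<in> B (P ?b t) y))"
      if t: "Ctx t" "ncell t 21 0 0 = y" "y \<in> Y" for t y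
    proof (cases "special y")
      case True
      then have "ncell t 7 0 y \<noteq> 0" using t by (simp add: Ctx_def mid_def)
      then have "P ?b t = t" using t by simp
      then show ?thesis using t True le_refl by simp
    next
      case False
      then have "ncell t 7 0 y = 0" using t by (simp add: Ctx_def mid_def)
      then have "P ?b t = P PD_p t" using t by simp
      then show ?thesis using L3[of t y] t False pr by simp
    qed
  qed (use Cs mono in \<open>auto simp: Ctx_def\<close>)
  have eq: "P PD s = (if ex.paired then P ?p s else s)"
    using found by (simp only: PD_def pe.simps bval.simps nval.simps ev.simps) auto
  have "Ctx (P PD s)" unfolding eq using L4 Cs by simp
  then show "base (P PD s)" "\<And>y. y \<in> Y \<Longrightarrow> mid (P PD s) y" by (auto simp: Ctx_def)
  show "\<not> ex.paired \<Longrightarrow> P PD s = s" by (simp only: eq if_False)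
  fix y x z u assume a: "ex.paired" "y \<in> Y" "\<not> special y" "x \<in> G y" "u \<in> F z - G z" "u \<notin> G y" "x \<notin> G z"
  have "z \<in> Y" using a(5) col_out by blast
  moreover obtain p q where "p \<le> k" "x = lst p" "q \<le> k" "u = lst q" using a(4,5) FG_sub J_lst by (meson DiffD1 subsetD)
  moreover from this a have "detectable y p z q" by (simp add: detectable_def)
  ultimately show "x \<in> B (P PD s) y" unfolding eq using L4 a(1-3) by simp
qed

text \<open>The stored edges in their true orientation, which exists only in the proof. At special
  columns the order of the stored sets is not known, so the true sets are named instead.\<close>

definition known1 :: "store \<Rightarrow> nat \<Rightarrow> nat set" where
  "known1 s y = (if y \<in> Y then if special y then F y else A s y else {})"
definition known2 :: "store \<Rightarrow> nat \<Rightarrow> nat set" where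
  "known2 s y = (if y \<in> Y then if special y then G y else B s y else {})"

lemma knows_PD:
  assumes C: "base s" "\<And>y. y \<in> Y \<Longrightarrow> visible s y" and found: "ncell s 8 0 0 \<noteq> 0 \<longleftrightarrow> ex.paired" and y: "y \<in> Y"
  shows "ex.knows (known1 (P PD s)) (known2 (P PD s)) y"
    "ex.oriented (A (P PD s) y, B (P PD s) y) (known1 (P PD s) y) (known2 (P PD s) y)"
proof -
  define t where "t = P PD s"
  have md: "mid t y" using PD(2)[OF C found y] by (simp add: t_def)
  show "ex.oriented (A (P PD s) y, B (P PD s) y) (known1 (P PD s) y) (known2 (P PD s) y)"
    using md y by (auto simp: mid_def known1_def known2_def t_def[symmetric] ex.oriented_def split: if_splits)
  have "ex.knows (known1 t) (known2 t) y"
  proof (cases "special y")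
    case True
    then show ?thesis using y unfolding ex.knows_def ex.known_def known1_def known2_def by simp
  next
    case ns: False
    then have eq: "known1 t y = A t y" "known2 t y = B t y" "A t y = W y" using y md by (auto simp: known1_def known2_def mid_def)
    show ?thesis
    proof (cases ex.paired)
      case False
      \<comment> \<open>Without a source and a sink detection is skipped, and \<open>knows\<close>
        asks for nothing beyond the common edges at a comparable column.\<close>
      then have "t = s" using PD(3)[OF C found] by (simp add: t_def)
      moreover have "plain s y" using C(2)[OF y] ns unfolding visible_def special_def by argo
      ultimately have "B t y = W y" by (simp add: plain_def)
      then show ?thesis using eq ns False unfolding ex.knows_def ex.known_def special_def by auto
    next
      case True
      note sub = unspecial_subset[OF y ns True]
      have det: "x \<in> B t y" if "x \<in> G y" "u \<in> F z - G z" "u \<notin> G y" "x \<notin> G z" for x z u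
        using PD(4)[OF C found True y ns that] by (simp add: t_def)
      have B: "W y \<subseteq> B t y" "B t y \<subseteq> G y" using md ns by (auto simp: mid_def)
      have "ex.known y (A t y) (B t y)" unfolding ex.known_def eq(3) using B sub by blast
      moreover have "\<not> ex.sided y" "(n \<in> F y) = (n \<in> G y)" using ns True by (auto simp: special_def)
      ultimately show ?thesis using det eq sub(2) unfolding ex.knows_def by auto
    qed
  qed
  then show "ex.knows (known1 (P PD s)) (known2 (P PD s)) y" by (simp add: t_def)
qed

end

subsection \<open>Aligning the orientations\<close>

text \<open>Collects evidence for a link between columns 43 and 22: flag 44 for a row that is single
  in both, flags 45 and 46 for a row single in one column and absent from the other. Scalars 47 to
  49 hold the corresponding positions.\<close>

definition PE_scan :: pr where
  "PE_scan = If (xor (hf 43 23) (hg 43 23))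
     (If (xor (hf 22 23) (hg 22 23)) (blk [set0 44 one, set0 47 (V 23)])
       (When (Conj (Neg (hf 22 23)) (Neg (hg 22 23))) (blk [set0 45 one, set0 48 (V 23)])))
     (When (Conj (xor (hf 22 23) (hg 22 23)) (Conj (Neg (hf 43 23)) (Neg (hg 43 23)))) (blk [set0 46 one, set0 49 (V 23)]))"

definition PE_swap :: pr where
  "PE_swap = ForK 23 (blk [set0 51 (NCell 5 (V 22) (V 23)), put 5 22 23 (NCell 6 (V 22) (V 23)), put 6 22 23 (V 51)])"

text \<open>The answer tells whether the true sides of the two rows differ, the stored entries
  whether the stored sides do. A disagreement means that exactly one column is stored exchanged, so
  column 22 is turned round.\<close>

definition PE_link :: pr where
  "PE_link = blk [When (nz (V 44)) (blk [set0 48 (V 47), set0 49 (V 47)]),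
    If (nz (V 44)) (ask False 43 22 48 48) (ask True 43 22 48 49),
    Basic (NAssign 9 one (V 22) one),
    When (xor (nz (V 13)) (xor (hf 43 48) (hf 22 49))) PE_swap]"

definition PE_pair :: pr where
  "PE_pair = blk [set0 44 NZero, set0 45 NZero, set0 46 NZero, ForK 23 PE_scan,
    When (disj (nz (V 44)) (Conj (nz (V 45)) (nz (V 46)))) PE_link]"

definition PE_visit :: pr where
  "PE_visit = blk [put0 9 43 one,
    ForN 22 (When (outside 22) (When (Conj (zr (NCell 9 NZero (V 22))) (zr (NCell 9 one (V 22)))) PE_pair))]"

text \<open>Reached columns are preferred to new ones, so a component is finished before the next
  one is begun.\<close>

definition PE_pick :: pr where
  "PE_pick = When (zr (NCell 9 NZero (V 22)))
    (When (disj (Neg (NLess (V 43) (V 0))) (nz (NCell 9 one (V 22)))) (set0 43 (V 22)))"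

definition PE_round :: pr where
  "PE_round = blk [set0 43 (V 0), ForN 22 (When (outside 22) PE_pick), When (NLess (V 43) (V 0)) PE_visit]"

definition PE :: pr where "PE = ForN 26 PE_round"

definition PE_ids :: "nat set" where "PE_ids = {5, 6, 9, 22, 23, 43, 44, 45, 46, 47, 48, 49, 51} \<union> ask_ids"

lemma mods_PE: "mods PE_scan \<subseteq> {44, 45, 46, 47, 48, 49}" "mods PE_swap \<subseteq> {5, 6, 23, 51}"
  "mods PE_pick \<subseteq> {43}" "mods PE_link \<subseteq> {5, 6, 9, 23, 48, 49, 51} \<union> ask_ids"
  "mods PE_pair \<subseteq> {5, 6, 9, 23, 44, 45, 46, 47, 48, 49, 51} \<union> ask_ids"
  "mods PE_round \<subseteq> PE_ids"
  by (auto simp: PE_ids_def PE_round_def PE_visit_def PE_pair_def PE_link_def PE_pick_def PE_swap_def PE_scan_def)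

locale labelling = stage +
  fixes F' G' :: "nat \<Rightarrow> nat set"
  assumes known': "y \<in> Y \<Longrightarrow> ex.known y (F' y) (G' y)"
begin

definition single :: "nat \<Rightarrow> nat set" where "single y = (F' y - G' y) \<union> (G' y - F' y)"

text \<open>Exactly the situations that \<open>link_colour\<close> decides; without one of them the
  columns are nested.\<close>

definition linked :: "nat \<Rightarrow> nat \<Rightarrow> bool" where
  "linked y z \<longleftrightarrow> (\<exists>a\<in>single y. \<exists>b\<in>single z. a = b \<or> a \<notin> F' z \<and> a \<notin> G' z \<and> b \<notin> F' y \<and> b \<notin> G' y)"

lemma linked_sym: "linked y z \<Longrightarrow> linked z y" by (auto simp: linked_def)

lemma unlinked_nested: "\<not> linked y z \<Longrightarrow> single y \<subseteq> F' z \<inter> G' z \<or> single z \<subseteq> F' y \<inter> G' y"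
  unfolding linked_def single_def by blast

definition orn :: "store \<Rightarrow> nat \<Rightarrow> bool \<Rightarrow> bool" where
  "orn t y c \<longleftrightarrow> A t y = (if c then G' y else F' y) \<and> B t y = (if c then F' y else G' y)"

lemma orn_cong: "ncell t 5 y = ncell s 5 y \<Longrightarrow> ncell t 6 y = ncell s 6 y \<Longrightarrow> orn t y = orn s y"
  by (simp add: orn_def AB_cong[of t y s] fun_eq_iff)

lemma orn_single: "orn t y c \<Longrightarrow> single y = (A t y - B t y) \<union> (B t y - A t y)"
  and orn_none: "orn t y c \<Longrightarrow> x \<notin> F' y \<and> x \<notin> G' y \<longleftrightarrow> x \<notin> A t y \<and> x \<notin> B t y"
  and orn_side: "orn t y c \<Longrightarrow> x \<in> single y \<Longrightarrow> x \<in> A t y \<longleftrightarrow> (x \<in> F' y) \<noteq> c"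
  by (auto simp: orn_def single_def split: if_splits)

lemma sub': assumes "y \<in> Y" shows "F' y \<subseteq> J" "G' y \<subseteq> J"
proof -
  have "F' y \<subseteq> F y" "G' y \<subseteq> G y" using known'[OF assms] by (simp_all add: ex.known_def)
  then show "F' y \<subseteq> J" "G' y \<subseteq> J" using FG_sub[of y] by auto
qed

lemma PE_swap:
  assumes s: "ncell s 22 0 0 = z" "z \<in> Y" "orn s z c"
  shows "orn (P PE_swap s) z (\<not> c)" "\<And>y. y \<noteq> z \<Longrightarrow> orn (P PE_swap s) y = orn s y"
proof -
  define Inv where "Inv D t \<longleftrightarrow> ncell t 22 0 0 = z \<and>
    (\<forall>y\<noteq>z. ncell t 5 y = ncell s 5 y \<and> ncell t 6 y = ncell s 6 y) \<and>
    (\<forall>p. ncell t 5 z p = (if p \<in> D then ncell s 6 z p else ncell s 5 z p) \<and>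
         ncell t 6 z p = (if p \<in> D then ncell s 5 z p else ncell s 6 z p))" for D and t :: store
  have "Inv {..k} (P PE_swap s)" unfolding PE_swap_def
  proof (rule forK)
    show "Inv {} s" using s by (simp add: Inv_def)
    show "Inv D t \<Longrightarrow> Inv D (set_ncell 23 0 0 i t)" for D t i
      by (simp add: Inv_def ncell_set_other cong: if_cong split del: if_split)
    show "Inv (insert p D) (P (blk [set0 51 (NCell 5 (V 22) (V 23)), put 5 22 23 (NCell 6 (V 22) (V 23)), put 6 22 23 (V 51)]) t)"
      if t: "Inv D t" "ncell t 23 0 0 = p" "p \<le> k" "p \<notin> D" for D t p
    proof -
      have z: "ncell t 22 0 0 = z" using t by (simp add: Inv_def)
      have "P (blk [set0 51 (NCell 5 (V 22) (V 23)), put 5 22 23 (NCell 6 (V 22) (V 23)), put 6 22 23 (V 51)]) t =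
        set_ncell 6 z p (ncell t 5 z p) (set_ncell 5 z p (ncell t 6 z p) (set_ncell 51 0 0 (ncell t 5 z p) t))"
        using t z by (simp add: ncell_set_other)
      moreover have "Inv (insert p D) \<dots>" using t(1,4) unfolding Inv_def
        by (auto simp: ncell_set_other fun_eq_iff)
      ultimately show ?thesis by simp
    qed
  qed
  then have r: "\<And>y. y \<noteq> z \<Longrightarrow> ncell (P PE_swap s) 5 y = ncell s 5 y \<and> ncell (P PE_swap s) 6 y = ncell s 6 y"
    "\<And>p. p \<le> k \<Longrightarrow> ncell (P PE_swap s) 5 z p = ncell s 6 z p \<and> ncell (P PE_swap s) 6 z p = ncell s 5 z p"
    by (auto simp: Inv_def)
  show "\<And>y. y \<noteq> z \<Longrightarrow> orn (P PE_swap s) y = orn s y" using r(1) orn_cong by blast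
  have "A (P PE_swap s) z = B s z" by (rule A_eqI[OF AB_sub(2)]) (simp add: r B_iff)
  moreover have "B (P PE_swap s) z = A s z" by (rule B_eqI[OF AB_sub(1)]) (simp add: r A_iff)
  ultimately show "orn (P PE_swap s) z (\<not> c)" using s(3) by (simp add: orn_def)
qed

lemma PE_scan:
  assumes s: "ncell s 43 0 0 = y" "ncell s 22 0 0 = z" "orn s y c" "orn s z d"
    and z: "ncell s 44 0 0 = 0" "ncell s 45 0 0 = 0" "ncell s 46 0 0 = 0"
  defines "t \<equiv> P (ForK 23 PE_scan) s"
  shows "if ncell t 44 0 0 = 0 then single y \<inter> single z \<inter> J = {} else ncell t 47 0 0 \<le> k \<and> lst (ncell t 47 0 0) \<in> single y \<inter> single z"
    "if ncell t 45 0 0 = 0 then \<forall>a\<in>single y \<inter> J. a \<in> F' z \<or> a \<in> G' z else ncell t 48 0 0 \<le> k \<and> lst (ncell t 48 0 0) \<in> single y - F' z - G' z"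
    "if ncell t 46 0 0 = 0 then \<forall>b\<in>single z \<inter> J. b \<in> F' y \<or> b \<in> G' y else ncell t 49 0 0 \<le> k \<and> lst (ncell t 49 0 0) \<in> single z - F' y - G' y"
proof -
  define S1 where "S1 = single y \<inter> single z"
  define S2 where "S2 = single y - F' z - G' z"
  define S3 where "S3 = single z - F' y - G' y"
  define ok where "ok u a b S D \<longleftrightarrow> (if ncell u a 0 0 = 0 then \<forall>p\<in>D. lst p \<notin> S else ncell u b 0 0 \<le> k \<and> lst (ncell u b 0 0) \<in> S)"
    for u :: store and a b :: nat and S and D :: "nat set"
  define Inv where "Inv D u \<longleftrightarrow> ncell u 43 0 0 = y \<and> ncell u 22 0 0 = z \<and> ncell u 5 = ncell s 5 \<and> ncell u 6 = ncell s 6 \<and>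
    ok u 44 47 S1 D \<and> ok u 45 48 S2 D \<and> ok u 46 49 S3 D" for D u
  have ok_set: "ok (set_ncell x i j v u) a b S D = ok u a b S D" if "x \<noteq> a" "x \<noteq> b" for x i j v u a b S D
    using that by (simp add: ok_def)
  have ok_new: "ok (set_ncell b 0 0 p (set_ncell a 0 0 (Suc 0) u)) a b S D" if "lst p \<in> S" "p \<le> k" "a \<noteq> b" for a b p u S D
    using that by (simp add: ok_def)
  have ok_old: "ok u a b S D \<Longrightarrow> lst p \<notin> S \<Longrightarrow> ok u a b S (insert p D)" for u a b S D p
    by (auto simp: ok_def split: if_splits)
  have Inv: "Inv {..k} t" unfolding t_def
  proof (rule forK)
    show "Inv {} s" using s z by (simp add: Inv_def ok_def)
    show "Inv D u \<Longrightarrow> Inv D (set_ncell 23 0 0 i u)" for D u i by (simp add: Inv_def ok_set ncell_set_other)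
    fix D u p assume u: "Inv D u" "ncell u 23 0 0 = p" "p \<le> k"
    have uv: "ncell u 43 0 0 = y" "ncell u 22 0 0 = z" "ncell u 5 = ncell s 5" "ncell u 6 = ncell s 6"
      and oks: "ok u 44 47 S1 D" "ok u 45 48 S2 D" "ok u 46 49 S3 D" using u by (auto simp: Inv_def)
    have AB: "0 < ncell s 5 y p \<longleftrightarrow> lst p \<in> A s y" "0 < ncell s 6 y p \<longleftrightarrow> lst p \<in> B s y"
      "0 < ncell s 5 z p \<longleftrightarrow> lst p \<in> A s z" "0 < ncell s 6 z p \<longleftrightarrow> lst p \<in> B s z"
      using A_iff[OF u(3)] B_iff[OF u(3)] by auto
    have sy: "lst p \<in> single y \<longleftrightarrow> (lst p \<in> A s y) \<noteq> (lst p \<in> B s y)" "lst p \<in> single z \<longleftrightarrow> (lst p \<in> A s z) \<noteq> (lst p \<in> B s z)"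
      using orn_single[OF s(3)] orn_single[OF s(4)] by auto
    have mem: "lst p \<in> S1 \<longleftrightarrow> lst p \<in> single y \<and> lst p \<in> single z"
      "lst p \<in> S2 \<longleftrightarrow> lst p \<in> single y \<and> lst p \<notin> A s z \<and> lst p \<notin> B s z"
      "lst p \<in> S3 \<longleftrightarrow> lst p \<in> single z \<and> lst p \<notin> A s y \<and> lst p \<notin> B s y"
      using orn_none[OF s(3), of "lst p"] orn_none[OF s(4), of "lst p"] by (auto simp: S1_def S2_def S3_def)
    have eq: "P PE_scan u = (if lst p \<in> S1 then set_ncell 47 0 0 p (set_ncell 44 0 0 (Suc 0) u)
      else if lst p \<in> S2 then set_ncell 48 0 0 p (set_ncell 45 0 0 (Suc 0) u)
      else if lst p \<in> S3 then set_ncell 49 0 0 p (set_ncell 46 0 0 (Suc 0) u) else u)"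
      using uv u(2) unfolding mem sy by (auto simp: PE_scan_def AB)
    show "Inv (insert p D) (P PE_scan u)"
    proof (cases "lst p \<in> S1")
      case True
      then have "lst p \<notin> S2" "lst p \<notin> S3" unfolding mem sy by auto
      then show ?thesis unfolding eq using True uv oks u(3)
        by (simp add: Inv_def ok_set ok_new ok_old ncell_set_other)
    next
      case n1: False
      show ?thesis
      proof (cases "lst p \<in> S2")
        case True
        then have "lst p \<notin> S3" unfolding mem sy by auto
        then show ?thesis unfolding eq using True n1 uv oks u(3)
          by (simp add: Inv_def ok_set ok_new ok_old ncell_set_other)
      next
        case False
        then show ?thesis unfolding eq using n1 uv oks u(3)
          by (simp add: Inv_def ok_set ok_new ok_old ncell_set_other)
      qed
    qed
  qed
  have none: "\<forall>p\<in>{..k}. lst p \<notin> S \<Longrightarrow> S \<inter> J = {}" for S using J_lst by fastforce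
  have oks: "ok t 44 47 S1 {..k}" "ok t 45 48 S2 {..k}" "ok t 46 49 S3 {..k}" using Inv by (auto simp: Inv_def)
  show "if ncell t 44 0 0 = 0 then single y \<inter> single z \<inter> J = {} else ncell t 47 0 0 \<le> k \<and> lst (ncell t 47 0 0) \<in> single y \<inter> single z"
    using oks(1) none[of S1] unfolding ok_def S1_def[symmetric] by (simp split: if_splits)
  show "if ncell t 45 0 0 = 0 then \<forall>a\<in>single y \<inter> J. a \<in> F' z \<or> a \<in> G' z else ncell t 48 0 0 \<le> k \<and> lst (ncell t 48 0 0) \<in> single y - F' z - G' z"
    using oks(2) none[of S2] unfolding ok_def S2_def by (auto split: if_splits)
  show "if ncell t 46 0 0 = 0 then \<forall>b\<in>single z \<inter> J. b \<in> F' y \<or> b \<in> G' y else ncell t 49 0 0 \<le> k \<and> lst (ncell t 49 0 0) \<in> single z - F' y - G' y"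
    using oks(3) none[of S3] unfolding ok_def S3_def by (auto split: if_splits)
qed

lemma PE_link:
  assumes s: "base s" "ncell s 43 0 0 = y" "ncell s 22 0 0 = z" "y \<in> Y" "z \<in> Y" "y \<noteq> z" "orn s y c" "orn s z d"
    and ab: "a \<le> k" "b \<le> k" "lst a \<in> single y" "lst b \<in> single z"
      "a = b \<or> lst a \<notin> F' z \<and> lst a \<notin> G' z \<and> lst b \<notin> F' y \<and> lst b \<notin> G' y"
    and sc: "if ncell s 44 0 0 \<noteq> 0 then ncell s 47 0 0 = a \<and> a = b else ncell s 48 0 0 = a \<and> ncell s 49 0 0 = b \<and> a \<noteq> b"
  shows "base (P PE_link s)" "orn (P PE_link s) z c" "\<And>y'. y' \<noteq> z \<Longrightarrow> orn (P PE_link s) y' = orn s y'"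
    "ncell (P PE_link s) 9 0 = ncell s 9 0" "ncell (P PE_link s) 9 1 = (ncell s 9 1)(z := 1)"
proof -
  define s1 where "s1 = P (When (nz (V 44)) (blk [set0 48 (V 47), set0 49 (V 47)])) s"
  have s1: "ncell s1 48 0 0 = a" "ncell s1 49 0 0 = b" "ncell s1 44 0 0 = ncell s 44 0 0" "base s1"
    "\<And>x. x \<notin> {48, 49} \<Longrightarrow> ncell s1 x = ncell s x"
    using sc s(1) by (auto simp: s1_def base_ids_def ncell_set_other split: if_splits)
  define s2 where "s2 = P (If (nz (V 44)) (ask False 43 22 48 48) (ask True 43 22 48 49)) s1"
  have fr2: "x \<notin> ask_ids \<Longrightarrow> ncell s2 x = ncell s1 x" for x by (simp add: s2_def ask_frame)
  have b2: "base s2" using base_ask[OF s1(4)] by (simp add: s2_def)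
  have v1: "ncell s1 43 0 0 = y" "ncell s1 22 0 0 = z" using s s1(5) by auto
  have h: "ncell s2 13 0 0 = of_bool (ex.hit {lst a, lst b} {y, z})"
  proof (cases "ncell s 44 0 0 \<noteq> 0")
    case True
    then have "s2 = P (ask False 43 22 48 48) s1" "a = b" using sc s1(3) by (simp_all add: s2_def)
    then show ?thesis using ask[OF s1(4), of 43 22 48 48 False] v1 s(4,5) s1(1) ab(1) by simp
  next
    case False
    then have "s2 = P (ask True 43 22 48 49) s1" "a \<noteq> b" using sc s1(3) by (simp_all add: s2_def)
    then show ?thesis using ask[OF s1(4), of 43 22 48 49 True] v1 s(4,5) s1(1,2) ab(1,2) by simp
  qed
  define s3 where "s3 = set_ncell 9 1 z 1 s2"
  have v3: "ncell s3 43 0 0 = y" "ncell s3 22 0 0 = z" "ncell s3 48 0 0 = a" "ncell s3 49 0 0 = b" "ncell s3 13 = ncell s2 13"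
    "ncell s3 5 = ncell s 5" "ncell s3 6 = ncell s 6" "base s3"
    using v1 s1 fr2 b2 by (simp_all add: s3_def ask_ids_def base_ids_def ncell_set_other)
  have o3: "orn s3 = orn s" by (rule ext, rule orn_cong) (simp_all add: v3)
  have colour: "ex.hit {lst a, lst b} {y, z} \<longleftrightarrow> (lst a \<in> F' y) \<noteq> (lst b \<in> F' z)"
    using ab by (intro ex.link_colour[OF known'[OF s(4)] _ known'[OF s(5)]]) (auto simp: single_def)
  have A3: "A s3 = A s" by (simp add: A_def v3 fun_eq_iff)
  have cond: "bval (xor (nz (V 13)) (xor (hf 43 48) (hf 22 49))) s3 \<longleftrightarrow> c \<noteq> d"
  proof -
    have "0 < ncell s3 5 y a \<longleftrightarrow> (lst a \<in> F' y) \<noteq> c" using A_iff[OF ab(1), of s3 y] orn_side[OF s(7) ab(3)] A3 by simp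
    moreover have "0 < ncell s3 5 z b \<longleftrightarrow> (lst b \<in> F' z) \<noteq> d" using A_iff[OF ab(2), of s3 z] orn_side[OF s(8) ab(4)] A3 by simp
    ultimately show ?thesis using v3 h colour by auto
  qed
  have eq: "P PE_link s = (if c \<noteq> d then P PE_swap s3 else s3)"
  proof -
    have "P PE_link s = P (When (xor (nz (V 13)) (xor (hf 43 48) (hf 22 49))) PE_swap) (P (Basic (NAssign 9 one (V 22) one)) s2)"
      by (simp only: PE_link_def blk.simps pe.simps(3) s1_def s2_def)
    moreover have "P (Basic (NAssign 9 one (V 22) one)) s2 = s3"
      using v1 fr2 by (simp add: s3_def ask_ids_def)
    ultimately have "P PE_link s = P (When (xor (nz (V 13)) (xor (hf 43 48) (hf 22 49))) PE_swap) s3" by (simp only:)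
    then show ?thesis using cond by (simp only: pe.simps ev.simps)
  qed
  have fs: "ncell (P PE_swap s3) x = ncell s3 x" if "x \<notin> {5, 6, 23, 51}" for x using that mods_PE(2) by (intro pe_frame) auto
  have "base (P PE_swap s3)" using v3(8) by (rule base_P) (auto simp: PE_swap_def base_ids_def)
  then show "base (P PE_link s)" using v3(8) by (simp add: eq)
  show "orn (P PE_link s) z c" using PE_swap(1)[OF v3(2) s(5), of d] s(8) o3 by (cases c; cases d) (simp_all add: eq)
  show "orn (P PE_link s) y' = orn s y'" if "y' \<noteq> z" for y' using PE_swap(2)[OF v3(2) s(5), of d y'] s(8) o3 that by (simp add: eq)
  show "ncell (P PE_link s) 9 0 = ncell s 9 0" "ncell (P PE_link s) 9 1 = (ncell s 9 1)(z := 1)"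
    using fs[of 9] fr2[of 9] s1(5)[of 9] by (auto simp: eq s3_def ask_ids_def fun_eq_iff)
qed

lemma PE_pair:
  assumes s: "base s" "ncell s 43 0 0 = y" "ncell s 22 0 0 = z" "y \<in> Y" "z \<in> Y" "y \<noteq> z" "orn s y c" "orn s z d"
  shows "base (P PE_pair s)" "orn (P PE_pair s) z (if linked y z then c else d)" "\<And>y'. y' \<noteq> z \<Longrightarrow> orn (P PE_pair s) y' = orn s y'"
    "ncell (P PE_pair s) 9 0 = ncell s 9 0" "ncell (P PE_pair s) 9 1 = (if linked y z then (ncell s 9 1)(z := 1) else ncell s 9 1)"
proof -
  define s0 where "s0 = set_ncell 46 0 0 0 (set_ncell 45 0 0 0 (set_ncell 44 0 0 0 s))"
  define t where "t = P (ForK 23 PE_scan) s0"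
  have fr: "ncell t x = ncell s x" if "x \<notin> {23, 44, 45, 46, 47, 48, 49}" for x
  proof -
    have "ncell t x = ncell s0 x" unfolding t_def using that mods_PE(1) by (intro pe_frame) auto
    then show ?thesis using that by (simp add: s0_def ncell_set_other)
  qed
  have o0: "orn s0 = orn s" by (rule ext, rule orn_cong) (simp_all add: s0_def ncell_set_other)
  have ot: "orn t = orn s" by (rule ext, rule orn_cong) (simp_all add: fr)
  have b0: "base s0" using s(1) by (simp add: s0_def base_ids_def)
  have bt: "base t" unfolding t_def using b0 by (rule base_P) (use mods_PE(1) in \<open>auto simp: base_ids_def PE_scan_def\<close>)
  have vt: "ncell t 43 0 0 = y" "ncell t 22 0 0 = z" using s fr by auto
  have scan: "if ncell t 44 0 0 = 0 then single y \<inter> single z \<inter> J = {} else ncell t 47 0 0 \<le> k \<and> lst (ncell t 47 0 0) \<in> single y \<inter> single z"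
    "if ncell t 45 0 0 = 0 then \<forall>a\<in>single y \<inter> J. a \<in> F' z \<or> a \<in> G' z else ncell t 48 0 0 \<le> k \<and> lst (ncell t 48 0 0) \<in> single y - F' z - G' z"
    "if ncell t 46 0 0 = 0 then \<forall>b\<in>single z \<inter> J. b \<in> F' y \<or> b \<in> G' y else ncell t 49 0 0 \<le> k \<and> lst (ncell t 49 0 0) \<in> single z - F' y - G' y"
    using PE_scan[of s0 y z c d] s o0 unfolding t_def by (simp_all add: s0_def)
  have singleJ: "single y \<subseteq> J" "single z \<subseteq> J" using sub'[OF s(4)] sub'[OF s(5)] by (auto simp: single_def)
  have cond: "bval (disj (nz (V 44)) (Conj (nz (V 45)) (nz (V 46)))) t \<longleftrightarrow>
      ncell t 44 0 0 \<noteq> 0 \<or> ncell t 45 0 0 \<noteq> 0 \<and> ncell t 46 0 0 \<noteq> 0" by auto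
  have "P PE_pair s = P (When (disj (nz (V 44)) (Conj (nz (V 45)) (nz (V 46)))) PE_link)
      (P (ForK 23 PE_scan) (P (set0 46 NZero) (P (set0 45 NZero) (P (set0 44 NZero) s))))"
    by (simp only: PE_pair_def blk.simps pe.simps(3))
  moreover have "P (set0 46 NZero) (P (set0 45 NZero) (P (set0 44 NZero) s)) = s0" by (simp add: s0_def)
  ultimately have "P PE_pair s = P (When (disj (nz (V 44)) (Conj (nz (V 45)) (nz (V 46)))) PE_link) t"
    by (simp only: t_def)
  then have eq: "P PE_pair s = (if ncell t 44 0 0 \<noteq> 0 \<or> ncell t 45 0 0 \<noteq> 0 \<and> ncell t 46 0 0 \<noteq> 0 then P PE_link t else t)"
    using cond by (simp only: pe.simps ev.simps)
  let ?goal = "base (P PE_pair s) \<and> orn (P PE_pair s) z (if linked y z then c else d) \<and> (\<forall>y'. y' \<noteq> z \<longrightarrow> orn (P PE_pair s) y' = orn s y') \<and>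
    ncell (P PE_pair s) 9 0 = ncell s 9 0 \<and> ncell (P PE_pair s) 9 1 = (if linked y z then (ncell s 9 1)(z := 1) else ncell s 9 1)"
  have ?goal
  proof (cases "ncell t 44 0 0 \<noteq> 0 \<or> ncell t 45 0 0 \<noteq> 0 \<and> ncell t 46 0 0 \<noteq> 0")
    case False
    have "\<not> linked y z"
    proof
      assume "linked y z"
      then obtain a b where ab: "a \<in> single y" "b \<in> single z" "a = b \<or> a \<notin> F' z \<and> a \<notin> G' z \<and> b \<notin> F' y \<and> b \<notin> G' y"
        by (auto simp: linked_def)
      then have "a \<in> J" "b \<in> J" using singleJ by auto
      with ab scan False show False by (auto split: if_splits)
    qed
    moreover have "P PE_pair s = t" unfolding eq using False by (rule if_not_P)
    ultimately show ?thesis using bt ot fr[of 9] s(8) by simp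
  next
    case True
    define a where "a = (if ncell t 44 0 0 \<noteq> 0 then ncell t 47 0 0 else ncell t 48 0 0)"
    define b where "b = (if ncell t 44 0 0 \<noteq> 0 then ncell t 47 0 0 else ncell t 49 0 0)"
    have ab: "a \<le> k" "b \<le> k" "lst a \<in> single y" "lst b \<in> single z"
      "a = b \<or> lst a \<notin> F' z \<and> lst a \<notin> G' z \<and> lst b \<notin> F' y \<and> lst b \<notin> G' y"
      "if ncell t 44 0 0 \<noteq> 0 then ncell t 47 0 0 = a \<and> a = b else ncell t 48 0 0 = a \<and> ncell t 49 0 0 = b \<and> a \<noteq> b"
      using scan True singleJ unfolding a_def b_def single_def by (cases "ncell t 44 0 0 = 0"; auto)+
    have "linked y z" unfolding linked_def using ab(3-5) by blast
    moreover have "P PE_pair s = P PE_link t" unfolding eq using True by (rule if_P)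
    ultimately show ?thesis
      using PE_link[OF bt vt s(4-6) _ _ ab, of c d] ot s(7,8) fr[of 9] by simp
  qed
  then show "base (P PE_pair s)" "orn (P PE_pair s) z (if linked y z then c else d)" "\<And>y'. y' \<noteq> z \<Longrightarrow> orn (P PE_pair s) y' = orn s y'"
    "ncell (P PE_pair s) 9 0 = ncell s 9 0" "ncell (P PE_pair s) 9 1 = (if linked y z then (ncell s 9 1)(z := 1) else ncell s 9 1)" by blast+
qed

text \<open>\<open>c y\<close> records whether column \<open>y\<close> is stored exchanged. Columns
  that are reached but not finished share one value because they belong to the same search tree;
  nothing relates the values of untouched columns.\<close>

definition consistent :: "store \<Rightarrow> (nat \<Rightarrow> bool) \<Rightarrow> bool" where
  "consistent t c \<longleftrightarrow> (\<forall>y\<in>Y. orn t y (c y)) \<and>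
    (\<forall>y\<in>Y. \<forall>z\<in>Y. ncell t 9 0 y \<noteq> 0 \<longrightarrow> linked y z \<longrightarrow> (ncell t 9 0 z \<noteq> 0 \<or> ncell t 9 1 z \<noteq> 0) \<and> c y = c z) \<and>
    (\<forall>y\<in>Y. \<forall>z\<in>Y. ncell t 9 0 y = 0 \<longrightarrow> ncell t 9 1 y \<noteq> 0 \<longrightarrow> ncell t 9 0 z = 0 \<longrightarrow> ncell t 9 1 z \<noteq> 0 \<longrightarrow> c y = c z)"

definition aligned :: "store \<Rightarrow> bool" where "aligned t \<longleftrightarrow> base t \<and> (\<exists>c. consistent t c)"

lemma consistentD:
  assumes "consistent t c"
  shows "y \<in> Y \<Longrightarrow> orn t y (c y)"
    "y \<in> Y \<Longrightarrow> z \<in> Y \<Longrightarrow> ncell t 9 0 y \<noteq> 0 \<Longrightarrow> linked y z \<Longrightarrow> (ncell t 9 0 z \<noteq> 0 \<or> ncell t 9 1 z \<noteq> 0) \<and> c y = c z"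
    "y \<in> Y \<Longrightarrow> z \<in> Y \<Longrightarrow> ncell t 9 0 y = 0 \<Longrightarrow> ncell t 9 1 y \<noteq> 0 \<Longrightarrow> ncell t 9 0 z = 0 \<Longrightarrow> ncell t 9 1 z \<noteq> 0 \<Longrightarrow> c y = c z"
    apply (rule assms[unfolded consistent_def, THEN conjunct1, rule_format], assumption)
   apply (rule assms[unfolded consistent_def, THEN conjunct2, THEN conjunct1, rule_format], assumption+)
  by (rule assms[unfolded consistent_def, THEN conjunct2, THEN conjunct2, rule_format])

lemma PE_visit:
  assumes s: "aligned s" "ncell s 43 0 0 = y" "y \<in> Y" "ncell s 9 0 y = 0"
    and pref: "\<And>z. z \<in> Y \<Longrightarrow> ncell s 9 0 z = 0 \<Longrightarrow> ncell s 9 1 z \<noteq> 0 \<Longrightarrow> ncell s 9 1 y \<noteq> 0"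
  shows "aligned (P PE_visit s)" "ncell (P PE_visit s) 9 0 = (ncell s 9 0)(y := 1)"
proof -
  define s1 where "s1 = set_ncell 9 0 y 1 s"
  define dn where "dn = (ncell s 9 0)(y := 1)"
  have d1: "ncell s1 9 0 = dn" "ncell s1 9 1 = ncell s 9 1" "ncell s1 43 0 0 = y" using s(2) by (auto simp: s1_def dn_def fun_eq_iff)
  have o1: "orn s1 = orn s" by (rule ext, rule orn_cong) (simp_all add: s1_def ncell_set_other)
  obtain c0 where "consistent s c0" using s(1) by (auto simp: aligned_def)
  note c0 = consistentD[OF this]
  \<comment> \<open>While \<open>y\<close> is being visited, its own links are exempt from the
    clause on finished columns and are followed through the treated set \<open>D\<close>
    instead.\<close>
  define ok where "ok t c D \<longleftrightarrow> (\<forall>v\<in>Y. orn t v (c v)) \<and>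
    (\<forall>v\<in>Y. \<forall>z\<in>Y. dn v \<noteq> 0 \<longrightarrow> v \<noteq> y \<longrightarrow> linked v z \<longrightarrow> (dn z \<noteq> 0 \<or> ncell t 9 1 z \<noteq> 0) \<and> c v = c z) \<and>
    (\<forall>z\<in>Y. dn z = 0 \<longrightarrow> ncell t 9 1 z \<noteq> 0 \<longrightarrow> c z = c y) \<and>
    (\<forall>z\<in>D \<inter> Y. dn z = 0 \<longrightarrow> linked y z \<longrightarrow> ncell t 9 1 z \<noteq> 0)" for t :: store and c :: "nat \<Rightarrow> bool" and D
  have ok1: "orn t v (c v)" if "ok t c D" "v \<in> Y" for t c D v
    by (rule that(1)[unfolded ok_def, THEN conjunct1, rule_format]) (rule that(2))
  have ok2: "(dn z \<noteq> 0 \<or> ncell t 9 1 z \<noteq> 0) \<and> c v = c z" if "ok t c D" "v \<in> Y" "z \<in> Y" "dn v \<noteq> 0" "v \<noteq> y" "linked v z" for t c D v z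
    by (rule that(1)[unfolded ok_def, THEN conjunct2, THEN conjunct1, rule_format]) (rule that(2-))+
  have ok3: "c z = c y" if "ok t c D" "z \<in> Y" "dn z = 0" "ncell t 9 1 z \<noteq> 0" for t c D z
    by (rule that(1)[unfolded ok_def, THEN conjunct2, THEN conjunct2, THEN conjunct1, rule_format]) (rule that(2-))+
  have ok4: "ncell t 9 1 z \<noteq> 0" if "ok t c D" "z \<in> D" "z \<in> Y" "dn z = 0" "linked y z" for t c D z
    by (rule that(1)[unfolded ok_def, THEN conjunct2, THEN conjunct2, THEN conjunct2, rule_format]) (use that in auto)
  define Inv where "Inv D t \<longleftrightarrow> base t \<and> ncell t 43 0 0 = y \<and> ncell t 9 0 = dn \<and> (\<exists>c. ok t c D)" for D t
  let ?b = "When (Conj (zr (NCell 9 NZero (V 22))) (zr (NCell 9 one (V 22)))) PE_pair"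
  have ok0: "ok s1 c0 {}"
    unfolding ok_def d1 o1
  proof (intro conjI ballI impI)
    fix v z assume v: "v \<in> Y" "z \<in> Y" "dn v \<noteq> 0" "v \<noteq> y" "linked v z"
    then have "ncell s 9 0 v \<noteq> 0" by (simp add: dn_def)
    from c0(2)[OF v(1,2) this v(5)] show "dn z \<noteq> 0 \<or> ncell s 9 1 z \<noteq> 0" "c0 v = c0 z" by (auto simp: dn_def)
  next
    fix z assume z: "z \<in> Y" "dn z = 0" "ncell s 9 1 z \<noteq> 0"
    then have "ncell s 9 0 z = 0" by (simp add: dn_def split: if_splits)
    with z pref[of z] c0(3)[of z y] s(3,4) show "c0 z = c0 y" by simp
  qed (use c0(1) in auto)
  have "Inv Y (P (ForN 22 (When (outside 22) ?b)) s1)"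
  proof (rule forY)
    show "Inv {} s1" using ok0 d1 s(1) by (auto simp: Inv_def s1_def aligned_def base_ids_def)
    show "Inv D t \<Longrightarrow> base t" for D t by (simp add: Inv_def)
    show "Inv D (set_ncell 22 0 0 i t)" if "Inv D t" for D t i
    proof -
      have "orn (set_ncell 22 0 0 i t) = orn t" by (rule ext, rule orn_cong) (simp_all add: ncell_set_other)
      then show ?thesis using that by (simp add: Inv_def ok_def base_ids_def ncell_set_other)
    qed
    fix D t z assume t: "Inv D t" "ncell t 22 0 0 = z" "z \<in> Y"
    then obtain c where bt: "base t" "ncell t 43 0 0 = y" "ncell t 9 0 = dn" and c: "ok t c D" by (auto simp: Inv_def)
    show "Inv (insert z D) (P ?b t)"
    proof (cases "dn z = 0 \<and> ncell t 9 1 z = 0")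
      case False
      then have "P ?b t = t" using t bt by auto
      moreover have "ok t c (insert z D)"
        unfolding ok_def
      proof (intro conjI ballI impI)
        fix v assume "v \<in> insert z D \<inter> Y" "dn v = 0" "linked y v"
        then show "ncell t 9 1 v \<noteq> 0" using False ok4[OF c, of v] by auto
      qed (use ok1[OF c] ok2[OF c] ok3[OF c] in auto)
      ultimately show ?thesis using bt by (auto simp: Inv_def)
    next
      case True
      then have eq: "P ?b t = P PE_pair t" using t bt by simp
      have zy: "y \<noteq> z" using True by (auto simp: dn_def)
      have o: "orn t y (c y)" "orn t z (c z)" using ok1[OF c] s(3) t(3) by auto
      note pr = PE_pair[OF bt(1,2) t(2) s(3) t(3) zy o]
      define c' where "c' = (if linked y z then c(z := c y) else c)"
      have cc: "\<And>v. v \<noteq> z \<Longrightarrow> c' v = c v" "c' z = (if linked y z then c y else c z)" by (auto simp: c'_def)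
      \<comment> \<open>A finished column other than \<open>y\<close> linked to \<open>z\<close>
        would have reached \<open>z\<close> before, so turning \<open>z\<close> round breaks no
        earlier agreement.\<close>
      have nl: "dn v \<noteq> 0 \<Longrightarrow> v \<noteq> y \<Longrightarrow> v \<in> Y \<Longrightarrow> \<not> linked v z" for v
      proof
        assume v: "dn v \<noteq> 0" "v \<noteq> y" "v \<in> Y" "linked v z"
        have "dn z \<noteq> 0 \<or> ncell t 9 1 z \<noteq> 0" using ok2[OF c v(3) t(3) v(1,2,4)] by (rule conjunct1)
        then show False using True by simp
      qed
      have "ok (P PE_pair t) c' (insert z D)"
        unfolding ok_def
      proof (intro conjI ballI impI)
        fix v assume v: "v \<in> Y"
        show "orn (P PE_pair t) v (c' v)"
          using pr(2,3) ok1[OF c v] cc by (cases "v = z") auto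
        fix u assume u: "u \<in> Y" "dn v \<noteq> 0" "v \<noteq> y" "linked v u"
        then have uz: "u \<noteq> z" using nl v by blast
        have "v \<noteq> z" using u(2) True by auto
        have old: "(dn u \<noteq> 0 \<or> ncell t 9 1 u \<noteq> 0) \<and> c v = c u" using ok2[OF c v u] .
        show "dn u \<noteq> 0 \<or> ncell (P PE_pair t) 9 1 u \<noteq> 0" using old pr(5) uz by simp
        show "c' v = c' u" using old cc uz \<open>v \<noteq> z\<close> by simp
      next
        fix v assume v: "v \<in> Y" "dn v = 0" "ncell (P PE_pair t) 9 1 v \<noteq> 0"
        show "c' v = c' y"
        proof (cases "v = z")
          case True
          then have "linked y z" using v(3) pr(5) \<open>dn z = 0 \<and> ncell t 9 1 z = 0\<close> by (simp split: if_splits)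
          then show ?thesis using True cc zy by simp
        next
          case False
          then have "ncell t 9 1 v \<noteq> 0" using v(3) pr(5) by (simp split: if_splits)
          then have "c v = c y" using ok3[OF c v(1,2)] by blast
          then show ?thesis using cc False zy by simp
        qed
      next
        fix v assume v: "v \<in> insert z D \<inter> Y" "dn v = 0" "linked y v"
        show "ncell (P PE_pair t) 9 1 v \<noteq> 0"
        proof (cases "v = z")
          case False
          then have "ncell t 9 1 v \<noteq> 0" using ok4[OF c, of v] v by blast
          then show ?thesis using pr(5) False by simp
        qed (use v(3) pr(5) in simp)
      qed
      moreover have "43 \<notin> mods PE_pair" using mods_PE(5) by (auto simp: ask_ids_def)
      then have "ncell (P PE_pair t) 43 0 0 = y" using bt(2) by (simp add: pe_frame)
      ultimately show ?thesis unfolding eq using pr(1,4) bt(3) by (auto simp: Inv_def)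
    qed
  qed
  moreover have eq: "P PE_visit s = P (ForN 22 (When (outside 22) ?b)) s1"
  proof -
    have "P (put0 9 43 one) s = s1" using s(2) by (simp add: s1_def)
    then show ?thesis by (simp only: PE_visit_def blk.simps pe.simps(3))
  qed
  ultimately obtain c where b: "base (P PE_visit s)" "ncell (P PE_visit s) 9 0 = dn" and c: "ok (P PE_visit s) c Y"
    by (auto simp: Inv_def)
  show "ncell (P PE_visit s) 9 0 = (ncell s 9 0)(y := 1)" using b(2) by (simp add: dn_def)
  let ?t = "P PE_visit s"
  have cy: "(dn z \<noteq> 0 \<or> ncell ?t 9 1 z \<noteq> 0) \<and> c y = c z" if z: "z \<in> Y" "linked y z" for z
  proof (cases "dn z = 0")
    case True
    then show ?thesis using ok4[OF c z(1) z(1) True z(2)] ok3[OF c z(1) True] by simp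
  next
    case False
    then show ?thesis using ok2[OF c z(1) s(3) False _ linked_sym[OF z(2)]] by (cases "z = y") auto
  qed
  have "(\<forall>v\<in>Y. \<forall>z\<in>Y. dn v \<noteq> 0 \<longrightarrow> linked v z \<longrightarrow> (dn z \<noteq> 0 \<or> ncell ?t 9 1 z \<noteq> 0) \<and> c v = c z)"
    using ok2[OF c] cy by metis
  moreover have "\<forall>v\<in>Y. \<forall>z\<in>Y. dn v = 0 \<longrightarrow> ncell ?t 9 1 v \<noteq> 0 \<longrightarrow> dn z = 0 \<longrightarrow> ncell ?t 9 1 z \<noteq> 0 \<longrightarrow> c v = c z"
    using ok3[OF c] by metis
  moreover have "\<forall>v\<in>Y. orn ?t v (c v)" using ok1[OF c] by blast
  ultimately have "consistent ?t c" unfolding consistent_def b(2) by (intro conjI)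
  then show "aligned ?t" using b(1) unfolding aligned_def by blast
qed

lemma PE_pick:
  assumes b: "base s"
  defines "s0 \<equiv> set_ncell 43 0 0 n s"
  defines "t \<equiv> P (ForN 22 (When (outside 22) PE_pick)) s0"
  shows "\<And>x. x \<notin> {22, 43} \<Longrightarrow> ncell t x = ncell s x"
    "if ncell t 43 0 0 < n then ncell t 43 0 0 \<in> Y \<and> ncell s 9 0 (ncell t 43 0 0) = 0 \<and>
        (\<forall>z\<in>Y. ncell s 9 0 z = 0 \<longrightarrow> ncell s 9 1 z \<noteq> 0 \<longrightarrow> ncell s 9 1 (ncell t 43 0 0) \<noteq> 0)
      else \<forall>z\<in>Y. ncell s 9 0 z \<noteq> 0"
proof -
  define Inv where "Inv D u \<longleftrightarrow> base u \<and> ncell u 9 = ncell s 9 \<and> (if ncell u 43 0 0 < n then ncell u 43 0 0 \<in> Y \<and> ncell s 9 0 (ncell u 43 0 0) = 0 \<and>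
        (\<forall>z\<in>D. ncell s 9 0 z = 0 \<longrightarrow> ncell s 9 1 z \<noteq> 0 \<longrightarrow> ncell s 9 1 (ncell u 43 0 0) \<noteq> 0)
      else \<forall>z\<in>D. ncell s 9 0 z \<noteq> 0)" for D u
  have "Inv Y t" unfolding t_def
  proof (rule forY)
    show "Inv {} s0" using b by (simp add: Inv_def s0_def base_ids_def ncell_set_other)
    show "Inv D u \<Longrightarrow> base u" for D u by (simp add: Inv_def)
    show "Inv D u \<Longrightarrow> Inv D (set_ncell 22 0 0 i u)" for D u i
      by (simp add: Inv_def base_ids_def ncell_set_other cong: if_cong split del: if_split)
    fix D u z assume u: "Inv D u" "ncell u 22 0 0 = z" "z \<in> Y"
    have bu: "base u" "ncell u 9 = ncell s 9" using u by (auto simp: Inv_def)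
    have u0: "ncell u 0 0 0 = n" using bu by (simp add: base_def)
    have eq: "P PE_pick u = (if ncell s 9 0 z = 0 \<and> (\<not> ncell u 43 0 0 < n \<or> ncell s 9 1 z \<noteq> 0) then set_ncell 43 0 0 z u else u)"
      using u(2) bu(2) u0 by (auto simp: PE_pick_def)
    show "Inv (insert z D) (P PE_pick u)"
    proof (cases "ncell s 9 0 z = 0 \<and> (\<not> ncell u 43 0 0 < n \<or> ncell s 9 1 z \<noteq> 0)")
      case True
      then have e: "P PE_pick u = set_ncell 43 0 0 z u" using eq by simp
      have z: "z < n" using u(3) by simp
      have "\<forall>z'\<in>insert z D. ncell s 9 0 z' = 0 \<longrightarrow> ncell s 9 1 z' \<noteq> 0 \<longrightarrow> ncell s 9 1 z \<noteq> 0"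
        using u(1) True by (auto simp: Inv_def split: if_splits)
      then show ?thesis unfolding e Inv_def using bu z u(3) True by (simp add: base_ids_def ncell_set_other)
    next
      case False
      then have e: "P PE_pick u = u" unfolding eq by (rule if_not_P)
      show ?thesis unfolding e using u(1) False by (auto simp: Inv_def split: if_splits)
    qed
  qed
  then show "if ncell t 43 0 0 < n then ncell t 43 0 0 \<in> Y \<and> ncell s 9 0 (ncell t 43 0 0) = 0 \<and>
        (\<forall>z\<in>Y. ncell s 9 0 z = 0 \<longrightarrow> ncell s 9 1 z \<noteq> 0 \<longrightarrow> ncell s 9 1 (ncell t 43 0 0) \<noteq> 0)
      else \<forall>z\<in>Y. ncell s 9 0 z \<noteq> 0" unfolding Inv_def by blast
  fix x assume x: "x \<notin> {22::nat, 43}"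
  have "ncell t x = ncell s0 x" unfolding t_def using x mods_PE(3) by (intro pe_frame) auto
  then show "ncell t x = ncell s x" using x by (simp add: s0_def ncell_set_other)
qed

lemma PE_round:
  assumes s: "aligned s"
  shows "aligned (P PE_round s)"
    "(\<forall>y\<in>Y. ncell (P PE_round s) 9 0 y \<noteq> 0) \<or> card {y\<in>Y. ncell s 9 0 y \<noteq> 0} < card {y\<in>Y. ncell (P PE_round s) 9 0 y \<noteq> 0}"
    "\<And>y. ncell s 9 0 y \<noteq> 0 \<Longrightarrow> ncell (P PE_round s) 9 0 y \<noteq> 0"
proof -
  have bs: "base s" "ncell s 0 0 0 = n" using s by (auto simp: aligned_def base_def)
  define t where "t = P (ForN 22 (When (outside 22) PE_pick)) (set_ncell 43 0 0 n s)"
  note pk = PE_pick[OF bs(1), folded t_def]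
  have at: "aligned t"
  proof -
    have "orn t = orn s" by (rule ext, rule orn_cong) (simp_all add: pk(1))
    moreover have "base t" 
    proof (subst base_cong[of t s])
      show "ncell t a = ncell s a" if "a \<in> base_ids" for a using that by (intro pk(1)) (auto simp: base_ids_def)
      have "rcell t 0 = rcell (set_ncell 43 0 0 n s) 0" unfolding t_def by (rule pe_rframe) (auto simp: PE_pick_def)
      then show "rcell t 0 = rcell s 0" by simp
    qed (rule bs(1))
    ultimately show ?thesis using s pk(1)[of 9] unfolding aligned_def consistent_def by simp
  qed
  have t0: "ncell t 0 0 0 = n" "ncell t 9 = ncell s 9" using pk(1) bs(2) by auto
  have eq: "P PE_round s = (if ncell t 43 0 0 < n then P PE_visit t else t)"
  proof -
    have "P PE_round s = P (When (NLess (V 43) (V 0)) PE_visit) (P (ForN 22 (When (outside 22) PE_pick)) (P (set0 43 (V 0)) s))"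
      by (simp only: PE_round_def blk.simps pe.simps(3))
    moreover have "P (set0 43 (V 0)) s = set_ncell 43 0 0 n s" using bs(2) by simp
    ultimately have "P PE_round s = P (When (NLess (V 43) (V 0)) PE_visit) t" by (simp only: t_def)
    then show ?thesis using t0 by (simp only: pe.simps ev.simps bval.simps nval.simps)
  qed
  have "aligned (P PE_round s) \<and> ((\<forall>y\<in>Y. ncell (P PE_round s) 9 0 y \<noteq> 0) \<or>
      card {y\<in>Y. ncell s 9 0 y \<noteq> 0} < card {y\<in>Y. ncell (P PE_round s) 9 0 y \<noteq> 0}) \<and>
    (\<forall>y. ncell s 9 0 y \<noteq> 0 \<longrightarrow> ncell (P PE_round s) 9 0 y \<noteq> 0)"
  proof (cases "ncell t 43 0 0 < n")
    case False
    then have "P PE_round s = t" "\<forall>z\<in>Y. ncell s 9 0 z \<noteq> 0" using eq pk(2) by auto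
    then show ?thesis using at t0(2) by simp
  next
    case True
    define y where "y = ncell t 43 0 0"
    have y: "y \<in> Y" "ncell s 9 0 y = 0" "\<And>z. z \<in> Y \<Longrightarrow> ncell s 9 0 z = 0 \<Longrightarrow> ncell s 9 1 z \<noteq> 0 \<Longrightarrow> ncell s 9 1 y \<noteq> 0"
      using True pk(2) unfolding y_def by auto
    have e: "P PE_round s = P PE_visit t" using eq True by simp
    note vis = PE_visit[OF at y_def[symmetric] y(1), unfolded t0(2), OF y(2,3)]
    have psub: "S \<subseteq> T \<Longrightarrow> x \<in> T \<Longrightarrow> x \<notin> S \<Longrightarrow> S \<subset> T" for x :: nat and S T by blast
    have "{y\<in>Y. ncell s 9 0 y \<noteq> 0} \<subseteq> {v\<in>Y. ((ncell s 9 0)(y := 1)) v \<noteq> 0}"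
      by (rule Collect_mono) simp
    moreover have "y \<in> {v\<in>Y. ((ncell s 9 0)(y := 1)) v \<noteq> 0}" "y \<notin> {y\<in>Y. ncell s 9 0 y \<noteq> 0}" using y(1,2) by simp_all
    ultimately have "{y\<in>Y. ncell s 9 0 y \<noteq> 0} \<subset> {v\<in>Y. ((ncell s 9 0)(y := 1)) v \<noteq> 0}" by (rule psub)
    then have "card {y\<in>Y. ncell s 9 0 y \<noteq> 0} < card {v\<in>Y. ((ncell s 9 0)(y := 1)) v \<noteq> 0}"
      by (intro psubset_card_mono) auto
    then show ?thesis unfolding e using vis by simp
  qed
  then show "aligned (P PE_round s)"
    "(\<forall>y\<in>Y. ncell (P PE_round s) 9 0 y \<noteq> 0) \<or> card {y\<in>Y. ncell s 9 0 y \<noteq> 0} < card {y\<in>Y. ncell (P PE_round s) 9 0 y \<noteq> 0}"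
    "\<And>y. ncell s 9 0 y \<noteq> 0 \<Longrightarrow> ncell (P PE_round s) 9 0 y \<noteq> 0" by blast+
qed

text \<open>Each round finishes one more column as long as there is one, so \<open>n\<close> rounds
  suffice. Then orientations agree along all links, and columns oriented differently are unlinked,
  hence nested.\<close>

lemma PE:
  assumes b: "base s" and o: "\<And>y. y \<in> Y \<Longrightarrow> ex.oriented (A s y, B s y) (F' y) (G' y)"
    and z: "\<And>y. y \<in> Y \<Longrightarrow> ncell s 9 0 y = 0 \<and> ncell s 9 1 y = 0"
  shows "base (P PE s)" "\<exists>c. (\<forall>y\<in>Y. orn (P PE s) y (c y)) \<and>
    (\<forall>y\<in>Y. \<forall>z\<in>Y. c y \<noteq> c z \<longrightarrow> single y \<subseteq> F' z \<inter> G' z \<or> single z \<subseteq> F' y \<inter> G' y)"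
proof -
  define N where "N t = card {y\<in>Y. ncell t 9 0 y \<noteq> 0}" for t :: store
  define Inv where "Inv i t \<longleftrightarrow> aligned t \<and> ((\<forall>y\<in>Y. ncell t 9 0 y \<noteq> 0) \<or> i \<le> N t)" for i t
  have set: "Inv i (set_ncell 26 0 0 v t) = Inv i t" for i v t
  proof -
    have "orn (set_ncell 26 0 0 v t) = orn t" by (rule ext, rule orn_cong) (simp_all add: ncell_set_other)
    then show ?thesis by (simp add: Inv_def aligned_def consistent_def N_def base_ids_def ncell_set_other)
  qed
  have "\<forall>y. \<exists>c. y \<in> Y \<longrightarrow> orn s y c"
    using o unfolding ex.oriented_def orn_def by (metis (full_types) prod.inject)
  then obtain c where "\<forall>y\<in>Y. orn s y (c y)" by metis
  then have "consistent s c" using z by (simp add: consistent_def)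
  then have al: "aligned s" using b unfolding aligned_def by blast
  have "Inv n (P PE s)" unfolding PE_def pe.simps(5)
  proof (rule loop_induct)
    show "Inv 0 (set_ncell 26 0 0 0 s)" unfolding set using al by (simp add: Inv_def)
    show "Inv (Suc i) (set_ncell 26 0 0 (Suc i) (P PE_round t))" if "Inv i t" for i t
    proof -
      have al: "aligned t" and or: "(\<forall>y\<in>Y. ncell t 9 0 y \<noteq> 0) \<or> i \<le> N t" using that by (auto simp: Inv_def)
      note r = PE_round[OF al, folded N_def]
      have "(\<forall>y\<in>Y. ncell (P PE_round t) 9 0 y \<noteq> 0) \<or> Suc i \<le> N (P PE_round t)"
      proof (cases "\<forall>y\<in>Y. ncell t 9 0 y \<noteq> 0")
        case True
        then show ?thesis using r(3) by blast
      next
        case False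
        then show ?thesis using or r(2) by linarith
      qed
      then have "Inv (Suc i) (P PE_round t)" unfolding Inv_def using r(1) by (rule conjI[rotated])
      then show ?thesis unfolding set .
    qed
  qed
  then have al: "aligned (P PE s)" and or: "(\<forall>y\<in>Y. ncell (P PE s) 9 0 y \<noteq> 0) \<or> n \<le> N (P PE s)" by (auto simp: Inv_def)
  have fin: "\<forall>y\<in>Y. ncell (P PE s) 9 0 y \<noteq> 0"
  proof (rule ccontr)
    assume nf: "\<not> ?thesis"
    then have "{y\<in>Y. ncell (P PE s) 9 0 y \<noteq> 0} \<subset> Y" by blast
    then have "N (P PE s) < card Y" unfolding N_def by (intro psubset_card_mono) auto
    also have "card Y \<le> n" using card_mono[of "{..<n}" Y] by auto
    finally show False using or nf by simp
  qed
  show "base (P PE s)" using al by (simp add: aligned_def)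
  obtain c where "consistent (P PE s) c" using al by (auto simp: aligned_def)
  note c = consistentD[OF this]
  have "\<forall>y\<in>Y. orn (P PE s) y (c y)" "\<forall>y\<in>Y. \<forall>z\<in>Y. linked y z \<longrightarrow> c y = c z"
    using c(1) c(2) fin by blast+
  then show "\<exists>c. (\<forall>y\<in>Y. orn (P PE s) y (c y)) \<and>
    (\<forall>y\<in>Y. \<forall>z\<in>Y. c y \<noteq> c z \<longrightarrow> single y \<subseteq> F' z \<inter> G' z \<or> single z \<subseteq> F' y \<inter> G' y)"
    using unlinked_nested by blast
qed

end

subsection \<open>Shortest paths\<close>

text \<open>\<open>fl\<close> is zero if there is no candidate and otherwise the successor of a
  minimiser, so one number serves as reachability flag and parent pointer.\<close>

definition argmin :: "nat \<Rightarrow> real \<Rightarrow> (nat \<Rightarrow> bool) \<Rightarrow> (nat \<Rightarrow> real) \<Rightarrow> nat set \<Rightarrow> bool" where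
  "argmin fl x C v D \<longleftrightarrow> (case fl of 0 \<Rightarrow> \<forall>q\<in>D. \<not> C q
     | Suc q \<Rightarrow> q \<in> D \<and> C q \<and> x = v q \<and> (\<forall>q'\<in>D. C q' \<longrightarrow> x \<le> v q'))"

lemma argmin_empty: "argmin 0 x C v {}"
  by (simp add: argmin_def)

lemma argmin_skip: "argmin fl x C v D \<Longrightarrow> \<not> (C q \<and> (fl = 0 \<or> v q < x)) \<Longrightarrow> argmin fl x C v (insert q D)"
  by (force simp: argmin_def split: nat.splits)

lemma argmin_take: "argmin fl x C v D \<Longrightarrow> C q \<Longrightarrow> fl = 0 \<or> v q < x \<Longrightarrow> argmin (Suc q) (v q) C v (insert q D)"
  by (force simp: argmin_def split: nat.splits)

definition PF_row_scan :: pr where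
  "PF_row_scan = When (Conj (Conj (nz (NCell 11 (V 25) (V 23))) (hf 21 23))
      (disj (zr (NCell 10 (V 25) (V 21))) (RLess (RSub (RCell 2 (V 25) (V 23)) (RCell 0 NZero (V 21))) (RCell 1 (V 25) (V 21)))))
    (blk [Basic (RAssign 1 (V 25) (V 21) (RSub (RCell 2 (V 25) (V 23)) (RCell 0 NZero (V 21)))), put 10 25 21 (NSuc (V 23))])"

text \<open>Computes level \<open>j\<close> of a column from level \<open>j\<close> of the rows;
  \<open>PF_col\<close> then gets level \<open>j + 1\<close> of a row from level \<open>j\<close> of
  the columns.\<close>

definition PF_row :: pr where "PF_row = blk [put 10 25 21 NZero, ForK 23 PF_row_scan]"

definition PF_col_scan :: pr where
  "PF_col_scan = When (Conj (Conj (nz (NCell 10 (V 25) (V 21))) (hg 21 23))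
      (disj (zr (NCell 11 (NSuc (V 25)) (V 23))) (RLess (RAdd (RCell 1 (V 25) (V 21)) (RCell 0 NZero (NCell 4 NZero (V 23)))) (RCell 2 (NSuc (V 25)) (V 23)))))
    (blk [Basic (RAssign 2 (NSuc (V 25)) (V 23) (RAdd (RCell 1 (V 25) (V 21)) (RCell 0 NZero (NCell 4 NZero (V 23))))),
      Basic (NAssign 11 (NSuc (V 25)) (V 23) (NSuc (V 21)))])"

text \<open>The dummy at position 0 stays unreachable beyond level 0, so tabulated walks return to
  it only by the closing step in \<open>PF_best\<close>.\<close>

definition PF_col :: pr where
  "PF_col = blk [Basic (NAssign 11 (NSuc (V 25)) (V 23) NZero), When (nz (V 23)) (ForN 21 (When (outside 21) PF_col_scan))]"

text \<open>Levels come in increasing order and only strict improvements are accepted, so a shortest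
  one among the cheapest closed walks is kept. The weight of the dummy, common to all closing steps,
  is left out.\<close>

definition PF_best :: pr where
  "PF_best = When (Conj (Conj (nz (NCell 10 (V 25) (V 21))) (nz (NCell 6 (V 21) NZero)))
      (disj (zr (V 52)) (RLess (RCell 1 (V 25) (V 21)) (RCell 3 NZero NZero))))
    (blk [set0 52 (NSuc (V 21)), set0 53 (V 25), Basic (RAssign 3 NZero NZero (RCell 1 (V 25) (V 21)))])"

definition PF_level :: pr where
  "PF_level = blk [ForN 21 (When (outside 21) PF_row), ForK 23 PF_col, ForN 21 (When (outside 21) PF_best)]"

definition PF :: pr where
  "PF = blk [ForK 23 (blk [Basic (NAssign 11 NZero (V 23) NZero)]), Basic (NAssign 11 NZero NZero one),
    Basic (RAssign 2 NZero NZero RZero), set0 52 NZero, ForK 25 PF_level]"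

lemma mods_PF: "mods PF_row_scan = {10}" "mods PF_row = {10, 23}" "mods PF_col_scan = {11}" "mods PF_col = {11, 21}"
  "mods PF_best = {52, 53}" "rmods PF_row_scan = {1}" "rmods PF_row = {1}" "rmods PF_col_scan = {2}" "rmods PF_col = {2}"
  "rmods PF_best = {3}" "mods PF_level = {10, 11, 21, 23, 52, 53}" "rmods PF_level = {1, 2, 3}"
  "mods PF = {10, 11, 21, 23, 25, 52, 53}" "rmods PF = {1, 2, 3}"
  by (auto simp: PF_row_scan_def PF_row_def PF_col_scan_def PF_col_def PF_best_def PF_level_def PF_def)

context stage
begin

abbreviation RYc :: "store \<Rightarrow> nat \<Rightarrow> nat \<Rightarrow> nat" where "RYc s \<equiv> ncell s 10"
abbreviation PXc :: "store \<Rightarrow> nat \<Rightarrow> nat \<Rightarrow> nat" where "PXc s \<equiv> ncell s 11"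
abbreviation DY :: "store \<Rightarrow> nat \<Rightarrow> nat \<Rightarrow> real" where "DY s \<equiv> rcell s 1"
abbreviation DX :: "store \<Rightarrow> nat \<Rightarrow> nat \<Rightarrow> real" where "DX s \<equiv> rcell s 2"

definition row_ok :: "store \<Rightarrow> nat \<Rightarrow> nat \<Rightarrow> nat set \<Rightarrow> bool" where
  "row_ok s j y D \<longleftrightarrow> argmin (RYc s j y) (DY s j y) (\<lambda>p. PXc s j p \<noteq> 0 \<and> lst p \<in> A s y) (\<lambda>p. DX s j p - w y) D"

definition col_ok :: "store \<Rightarrow> nat \<Rightarrow> nat \<Rightarrow> nat set \<Rightarrow> bool" where
  "col_ok s j p D \<longleftrightarrow> (if p = 0 then PXc s (Suc j) p = 0
    else argmin (PXc s (Suc j) p) (DX s (Suc j) p) (\<lambda>y. RYc s j y \<noteq> 0 \<and> lst p \<in> B s y) (\<lambda>y. DY s j y + w (lst p)) D)"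

lemma row_ok_cong:
  assumes "RYc t j y = RYc s j y" "DY t j y = DY s j y" "PXc t j = PXc s j" "DX t j = DX s j" "ncell t 5 = ncell s 5"
  shows "row_ok t j y D = row_ok s j y D"
  using assms AB_cong(1)[of t y s] by (simp add: row_ok_def)

lemma col_ok_cong:
  assumes "PXc t (Suc j) p = PXc s (Suc j) p" "DX t (Suc j) p = DX s (Suc j) p" "RYc t j = RYc s j" "DY t j = DY s j" "ncell t 6 = ncell s 6"
  shows "col_ok t j p D = col_ok s j p D"
  using assms AB_cong(2)[of t _ s] by (cases "p = 0") (simp_all add: col_ok_def)

lemma PF_row:
  assumes s: "base s" "ncell s 25 0 0 = j" "ncell s 21 0 0 = y" "y \<in> Y"
  shows "row_ok (P PF_row s) j y {..k}"
    "\<And>j' y'. (j', y') \<noteq> (j, y) \<Longrightarrow> RYc (P PF_row s) j' y' = RYc s j' y' \<and> DY (P PF_row s) j' y' = DY s j' y'"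
proof -
  define s0 where "s0 = set_ncell 10 j y 0 s"
  define Inv where "Inv D t \<longleftrightarrow> base t \<and> ncell t 25 0 0 = j \<and> ncell t 21 0 0 = y \<and> row_ok t j y D \<and>
    PXc t = PXc s \<and> ncell t 5 = ncell s 5 \<and> DX t = DX s \<and>
    (\<forall>j' y'. (j', y') \<noteq> (j, y) \<longrightarrow> RYc t j' y' = RYc s j' y' \<and> DY t j' y' = DY s j' y')" for D t
  have set: "row_ok (set_ncell a i' j' v t) j y D = row_ok t j y D" if "a \<notin> {5, 10, 11}" for a i' j' v t D
    using that by (intro row_ok_cong) (simp_all add: ncell_set_other)
  have "Inv {..k} (P (ForK 23 PF_row_scan) s0)"
  proof (rule forK)
    show "Inv {} s0" using s by (simp add: Inv_def s0_def base_ids_def row_ok_def argmin_empty ncell_set_other)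
    show "Inv D t \<Longrightarrow> Inv D (set_ncell 23 0 0 i t)" for D t i by (simp add: Inv_def base_ids_def ncell_set_other set)
    fix D t p assume t: "Inv D t" "ncell t 23 0 0 = p" "p \<le> k" "p \<notin> D"
    have tb: "base t" "ncell t 25 0 0 = j" "ncell t 21 0 0 = y" and ok: "row_ok t j y D"
      and same: "PXc t = PXc s" "ncell t 5 = ncell s 5" "DX t = DX s"
      and fr: "\<And>j' y'. (j', y') \<noteq> (j, y) \<Longrightarrow> RYc t j' y' = RYc s j' y' \<and> DY t j' y' = DY s j' y'"
      using t(1) unfolding Inv_def by blast+
    have wy: "rcell t 0 0 y = w y" using tb(1) s(4) by (simp add: base_def)
    define c where "c \<longleftrightarrow> (PXc t j p \<noteq> 0 \<and> lst p \<in> A t y) \<and> (RYc t j y = 0 \<or> DX t j p - w y < DY t j y)"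
    have eq: "P PF_row_scan t = (if c then set_ncell 10 j y (Suc p) (set_rcell 1 j y (DX t j p - w y) t) else t)"
      using tb t(2) wy A_iff[OF t(3), of t y] unfolding c_def by (auto simp: PF_row_scan_def)
    show "Inv (insert p D) (P PF_row_scan t)"
    proof (cases c)
      case True
      define u where "u = set_ncell 10 j y (Suc p) (set_rcell 1 j y (DX t j p - w y) t)"
      have "A u y = A t y" "PXc u = PXc t" "DX u = DX t" by (simp_all add: u_def A_def ncell_set_other rcell_set_other)
      then have "row_ok u j y (insert p D)"
        using argmin_take[OF ok[unfolded row_ok_def]] True by (simp add: row_ok_def c_def u_def)
      moreover have "P PF_row_scan t = u" unfolding eq u_def using True by (rule if_P)
      ultimately show ?thesis using tb same fr
        by (simp add: Inv_def) (simp add: u_def base_ids_def ncell_set_other rcell_set_other)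
    next
      case False
      then have "P PF_row_scan t = t" unfolding eq by (rule if_not_P)
      moreover have "row_ok t j y (insert p D)"
        using argmin_skip[OF ok[unfolded row_ok_def], of p] False unfolding row_ok_def c_def by blast
      ultimately show ?thesis using tb same fr by (simp add: Inv_def)
    qed
  qed
  moreover have "P PF_row s = P (ForK 23 PF_row_scan) s0"
  proof -
    have "P (put 10 25 21 NZero) s = s0" using s by (simp add: s0_def)
    then show ?thesis by (simp only: PF_row_def blk.simps pe.simps(3))
  qed
  ultimately have "Inv {..k} (P PF_row s)" by simp
  then show "row_ok (P PF_row s) j y {..k}"
    "\<And>j' y'. (j', y') \<noteq> (j, y) \<Longrightarrow> RYc (P PF_row s) j' y' = RYc s j' y' \<and> DY (P PF_row s) j' y' = DY s j' y'"
    unfolding Inv_def by blast+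
qed

lemma PF_col:
  assumes s: "base s" "ncell s 25 0 0 = j" "ncell s 23 0 0 = p" "p \<le> k"
  shows "col_ok (P PF_col s) j p Y"
    "\<And>j' p'. (j', p') \<noteq> (Suc j, p) \<Longrightarrow> PXc (P PF_col s) j' p' = PXc s j' p' \<and> DX (P PF_col s) j' p' = DX s j' p'"
proof -
  define s0 where "s0 = set_ncell 11 (Suc j) p 0 s"
  let ?L = "ForN 21 (When (outside 21) PF_col_scan)"
  have eq0: "P PF_col s = (if p = 0 then s0 else P ?L s0)"
  proof -
    have "P (Basic (NAssign 11 (NSuc (V 25)) (V 23) NZero)) s = s0" using s by (simp add: s0_def)
    then have "P PF_col s = P (When (nz (V 23)) ?L) s0" by (simp only: PF_col_def blk.simps pe.simps(3))
    moreover have "bval (nz (V 23)) s0 \<longleftrightarrow> p \<noteq> 0" using s by (simp add: s0_def)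
    ultimately show ?thesis by (simp only: pe.simps ev.simps) simp
  qed
  define Inv where "Inv D t \<longleftrightarrow> base t \<and> ncell t 25 0 0 = j \<and> ncell t 23 0 0 = p \<and> col_ok t j p D \<and>
    RYc t = RYc s \<and> ncell t 6 = ncell s 6 \<and> DY t = DY s \<and>
    (\<forall>j' p'. (j', p') \<noteq> (Suc j, p) \<longrightarrow> PXc t j' p' = PXc s j' p' \<and> DX t j' p' = DX s j' p')" for D t
  have set: "col_ok (set_ncell a i' j' v t) j p D = col_ok t j p D" if "a \<notin> {6, 10, 11}" for a i' j' v t D
    using that by (intro col_ok_cong) (simp_all add: ncell_set_other)
  have I0: "Inv {} s0" using s by (simp add: Inv_def s0_def base_ids_def col_ok_def argmin_empty ncell_set_other)
  have IL: "Inv Y (P ?L s0)" if p0: "p \<noteq> 0"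
  proof (rule forY)
    show "Inv {} s0" by (rule I0)
    show "Inv D t \<Longrightarrow> base t" for D t by (simp add: Inv_def)
    show "Inv D t \<Longrightarrow> Inv D (set_ncell 21 0 0 i t)" for D t i by (simp add: Inv_def base_ids_def ncell_set_other set)
    fix D t y assume t: "Inv D t" "ncell t 21 0 0 = y" "y \<in> Y" "y \<notin> D"
    have tb: "base t" "ncell t 25 0 0 = j" "ncell t 23 0 0 = p" and ok: "col_ok t j p D"
      and same: "RYc t = RYc s" "ncell t 6 = ncell s 6" "DY t = DY s"
      and fr: "\<And>j' p'. (j', p') \<noteq> (Suc j, p) \<Longrightarrow> PXc t j' p' = PXc s j' p' \<and> DX t j' p' = DX s j' p'"
      using t(1) unfolding Inv_def by blast+
    have "lst p \<noteq> n" using lst_eq[OF s(4), of 0] lst(1) p0 by simp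
    then have "lst p < n" using lst_in[OF s(4)] I_facts(1) by auto
    then have wy: "rcell t 0 0 (ncell t 4 0 p) = w (lst p)" using tb(1) s(4) by (simp add: base_def)
    define c where "c \<longleftrightarrow> (RYc t j y \<noteq> 0 \<and> lst p \<in> B t y) \<and> (PXc t (Suc j) p = 0 \<or> DY t j y + w (lst p) < DX t (Suc j) p)"
    have eq: "P PF_col_scan t = (if c then set_ncell 11 (Suc j) p (Suc y) (set_rcell 2 (Suc j) p (DY t j y + w (lst p)) t) else t)"
      using tb t(2) wy B_iff[OF s(4), of t y] unfolding c_def by (auto simp: PF_col_scan_def)
    have ok': "argmin (PXc t (Suc j) p) (DX t (Suc j) p) (\<lambda>y. RYc t j y \<noteq> 0 \<and> lst p \<in> B t y) (\<lambda>y. DY t j y + w (lst p)) D"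
      using ok p0 by (simp add: col_ok_def)
    show "Inv (insert y D) (P PF_col_scan t)"
    proof (cases c)
      case True
      define u where "u = set_ncell 11 (Suc j) p (Suc y) (set_rcell 2 (Suc j) p (DY t j y + w (lst p)) t)"
      have "B u = B t" "RYc u = RYc t" "DY u = DY t" by (simp_all add: u_def B_def ncell_set_other rcell_set_other fun_eq_iff)
      then have "col_ok u j p (insert y D)"
        using argmin_take[OF ok'] True p0 by (simp add: col_ok_def c_def u_def)
      moreover have "P PF_col_scan t = u" unfolding eq u_def using True by (rule if_P)
      ultimately show ?thesis using tb same fr
        by (simp add: Inv_def) (simp add: u_def base_ids_def ncell_set_other rcell_set_other)
    next
      case False
      then have "P PF_col_scan t = t" unfolding eq by (rule if_not_P)
      moreover have "col_ok t j p (insert y D)"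
        using argmin_skip[OF ok', of y] False p0 unfolding col_ok_def c_def by (simp only: if_False) blast
      ultimately show ?thesis using tb same fr by (simp add: Inv_def)
    qed
  qed
  have "Inv (if p = 0 then {} else Y) (P PF_col s)" unfolding eq0 using I0 IL by simp
  then show "col_ok (P PF_col s) j p Y"
    "\<And>j' p'. (j', p') \<noteq> (Suc j, p) \<Longrightarrow> PXc (P PF_col s) j' p' = PXc s j' p' \<and> DX (P PF_col s) j' p' = DX s j' p'"
    unfolding Inv_def by (auto simp: col_ok_def)
qed

definition closes :: "store \<Rightarrow> nat \<Rightarrow> nat \<Rightarrow> bool" where "closes s j y \<longleftrightarrow> RYc s j y \<noteq> 0 \<and> n \<in> B s y"

definition best_ok :: "store \<Rightarrow> (nat \<Rightarrow> nat \<Rightarrow> bool) \<Rightarrow> bool" where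
  "best_ok s S \<longleftrightarrow> (case ncell s 52 0 0 of 0 \<Rightarrow> \<forall>j y. S j y \<longrightarrow> \<not> closes s j y
    | Suc y \<Rightarrow> S (ncell s 53 0 0) y \<and> closes s (ncell s 53 0 0) y \<and> rcell s 3 0 0 = DY s (ncell s 53 0 0) y \<and>
      (\<forall>j' y'. S j' y' \<longrightarrow> closes s j' y' \<longrightarrow> rcell s 3 0 0 < DY s j' y' \<or> rcell s 3 0 0 = DY s j' y' \<and> ncell s 53 0 0 \<le> j'))"

lemma best_ok_cong:
  assumes "\<And>j y. S j y \<Longrightarrow> closes t j y = closes s j y \<and> DY t j y = DY s j y"
    "ncell t 52 = ncell s 52" "ncell t 53 = ncell s 53" "rcell t 3 = rcell s 3"
  shows "best_ok t S \<longleftrightarrow> best_ok s S"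
  using assms unfolding best_ok_def by (auto split: nat.split)

lemma PF_best:
  assumes s: "base s" "ncell s 25 0 0 = j" and ok: "best_ok s (\<lambda>j' y. j' < j \<and> y \<in> Y)"
  shows "best_ok (P (ForN 21 (When (outside 21) PF_best)) s) (\<lambda>j' y. j' < Suc j \<and> y \<in> Y)"
proof -
  define Inv where "Inv D t \<longleftrightarrow> base t \<and> ncell t 25 0 0 = j \<and> ncell t 6 = ncell s 6 \<and> RYc t = RYc s \<and> DY t = DY s \<and>
    best_ok t (\<lambda>j' y. (j' < j \<or> j' = j \<and> y \<in> D) \<and> y \<in> Y)" for D t
  have set: "best_ok (set_ncell a i' j' v t) S = best_ok t S" if "a \<notin> {6, 10, 52, 53}" for a i' j' v t S
    using that by (intro best_ok_cong) (simp_all add: closes_def B_def ncell_set_other)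
  have "Inv Y (P (ForN 21 (When (outside 21) PF_best)) s)"
  proof (rule forY)
    show "Inv {} s" using s ok by (simp add: Inv_def)
    show "Inv D t \<Longrightarrow> base t" for D t by (simp add: Inv_def)
    show "Inv D t \<Longrightarrow> Inv D (set_ncell 21 0 0 i t)" for D t i by (simp add: Inv_def base_ids_def ncell_set_other set)
    fix D t y assume t: "Inv D t" "ncell t 21 0 0 = y" "y \<in> Y" "y \<notin> D"
    define S where "S j' y' \<longleftrightarrow> (j' < j \<or> j' = j \<and> y' \<in> D) \<and> y' \<in> Y" for j' y'
    define S' where "S' j' y' \<longleftrightarrow> (j' < j \<or> j' = j \<and> y' \<in> insert y D) \<and> y' \<in> Y" for j' y'
    have S': "S' j' y' \<longleftrightarrow> S j' y' \<or> j' = j \<and> y' = y" for j' y' using t(3) by (auto simp: S_def S'_def)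
    have Seq: "S' = (\<lambda>j' ya. (j' < j \<or> j' = j \<and> ya \<in> insert y D) \<and> ya \<in> Y)" by (simp add: S'_def fun_eq_iff)
    have Sj: "S j' y' \<Longrightarrow> j' \<le> j" for j' y' by (auto simp: S_def)
    have tb: "base t" "ncell t 25 0 0 = j" and same: "ncell t 6 = ncell s 6" "RYc t = RYc s" "DY t = DY s"
      and ok: "best_ok t S" using t(1) unfolding Inv_def S_def by blast+
    have cl: "closes t j y \<longleftrightarrow> RYc t j y \<noteq> 0 \<and> ncell t 6 y 0 \<noteq> 0" using B_iff[of 0 t y] n_J by (simp add: closes_def)
    define c where "c \<longleftrightarrow> closes t j y \<and> (ncell t 52 0 0 = 0 \<or> DY t j y < rcell t 3 0 0)"
    define u where "u = set_rcell 3 0 0 (DY t j y) (set_ncell 53 0 0 j (set_ncell 52 0 0 (Suc y) t))"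
    have eq: "P PF_best t = (if c then u else t)"
      using tb t(2) unfolding c_def cl by (auto simp: PF_best_def u_def)
    have "Inv (insert y D) (if c then u else t)"
    proof (cases c)
      case True
      have cu: "closes u j' y' = closes t j' y'" "DY u = DY t" for j' y'
        by (simp_all add: u_def closes_def B_def ncell_set_other rcell_set_other)
      have v: "ncell u 52 0 0 = Suc y" "ncell u 53 0 0 = j" "rcell u 3 0 0 = DY t j y" by (simp_all add: u_def)
      have lt: "DY t j y < DY t j' y' \<or> DY t j y = DY t j' y' \<and> j \<le> j'" if "S' j' y'" "closes t j' y'" for j' y'
      proof (cases "j' = j \<and> y' = y")
        case False
        then have "S j' y'" using that S' by blast
        show ?thesis
        proof (cases "ncell t 52 0 0")
          case 0
          then show ?thesis using ok that(2) \<open>S j' y'\<close> by (simp add: best_ok_def)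
        next
          case (Suc q)
          then have "rcell t 3 0 0 < DY t j' y' \<or> rcell t 3 0 0 = DY t j' y'"
          proof -
            have "\<forall>j' y'. S j' y' \<longrightarrow> closes t j' y' \<longrightarrow>
                rcell t 3 0 0 < DY t j' y' \<or> rcell t 3 0 0 = DY t j' y' \<and> ncell t 53 0 0 \<le> j'"
              using ok unfolding best_ok_def Suc nat.case by (elim conjE)
            then show ?thesis using that(2) \<open>S j' y'\<close> by blast
          qed
          moreover have "DY t j y < rcell t 3 0 0" using True Suc by (simp add: c_def)
          ultimately show ?thesis by auto
        qed
      qed auto
      have "S' j y" "closes t j y" using True by (auto simp: c_def S')
      then have "best_ok u S'" unfolding best_ok_def v nat.case cu using lt by blast
      moreover have "base u" "ncell u 25 0 0 = j" "ncell u 6 = ncell s 6" "RYc u = RYc s" "DY u = DY s"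
        using tb same by (simp_all add: u_def base_ids_def ncell_set_other rcell_set_other)
      ultimately show ?thesis unfolding Inv_def Seq[symmetric] using True by simp
    next
      case False
      have "best_ok t S'"
      proof (cases "ncell t 52 0 0")
        case 0
        then have "\<not> closes t j y" using False by (simp add: c_def)
        then show ?thesis using ok 0 by (auto simp: best_ok_def S')
      next
        case (Suc q)
        note b = ok[unfolded best_ok_def Suc nat.case]
        have b1: "S (ncell t 53 0 0) q" "closes t (ncell t 53 0 0) q" "rcell t 3 0 0 = DY t (ncell t 53 0 0) q" using b by simp_all
        have b2: "\<forall>j' y'. S j' y' \<longrightarrow> closes t j' y' \<longrightarrow>
            rcell t 3 0 0 < DY t j' y' \<or> rcell t 3 0 0 = DY t j' y' \<and> ncell t 53 0 0 \<le> j'" using b by (elim conjE)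
        have "rcell t 3 0 0 < DY t j' y' \<or> rcell t 3 0 0 = DY t j' y' \<and> ncell t 53 0 0 \<le> j'"
          if "S' j' y'" "closes t j' y'" for j' y'
        proof (cases "S j' y'")
          case True
          then show ?thesis using b2 that(2) by blast
        next
          case False
          then have jy: "j' = j" "y' = y" using that(1) S' by auto
          then have "\<not> DY t j' y' < rcell t 3 0 0" using \<open>\<not> c\<close> that(2) Suc by (simp add: c_def)
          moreover have "ncell t 53 0 0 \<le> j'" using Sj[OF b1(1)] jy by simp
          ultimately show ?thesis by linarith
        qed
        then show ?thesis unfolding best_ok_def Suc nat.case using b1 S' by blast
      qed
      then show ?thesis unfolding Inv_def Seq[symmetric] using False tb same by simp
    qed
    then show "Inv (insert y D) (P PF_best t)" unfolding eq .
  qed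
  moreover have "(\<lambda>j' y. (j' < j \<or> j' = j \<and> y \<in> Y) \<and> y \<in> Y) = (\<lambda>j' y. j' < Suc j \<and> y \<in> Y)" by (auto simp: fun_eq_iff)
  ultimately show ?thesis by (simp add: Inv_def del: pe.simps)
qed

definition start_ok :: "store \<Rightarrow> bool" where
  "start_ok s \<longleftrightarrow> (\<forall>p\<le>k. PXc s 0 p \<noteq> 0 \<longleftrightarrow> p = 0) \<and> DX s 0 0 = 0"

definition level_ok :: "store \<Rightarrow> nat \<Rightarrow> bool" where
  "level_ok s j \<longleftrightarrow> (\<forall>y\<in>Y. row_ok s j y {..k}) \<and> (\<forall>p\<le>k. col_ok s j p Y)"

lemma PF_rows:
  assumes s: "base s" "ncell s 25 0 0 = j"
  defines "t \<equiv> P (ForN 21 (When (outside 21) PF_row)) s"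
  shows "\<forall>y\<in>Y. row_ok t j y {..k}" "\<And>j'. j' \<noteq> j \<Longrightarrow> RYc t j' = RYc s j' \<and> DY t j' = DY s j'"
proof -
  define Inv where "Inv D t \<longleftrightarrow> base t \<and> ncell t 25 0 0 = j \<and> (\<forall>y\<in>D. row_ok t j y {..k}) \<and>
    (\<forall>j'. j' \<noteq> j \<longrightarrow> RYc t j' = RYc s j' \<and> DY t j' = DY s j')" for D t
  have set: "row_ok (set_ncell 21 i' j' v t) j y D = row_ok t j y D" for i' j' v t D y
    by (intro row_ok_cong) (simp_all add: ncell_set_other)
  have "Inv Y t" unfolding t_def
  proof (rule forY)
    show "Inv {} s" using s by (simp add: Inv_def)
    show "Inv D t \<Longrightarrow> base t" for D t by (simp add: Inv_def)
    show "Inv D t \<Longrightarrow> Inv D (set_ncell 21 0 0 i t)" for D t i by (simp add: Inv_def base_ids_def ncell_set_other set)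
    fix D t y assume t: "Inv D t" "ncell t 21 0 0 = y" "y \<in> Y" "y \<notin> D"
    have tb: "base t" "ncell t 25 0 0 = j" and rows: "\<And>v. v \<in> D \<Longrightarrow> row_ok t j v {..k}"
      and fr: "\<And>j'. j' \<noteq> j \<Longrightarrow> RYc t j' = RYc s j' \<and> DY t j' = DY s j'" using t(1) unfolding Inv_def by blast+
    note r = PF_row[OF tb t(2,3)]
    have "base (P PF_row t)" using tb(1) by (rule base_P) (simp_all add: mods_PF base_ids_def)
    moreover have "ncell (P PF_row t) 25 0 0 = j" using tb(2) by (simp add: pe_frame mods_PF)
    moreover have "row_ok (P PF_row t) j v {..k}" if "v \<in> D" for v
    proof -
      have "v \<noteq> y" using that t(4) by blast
      then have "row_ok (P PF_row t) j v {..k} = row_ok t j v {..k}"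
        using r(2)[of j v] by (intro row_ok_cong) (simp_all add: pe_frame pe_rframe mods_PF)
      then show ?thesis using rows[OF that] by simp
    qed
    moreover have "RYc (P PF_row t) j' = RYc s j' \<and> DY (P PF_row t) j' = DY s j'" if "j' \<noteq> j" for j'
      using r(2)[of j'] fr[OF that] that by (simp add: fun_eq_iff)
    ultimately show "Inv (insert y D) (P PF_row t)" using r(1) unfolding Inv_def by blast
  qed
  then show "\<forall>y\<in>Y. row_ok t j y {..k}" "\<And>j'. j' \<noteq> j \<Longrightarrow> RYc t j' = RYc s j' \<and> DY t j' = DY s j'"
    unfolding Inv_def by blast+
qed

lemma PF_cols:
  assumes s: "base s" "ncell s 25 0 0 = j"
  defines "t \<equiv> P (ForK 23 PF_col) s"
  shows "\<forall>p\<le>k. col_ok t j p Y" "\<And>j'. j' \<noteq> Suc j \<Longrightarrow> PXc t j' = PXc s j' \<and> DX t j' = DX s j'"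
proof -
  define Inv where "Inv D t \<longleftrightarrow> base t \<and> ncell t 25 0 0 = j \<and> (\<forall>p\<in>D. col_ok t j p Y) \<and>
    (\<forall>j'. j' \<noteq> Suc j \<longrightarrow> PXc t j' = PXc s j' \<and> DX t j' = DX s j')" for D t
  have set: "col_ok (set_ncell 23 i' j' v t) j p D = col_ok t j p D" for i' j' v t D p
    by (intro col_ok_cong) (simp_all add: ncell_set_other)
  have "Inv {..k} t" unfolding t_def
  proof (rule forK)
    show "Inv {} s" using s by (simp add: Inv_def)
    show "Inv D t \<Longrightarrow> Inv D (set_ncell 23 0 0 i t)" for D t i by (simp add: Inv_def base_ids_def ncell_set_other set)
    fix D t p assume t: "Inv D t" "ncell t 23 0 0 = p" "p \<le> k" "p \<notin> D"
    have tb: "base t" "ncell t 25 0 0 = j" and cols: "\<And>v. v \<in> D \<Longrightarrow> col_ok t j v Y"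
      and fr: "\<And>j'. j' \<noteq> Suc j \<Longrightarrow> PXc t j' = PXc s j' \<and> DX t j' = DX s j'" using t(1) unfolding Inv_def by blast+
    note r = PF_col[OF tb t(2,3)]
    have "base (P PF_col t)" using tb(1) by (rule base_P) (simp_all add: mods_PF base_ids_def)
    moreover have "ncell (P PF_col t) 25 0 0 = j" using tb(2) by (simp add: pe_frame mods_PF)
    moreover have "col_ok (P PF_col t) j v Y" if "v \<in> D" for v
    proof -
      have "v \<noteq> p" using that t(4) by blast
      then have "col_ok (P PF_col t) j v Y = col_ok t j v Y"
        using r(2)[of "Suc j" v] by (intro col_ok_cong) (simp_all add: pe_frame pe_rframe mods_PF)
      then show ?thesis using cols[OF that] by simp
    qed
    moreover have "PXc (P PF_col t) j' = PXc s j' \<and> DX (P PF_col t) j' = DX s j'" if "j' \<noteq> Suc j" for j'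
      using r(2)[of j'] fr[OF that] that by (simp add: fun_eq_iff)
    ultimately show "Inv (insert p D) (P PF_col t)" using r(1) unfolding Inv_def by blast
  qed
  then show "\<forall>p\<le>k. col_ok t j p Y" "\<And>j'. j' \<noteq> Suc j \<Longrightarrow> PXc t j' = PXc s j' \<and> DX t j' = DX s j'"
    unfolding Inv_def by auto
qed

definition levels_ok :: "store \<Rightarrow> nat \<Rightarrow> bool" where
  "levels_ok s j \<longleftrightarrow> start_ok s \<and> (\<forall>j'<j. level_ok s j') \<and> best_ok s (\<lambda>j' y. j' < j \<and> y \<in> Y)"

lemma PF_level:
  assumes s: "base s" "ncell s 25 0 0 = j" "levels_ok s j"
  shows "levels_ok (P PF_level s) (Suc j)"
proof -
  define s1 where "s1 = P (ForN 21 (When (outside 21) PF_row)) s"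
  define s2 where "s2 = P (ForK 23 PF_col) s1"
  define s3 where "s3 = P (ForN 21 (When (outside 21) PF_best)) s2"
  have m: "mods (ForN 21 (When (outside 21) PF_row)) = {10, 21, 23}" "rmods (ForN 21 (When (outside 21) PF_row)) = {1}"
    "mods (ForK 23 PF_col) = {11, 21, 23}" "rmods (ForK 23 PF_col) = {2}"
    "mods (ForN 21 (When (outside 21) PF_best)) = {21, 52, 53}" "rmods (ForN 21 (When (outside 21) PF_best)) = {3}"
    by (auto simp: mods_PF)
  have fn1: "ncell s1 a = ncell s a" if "a \<notin> {10, 21, 23}" for a
    unfolding s1_def by (rule pe_frame) (simp only: m that not_False_eq_True)
  have "rcell s1 a = rcell s a" if "a \<noteq> 1" for a
    unfolding s1_def by (rule pe_rframe) (simp only: m that singleton_iff not_False_eq_True)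
  note fr1 = fn1 this
  have fn2: "ncell s2 a = ncell s1 a" if "a \<notin> {11, 21, 23}" for a
    unfolding s2_def by (rule pe_frame) (simp only: m that not_False_eq_True)
  have "rcell s2 a = rcell s1 a" if "a \<noteq> 2" for a
    unfolding s2_def by (rule pe_rframe) (simp only: m that singleton_iff not_False_eq_True)
  note fr2 = fn2 this
  have fn3: "ncell s3 a = ncell s2 a" if "a \<notin> {21, 52, 53}" for a
    unfolding s3_def by (rule pe_frame) (simp only: m that not_False_eq_True)
  have "rcell s3 a = rcell s2 a" if "a \<noteq> 3" for a
    unfolding s3_def by (rule pe_rframe) (simp only: m that singleton_iff not_False_eq_True)
  note fr3 = fn3 this
  have b1: "base s1" unfolding s1_def using s(1) by (rule base_P) (simp_all add: m base_ids_def del: mods.simps rmods.simps)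
  have b2: "base s2" unfolding s2_def using b1 by (rule base_P) (simp_all add: m base_ids_def del: mods.simps rmods.simps)
  have j1: "ncell s1 25 0 0 = j" "ncell s2 25 0 0 = j" using s(2) fr1 fr2 by simp_all
  note r1 = PF_rows[OF s(1,2), folded s1_def]
  note r2 = PF_cols[OF b1 j1(1), folded s2_def]
  have e: "P PF_level s = s3" by (simp only: PF_level_def blk.simps pe.simps(3) s1_def s2_def s3_def)
  have st: "start_ok s" "\<And>j'. j' < j \<Longrightarrow> level_ok s j'" "best_ok s (\<lambda>j' y. j' < j \<and> y \<in> Y)" using s(3) by (auto simp: levels_ok_def)
  have PX: "PXc s3 j' = PXc s j'" "DX s3 j' = DX s j'" if "j' \<noteq> Suc j" for j' using r2(2)[OF that] fr1 fr3 by simp_all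
  have RY: "RYc s3 j' = RYc s j'" "DY s3 j' = DY s j'" if "j' \<noteq> j" for j' using r1(2)[OF that] fr2 fr3 by simp_all
  have H: "ncell s3 5 = ncell s 5" "ncell s3 6 = ncell s 6" using fr1 fr2 fr3 by simp_all
  have "start_ok s3" using st(1) PX[of 0] by (simp add: start_ok_def)
  moreover have "level_ok s3 j'" if "j' < Suc j" for j'
  proof (cases "j' = j")
    case False
    then have j': "j' < j" using that by simp
    have "row_ok s3 j' y D = row_ok s j' y D" for y D
      using j' H PX[of j'] RY[of j'] by (intro row_ok_cong) simp_all
    moreover have "col_ok s3 j' p D = col_ok s j' p D" for p D
      using j' H PX[of "Suc j'"] RY[of j'] by (intro col_ok_cong) simp_all
    ultimately show ?thesis using st(2)[OF j'] by (simp add: level_ok_def)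
  next
    case True
    have "row_ok s3 j y D = row_ok s1 j y D" for y D
      using fr1 fr2 fr3 r2(2)[of j] by (intro row_ok_cong) simp_all
    moreover have "col_ok s3 j p D = col_ok s2 j p D" for p D
      using fr3 by (intro col_ok_cong) simp_all
    ultimately show ?thesis using r1(1) r2(1) True by (simp add: level_ok_def)
  qed
  moreover have "best_ok s2 (\<lambda>j' y. j' < j \<and> y \<in> Y)"
  proof -
    have "best_ok s2 (\<lambda>j' y. j' < j \<and> y \<in> Y) = best_ok s (\<lambda>j' y. j' < j \<and> y \<in> Y)"
      using fr1 fr2 r1(2) by (intro best_ok_cong) (auto simp: closes_def B_def)
    then show ?thesis using st(3) by simp
  qed
  then have "best_ok s3 (\<lambda>j' y. j' < Suc j \<and> y \<in> Y)" unfolding s3_def using PF_best[OF b2 j1(2)] by blast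
  ultimately show ?thesis unfolding e levels_ok_def by blast
qed

lemma PF:
  assumes "base s"
  shows "levels_ok (P PF s) (Suc k)"
proof -
  define s1 where "s1 = P (ForK 23 (blk [Basic (NAssign 11 NZero (V 23) NZero)])) s"
  define s2 where "s2 = set_ncell 52 0 0 0 (set_rcell 2 0 0 0 (set_ncell 11 0 0 1 s1))"
  define Z where "Z D t \<longleftrightarrow> (\<forall>p\<in>D. PXc t 0 p = 0)" for D and t :: store
  have "Z {..k} s1" unfolding s1_def
    by (rule forK) (auto simp: Z_def)
  then have st: "start_ok s2" by (simp add: start_ok_def s2_def Z_def)
  have b1: "base s1" unfolding s1_def using assms by (rule base_P) (simp_all add: base_ids_def)
  then have b2: "base s2" by (simp add: s2_def base_ids_def)
  have lev: "levels_ok (set_ncell 25 0 0 i t) j = levels_ok t j" for i t j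
  proof -
    let ?t = "set_ncell 25 0 0 i t"
    have "row_ok ?t j' y D = row_ok t j' y D" for j' y D by (intro row_ok_cong) (simp_all add: ncell_set_other)
    moreover have "col_ok ?t j' p D = col_ok t j' p D" for j' p D by (intro col_ok_cong) (simp_all add: ncell_set_other)
    moreover have "best_ok ?t S = best_ok t S" for S by (intro best_ok_cong) (simp_all add: closes_def B_def ncell_set_other)
    ultimately show ?thesis by (simp add: levels_ok_def level_ok_def start_ok_def ncell_set_other)
  qed
  define Inv where "Inv j t \<longleftrightarrow> base t \<and> levels_ok t j" for j t
  have "Inv (Suc k) (P (ForK 25 PF_level) s2)" unfolding pe.simps(6)
  proof (rule loop_induct[where Inv = Inv])
    have "best_ok s2 (\<lambda>j' y. j' < 0 \<and> y \<in> Y)" by (simp add: best_ok_def s2_def)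
    then show "Inv 0 (set_ncell 25 0 0 0 s2)" using st b2 by (simp add: Inv_def lev) (simp add: levels_ok_def base_ids_def)
    fix i t assume t: "Inv i t" "ncell t 25 0 0 = i"
    then have "levels_ok (P PF_level t) (Suc i)" by (intro PF_level) (auto simp: Inv_def)
    moreover have "base (P PF_level t)" by (rule base_P) (use t in \<open>auto simp: Inv_def mods_PF base_ids_def\<close>)
    ultimately show "Inv (Suc i) (set_ncell 25 0 0 (Suc i) (P PF_level t))" by (simp add: Inv_def lev base_ids_def)
  qed
  moreover have "P PF s = P (ForK 25 PF_level) s2"
  proof -
    have "P (set0 52 NZero) (P (Basic (RAssign 2 NZero NZero RZero)) (P (Basic (NAssign 11 NZero NZero one)) s1)) = s2"
      by (simp add: s2_def)
    then show ?thesis by (simp only: PF_def blk.simps pe.simps(3) s1_def)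
  qed
  ultimately show ?thesis by (simp add: Inv_def)
qed

end

section \<open>Tables of the dynamic program versus walks\<close>

lemma argminD: "argmin fl x C v D \<Longrightarrow> fl \<noteq> 0 \<Longrightarrow> fl - 1 \<in> D \<and> C (fl - 1) \<and> x = v (fl - 1)"
  by (auto simp: argmin_def split: nat.splits)

lemma argmin_le: "argmin fl x C v D \<Longrightarrow> q \<in> D \<Longrightarrow> C q \<Longrightarrow> fl \<noteq> 0 \<and> x \<le> v q"
  by (auto simp: argmin_def split: nat.splits)

context stage
begin

definition HF :: "store \<Rightarrow> nat \<Rightarrow> nat set" where "HF s y = (if y \<in> Y then A s y else {})"
definition HG :: "store \<Rightarrow> nat \<Rightarrow> nat set" where "HG s y = (if y \<in> Y then B s y else {})"

primrec trace :: "store \<Rightarrow> nat \<Rightarrow> nat \<Rightarrow> (nat \<times> nat) list" where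
  "trace s 0 p = []"
| "trace s (Suc j) p = (let y = PXc s (Suc j) p - 1 in trace s j (RYc s j y - 1) @ [(y, lst p)])"

lemma row_parent:
  assumes "levels_ok s (Suc k)" "j \<le> k" "y \<in> Y" "RYc s j y \<noteq> 0"
  shows "RYc s j y - 1 \<le> k \<and> PXc s j (RYc s j y - 1) \<noteq> 0 \<and> lst (RYc s j y - 1) \<in> HF s y \<and>
    DY s j y = DX s j (RYc s j y - 1) - w y"
proof -
  have "row_ok s j y {..k}" using assms by (auto simp: levels_ok_def level_ok_def)
  from argminD[OF this[unfolded row_ok_def] assms(4)] assms(3) show ?thesis by (auto simp: HF_def)
qed

lemma row_complete:
  assumes "levels_ok s (Suc k)" "j \<le> k" "y \<in> Y" "p \<le> k" "PXc s j p \<noteq> 0" "lst p \<in> A s y"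
  shows "RYc s j y \<noteq> 0 \<and> DY s j y \<le> DX s j p - w y"
proof -
  have "row_ok s j y {..k}" using assms by (auto simp: levels_ok_def level_ok_def)
  from argmin_le[OF this[unfolded row_ok_def], of p] assms(4-) show ?thesis by auto
qed

lemma col_parent:
  assumes "levels_ok s (Suc k)" "j \<le> k" "p \<le> k" "PXc s (Suc j) p \<noteq> 0"
  shows "p \<noteq> 0 \<and> PXc s (Suc j) p - 1 \<in> Y \<and> RYc s j (PXc s (Suc j) p - 1) \<noteq> 0 \<and> lst p \<in> HG s (PXc s (Suc j) p - 1) \<and>
    DX s (Suc j) p = DY s j (PXc s (Suc j) p - 1) + w (lst p)"
proof -
  have ok: "col_ok s j p Y" using assms by (auto simp: levels_ok_def level_ok_def)
  then have p: "p \<noteq> 0" using assms(4) by (cases "p = 0") (simp_all add: col_ok_def)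
  then have "argmin (PXc s (Suc j) p) (DX s (Suc j) p) (\<lambda>y. RYc s j y \<noteq> 0 \<and> lst p \<in> B s y) (\<lambda>y. DY s j y + w (lst p)) Y"
    using ok by (simp add: col_ok_def)
  from argminD[OF this assms(4)] p show ?thesis by (simp add: HG_def)
qed

lemma col_complete:
  assumes "levels_ok s (Suc k)" "j \<le> k" "p \<le> k" "p \<noteq> 0" "y \<in> Y" "RYc s j y \<noteq> 0" "lst p \<in> B s y"
  shows "PXc s (Suc j) p \<noteq> 0 \<and> DX s (Suc j) p \<le> DY s j y + w (lst p)"
proof -
  have "col_ok s j p Y" using assms by (auto simp: levels_ok_def level_ok_def)
  then have "argmin (PXc s (Suc j) p) (DX s (Suc j) p) (\<lambda>y. RYc s j y \<noteq> 0 \<and> lst p \<in> B s y) (\<lambda>y. DY s j y + w (lst p)) Y"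
    using assms(4) by (simp add: col_ok_def)
  from argmin_le[OF this assms(5)] assms(6,7) show ?thesis by auto
qed

lemma lst_n: "p \<le> k \<Longrightarrow> lst p = n \<longleftrightarrow> p = 0"
  using lst_eq[of p 0] lst(1) by simp

lemma start_eq: "levels_ok s (Suc k) \<Longrightarrow> p \<le> k \<Longrightarrow> PXc s 0 p \<noteq> 0 \<longleftrightarrow> p = 0"
  and start_0: "levels_ok s (Suc k) \<Longrightarrow> DX s 0 0 = 0"
  by (auto simp: levels_ok_def start_ok_def)

lemma trace_walk:
  assumes s: "levels_ok s (Suc k)"
  shows "j \<le> Suc k \<Longrightarrow> p \<le> k \<Longrightarrow> PXc s j p \<noteq> 0 \<Longrightarrow>
    wk (HF s) (HG s) n (trace s j p) (lst p) \<and> length (trace s j p) = j \<and> n \<notin> snd ` set (trace s j p) \<and>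
    wcost w (trace s j p) = DX s j p"
proof (induction j arbitrary: p)
  case 0
  then have "p = 0" using start_eq[OF s] by simp
  then show ?case using start_0[OF s] lst(1) by simp
next
  case (Suc j)
  define y where "y = PXc s (Suc j) p - 1"
  define p' where "p' = RYc s j y - 1"
  have j: "j \<le> k" using Suc.prems(1) by simp
  have y: "p \<noteq> 0" "y \<in> Y" "RYc s j y \<noteq> 0" "lst p \<in> HG s y" "DX s (Suc j) p = DY s j y + w (lst p)"
    using col_parent[OF s j Suc.prems(2,3)] by (simp_all add: y_def)
  have p': "p' \<le> k" "PXc s j p' \<noteq> 0" "lst p' \<in> HF s y" "DY s j y = DX s j p' - w y"
    using row_parent[OF s j y(2,3)] by (simp_all add: p'_def)
  have "lst p \<noteq> n" using lst_n[OF Suc.prems(2)] y(1) by simp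
  moreover have tr: "trace s (Suc j) p = trace s j p' @ [(y, lst p)]" by (simp only: trace.simps Let_def y_def p'_def)
  have "wk (HF s) (HG s) n (trace s j p') (lst p')" "length (trace s j p') = j" "n \<notin> snd ` set (trace s j p')"
    "wcost w (trace s j p') = DX s j p'" using Suc.IH[of p'] j p' by simp_all
  ultimately show ?case unfolding tr using p'(3,4) y(4,5) by (auto simp: wk_append)
qed

lemma HFG_J: "HF s y \<subseteq> J" "HG s y \<subseteq> J" using AB_sub by (auto simp: HF_def HG_def)

lemma HFG_Y: "x \<in> HF s y \<or> x \<in> HG s y \<Longrightarrow> y \<in> Y" by (auto simp: HF_def HG_def split: if_splits)

text \<open>Induction on the walk from its end, as the next level arises by appending one
  step.\<close>

lemma walk_table:
  assumes s: "levels_ok s (Suc k)"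
  shows "wk (HF s) (HG s) n ps x \<Longrightarrow> n \<notin> snd ` set ps \<Longrightarrow> length ps \<le> Suc k \<Longrightarrow> p \<le> k \<Longrightarrow> x = lst p \<Longrightarrow>
    PXc s (length ps) p \<noteq> 0 \<and> DX s (length ps) p \<le> wcost w ps"
proof (induction ps arbitrary: x p rule: rev_induct)
  case Nil
  then have "p = 0" using lst_n[of p] by simp
  then show ?case using start_eq[OF s, of 0] start_0[OF s] by simp
next
  case (snoc e ps)
  obtain y where e: "e = (y, x)" using snoc.prems(1) by (cases e) (auto simp: wk_append)
  obtain m where m: "wk (HF s) (HG s) n ps m" "m \<in> HF s y" "x \<in> HG s y" using snoc.prems(1) by (auto simp: wk_append e)
  have y: "y \<in> Y" "m \<in> A s y" "lst p \<in> B s y" using m HFG_Y[of m s y] snoc.prems(5) by (auto simp: HF_def HG_def)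
  obtain p' where p': "p' \<le> k" "m = lst p'" using J_lst[OF subsetD[OF HFG_J(1) m(2)]] by blast
  have IH: "PXc s (length ps) p' \<noteq> 0" "DX s (length ps) p' \<le> wcost w ps"
    using snoc.IH[OF m(1) _ _ p'] snoc.prems(2,3) by auto
  have j: "length ps \<le> k" using snoc.prems(3) by simp
  have "p \<noteq> 0" using snoc.prems(2,5) lst(1) e by auto
  then show ?case
  proof -
    have a: "RYc s (length ps) y \<noteq> 0" "DY s (length ps) y \<le> DX s (length ps) p' - w y"
      using row_complete[OF s j y(1) p'(1) IH(1)] y(2) p'(2) by simp_all
    have "PXc s (Suc (length ps)) p \<noteq> 0 \<and> DX s (Suc (length ps)) p \<le> DY s (length ps) y + w (lst p)"
      by (rule col_complete[OF s j snoc.prems(4) \<open>p \<noteq> 0\<close> y(1) a(1) y(3)])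
    then show ?thesis using a(2) IH(2) snoc.prems(5) e by simp
  qed
qed

lemma closed_table:
  assumes s: "levels_ok s (Suc k)" and qs: "rooted (HF s) (HG s) n (Suc k) qs"
  obtains j y where "length qs = Suc j" "j \<le> k" "y \<in> Y" "closes s j y" "DY s j y + w n \<le> wcost w qs"
proof -
  have q: "wk (HF s) (HG s) n qs n" "qs \<noteq> []" "n \<notin> snd ` set (butlast qs)" "length qs \<le> Suc k"
    using qs by (auto simp: rooted_def)
  obtain y x where yx: "qs = butlast qs @ [(y, x)]" using q(2) by (metis append_butlast_last_id surj_pair)
  define ps where "ps = butlast qs"
  have "qs = ps @ [(y, x)]" using yx by (simp add: ps_def)
  then obtain m where m: "wk (HF s) (HG s) n ps m" "m \<in> HF s y" "n \<in> HG s y" "x = n" using q(1) by (auto simp: wk_append)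
  have len: "length qs = Suc (length ps)" "length ps \<le> k" using \<open>qs = ps @ [(y, x)]\<close> q(4) by auto
  have y: "y \<in> Y" "m \<in> A s y" "n \<in> B s y" using m HFG_Y[of m s y] by (auto simp: HF_def HG_def)
  obtain p where p: "p \<le> k" "m = lst p" using J_lst[OF subsetD[OF HFG_J(1) m(2)]] by blast
  have t: "PXc s (length ps) p \<noteq> 0" "DX s (length ps) p \<le> wcost w ps"
  proof -
    have "n \<notin> snd ` set ps" using q(3) by (simp only: ps_def not_False_eq_True)
    from walk_table[OF s m(1) this _ p] len(2)
    show "PXc s (length ps) p \<noteq> 0" "DX s (length ps) p \<le> wcost w ps" by simp_all
  qed
  have "RYc s (length ps) y \<noteq> 0 \<and> DY s (length ps) y \<le> DX s (length ps) p - w y"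
    using row_complete[OF s len(2) y(1) p(1) t(1)] y(2) p(2) by blast
  then have "RYc s (length ps) y \<noteq> 0" "DY s (length ps) y \<le> wcost w ps - w y" using t(2) by auto
  moreover have "wcost w qs = wcost w ps + (w n - w y)" unfolding \<open>qs = ps @ [(y, x)]\<close> m(4) by simp
  ultimately show ?thesis using that[OF len y(1)] y(3) by (simp add: closes_def)
qed

definition cycle :: "store \<Rightarrow> nat \<Rightarrow> nat \<Rightarrow> (nat \<times> nat) list" where
  "cycle s j y = trace s j (RYc s j y - 1) @ [(y, n)]"

lemma best_none:
  assumes s: "levels_ok s (Suc k)" "ncell s 52 0 0 = 0"
  shows "\<not> rooted (HF s) (HG s) n (Suc k) qs"
proof
  assume "rooted (HF s) (HG s) n (Suc k) qs"
  from closed_table[OF s(1) this] obtain j y where "j \<le> k" "y \<in> Y" "closes s j y" by metis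
  moreover have "\<forall>j y. j < Suc k \<and> y \<in> Y \<longrightarrow> \<not> closes s j y"
    using s by (simp add: levels_ok_def best_ok_def)
  ultimately show False by (meson le_imp_less_Suc)
qed

text \<open>Table entries and costs of closed walks differ by the constant \<open>w n\<close>, so
  the program never needs the weight of the dummy; a closed walk ending from level \<open>j\<close>
  has length \<open>j + 1\<close>.\<close>

lemma best_lexmin:
  assumes s: "levels_ok s (Suc k)" "ncell s 52 0 0 \<noteq> 0"
  defines "j \<equiv> ncell s 53 0 0" and "y \<equiv> ncell s 52 0 0 - 1"
  shows "j \<le> k" "y \<in> Y" "closes s j y" "lexmin (HF s) (HG s) w n (Suc k) (cycle s j y)"
proof -
  have Suc: "ncell s 52 0 0 = Suc y" using s(2) by (simp add: y_def)
  have b: "best_ok s (\<lambda>j' y. j' < Suc k \<and> y \<in> Y)" using s(1) by (simp add: levels_ok_def)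
  note b = b[unfolded best_ok_def Suc nat.case, folded j_def]
  show jy: "j \<le> k" "y \<in> Y" "closes s j y" using b by auto
  have min: "DY s j y < DY s j' y' \<or> DY s j y = DY s j' y' \<and> j \<le> j'" if "j' \<le> k" "y' \<in> Y" "closes s j' y'" for j' y'
  proof -
    have r: "rcell s 3 0 0 = DY s j y" by (rule b[THEN conjunct2, THEN conjunct2, THEN conjunct1])
    have "\<forall>j' y'. j' < Suc k \<and> y' \<in> Y \<longrightarrow> closes s j' y' \<longrightarrow> rcell s 3 0 0 < DY s j' y' \<or> rcell s 3 0 0 = DY s j' y' \<and> j \<le> j'"
      by (rule b[THEN conjunct2, THEN conjunct2, THEN conjunct2])
    then have "rcell s 3 0 0 < DY s j' y' \<or> rcell s 3 0 0 = DY s j' y' \<and> j \<le> j'" using that by (meson le_imp_less_Suc)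
    then show ?thesis unfolding r .
  qed
  have RY: "RYc s j y \<noteq> 0" "n \<in> HG s y" using jy by (auto simp: closes_def HG_def)
  define p where "p = RYc s j y - 1"
  have p: "p \<le> k" "PXc s j p \<noteq> 0" "lst p \<in> HF s y" "DY s j y = DX s j p - w y"
    using row_parent[OF s(1) jy(1,2) RY(1)] by (simp_all add: p_def)
  note tr = trace_walk[OF s(1) _ p(1,2)]
  have c: "cycle s j y = trace s j p @ [(y, n)]" by (simp add: cycle_def p_def)
  have root: "rooted (HF s) (HG s) n (Suc k) (cycle s j y)"
    using tr jy(1) p(3) RY(2) by (auto simp: rooted_def c wk_append)
  have cost: "wcost w (cycle s j y) = DY s j y + w n" "length (cycle s j y) = Suc j"
    using tr jy(1) p(4) by (simp_all add: c)
  show "lexmin (HF s) (HG s) w n (Suc k) (cycle s j y)"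
    unfolding lexmin_def
  proof (intro conjI allI impI root)
    fix qs assume "rooted (HF s) (HG s) n (Suc k) qs"
    from closed_table[OF s(1) this] obtain j' y' where jy': "length qs = Suc j'" "j' \<le> k" "y' \<in> Y" "closes s j' y'"
      "DY s j' y' + w n \<le> wcost w qs" by metis
    show "wcost w (cycle s j y) < wcost w qs \<or> wcost w (cycle s j y) = wcost w qs \<and> length (cycle s j y) \<le> length qs"
      using min[OF jy'(2-4)] jy'(1,5) unfolding cost by auto
  qed
qed

end

subsection \<open>Augmentation\<close>

text \<open>One level back: the column enters the set and its parent row leaves it. At level 0 the
  parent is the dummy, which is removed in this way.\<close>

definition PG_hop :: pr where
  "PG_hop = blk [put0 3 56 one, set0 57 (NSub (NCell 10 (V 55) (V 56)) one), Basic (NAssign 3 NZero (NCell 4 NZero (V 57)) NZero),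
    If (zr (V 55)) (set0 58 one) (blk [set0 56 (NSub (NCell 11 (V 55) (V 57)) one), set0 55 (NSub (V 55) one)])]"

definition PG_trace :: pr where
  "PG_trace = blk [set0 55 (V 53), set0 56 (NSub (V 52) one), set0 58 NZero, ForK 23 (When (zr (V 58)) PG_hop)]"

definition PG_copy :: pr where
  "PG_copy = blk [Basic (NAssign 1 (NSuc (V 2)) (V 21) (NCell 3 NZero (V 21))),
    When (nz (NCell 3 NZero (V 21))) (blk [Basic (NAssign 4 NZero (V 59) (V 21)), set0 59 (NSuc (V 59))])]"

text \<open>Position 0 of the list still holds the dummy, so refilling starts at 1. The
  characteristic vector has lost the dummy with the traced cycle and regains it for the next
  stage.\<close>

definition PG_build :: pr where
  "PG_build = blk [set0 59 one, ForN 21 PG_copy, Basic (NAssign 3 NZero (V 0) one)]"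

definition PG :: pr where
  "PG = If (nz (V 52)) (blk [PG_trace, PG_build, set0 2 (NSuc (V 2))]) (set0 12 one)"

lemma mods_PG: "mods PG_hop = {3, 55, 56, 57, 58}" "mods PG_trace = {3, 23, 55, 56, 57, 58}" "mods PG_copy = {1, 4, 59}"
  "mods PG_build = {1, 3, 4, 21, 59}" "rmods PG_trace = {}" "rmods PG_build = {}"
  by (auto simp: PG_hop_def PG_trace_def PG_copy_def PG_build_def)

context stage
begin

lemma wk_H: "wk (HF s) (HG s) a ps b \<Longrightarrow> fst ` set ps \<subseteq> Y \<and> snd ` set ps \<subseteq> J"
proof (induction ps arbitrary: a)
  case (Cons p ps)
  then have p: "a \<in> HF s (fst p)" "snd p \<in> HG s (fst p)" "wk (HF s) (HG s) (snd p) ps b" by simp_all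
  have "fst p \<in> Y" using HFG_Y[of a s "fst p"] p(1) by blast
  moreover have "snd p \<in> J" by (rule subsetD[OF HFG_J(2) p(2)])
  ultimately show ?case using Cons.IH[OF p(3)] by simp
qed simp

lemma PG_trace:
  assumes s: "base s" "levels_ok s (Suc k)" "ncell s 52 0 0 \<noteq> 0"
  defines "c \<equiv> cycle s (ncell s 53 0 0) (ncell s 52 0 0 - 1)"
  shows "ncell (P PG_trace s) 3 0 x = of_bool (x \<in> J - snd ` set c \<or> x \<in> fst ` set c)"
proof -
  define j0 where "j0 = ncell s 53 0 0"
  define y0 where "y0 = ncell s 52 0 0 - 1"
  note jy0 = best_lexmin[OF s(2,3), folded j0_def y0_def]
  have c: "c = cycle s j0 y0" by (simp add: c_def j0_def y0_def)
  have wkc: "wk (HF s) (HG s) n c n" using jy0(4) by (simp add: c lexmin_def rooted_def)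
  define C where "C j y = fst ` set (cycle s j y)" for j y
  define R where "R j y = snd ` set (cycle s j y)" for j y
  have CR0: "C 0 y = {y}" "R 0 y = {n}" for y by (simp_all add: C_def R_def cycle_def)
  have CRS: "C (Suc j) y = insert y (C j (PXc s (Suc j) (RYc s (Suc j) y - 1) - 1))"
    "R (Suc j) y = insert (lst (RYc s (Suc j) y - 1)) (R j (PXc s (Suc j) (RYc s (Suc j) y - 1) - 1))" for j y
    by (auto simp: C_def R_def cycle_def Let_def)
  define q where "q x D E = (if x \<in> D then 1 else if x \<in> E then 0 else of_bool (x \<in> J) :: nat)" for x :: nat and D E
  have CY: "C j0 y0 \<subseteq> Y"
    unfolding C_def c[symmetric] using wk_H[OF wkc] by (rule conjunct1)
  have RJ: "R j0 y0 \<subseteq> J"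
    unfolding R_def c[symmetric] using wk_H[OF wkc] by (rule conjunct2)
  \<comment> \<open>\<open>D\<close> and \<open>E\<close> are the columns added and rows removed so
    far. Together with the part of the cycle that the pointers 55 and 56 still lead to, they make up
    the whole cycle.\<close>
  define Q where "Q i t D E \<longleftrightarrow> (\<forall>x. ncell t 3 0 x = q x D E) \<and> D \<subseteq> C j0 y0 \<and> E \<subseteq> R j0 y0 \<and>
      (if ncell t 58 0 0 = 0 then ncell t 55 0 0 + i = j0 \<and> ncell t 56 0 0 \<in> Y \<and> RYc s (ncell t 55 0 0) (ncell t 56 0 0) \<noteq> 0 \<and>
         D \<union> C (ncell t 55 0 0) (ncell t 56 0 0) = C j0 y0 \<and> E \<union> R (ncell t 55 0 0) (ncell t 56 0 0) = R j0 y0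
       else D = C j0 y0 \<and> E = R j0 y0)" for i and t :: store and D E
  define Inv where "Inv i t \<longleftrightarrow> ncell t 4 = ncell s 4 \<and> ncell t 10 = ncell s 10 \<and> ncell t 11 = ncell s 11 \<and> (\<exists>D E. Q i t D E)" for i t
  have Q_set: "Q i (set_ncell 23 0 0 v t) D E = Q i t D E" for i t v D E by (simp add: Q_def ncell_set_other)
  have Inv_set: "Inv i (set_ncell 23 0 0 v t) = Inv i t" for i t v by (simp add: Inv_def Q_set ncell_set_other)
  define s0 where "s0 = set_ncell 58 0 0 0 (set_ncell 56 0 0 y0 (set_ncell 55 0 0 j0 s))"
  have lst4: "p \<le> k \<Longrightarrow> ncell s 4 0 p = lst p" for p using s(1) by (simp add: base_def)
  have "Inv (Suc k) (P (ForK 23 (When (zr (V 58)) PG_hop)) s0)" unfolding pe.simps(6)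
  proof (rule loop_induct[where Inv = Inv])
    have "Q 0 s0 {} {}" unfolding Q_def using s(1) jy0(2,3) by (simp add: s0_def q_def base_def closes_def)
    then have "Inv 0 s0" unfolding Inv_def by (auto simp: s0_def ncell_set_other)
    then show "Inv 0 (set_ncell 23 0 0 0 s0)" unfolding Inv_set .
    fix i t assume t: "Inv i t"
    then obtain D E where QDE: "Q i t D E" by (auto simp: Inv_def)
    have a: "ncell t 4 = ncell s 4" "ncell t 10 = ncell s 10" "ncell t 11 = ncell s 11" using t by (simp_all add: Inv_def)
    note Q1 = QDE[unfolded Q_def]
    have q3: "ncell t 3 0 x = q x D E" for x by (rule Q1[THEN conjunct1, rule_format])
    have DE: "D \<subseteq> C j0 y0" "E \<subseteq> R j0 y0"
      by (rule Q1[THEN conjunct2, THEN conjunct1], rule Q1[THEN conjunct2, THEN conjunct2, THEN conjunct1])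
    note cs = Q1[THEN conjunct2, THEN conjunct2, THEN conjunct2]
    have "Inv (Suc i) (P (When (zr (V 58)) PG_hop) t)"
    proof (cases "ncell t 58 0 0 = 0")
      case False
      then have "P (When (zr (V 58)) PG_hop) t = t" by simp
      moreover have "D = C j0 y0 \<and> E = R j0 y0" using cs False by simp
      then have "Q (Suc i) t D E" unfolding Q_def using q3 False by simp
      ultimately show ?thesis unfolding Inv_def using a by auto
    next
      case True
      define j where "j = ncell t 55 0 0"
      define y where "y = ncell t 56 0 0"
      define p where "p = RYc s j y - 1"
      have st: "j + i = j0" "y \<in> Y" "RYc s j y \<noteq> 0" "D \<union> C j y = C j0 y0" "E \<union> R j y = R j0 y0"
        using cs True by (simp_all add: j_def y_def)
      have jk: "j \<le> k" using st(1) jy0(1) by simp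
      have p: "p \<le> k" "PXc s j p \<noteq> 0" using row_parent[OF s(2) jk st(2,3)] by (simp_all add: p_def)
      define t1 where "t1 = set_ncell 3 0 (lst p) 0 (set_ncell 57 0 0 p (set_ncell 3 0 y 1 t))"
      have eq: "P (When (zr (V 58)) PG_hop) t = (if j = 0 then set_ncell 58 0 0 1 t1
          else set_ncell 55 0 0 (j - 1) (set_ncell 56 0 0 (PXc s j p - 1) t1))"
        using True a lst4[OF p(1)] by (auto simp: PG_hop_def t1_def p_def j_def y_def ncell_set_other)
      have lpJ: "lst p \<in> J" "y \<notin> J" using lst_in[OF p(1)] st(2) by auto
      have "y \<in> C j y" by (simp add: C_def cycle_def)
      moreover have "lst p \<in> R j y"
      proof (cases j)
        case 0
        then have "p = 0" using p start_eq[OF s(2) p(1)] by simp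
        then show ?thesis using 0 lst(1) CR0 by simp
      qed (simp add: CRS p_def)
      ultimately have DE': "insert y D \<subseteq> C j0 y0" "insert (lst p) E \<subseteq> R j0 y0" using st DE by auto
      have q1: "ncell t1 3 0 x = q x (insert y D) (insert (lst p) E)" for x
        using lpJ DE' CY RJ q3[of x] by (auto simp: t1_def q_def)
      have a1: "ncell t1 4 = ncell s 4" "ncell t1 10 = ncell s 10" "ncell t1 11 = ncell s 11" "ncell t1 58 0 0 = 0"
        using a True by (simp_all add: t1_def ncell_set_other)
      show ?thesis
      proof (cases j)
        case 0
        then have "p = 0" using p start_eq[OF s(2) p(1)] by simp
        then have "insert y D = C j0 y0" "insert (lst p) E = R j0 y0" using st(4,5) 0 CR0 lst(1) by auto
        then have "Q (Suc i) (set_ncell 58 0 0 1 t1) (insert y D) (insert (lst p) E)" unfolding Q_def using q1 by simp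
        moreover have "P (When (zr (V 58)) PG_hop) t = set_ncell 58 0 0 1 t1" unfolding eq using 0 by simp
        ultimately show ?thesis unfolding Inv_def using a1 by (auto simp: ncell_set_other)
      next
        case (Suc j')
        define y' where "y' = PXc s j p - 1"
        have "y' \<in> Y" "RYc s j' y' \<noteq> 0"
          using col_parent[OF s(2) _ p(1), of j'] p(2) jk by (simp_all add: Suc y'_def)
        moreover have "insert y D \<union> C j' y' = C j0 y0" "insert (lst p) E \<union> R j' y' = R j0 y0"
          using st(4,5) by (auto simp: Suc CRS y'_def p_def)
        moreover define t2 where "t2 = set_ncell 55 0 0 j' (set_ncell 56 0 0 y' t1)"
        have v2: "ncell t2 58 0 0 = 0" "ncell t2 55 0 0 = j'" "ncell t2 56 0 0 = y'" "ncell t2 3 = ncell t1 3"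
          "ncell t2 4 = ncell s 4" "ncell t2 10 = ncell s 10" "ncell t2 11 = ncell s 11"
          using a1 by (simp_all add: t2_def ncell_set_other)
        ultimately have "Q (Suc i) t2 (insert y D) (insert (lst p) E)"
          unfolding Q_def v2 using q1 st(1) DE' Suc by simp
        moreover have "P (When (zr (V 58)) PG_hop) t = t2" unfolding eq t2_def y'_def using Suc by simp
        ultimately show ?thesis unfolding Inv_def using v2 by auto
      qed
    qed
    then show "Inv (Suc i) (set_ncell 23 0 0 (Suc i) (P (When (zr (V 58)) PG_hop) t))" unfolding Inv_set .
  qed
  moreover have "P PG_trace s = P (ForK 23 (When (zr (V 58)) PG_hop)) s0"
  proof -
    have "P (set0 58 NZero) (P (set0 56 (NSub (V 52) one)) (P (set0 55 (V 53)) s)) = s0"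
      by (simp add: s0_def j0_def y0_def)
    then show ?thesis by (simp only: PG_trace_def blk.simps pe.simps(3))
  qed
  ultimately have fin: "Inv (Suc k) (P PG_trace s)" by simp
  then obtain D E where QDE: "Q (Suc k) (P PG_trace s) D E" by (auto simp: Inv_def)
  note Q1 = QDE[unfolded Q_def]
  have q3: "ncell (P PG_trace s) 3 0 x = q x D E" by (rule Q1[THEN conjunct1, rule_format])
  have "ncell (P PG_trace s) 58 0 0 \<noteq> 0"
  proof
    assume "ncell (P PG_trace s) 58 0 0 = 0"
    then have "ncell (P PG_trace s) 55 0 0 + Suc k = j0" using Q1[THEN conjunct2, THEN conjunct2, THEN conjunct2] by simp
    then show False using jy0(1) by simp
  qed
  then have "D = C j0 y0" "E = R j0 y0" using Q1[THEN conjunct2, THEN conjunct2, THEN conjunct2] by simp_all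
  then show ?thesis unfolding q3 q_def C_def R_def c by auto
qed

lemma PG_build:
  assumes s: "ncell s 0 0 0 = n" "ncell s 2 0 0 = k'" "ncell s 4 0 0 = n" "\<And>x. ncell s 3 0 x = of_bool (x \<in> K)" "K \<subseteq> {..<n}"
  defines "t \<equiv> P PG_build s"
  shows "ncell t 3 0 x = of_bool (x \<in> insert n K)" "ncell t 4 0 0 = n" "inj_on (ncell t 4 0) {..card K}"
    "ncell t 4 0 ` {..card K} = insert n K" "\<And>i. i < n \<Longrightarrow> ncell t 1 (Suc k') i = of_bool (i \<in> K)"
    "\<And>i. i \<noteq> Suc k' \<Longrightarrow> ncell t 1 i = ncell s 1 i"
proof -
  define s0 where "s0 = set_ncell 59 0 0 1 s"
  define Inv where "Inv i u \<longleftrightarrow> ncell u 0 0 0 = n \<and> ncell u 2 0 0 = k' \<and> ncell u 3 = ncell s 3 \<and> ncell u 4 0 0 = n \<and>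
    ncell u 59 0 0 = Suc (card (K \<inter> {..<i})) \<and> inj_on (ncell u 4 0) {..card (K \<inter> {..<i})} \<and>
    ncell u 4 0 ` {..card (K \<inter> {..<i})} = insert n (K \<inter> {..<i}) \<and>
    (\<forall>x<i. ncell u 1 (Suc k') x = of_bool (x \<in> K)) \<and> (\<forall>i. i \<noteq> Suc k' \<longrightarrow> ncell u 1 i = ncell s 1 i)" for i and u :: store
  have "Inv n (P (ForN 21 PG_copy) s0)" unfolding pe.simps(5)
  proof (rule loop_induct[where Inv = Inv])
    show "Inv 0 (set_ncell 21 0 0 0 s0)" using s by (simp add: Inv_def s0_def ncell_set_other)
    fix i u assume i: "i < n" and u: "Inv i u" "ncell u 21 0 0 = i"
    define m where "m = card (K \<inter> {..<i})"
    have a: "ncell u 0 0 0 = n" "ncell u 2 0 0 = k'" "ncell u 3 = ncell s 3" "ncell u 4 0 0 = n" "ncell u 59 0 0 = Suc m"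
      "inj_on (ncell u 4 0) {..m}" "ncell u 4 0 ` {..m} = insert n (K \<inter> {..<i})"
      "\<And>x. x < i \<Longrightarrow> ncell u 1 (Suc k') x = of_bool (x \<in> K)" "\<And>i. i \<noteq> Suc k' \<Longrightarrow> ncell u 1 i = ncell s 1 i"
      using u(1) by (simp_all add: Inv_def m_def)
    define v where "v = set_ncell 1 (Suc k') i (of_bool (i \<in> K)) u"
    show "Inv (Suc i) (set_ncell 21 0 0 (Suc i) (P PG_copy u))"
    proof (cases "i \<in> K")
      case False
      then have "P PG_copy u = v" using a u(2) s(4) by (simp add: PG_copy_def v_def)
      moreover have "K \<inter> {..<Suc i} = K \<inter> {..<i}" using False by (auto simp: less_Suc_eq)
      ultimately show ?thesis using a False by (simp add: Inv_def v_def m_def ncell_set_other less_Suc_eq fun_eq_iff)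
    next
      case True
      define v' where "v' = set_ncell 59 0 0 (Suc (Suc m)) (set_ncell 4 0 (Suc m) i v)"
      have K: "K \<inter> {..<Suc i} = insert i (K \<inter> {..<i})" using True by (auto simp: less_Suc_eq)
      have card: "card (K \<inter> {..<Suc i}) = Suc m" unfolding K by (simp add: m_def)
      have e4: "ncell v' 4 0 = (ncell u 4 0)(Suc m := i)" by (simp add: v'_def v_def fun_eq_iff)
      have vf: "ncell v' 0 0 0 = n" "ncell v' 2 0 0 = k'" "ncell v' 3 = ncell s 3" "ncell v' 4 0 0 = n" "ncell v' 59 0 0 = Suc (Suc m)"
        using a by (simp_all add: v'_def v_def ncell_set_other)
      have "P PG_copy u = v'" using a u(2) s(4) True by (simp add: PG_copy_def v_def v'_def)
      moreover have "inj_on (ncell v' 4 0) {..Suc m}"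
      proof -
        have "i \<notin> ncell u 4 0 ` {..m}" unfolding a(7) using i by auto
        then show ?thesis unfolding e4 atMost_Suc using a(6) by (auto simp: inj_on_def)
      qed
      moreover have "ncell v' 4 0 ` {..Suc m} = insert n (K \<inter> {..<Suc i})"
      proof -
        have "(ncell u 4 0)(Suc m := i) ` {..m} = ncell u 4 0 ` {..m}" by (intro image_cong) auto
        then show ?thesis by (simp only: e4 atMost_Suc image_insert fun_upd_same a(7) K insert_commute)
      qed
      moreover have "ncell v' 1 i' = ncell s 1 i'" if "i' \<noteq> Suc k'" for i'
        using a(9)[OF that] that by (simp add: v'_def v_def fun_eq_iff)
      moreover have "ncell v' 1 (Suc k') x = of_bool (x \<in> K)" if "x < Suc i" for x
        using a(8)[of x] that True by (auto simp: v'_def v_def less_Suc_eq)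
      ultimately show ?thesis using vf by (simp add: Inv_def card ncell_set_other)
    qed
  qed
  then have iv: "Inv n (P (ForN 21 PG_copy) s0)" .
  define u where "u = P (ForN 21 PG_copy) s0"
  have Kn: "K \<inter> {..<n} = K" using s(5) by auto
  have a: "ncell u 0 0 0 = n" "ncell u 3 = ncell s 3" "ncell u 4 0 0 = n"
      "inj_on (ncell u 4 0) {..card K}" "ncell u 4 0 ` {..card K} = insert n K"
      "\<And>x. x < n \<Longrightarrow> ncell u 1 (Suc k') x = of_bool (x \<in> K)" "\<And>i. i \<noteq> Suc k' \<Longrightarrow> ncell u 1 i = ncell s 1 i"
    using iv by (simp_all add: Inv_def u_def Kn)
  have t: "t = set_ncell 3 0 n 1 u"
  proof -
    have "P (set0 59 one) s = s0" by (simp add: s0_def)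
    then have "t = P (Basic (NAssign 3 NZero (V 0) one)) u" by (simp only: t_def PG_build_def blk.simps pe.simps(3) u_def)
    then show ?thesis using a(1) by simp
  qed
  have t4: "ncell t 4 = ncell u 4" "ncell t 1 = ncell u 1" by (simp_all add: t ncell_set_other)
  show "ncell t 3 0 x = of_bool (x \<in> insert n K)" using a(2) s(4) by (auto simp: t)
  show "ncell t 4 0 0 = n" "inj_on (ncell t 4 0) {..card K}" "ncell t 4 0 ` {..card K} = insert n K"
    "\<And>i. i < n \<Longrightarrow> ncell t 1 (Suc k') i = of_bool (i \<in> K)" "\<And>i. i \<noteq> Suc k' \<Longrightarrow> ncell t 1 i = ncell s 1 i"
    unfolding t4 using a by simp_all
qed

end

section \<open>Correctness of one augmentation\<close>

definition STEP :: pr where "STEP = blk [PA, PB, PC, PD, PE, PF, PG]"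

text \<open>The state between two stages. Unlike \<open>base\<close> it presupposes no list
  \<open>lst\<close> but says what makes array 4 such a list for the new set.\<close>

definition ready :: "nat \<Rightarrow> (nat \<Rightarrow> real) \<Rightarrow> nat \<Rightarrow> nat set \<Rightarrow> store \<Rightarrow> bool" where
  "ready n w k I s \<longleftrightarrow> ncell s 0 0 0 = n \<and> ncell s 2 0 0 = k \<and> (\<forall>j. ncell s 3 0 j = of_bool (j \<in> insert n I)) \<and>
    ncell s 4 0 0 = n \<and> inj_on (ncell s 4 0) {..k} \<and> ncell s 4 0 ` {..k} = insert n I \<and>
    (\<forall>j<n. rcell s 0 0 j = w j) \<and> ncell s 50 0 0 = 0"

lemma mods_phases:
  "mods PA \<subseteq> {5, 6, 7, 8, 9, 21, 23} \<union> ask_ids" "mods PB \<subseteq> {5, 6, 7, 21, 23, 24, 40, 41, 42} \<union> ask_ids"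
  "mods PC \<subseteq> {5, 7, 8, 21, 22, 23, 40} \<union> ask_ids" "mods PE \<subseteq> insert 26 PE_ids"
  "rmods PA = {}" "rmods PB = {}" "rmods PC = {}"
  using mods_PE(6)
  by (auto simp: PA_def PB_def PB_col_def PB_scan_def PB_mark_def PC_def PC_col_def PC_scan_def PE_def)

lemma stop_frame:
  assumes "x \<notin> {5, 6, 7, 8, 9, 10, 11, 21, 22, 23, 24, 25, 26, 40, 41, 42, 43, 44, 45, 46, 47, 48, 49, 51, 52, 53} \<union> ask_ids"
  shows "x \<notin> mods (blk [PA, PB, PC, PD, PE, PF])"
proof -
  have not_mods: "mods p \<subseteq> S \<Longrightarrow> x \<notin> S \<Longrightarrow> x \<notin> mods p" for p S by blast
  have "x \<notin> mods PA" by (rule not_mods[OF mods_phases(1)]) (use assms in simp)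
  moreover have "x \<notin> mods PB" by (rule not_mods[OF mods_phases(2)]) (use assms in simp)
  moreover have "x \<notin> mods PC" by (rule not_mods[OF mods_phases(3)]) (use assms in simp)
  moreover have "x \<notin> mods PD" by (rule not_mods[OF mods_PD(4)]) (use assms in simp)
  moreover have "x \<notin> mods PE" by (rule not_mods[OF mods_phases(4)]) (use assms in \<open>simp add: PE_ids_def\<close>)
  moreover have "x \<notin> mods PF" unfolding mods_PF using assms by simp
  ultimately show ?thesis by (simp only: blk.simps mods.simps Un_iff simp_thms)
qed

context stage
begin

lemma step:
  assumes s: "base s"
  defines "s' \<equiv> P STEP s"
  shows "(\<exists>I'. max_weight_common_indep m1 m2 w (Suc k) I' \<and> ready n w (Suc k) I' s' \<and>
      (\<forall>i<n. ncell s' 1 (Suc k) i = of_bool (i \<in> I')) \<and> (\<forall>i. i \<noteq> Suc k \<longrightarrow> ncell s' 1 i = ncell s 1 i) \<and>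
      ncell s' 12 = ncell s 12) \<or>
    (\<nexists>K. m1 K \<and> m2 K \<and> card K = Suc k) \<and> s' 
      = set_ncell 12 0 0 1 (P (blk [PA, PB, PC, PD, PE, PF]) s)"
proof -
  define s1 where "s1 = P PA s"
  define s2 where "s2 = P PB s1"
  define s3 where "s3 = P PC s2"
  define s4 where "s4 = P PD s3"
  define s5 where "s5 = P PE s4"
  define s6 where "s6 = P PF s5"
  note pa = PA[OF s, folded s1_def]
  have pl: "plain s1 y" if "y \<in> Y" for y using pa(3,4)[OF that] by (simp add: plain_def)
  have pb: "base s2" "y \<in> Y \<Longrightarrow> split_col s2 y" for y
    unfolding s2_def by (rule PB(1)[OF pa(1)], erule pl) (rule PB(2)[OF pa(1)], erule pl)
  have "8 \<notin> mods PB" using mods_phases(2) by (auto simp: ask_ids_def)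
  then have eight: "ncell s2 8 0 0 = 0" using pa(2) by (simp add: s2_def pe_frame)
  have pc: "base s3" "y \<in> Y \<Longrightarrow> source_col s3 y" "ncell s3 8 0 0 \<noteq> 0 \<longleftrightarrow> (\<exists>y\<in>Y. partner y)" for y
    unfolding s3_def by (rule PC(1)[OF pb(1) _ eight], erule pb(2)) (rule PC(2)[OF pb(1) _ eight], erule pb(2), assumption, rule PC(3)[OF pb(1) _ eight], erule pb(2))
  have vis: "visible s3 y" if "y \<in> Y" for y using source_visible[OF that pc(2)[OF that]] .
  have found: "ncell s3 8 0 0 \<noteq> 0 \<longleftrightarrow> ex.paired" using pc(3) found_iff by simp
  have pd: "base s4" unfolding s4_def by (rule PD(1)[OF pc(1) _ found]) (erule vis)
  have kn: "y \<in> Y \<Longrightarrow> ex.knows (known1 s4) (known2 s4) y"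
    "y \<in> Y \<Longrightarrow> ex.oriented (A s4 y, B s4 y) (known1 s4 y) (known2 s4 y)" for y
    unfolding s4_def by (rule knows_PD(1)[OF pc(1) _ found], erule vis) (assumption, rule knows_PD(2)[OF pc(1) _ found], erule vis)
  have "9 \<notin> mods PB" "9 \<notin> mods PC" "9 \<notin> mods PD" using mods_phases(2,3) mods_PD(4) by (auto simp: ask_ids_def)
  then have nine: "ncell s4 9 0 y = 0 \<and> ncell s4 9 1 y = 0" if "y \<in> Y" for y
    using pa(4)[OF that] by (simp add: s4_def s3_def s2_def pe_frame)
  interpret lab: labelling n m1 m2 w orc k I lst "known1 s4" "known2 s4"
    by unfold_locales (use kn(1) in \<open>simp add: ex.knows_def\<close>)
  have pe: "base s5" "\<exists>c. (\<forall>y\<in>Y. lab.orn s5 y (c y)) \<and>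
    (\<forall>y\<in>Y. \<forall>z\<in>Y. c y \<noteq> c z \<longrightarrow> lab.single y \<subseteq> known1 s4 z \<inter> known2 s4 z \<or> lab.single z \<subseteq> known1 s4 y \<inter> known2 s4 y)"
    unfolding s5_def by (rule lab.PE(1)[OF pd], erule kn(2), erule nine) (rule lab.PE(2)[OF pd], erule kn(2), erule nine)
  from pe(2) obtain c where c: "\<forall>y\<in>Y. lab.orn s5 y (c y)"
    "\<forall>y\<in>Y. \<forall>z\<in>Y. c y \<noteq> c z \<longrightarrow> lab.single y \<subseteq> known1 s4 z \<inter> known2 s4 z \<or> lab.single z \<subseteq> known1 s4 y \<inter> known2 s4 y"
    by blast
  have b6: "base s6" unfolding s6_def using pe(1) by (rule base_P) (simp_all add: mods_PF base_ids_def)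
  have lev: "levels_ok s6 (Suc k)" unfolding s6_def by (rule PF[OF pe(1)])
  have AB6: "A s6 = A s5" "B s6 = B s5" by (simp_all add: s6_def A_def B_def pe_frame mods_PF fun_eq_iff)
  have H: "HF s6 y = (if c y then known2 s4 y else known1 s4 y)" "HG s6 y = (if c y then known1 s4 y else known2 s4 y)" for y
  proof -
    have "HF s6 y = (if c y then known2 s4 y else known1 s4 y) \<and> HG s6 y = (if c y then known1 s4 y else known2 s4 y)"
    proof (cases "y \<in> Y")
      case True
      then have "lab.orn s5 y (c y)" using c(1) by blast
      then show ?thesis unfolding HF_def HG_def AB6 lab.orn_def using True by (simp only: if_True simp_thms)
    next
      case False
      then show ?thesis unfolding HF_def HG_def known1_def known2_def by (simp only: if_False simp_thms if_cancel)
    qed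
    then show "HF s6 y = (if c y then known2 s4 y else known1 s4 y)" "HG s6 y = (if c y then known1 s4 y else known2 s4 y)" by blast+
  qed
  have rec: "recoloured F G (known1 s4) (known2 s4) (HF s6) (HG s6) c w n (card J) (insert n {..<n}) J"
  proof (rule ex.recoloured_exchange)
    show "ex.knows (known1 s4) (known2 s4) y" if "y \<in> insert n {..<n} - J" for y using kn(1) that Y_eq by blast
    show "known1 s4 y = {} \<and> known2 s4 y = {}" if "y \<notin> insert n {..<n} - J" for y
      using that unfolding Y_eq known1_def known2_def by (simp only: if_False simp_thms)
    show "(known1 s4 y - known2 s4 y) \<union> (known2 s4 y - known1 s4 y) \<subseteq> known1 s4 z \<inter> known2 s4 z \<or>
        (known1 s4 z - known2 s4 z) \<union> (known2 s4 z - known1 s4 z) \<subseteq> known1 s4 y \<inter> known2 s4 y"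
      if "y \<in> insert n {..<n} - J" "z \<in> insert n {..<n} - J" "c y \<noteq> c z" for y z
      using c(2) that unfolding Y_eq lab.single_def by blast
  qed (use H in auto)
  interpret rec: recoloured F G "known1 s4" "known2 s4" "HF s6" "HG s6" c w n "card J" "insert n {..<n}" J by (rule rec)
  have e: "s' = P PG s6"
    by (simp only: s'_def STEP_def blk.simps pe.simps(3) s6_def s5_def s4_def s3_def s2_def s1_def)
  have e6: "P (blk [PA, PB, PC, PD, PE, PF]) s = s6"
    by (simp only: blk.simps pe.simps(3) s6_def s5_def s4_def s3_def s2_def s1_def)
  show ?thesis
  proof (cases "ncell s6 52 0 0 = 0")
    case True
    \<comment> \<open>A larger common independent set is a common base without the dummy. It gives a
      rooted walk in the true graphs and hence, by \<open>rooted_D_to_H\<close>, one in the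
      recoloured graphs, which the empty table excludes.\<close>
    have "\<not> (m1 K \<and> m2 K \<and> card K = Suc k)" for K
    proof
      assume K: "m1 K \<and> m2 K \<and> card K = Suc k"
      have nK: "n \<notin> K" using K M1.indep_subset_ground by blast
      then have "K - {n} = K" by simp
      then have "extend n (Suc k) m1 K" "extend n (Suc k) m2 K" using K by (simp_all add: extend_def)
      from ex.common_base_walk[OF this _ nK] obtain ps where "rooted F G n (card J) ps" using K card_J by auto
      then obtain qs where "rooted (HF s6) (HG s6) n (card J) qs" using rec.rooted_D_to_H by blast
      then show False using best_none[OF lev True] unfolding card_J by blast
    qed
    moreover have "P PG s6 = set_ncell 12 0 0 1 s6" using True by (simp add: PG_def)
    ultimately show ?thesis unfolding e e6 by blast
  next
    case False
    define j where "j = ncell s6 53 0 0"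
    define y where "y = ncell s6 52 0 0 - 1"
    note bl = best_lexmin[OF lev False, folded j_def y_def]
    \<comment> \<open>The computed cycle may use edges of the wrong graph, but an optimal walk of
      the true graphs has the same columns and rows, and the new set depends on nothing
      else.\<close>
    obtain ps where ps: "lexmin F G w n (card J) ps" "fst ` set ps = fst ` set (cycle s6 j y)"
      "snd ` set ps = snd ` set (cycle s6 j y)"
      using rec.lexmin_H_to_D bl(4) unfolding card_J by blast
    define K where "K = ex.after ps"
    have K: "extend n (Suc k) m1 K" "extend n (Suc k) m2 K" "card K = Suc k" "n \<notin> K"
      "\<And>L. extend n (Suc k) m1 L \<Longrightarrow> extend n (Suc k) m2 L \<Longrightarrow> card L = Suc k \<Longrightarrow> n \<notin> L \<Longrightarrow> sum w L \<le> sum w K"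
      using ex.lexmin_optimal[OF ps(1)] card_J unfolding K_def by simp_all
    have mK: "m1 K" "m2 K" using K(1,2,4) by (simp_all add: extend_def)
    have opt': "max_weight_common_indep m1 m2 w (Suc k) K"
      unfolding max_weight_common_indep_def common_indep_def
    proof (intro conjI allI impI mK K(3))
      fix L assume L: "(m1 L \<and> m2 L) \<and> card L = Suc k"
      have nL: "n \<notin> L" using L M1.indep_subset_ground by blast
      then have "L - {n} = L" by simp
      then show "sum w L \<le> sum w K" using K(5)[of L] L nL by (simp add: extend_def)
    qed
    have Kn: "K \<subseteq> {..<n}" using mK(1) M1.indep_subset_ground by blast
    define s7 where "s7 = P PG_trace s6"
    have q7: "ncell s7 3 0 x = of_bool (x \<in> K)" for x
      using PG_trace[OF b6 lev False, of x] unfolding s7_def j_def[symmetric] y_def[symmetric] K_def ex.after_def ps(2,3)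
      by (simp only: Un_iff)
    have fr7: "x \<notin> {3, 23, 55, 56, 57, 58} \<Longrightarrow> ncell s7 x = ncell s6 x" for x
      unfolding s7_def by (rule pe_frame) (simp only: mods_PG not_False_eq_True)
    have v7: "ncell s7 0 0 0 = n" "ncell s7 2 0 0 = k" "ncell s7 4 0 0 = n"
      using b6 lst(1) by (auto simp: fr7 base_def)
    define s8 where "s8 = P PG_build s7"
    note bd = PG_build[OF v7 q7 Kn, folded s8_def, unfolded K(3)]
    have fr8: "x \<notin> {1, 3, 4, 21, 59} \<Longrightarrow> ncell s8 x = ncell s7 x" for x
      unfolding s8_def by (rule pe_frame) (simp only: mods_PG not_False_eq_True)
    have r8: "rcell s8 = rcell s6" by (simp add: s8_def s7_def pe_rframe mods_PG fun_eq_iff)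
    have e': "s' = set_ncell 2 0 0 (Suc k) s8"
    proof -
      have "P PG s6 = P (set0 2 (NSuc (V 2))) s8"
        using False by (simp only: PG_def pe.simps(4) blk.simps pe.simps(3) s8_def s7_def) simp
      then show ?thesis using fr8[of 2] v7(2) unfolding e by simp
    qed
    have "ready n w (Suc k) K s'"
      using bd(1-4) fr8 fr7 r8 v7 b6 unfolding e' ready_def by (simp add: ncell_set_other base_def)
    moreover have "\<forall>i<n. ncell s' 1 (Suc k) i = of_bool (i \<in> K)" using bd(5) by (simp add: e')
    moreover have f16: "ncell s6 x = ncell s x" if "x \<in> {1, 12}" for x
    proof -
      show ?thesis unfolding e6[symmetric] using that
        by (intro pe_frame stop_frame) (auto simp: ask_ids_def)
    qed
    have "\<forall>i. i \<noteq> Suc k \<longrightarrow> ncell s' 1 i = ncell s 1 i"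
      using bd(6) fr7[of 1] f16[of 1] by (simp add: e' ncell_set_other)
    moreover have "ncell s' 12 = ncell s 12" using fr8[of 12] fr7[of 12] f16[of 12] by (simp add: e' ncell_set_other)
    ultimately show ?thesis using opt' by blast
  qed
qed

end

lemma base_ready: "stage n m1 m2 w orc k I lst \<Longrightarrow> lst = ncell s 4 0 \<Longrightarrow> ready n w k I s \<Longrightarrow> stage.base n w k I lst s"
  by (simp add: stage.base_def ready_def)

lemma wellformed_STEP: "wellformed STEP"
  by (simp add: STEP_def PA_def PB_def PB_col_def PB_scan_def PB_mark_def PC_def PC_col_def PC_scan_def
    PD_def PD_p_def PD_z_def PD_ask_def PE_def PE_round_def PE_visit_def PE_pair_def PE_link_def PE_pick_def PE_swap_def PE_scan_def
    PF_row_scan_def PF_row_def PF_col_scan_def PF_col_def PF_best_def PF_level_def PF_def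
    PG_def PG_hop_def PG_trace_def PG_copy_def PG_build_def ask_ids_def)

lemma mods_STEP: "0 \<notin> mods STEP" "20 \<notin> mods STEP"
  by (simp_all add: STEP_def PA_def PB_def PB_col_def PB_scan_def PB_mark_def PC_def PC_col_def PC_scan_def
    PD_def PD_p_def PD_z_def PD_ask_def PE_def PE_round_def PE_visit_def PE_pair_def PE_link_def PE_pick_def PE_swap_def PE_scan_def
    PF_row_scan_def PF_row_def PF_col_scan_def PF_col_def PF_best_def PF_level_def PF_def
    PG_def PG_hop_def PG_trace_def PG_copy_def PG_build_def ask_ids_def)

section \<open>Running time from loop nesting depths\<close>

primrec tK :: "pr \<Rightarrow> nat" where
  "tK (Basic c) = ccost c"
| "tK (Probe two) = ccost (probe two)"
| "tK (Sq p q) = tK p + tK q"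
| "tK (If b p q) = 1 + bcost b + tK p + tK q"
| "tK (ForN v p) = tK p + 20"
| "tK (ForK v p) = tK p + 20"

primrec dn :: "pr \<Rightarrow> nat" where
  "dn (Basic c) = 0" | "dn (Probe two) = 0" | "dn (Sq p q) = max (dn p) (dn q)" | "dn (If b p q) = max (dn p) (dn q)"
| "dn (ForN v p) = Suc (dn p)" | "dn (ForK v p) = dn p"

primrec dk :: "pr \<Rightarrow> nat" where
  "dk (Basic c) = 0" | "dk (Probe two) = 0" | "dk (Sq p q) = max (dk p) (dk q)" | "dk (If b p q) = max (dk p) (dk q)"
| "dk (ForN v p) = dk p" | "dk (ForK v p) = Suc (dk p)"

lemma tm_bound: "tm n k p \<le> tK p * (Suc n ^ dn p * Suc (Suc k) ^ dk p)"
proof (induction p)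
  case (Sq p q)
  have "Suc n ^ dn p * Suc (Suc k) ^ dk p \<le> Suc n ^ dn (Sq p q) * Suc (Suc k) ^ dk (Sq p q)"
    "Suc n ^ dn q * Suc (Suc k) ^ dk q \<le> Suc n ^ dn (Sq p q) * Suc (Suc k) ^ dk (Sq p q)"
    by (intro mult_le_mono power_increasing; simp)+
  with Sq show ?case unfolding tm.simps tK.simps add_mult_distrib
    by (meson add_mono mult_le_mono2 order_trans)
next
  case (If b p q)
  define M where "M = Suc n ^ dn (If b p q) * Suc (Suc k) ^ dk (If b p q)"
  have "Suc n ^ dn p * Suc (Suc k) ^ dk p \<le> M" "Suc n ^ dn q * Suc (Suc k) ^ dk q \<le> M"
    unfolding M_def by (intro mult_le_mono power_increasing; simp)+
  then have "tm n k p \<le> tK p * M" "tm n k q \<le> tK q * M" using If by (meson mult_le_mono2 order_trans)+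
  moreover have "1 \<le> M" by (simp add: M_def)
  then have "1 + bcost b \<le> (1 + bcost b) * M" using mult_le_mono2[of 1 M "1 + bcost b"] by simp
  ultimately show ?case unfolding tm.simps tK.simps add_mult_distrib M_def[symmetric] by linarith
next
  case (ForN v p)
  define M where "M = Suc n ^ dn p * Suc (Suc k) ^ dk p"
  have "1 \<le> M" by (simp add: M_def)
  then have "20 \<le> 20 * M" by simp
  then have "tm n k p + 20 \<le> (tK p + 20) * M" using ForN[folded M_def] unfolding add_mult_distrib by linarith
  then have "Suc n * (tm n k p + 20) \<le> Suc n * ((tK p + 20) * M)" by (rule mult_le_mono2)
  also have "\<dots> = (tK p + 20) * (Suc n ^ dn (ForN v p) * Suc (Suc k) ^ dk (ForN v p))" by (simp only: M_def dn.simps dk.simps power_Suc mult_ac)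
  finally show ?case by simp
next
  case (ForK v p)
  define M where "M = Suc n ^ dn p * Suc (Suc k) ^ dk p"
  have "1 \<le> M" by (simp add: M_def)
  then have "20 \<le> 20 * M" by simp
  then have "tm n k p + 20 \<le> (tK p + 20) * M" using ForK[folded M_def] unfolding add_mult_distrib by linarith
  then have "Suc (Suc k) * (tm n k p + 20) \<le> Suc (Suc k) * ((tK p + 20) * M)" by (rule mult_le_mono2)
  also have "\<dots> = (tK p + 20) * (Suc n ^ dn (ForK v p) * Suc (Suc k) ^ dk (ForK v p))" by (simp only: M_def dn.simps dk.simps power_Suc mult_ac)
  finally show ?case by simp
qed simp_all

text \<open>Both degrees are attained by \<open>PD\<close>, where two loops over columns and two
  over positions are nested.\<close>

lemma degrees_STEP: "dn STEP = 2" "dk STEP = 2"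
  by (simp_all add: STEP_def PA_def PB_def PB_col_def PB_scan_def PB_mark_def PC_def PC_col_def PC_scan_def
    PD_def PD_p_def PD_z_def PD_ask_def PE_def PE_round_def PE_visit_def PE_pair_def PE_link_def PE_pick_def PE_swap_def PE_scan_def
    PF_row_scan_def PF_row_def PF_col_scan_def PF_col_def PF_best_def PF_level_def PF_def
    PG_def PG_hop_def PG_trace_def PG_copy_def PG_build_def ask_def)

lemma tm_STEP: "tm n k STEP \<le> tK STEP * (Suc n ^ 2 * Suc (Suc k) ^ 2)"
  using tm_bound[of n k STEP] unfolding degrees_STEP .

section \<open>The algorithm\<close>

text \<open>Moves the problem to the indices below \<open>n\<close>, where the number
  \<open>n\<close> is available as the dummy.\<close>

lemma matroid_pullback:
  assumes "matroid E indep" and f: "bij_betw f N E"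
  shows "matroid N (\<lambda>S. S \<subseteq> N \<and> indep (f ` S))"
proof -
  interpret matroid E indep by fact
  have inj: "inj_on f N" and img: "f ` N = E" using f by (auto simp: bij_betw_def)
  show ?thesis
  proof
    show "finite N" using f finite_ground bij_betw_finite by blast
    show "{} \<subseteq> N \<and> indep (f ` {})" using indep_empty by simp
    show "S \<subseteq> N \<and> indep (f ` S)" if "T \<subseteq> N \<and> indep (f ` T)" "S \<subseteq> T" for S T
      using that indep_mono[of "f ` T" "f ` S"] by blast
    show "\<exists>e\<in>T - S. insert e S \<subseteq> N \<and> indep (f ` insert e S)"
      if S: "S \<subseteq> N \<and> indep (f ` S)" and T: "T \<subseteq> N \<and> indep (f ` T)" and c: "card S < card T" for S T
    proof -
      have "card (f ` S) < card (f ` T)"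
        using S T c by (simp add: card_image inj_on_subset[OF inj])
      then obtain e where "e \<in> f ` T - f ` S" "indep (insert e (f ` S))" using indep_augment[of "f ` S" "f ` T"] S T by blast
      then obtain x where "x \<in> T" "x \<notin> S" "indep (f ` insert x S)" by auto
      with S T show ?thesis by blast
    qed
  qed blast
qed

lemma circuit_pullback:
  assumes "inj_on f N" "f ` N = E" "circuit N (\<lambda>S. S \<subseteq> N \<and> indep (f ` S)) C"
  shows "circuit E indep (f ` C)"
proof -
  have C: "C \<subseteq> N" "\<not> indep (f ` C)" "\<And>D. D \<subset> C \<Longrightarrow> indep (f ` D)"
    using assms(3) by (auto simp: circuit_def)
  have "indep D" if D: "D \<subset> f ` C" for D
  proof -
    define D' where "D' = {x\<in>C. f x \<in> D}"
    have "f ` D' = D" using D by (auto simp: D'_def)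
    moreover from this have "D' \<subset> C" using D by (auto simp: D'_def)
    ultimately show ?thesis using C(3) by metis
  qed
  then show ?thesis using C(1,2) assms(2) by (auto simp: circuit_def)
qed

lemma rank_pullback:
  assumes "inj_on f N" "X \<subseteq> N"
  shows "rank (\<lambda>S. S \<subseteq> N \<and> indep (f ` S)) X = rank indep (f ` X)"
proof -
  have "{card I | I. I \<subseteq> X \<and> I \<subseteq> N \<and> indep (f ` I)} = {card I | I. I \<subseteq> f ` X \<and> indep I}" (is "?A = ?B")
  proof
    show "?A \<subseteq> ?B"
    proof
      fix c assume "c \<in> ?A"
      then obtain I where "c = card I" "I \<subseteq> X" "I \<subseteq> N" "indep (f ` I)" by auto
      moreover from this have "card (f ` I) = card I" using assms(1) by (intro card_image) (rule inj_on_subset)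
      ultimately show "c \<in> ?B" by (auto intro!: exI[of _ "f ` I"])
    qed
    show "?B \<subseteq> ?A"
    proof
      fix c assume "c \<in> ?B"
      then obtain I where I: "c = card I" "I \<subseteq> f ` X" "indep I" by auto
      then obtain I' where I': "I' \<subseteq> X" "I = f ` I'" by (meson subset_image_iff)
      then have "card I = card I'" using assms by (metis card_image inj_on_subset order_trans)
      then show "c \<in> ?A" using I I' assms(2) by (auto intro!: exI[of _ I'])
    qed
  qed
  then show ?thesis unfolding rank_def by simp
qed

text \<open>The maximum is unknown in advance, so \<open>n + 1\<close> iterations are made; once the
  stop flag is set, each remaining one has constant cost.\<close>

definition MAIN :: com where
  "MAIN = Seq (Seq (NAssign 3 NZero (V 0) one) (NAssign 4 NZero NZero (V 0)))
     (For 20 (NSuc (V 0)) (Cond (zr (V 12)) (compile STEP) Skip))"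

context min_rank_input
begin

definition optimal_output :: "nat \<Rightarrow> store \<Rightarrow> bool" where
  "optimal_output k s \<longleftrightarrow> (\<forall>k'\<le>k. max_weight_common_indep m1 m2 w k' {i. i < n \<and> ncell s 1 k' i \<noteq> 0})"

text \<open>As long as the stop flag is clear, the loop counter equals the current size, so
  iteration \<open>i\<close> is charged for an augmentation of a set of size
  \<open>i\<close>.\<close>

definition main_inv :: "store \<Rightarrow> bool" where
  "main_inv s \<longleftrightarrow> (\<exists>k I. max_weight_common_indep m1 m2 w k I \<and> ncell s 0 0 0 = n \<and> ncell s 2 0 0 = k \<and> optimal_output k s \<and>
    (if ncell s 12 0 0 = 0 then ncell s 20 0 0 = k \<and> ready n w k I s else \<nexists>K. m1 K \<and> m2 K \<and> card K = Suc k))"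

lemma common_card_le:
  assumes "m1 K" shows "card K \<le> n"
  using M1.indep_subset_ground[OF assms] card_mono[of "{..<n}" K] by simp

lemma stage: "max_weight_common_indep m1 m2 w k I \<Longrightarrow> ready n w k I s \<Longrightarrow> stage n m1 m2 w orc k I (ncell s 4 0)"
  by unfold_locales (auto simp: ready_def)

definition main_step :: "store \<Rightarrow> store" where
  "main_step s = (if ncell s 12 0 0 = 0 then pe orc n (ncell s 2 0 0) STEP s else s)"

text \<open>An augmentation is attempted in iteration \<open>i\<close> only if a common independent
  set of size \<open>i\<close> exists, so the sum has nonconstant terms up to the maximum size only,
  the failing last attempt included.\<close>

definition step_bound :: "nat \<Rightarrow> nat" where
  "step_bound i = 9 + (if \<exists>K. m1 K \<and> m2 K \<and> card K = i then tm n i STEP else 1)"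

lemma main_body:
  assumes s: "main_inv s" "ncell s 20 0 0 = i"
  shows "main_inv (set_ncell 20 0 0 (Suc i) (main_step s))" "ncell (main_step s) 20 0 0 = i"
    "\<exists>t\<le>step_bound i. exec orc (Cond (zr (V 12)) (compile STEP) Skip) s t (main_step s)"
proof -
  obtain k I where opt: "max_weight_common_indep m1 m2 w k I" and s0: "ncell s 0 0 0 = n" and k: "ncell s 2 0 0 = k" and out: "optimal_output k s"
    and cs: "if ncell s 12 0 0 = 0 then ncell s 20 0 0 = k \<and> ready n w k I s else \<nexists>K. m1 K \<and> m2 K \<and> card K = Suc k"
    using s(1) by (auto simp: main_inv_def)
  have "main_inv (set_ncell 20 0 0 (Suc i) (main_step s)) \<and> ncell (main_step s) 20 0 0 = i \<and>
    (\<exists>t\<le>step_bound i. exec orc (Cond (zr (V 12)) (compile STEP) Skip) s t (main_step s))"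
  proof (cases "ncell s 12 0 0 = 0")
    case False
    then have fs: "main_step s = s" by (simp add: main_step_def)
    have "main_inv (set_ncell 20 0 0 (Suc i) s)" unfolding main_inv_def
      using opt s0 k out cs False by (intro exI[of _ k] exI[of _ I]) (simp add: optimal_output_def ncell_set_other)
    moreover have "exec orc (Cond (zr (V 12)) (compile STEP) Skip) s (1 + bcost (zr (V 12)) + 1) s"
      by (rule exec.Cond_False) (use False exec.Skip in auto)
    moreover have "1 + bcost (zr (V 12)) + 1 \<le> step_bound i" by (simp add: step_bound_def)
    ultimately show ?thesis unfolding fs using s(2) by blast
  next
    case True
    then have ki: "k = i" and rd: "ready n w k I s" using cs s(2) by simp_all
    interpret st: stage n m1 m2 w orc k I "ncell s 4 0" by (rule stage[OF opt rd])
    have bs: "st.base s" using base_ready[OF st.stage_axioms refl rd] .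
    define s' where "s' = pe orc n k STEP s"
    have fs: "main_step s = s'" using True k by (simp add: main_step_def s'_def)
    have s20: "ncell s' 20 0 0 = i" "ncell s' 0 0 0 = n" using mods_STEP s(2) s0 by (simp_all add: s'_def pe_frame)
    obtain t where t: "t \<le> tm n k STEP" "exec orc (compile STEP) s t s'"
      using exec_compile[OF wellformed_STEP s0 k] unfolding s'_def by blast
    have "exec orc (Cond (zr (V 12)) (compile STEP) Skip) s (1 + bcost (zr (V 12)) + t) s'"
      by (rule exec.Cond_True) (use True t(2) in auto)
    moreover have "m1 I \<and> m2 I \<and> card I = i" using st.I_facts ki by blast
    then have "\<exists>K. m1 K \<and> m2 K \<and> card K = i" by blast
    then have "1 + bcost (zr (V 12)) + t \<le> step_bound i" using t(1) ki by (simp add: step_bound_def)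
    moreover have "main_inv (set_ncell 20 0 0 (Suc i) s')"
      using st.step[OF bs, folded s'_def]
    proof
      assume "\<exists>I'. max_weight_common_indep m1 m2 w (Suc k) I' \<and> ready n w (Suc k) I' s' \<and>
        (\<forall>i<n. ncell s' 1 (Suc k) i = of_bool (i \<in> I')) \<and> (\<forall>i. i \<noteq> Suc k \<longrightarrow> ncell s' 1 i = ncell s 1 i) \<and> ncell s' 12 = ncell s 12"
      then obtain I' where I': "max_weight_common_indep m1 m2 w (Suc k) I'" "ready n w (Suc k) I' s'"
        "\<forall>i<n. ncell s' 1 (Suc k) i = of_bool (i \<in> I')" "\<forall>i. i \<noteq> Suc k \<longrightarrow> ncell s' 1 i = ncell s 1 i" "ncell s' 12 = ncell s 12"
        by blast
      have "I' \<subseteq> {..<n}" using I'(1) M1.indep_subset_ground by (simp add: max_weight_common_indep_def common_indep_def)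
      then have row: "{i. i < n \<and> ncell s' 1 (Suc k) i \<noteq> 0} = I'" using I'(3) by auto
      have "optimal_output (Suc k) s'" unfolding optimal_output_def
      proof (intro allI impI)
        fix k' assume "k' \<le> Suc k"
        then consider "k' = Suc k" | "k' \<le> k" "k' \<noteq> Suc k" by linarith
        then show "max_weight_common_indep m1 m2 w k' {i. i < n \<and> ncell s' 1 k' i \<noteq> 0}"
        proof cases
          case 1
          then show ?thesis using row I'(1) by simp
        next
          case 2
          then show ?thesis using out I'(4) by (simp add: optimal_output_def)
        qed
      qed
      then have out': "optimal_output (Suc k) (set_ncell 20 0 0 (Suc i) s')" by (simp add: optimal_output_def ncell_set_other)
      have rd': "ready n w (Suc k) I' (set_ncell 20 0 0 (Suc i) s')" using I'(2) by (simp add: ready_def ncell_set_other)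
      show ?thesis unfolding main_inv_def
        using I'(1,5) True ki out' rd' by (intro exI[of _ "Suc k"] exI[of _ I']) (simp add: ready_def)
    next
      assume no: "(\<nexists>K. m1 K \<and> m2 K \<and> card K = Suc k) \<and> s' = set_ncell 12 0 0 1 (pe orc n k (blk [PA, PB, PC, PD, PE, PF]) s)"
      define s6 where "s6 = pe orc n k (blk [PA, PB, PC, PD, PE, PF]) s"
      have "ncell s6 x = ncell s x" if "x \<in> {1, 2}" for x unfolding s6_def using that
        by (intro pe_frame stop_frame) (auto simp: ask_ids_def)
      then have s6: "ncell s6 1 = ncell s 1" "ncell s6 2 = ncell s 2" by simp_all
      have s': "s' = set_ncell 12 0 0 1 s6" using no by (simp add: s6_def)
      have none: "\<nexists>K. m1 K \<and> m2 K \<and> card K = Suc k" using no by (rule conjunct1)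
      have "ncell s6 0 0 0 = n" using s20(2) by (simp add: s')
      then show ?thesis unfolding main_inv_def
        using opt k none out s6
        by (intro exI[of _ k] exI[of _ I]) (simp add: s' optimal_output_def ncell_set_other)
    qed
    ultimately show ?thesis unfolding fs using s20 by blast
  qed
  then show "main_inv (set_ncell 20 0 0 (Suc i) (main_step s))" "ncell (main_step s) 20 0 0 = i"
    "\<exists>t\<le>step_bound i. exec orc (Cond (zr (V 12)) (compile STEP) Skip) s t (main_step s)"
    by blast+
qed

lemma main_run:
  assumes init: "ncell s 0 0 0 = n" "\<And>a i j. a \<noteq> 0 \<Longrightarrow> ncell s a i j = 0" "\<And>j. j < n \<Longrightarrow> rcell s 0 0 j = w j"
  shows "\<exists>t s'. exec orc MAIN s t s' \<and>
    t \<le> (\<Sum>i<Suc n. 29 + (if \<exists>K. m1 K \<and> m2 K \<and> card K = i then tm n i STEP else 1)) + 40 \<and>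
    (\<nexists>K. m1 K \<and> m2 K \<and> card K = Suc (ncell s' 2 0 0)) \<and> optimal_output (ncell s' 2 0 0) s'"
proof -
  define s1 where "s1 = set_ncell 3 0 n 1 s"
  define s2 where "s2 = set_ncell 4 0 0 n s1"
  have "exec orc (NAssign 3 NZero (V 0) one) s (1 + ncost NZero + ncost (V 0) + ncost one) s1"
    using exec.NAssign[of orc 3 NZero "V 0" one s] init(1) by (simp add: s1_def)
  moreover have "exec orc (NAssign 4 NZero NZero (V 0)) s1 (1 + ncost NZero + ncost NZero + ncost (V 0)) s2"
    using exec.NAssign[of orc 4 NZero NZero "V 0" s1] init(1) by (simp add: s2_def s1_def)
  ultimately have e2: "exec orc (Seq (NAssign 3 NZero (V 0) one) (NAssign 4 NZero NZero (V 0))) s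
     ((1 + ncost NZero + ncost (V 0) + ncost one) + (1 + ncost NZero + ncost NZero + ncost (V 0))) s2" by (rule exec.Seq)
  define s3 where "s3 = set_ncell 20 0 0 0 s2"
  have s3: "ncell s3 0 0 0 = n" "ncell s3 2 0 0 = 0" "ncell s3 12 0 0 = 0" "ncell s3 20 0 0 = 0" "\<And>i j. ncell s3 1 i j = 0"
    using init(1,2) by (simp_all add: s3_def s2_def s1_def)
  have empty: "max_weight_common_indep m1 m2 w 0 {}"
    unfolding max_weight_common_indep_def common_indep_def
    using M1.indep_empty M2.indep_empty M1.indep_finite by (auto simp: card_eq_0_iff)
  have "ready n w 0 {} s3" using init by (simp add: ready_def s3_def s2_def s1_def)
  then have inv: "main_inv s3" unfolding main_inv_def
    using empty s3 by (intro exI[of _ 0] exI[of _ "{}"]) (simp add: optimal_output_def)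
  have "\<exists>t\<le>(\<Sum>i<Suc n. step_bound i + 20) + 20. exec orc (For 20 (NSuc (V 0)) (Cond (zr (V 12)) (compile STEP) Skip)) s2 t (loop 20 main_step (Suc n) s2)"
  proof (rule exec_For[where Inv = main_inv])
    fix i t assume "main_inv t" "ncell t 20 0 0 = i"
    from main_body[OF this]
    show "(\<exists>u\<le>step_bound i. exec orc (Cond (zr (V 12)) (compile STEP) Skip) t u (main_step t)) \<and> ncell (main_step t) 20 0 0 = i \<and> main_inv (set_ncell 20 0 0 (Suc i) (main_step t))"
      by blast
  qed (use inv in \<open>auto simp: s3_def main_inv_def\<close>)
  then obtain t where t: "t \<le> (\<Sum>i<Suc n. step_bound i + 20) + 20"
    "exec orc (For 20 (NSuc (V 0)) (Cond (zr (V 12)) (compile STEP) Skip)) s2 t (loop 20 main_step (Suc n) s2)" by blast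
  define s' where "s' = loop 20 main_step (Suc n) s2"
  have "main_inv s'" unfolding s'_def
  proof (rule loop_induct[where Inv = "\<lambda>i. main_inv"])
    show "main_inv (set_ncell 20 0 0 0 s2)" using inv by (simp add: s3_def)
    show "main_inv (set_ncell 20 0 0 (Suc i) (main_step t))" if "main_inv t" "ncell t 20 0 0 = i" for i t
      using main_body(1)[OF that] .
  qed
  moreover have "ncell s' 20 0 0 = Suc n" unfolding s'_def by (rule loop_counter)
  \<comment> \<open>A clear flag after \<open>n + 1\<close> iterations would mean a common
    independent set of \<open>n + 1\<close> elements.\<close>
  ultimately have fin: "(\<nexists>K. m1 K \<and> m2 K \<and> card K = Suc (ncell s' 2 0 0)) \<and> optimal_output (ncell s' 2 0 0) s'"
    unfolding main_inv_def using common_card_le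
    by (force simp: max_weight_common_indep_def common_indep_def split: if_splits)
  have T20: "step_bound i + 20 = 29 + (if \<exists>K. m1 K \<and> m2 K \<and> card K = i then tm n i STEP else 1)" for i by (simp add: step_bound_def)
  have "exec orc MAIN s (((1 + ncost NZero + ncost (V 0) + ncost one) + (1 + ncost NZero + ncost NZero + ncost (V 0))) + t) s'"
    unfolding MAIN_def s'_def by (rule exec.Seq[OF e2 t(2)])
  moreover have "((1 + ncost NZero + ncost (V 0) + ncost one) + (1 + ncost NZero + ncost NZero + ncost (V 0))) + t \<le>
    (\<Sum>i<Suc n. 29 + (if \<exists>K. m1 K \<and> m2 K \<and> card K = i then tm n i STEP else 1)) + 40"
    using t(1) unfolding T20 by simp
  ultimately show ?thesis using fin by blast
qed

end

lemma add_three: "a + c \<le> y \<Longrightarrow> b \<le> x \<Longrightarrow> a + b + c \<le> x + (y :: nat)"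
  by simp

text \<open>For \<open>n > 0\<close> the second hypothesis gives \<open>r + 1 \<le> 2 r\<close>,
  \<open>n + 1 \<le> 2 n\<close> and \<open>r + 2 \<le> 3 r\<close>, and 72 is the product of 2, 4
  and 9. The linear overhead is at most \<open>200 n\<close>. The maximum with 1 covers
  \<open>n = 0\<close>.\<close>

lemma total_time:
  assumes "r \<le> n" "n \<noteq> 0 \<Longrightarrow> r \<noteq> 0"
  shows "(\<Sum>i<Suc n. 29 + (if i \<le> r then tm n i STEP else 1)) + 40 \<le> (72 * tK STEP + 200) * max 1 (r ^ 3 * n ^ 2)"
proof -
  define C where "C = tK STEP"
  have step: "tm n i STEP \<le> C * ((Suc n) ^ 2 * (Suc (Suc r)) ^ 2)" if "i \<le> r" for i
  proof -
    have "(Suc (Suc i)) ^ 2 \<le> (Suc (Suc r)) ^ 2" using that by (intro power_mono) auto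
    then have "(Suc n) ^ 2 * (Suc (Suc i)) ^ 2 \<le> (Suc n) ^ 2 * (Suc (Suc r)) ^ 2" by (rule mult_le_mono2)
    then show ?thesis using tm_STEP[of n i] unfolding C_def by (meson mult_le_mono2 order_trans)
  qed
  have "(\<Sum>i<Suc n. 29 + (if i \<le> r then tm n i STEP else 1)) \<le>
      (\<Sum>i<Suc n. 30 + (if i \<le> r then C * ((Suc n) ^ 2 * (Suc (Suc r)) ^ 2) else 0))"
    by (intro sum_mono) (use step in \<open>auto intro: le_SucI\<close>)
  also have "\<dots> = 30 * Suc n + (\<Sum>i<Suc n. if i \<le> r then C * ((Suc n) ^ 2 * (Suc (Suc r)) ^ 2) else 0)"
    by (simp add: sum.distrib del: sum.lessThan_Suc)
  also have "(\<Sum>i<Suc n. if i \<le> r then C * ((Suc n) ^ 2 * (Suc (Suc r)) ^ 2) else 0) =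
      Suc r * (C * ((Suc n) ^ 2 * (Suc (Suc r)) ^ 2))"
  proof -
    have "{..<Suc n} \<inter> {i. i \<le> r} = {..r}" using assms(1) by auto
    then show ?thesis by (subst sum.If_cases) simp_all
  qed
  finally have le: "(\<Sum>i<Suc n. 29 + (if i \<le> r then tm n i STEP else 1)) + 40 \<le>
    30 * Suc n + Suc r * (C * ((Suc n) ^ 2 * (Suc (Suc r)) ^ 2)) + 40" by simp
  show ?thesis
  proof (cases "n = 0")
    case True
    then have "r = 0" using assms(1) by simp
    then show ?thesis using le True by (simp add: C_def power2_eq_square)
  next
    case False
    then have n1: "1 \<le> n" and r1: "1 \<le> r" using assms(2) by auto
    have a: "Suc r \<le> 2 * r" "Suc n \<le> 2 * n" "Suc (Suc r) \<le> 3 * r" using n1 r1 by auto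
    have "Suc r * (C * ((Suc n) ^ 2 * (Suc (Suc r)) ^ 2)) \<le> (2 * r) * (C * ((2 * n) ^ 2 * (3 * r) ^ 2))"
      by (intro mult_le_mono power_mono a order_refl) simp_all
    also have "\<dots> = 72 * C * (r ^ 3 * n ^ 2)" by (simp add: power2_eq_square power3_eq_cube)
    finally have b: "Suc r * (C * ((Suc n) ^ 2 * (Suc (Suc r)) ^ 2)) \<le> 72 * C * (r ^ 3 * n ^ 2)" .
    have n2: "n \<le> r ^ 3 * n ^ 2"
    proof -
      have "1 * n \<le> (r ^ 3 * n) * n" using n1 r1 by (intro mult_le_mono1) (simp add: Suc_le_eq)
      then show ?thesis by (simp add: power2_eq_square mult.assoc)
    qed
    have "30 * Suc n + 40 \<le> 200 * n" using n1 by simp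
    also have "\<dots> \<le> 200 * (r ^ 3 * n ^ 2)" by (rule mult_le_mono2[OF n2])
    finally have "30 * Suc n + Suc r * (C * ((Suc n) ^ 2 * (Suc (Suc r)) ^ 2)) + 40 \<le> 72 * C * (r ^ 3 * n ^ 2) + 200 * (r ^ 3 * n ^ 2)"
      using b by (rule add_three)
    also have "\<dots> = (72 * C + 200) * (r ^ 3 * n ^ 2)" by (rule add_mult_distrib[symmetric])
    finally have "30 * Suc n + Suc r * (C * ((Suc n) ^ 2 * (Suc (Suc r)) ^ 2)) + 40 \<le> (72 * C + 200) * (r ^ 3 * n ^ 2)" .
    note this
    also have "(72 * C + 200) * (r ^ 3 * n ^ 2) \<le> (72 * C + 200) * max 1 (r ^ 3 * n ^ 2)" by (intro mult_le_mono2) simp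
    finally show ?thesis using le order_trans unfolding C_def by blast
  qed
qed

lemma (in matroid) common_cards:
  assumes "matroid E indep'"
  shows "finite {card I | I. common_indep indep indep' I}" "0 \<in> {card I | I. common_indep indep indep' I}"
    "common_indep indep indep' K \<Longrightarrow> j \<le> card K \<Longrightarrow> \<exists>L. common_indep indep indep' L \<and> card L = j"
proof -
  interpret M': matroid E indep' by fact
  have "{card I | I. common_indep indep indep' I} \<subseteq> card ` Pow E"
    using indep_subset_ground by (auto simp: common_indep_def)
  then show "finite {card I | I. common_indep indep indep' I}" using finite_ground by (meson finite_Pow_iff finite_imageI finite_subset)
  show "0 \<in> {card I | I. common_indep indep indep' I}"
    using indep_empty M'.indep_empty by (auto simp: common_indep_def intro!: exI[of _ "{}"])
  assume K: "common_indep indep indep' K" "j \<le> card K"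
  then obtain L where "L \<subseteq> K" "card L = j" using obtain_subset_with_card_n by metis
  then show "\<exists>L. common_indep indep indep' L \<and> card L = j"
    using K indep_mono M'.indep_mono unfolding common_indep_def by blast
qed

theorem theorem5p4:
  shows "\<exists>(P :: com) (c :: nat).
    \<forall>(E :: 'a set) (indep1 :: 'a set \<Rightarrow> bool) (indep2 :: 'a set \<Rightarrow> bool)
      (w :: 'a \<Rightarrow> real) (xs :: 'a list) (n :: nat) (r :: nat).
      matroid E indep1 \<longrightarrow> matroid E indep2 \<longrightarrow>
      loopless E indep1 \<longrightarrow> loopless E indep2 \<longrightarrow>
      (\<forall>C1 C2. circuit E indep1 C1 \<longrightarrow> circuit E indep2 C2 \<longrightarrow> C2 - C1 \<noteq> {}) \<longrightarrow>
      card E = n \<longrightarrow> max_common_card indep1 indep2 = r \<longrightarrow>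
      set xs = E \<longrightarrow> distinct xs \<longrightarrow>
      (\<exists>t s. exec (min_rank_oracle indep1 indep2 xs) P (initial_store xs w) t s \<and>
        t \<le> c * max 1 (r ^ 3 * n ^ 2) \<and>
        output_last s = r \<and>
        (\<forall>k\<le>r. max_weight_common_indep indep1 indep2 w k (output_set xs s k)))"
proof (rule exI[of _ MAIN], rule exI[of _ "72 * tK STEP + 200"], intro allI impI)
  fix E :: "'a set" and indep1 indep2 :: "'a set \<Rightarrow> bool" and w :: "'a \<Rightarrow> real" and xs :: "'a list" and n r :: nat
  assume M: "matroid E indep1" "matroid E indep2" and loops: "loopless E indep1" "loopless E indep2"
    and circ: "\<forall>C1 C2. circuit E indep1 C1 \<longrightarrow> circuit E indep2 C2 \<longrightarrow> C2 - C1 \<noteq> {}"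
    and n: "card E = n" and r: "max_common_card indep1 indep2 = r" and xs: "set xs = E" "distinct xs"
  define f where "f = nth xs"
  have len: "length xs = n" using n distinct_card[OF xs(2)] xs(1) by simp
  have bij: "bij_betw f {..<n} E" using bij_betw_nth[OF xs(2), of "{..<n}" E] len xs(1) by (simp add: f_def)
  then have inj: "inj_on f {..<n}" and img: "f ` {..<n} = E" by (simp_all add: bij_betw_def)
  define m1 where "m1 S \<longleftrightarrow> S \<subseteq> {..<n} \<and> indep1 (f ` S)" for S
  define m2 where "m2 S \<longleftrightarrow> S \<subseteq> {..<n} \<and> indep2 (f ` S)" for S
  define orc where "orc = min_rank_oracle indep1 indep2 xs"
  have m12: "m1 = (\<lambda>S. S \<subseteq> {..<n} \<and> indep1 (f ` S))" "m2 = (\<lambda>S. S \<subseteq> {..<n} \<and> indep2 (f ` S))"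
    by (simp_all add: m1_def m2_def fun_eq_iff)
  \<comment> \<open>At the dummy index \<open>n\<close> the weight \<open>w \<circ> f\<close> is
    whatever \<open>xs ! n\<close> yields; it contributes equally to all quantities that are
    compared.\<close>
  interpret mi: min_rank_input n m1 m2 "w \<circ> f" orc
  proof (intro min_rank_input.intro two_matroids.intro two_matroids_axioms.intro min_rank_input_axioms.intro)
    show "matroid {..<n} m1" "matroid {..<n} m2" unfolding m12 using matroid_pullback[OF _ bij] M by blast+
    show "n \<notin> {..<n}" by simp
    show "C2 - C1 \<noteq> {}" if "circuit {..<n} m1 C1" "circuit {..<n} m2 C2" for C1 C2
    proof -
      have "f ` C2 - f ` C1 \<noteq> {}"
        using circuit_pullback[OF inj img that(1)[unfolded m12]] circuit_pullback[OF inj img that(2)[unfolded m12]] circ by blast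
      then show ?thesis by blast
    qed
    show "orc X = min (rank m1 (X \<inter> {..<n})) (rank m2 (X \<inter> {..<n}))" for X
    proof -
      have "{xs ! i | i. i < length xs \<and> i \<in> X} = f ` (X \<inter> {..<n})" by (auto simp: f_def len)
      then show ?thesis unfolding orc_def min_rank_oracle_def min_rank_def m12
        by (simp add: rank_pullback[OF inj])
    qed
  qed
  define s where "s = initial_store xs w"
  have "ncell s 0 0 0 = n" "\<And>a i j. a \<noteq> 0 \<Longrightarrow> ncell s a i j = 0" "\<And>j. j < n \<Longrightarrow> rcell s 0 0 j = (w \<circ> f) j"
    by (simp_all add: s_def initial_store_def len f_def)
  from mi.main_run[OF this] obtain t s' where ex: "exec orc MAIN s t s'"
    and t: "t \<le> (\<Sum>i<Suc n. 29 + (if \<exists>K. m1 K \<and> m2 K \<and> card K = i then tm n i STEP else 1)) + 40"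
    and none: "\<nexists>K. m1 K \<and> m2 K \<and> card K = Suc (ncell s' 2 0 0)" and out: "mi.optimal_output (ncell s' 2 0 0) s'" by blast
  define k where "k = ncell s' 2 0 0"
  interpret M1: matroid E indep1 by (rule M(1))
  have push: "common_indep indep1 indep2 (f ` K) \<and> card (f ` K) = card K" if "m1 K \<and> m2 K" for K
    using that inj_on_subset[OF inj, of K] by (simp add: m12 common_indep_def card_image)
  have pull: "\<exists>K. m1 K \<and> m2 K \<and> f ` K = L \<and> card K = card L" if "common_indep indep1 indep2 L" for L
  proof -
    have "L \<subseteq> f ` {..<n}" unfolding img using that M1.indep_subset_ground by (auto simp: common_indep_def)
    then obtain K where "K \<subseteq> {..<n}" "L = f ` K" by (meson subset_image_iff)
    then show ?thesis using that inj_on_subset[OF inj, of K] by (intro exI[of _ K]) (simp add: m12 common_indep_def card_image)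
  qed
  have cards: "(\<exists>K. m1 K \<and> m2 K \<and> card K = i) \<longleftrightarrow> (\<exists>L. common_indep indep1 indep2 L \<and> card L = i)" for i
  proof
    assume "\<exists>K. m1 K \<and> m2 K \<and> card K = i"
    then obtain K where "m1 K \<and> m2 K" "card K = i" by blast
    with push[OF this(1)] show "\<exists>L. common_indep indep1 indep2 L \<and> card L = i" by (intro exI[of _ "f ` K"]) simp
  next
    assume "\<exists>L. common_indep indep1 indep2 L \<and> card L = i"
    then obtain L where "common_indep indep1 indep2 L" "card L = i" by blast
    with pull[OF this(1)] show "\<exists>K. m1 K \<and> m2 K \<and> card K = i" by auto
  qed
  note cc = M1.common_cards[OF M(2)]
  have rI: "\<exists>L. common_indep indep1 indep2 L \<and> card L = r"
    
  proof -
    have "Max {card I | I. common_indep indep1 indep2 I} \<in> {card I | I. common_indep indep1 indep2 I}"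
      by (rule Max_in[OF cc(1)]) (use cc(2) in blast)
    then show ?thesis unfolding r[unfolded max_common_card_def] by auto
  qed
  have rmax: "common_indep indep1 indep2 L \<Longrightarrow> card L \<le> r" for L
    unfolding r[symmetric] max_common_card_def by (rule Max_ge[OF cc(1)]) blast
  have le_r: "(\<exists>K. m1 K \<and> m2 K \<and> card K = i) \<longleftrightarrow> i \<le> r" for i
    unfolding cards
  proof
    assume "\<exists>L. common_indep indep1 indep2 L \<and> card L = i"
    then show "i \<le> r" using rmax by blast
  next
    assume i: "i \<le> r"
    obtain L where L: "common_indep indep1 indep2 L" "card L = r" using rI by blast
    show "\<exists>L. common_indep indep1 indep2 L \<and> card L = i" by (rule cc(3)[OF L(1)]) (simp add: L(2) i)
  qed
  have "k \<le> r"
  proof -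
    have "m1 {i. i < n \<and> ncell s' 1 k i \<noteq> 0} \<and> m2 {i. i < n \<and> ncell s' 1 k i \<noteq> 0} \<and> card {i. i < n \<and> ncell s' 1 k i \<noteq> 0} = k"
      using out by (simp add: mi.optimal_output_def k_def max_weight_common_indep_def common_indep_def)
    then show ?thesis using le_r by blast
  qed
  moreover have "\<not> Suc k \<le> r" using none le_r unfolding k_def by blast
  ultimately have kr: "k = r" by simp
  have "r \<le> n"
  proof -
    obtain K where "m1 K" "card K = r" using le_r[of r] by blast
    then show ?thesis using mi.common_card_le by blast
  qed
  \<comment> \<open>Looplessness of both matroids makes every singleton a common independent
    set.\<close>
  moreover have "r \<noteq> 0" if n0: "n \<noteq> 0"
  proof -
    obtain e where "e \<in> E" using n0 n by fastforce
    then have "common_indep indep1 indep2 {e}" using loops by (simp add: loopless_def common_indep_def)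
    from rmax[OF this] show ?thesis by simp
  qed
  ultimately have "t \<le> (72 * tK STEP + 200) * max 1 (r ^ 3 * n ^ 2)"
    using t total_time[of r n] unfolding le_r by linarith
  moreover have "max_weight_common_indep indep1 indep2 w i (output_set xs s' i)" if "i \<le> r" for i
  proof -
    define K where "K = {j. j < n \<and> ncell s' 1 i j \<noteq> 0}"
    have "output_set xs s' i = f ` K" by (auto simp: output_set_def K_def f_def len)
    moreover have opt: "max_weight_common_indep m1 m2 (w \<circ> f) i K"
      using out that kr unfolding mi.optimal_output_def k_def K_def by blast
    have sum: "sum w (f ` L) = sum (w \<circ> f) L" if "L \<subseteq> {..<n}" for L
      using inj_on_subset[OF inj that] by (rule sum.reindex)
    have "max_weight_common_indep indep1 indep2 w i (f ` K)"
      unfolding max_weight_common_indep_def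
    proof (intro conjI allI impI)
      have K: "m1 K \<and> m2 K" "card K = i" using opt by (simp_all add: max_weight_common_indep_def common_indep_def)
      then show "common_indep indep1 indep2 (f ` K)" "card (f ` K) = i" using push by simp_all
      fix L assume L: "common_indep indep1 indep2 L \<and> card L = i"
      then obtain K' where K': "m1 K'" "m2 K'" "f ` K' = L" "card K' = i" using pull[of L] by auto
      then have "sum (w \<circ> f) K' \<le> sum (w \<circ> f) K" using opt by (simp add: max_weight_common_indep_def common_indep_def)
      moreover have "K' \<subseteq> {..<n}" "K \<subseteq> {..<n}" using K' K by (simp_all add: m12)
      ultimately show "sum w L \<le> sum w (f ` K)" unfolding K'(3)[symmetric] by (simp add: sum)
    qed
    ultimately show ?thesis by simp
  qed
  ultimately show "\<exists>t s. exec (min_rank_oracle indep1 indep2 xs) MAIN (initial_store xs w) t s \<and>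
      t \<le> (72 * tK STEP + 200) * max 1 (r ^ 3 * n ^ 2) \<and> output_last s = r \<and>
      (\<forall>k\<le>r. max_weight_common_indep indep1 indep2 w k (output_set xs s k))"
    using ex kr unfolding orc_def s_def output_last_def k_def by blast
qed

end
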